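(* Let $w$ satisfy Assumption A, let $\rho\in\mathcal D_{\rm per}$, and for each $\varepsilon>0$ let $v_\varepsilon(\rho)\in\mathrm H^{-1}_{\rm per}(I)$ be any potential such that $\min\{F^\varepsilon_{\rm per}(\zeta)-n\langle v_\varepsilon(\rho),\zeta\rangle:\sqrt\zeta\in\mathrm H^1_{\rm per}(I),\ \int_I\zeta=1\}=F^\varepsilon_{\rm per}(\rho)-n\langle v_\varepsilon(\rho),\rho\rangle.$ Then there exist constants $C_\varepsilon\in\mathbb R$ and a sequence $\varepsilon_k\downarrow0$ such that $v_{\varepsilon_k}(\rho)+C_{\varepsilon_k}\rightharpoonup v_{\rm OT}(\rho)$ weakly in $\mathrm H^{-1}_{\rm per}(I)$, where $v_{\rm OT}(\rho)$ is a regular Kantorovich potential for $F_{\rm OT}(\rho)$. Moreover, if $w$ is $C^1$ on $\{(x,y)\in I\times I:|x-y|_{\mathbb T}>0\}$, then the regular Kantorovich potential $v_{\rm OT}(\rho)$ is unique and $v_\varepsilon(\rho)+C_\varepsilon\rightharpoonup v_{\rm OT}(\rho)$ as $\varepsilon\downarrow0$ without passing to a subsequence.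
   Context: $I=[0,2\pi]$, $I_n=I^n$, $|t|_{\mathbb T}=\min\{|t-k|:k\in2\pi\mathbb Z\}$. Assumption A: $w:I\times I\to[0,+\infty]$ symmetric, continuous (for the topology of $[0,+\infty]$), with $\{w=\infty\}=\{(x,y):|x-y|_{\mathbb T}=0\}$. $c_n(x)=\sum_{i\ne j}w(x_i,x_j)$; $F_{\rm OT}(\rho)=\min\{\int_{I_n}c_n\,d\gamma:\gamma\in\mathcal P(I_n),\text{ all marginals }=\rho\}$. $\mathrm H^1_{\rm per}(I)$: restrictions to $I$ of $2\pi$-periodic $\mathrm H^1_{\rm loc}(\mathbb R)$ functions; $\mathrm H^{-1}_{\rm per}(I)$ its dual, $\langle\cdot,\cdot\rangle$ the duality pairing. $\mathcal D_{\rm per}=\{\rho\in\mathrm H^1_{\rm per}(I):\rho(x)>0\ \forall x\in I,\ \int_I\rho=1\}$. $F^\varepsilon_{\rm per}(\rho)=\inf\{\sum_k\lambda_k\int_{I_n}(\varepsilon|\nabla\Psi_k|^2+c_n|\Psi_k|^2)\}$ over orthonormal $\Psi_k\in\wedge^n\mathrm L^2(I)\cap\mathrm H^1_{\rm per}(I_n)$, $\lambda_k\ge0$, $\sum\lambda_k=1$, $\sum_k\lambda_k\rho_{\Psi_k}=n\rho$, where $\rho_\Psi(x)=n\int|\Psi(x,x_2,\dots,x_n)|^2dx_2\cdots dx_n$ and $\mathrm H^1_{\rm per}(I_n)$ is periodic $\mathrm H^1$ on $I_n$. Kantorovich potential: a $\rho$-integrable $v:I\to\mathbb R$ with $F_{\rm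 OT}(\rho)=n\int_I\rho v$ and $c_n(x_1,\dots,x_n)-\sum_{j=1}^nv(x_j)\ge0$ for every $(x_1,\dots,x_n)\in I_n$; it is regular if continuous (a continuous function is viewed as an element of $\mathrm H^{-1}_{\rm per}(I)$). *)

theory Defs
  imports "HOL-Probability.Probability" "HOL-Combinatorics.Permutations"
begin

definition Iper :: "real set" where
  "Iper = {0 .. 2 * pi}"

definition distT :: "real \<Rightarrow> real" where
  "distT t = Inf {\<bar>t - 2 * pi * real_of_int k\<bar> | k. True}"

definition assumptionA :: "(real \<times> real \<Rightarrow> ennreal) \<Rightarrow> bool" where
  "assumptionA w \<longleftrightarrow>
     (\<forall>x\<in>Iper. \<forall>y\<in>Iper. w (x, y) = w (y, x)) \<and>
     continuous_on (Iper \<times> Iper) w \<and>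
     {p \<in> Iper \<times> Iper. w p = \<infinity>} = {(x, y) \<in> Iper \<times> Iper. distT (x - y) = 0}"

definition offdiag :: "(real \<times> real) set" where
  "offdiag = {(x, y) \<in> Iper \<times> Iper. distT (x - y) > 0}"

definition C1_offdiag :: "(real \<times> real \<Rightarrow> ennreal) \<Rightarrow> bool" where
  "C1_offdiag w \<longleftrightarrow>
     (\<exists>D :: real \<times> real \<Rightarrow> ((real \<times> real) \<Rightarrow>\<^sub>L real).
        continuous_on offdiag D \<and>
        (\<forall>p\<in>offdiag. ((\<lambda>q. enn2real (w q)) has_derivative blinfun_apply (D p)) (at p within offdiag)))"

definition trig1 :: "int \<Rightarrow> real \<Rightarrow> complex" where
  "trig1 m t = cis (real_of_int m * t)"

text \<open>g is the periodic weak derivative of f on I (test functions: trigonometric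
  polynomials, i.e. smooth 2 pi-periodic functions up to density).\<close>
definition wderiv1 :: "(real \<Rightarrow> complex) \<Rightarrow> (real \<Rightarrow> complex) \<Rightarrow> bool" where
  "wderiv1 f g \<longleftrightarrow>
     f \<in> borel_measurable (lebesgue_on Iper) \<and> g \<in> borel_measurable (lebesgue_on Iper) \<and>
     integrable (lebesgue_on Iper) (\<lambda>t. (cmod (f t))\<^sup>2) \<and>
     integrable (lebesgue_on Iper) (\<lambda>t. (cmod (g t))\<^sup>2) \<and>
     (\<forall>m::int. (\<integral>t. f t * (\<i> * of_int m * trig1 m t) \<partial>lebesgue_on Iper)
                = - (\<integral>t. g t * trig1 m t \<partial>lebesgue_on Iper))"

definition H1per :: "(real \<Rightarrow> real) \<Rightarrow> bool" where
  "H1per f \<longleftrightarrow> (\<exists>g. wderiv1 (\<lambda>t. complex_of_real (f t)) g)"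

definition Hminus :: "((real \<Rightarrow> real) \<Rightarrow> real) \<Rightarrow> bool" where
  "Hminus v \<longleftrightarrow>
     (\<forall>f h a b. H1per f \<longrightarrow> H1per h \<longrightarrow> v (\<lambda>t. a * f t + b * h t) = a * v f + b * v h) \<and>
     (\<exists>B. \<forall>f g. wderiv1 (\<lambda>t. complex_of_real (f t)) g \<longrightarrow>
          \<bar>v f\<bar> \<le> B * sqrt ((\<integral>t. (f t)\<^sup>2 \<partial>lebesgue_on Iper) + (\<integral>t. (cmod (g t))\<^sup>2 \<partial>lebesgue_on Iper)))"

text \<open>The set D_per (continuous representative of rho).\<close>
definition Dper :: "(real \<Rightarrow> real) \<Rightarrow> bool" where
  "Dper \<rho> \<longleftrightarrow> H1per \<rho> \<and> continuous_on Iper \<rho> \<and> (\<forall>x\<in>Iper. \<rho> x > 0) \<and>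
     (\<integral>t. \<rho> t \<partial>lebesgue_on Iper) = 1"

definition adm :: "(real \<Rightarrow> real) \<Rightarrow> bool" where
  "adm \<zeta> \<longleftrightarrow> (\<forall>x\<in>Iper. 0 \<le> \<zeta> x) \<and> H1per (\<lambda>t. sqrt (\<zeta> t)) \<and>
     (\<integral>t. \<zeta> t \<partial>lebesgue_on Iper) = 1"

definition muN :: "nat \<Rightarrow> (nat \<Rightarrow> real) measure" where
  "muN n = PiM {..<n} (\<lambda>_. lebesgue_on Iper)"

definition cN :: "nat \<Rightarrow> (real \<times> real \<Rightarrow> ennreal) \<Rightarrow> (nat \<Rightarrow> real) \<Rightarrow> ennreal" where
  "cN n w x = (\<Sum>i\<in>{..<n}. \<Sum>j\<in>{..<n} - {i}. w (x i, x j))"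

definition trigN :: "nat \<Rightarrow> (nat \<Rightarrow> int) \<Rightarrow> (nat \<Rightarrow> real) \<Rightarrow> complex" where
  "trigN n m x = cis (\<Sum>j<n. real_of_int (m j) * x j)"

definition wgradN :: "nat \<Rightarrow> ((nat \<Rightarrow> real) \<Rightarrow> complex) \<Rightarrow> (nat \<Rightarrow> (nat \<Rightarrow> real) \<Rightarrow> complex) \<Rightarrow> bool" where
  "wgradN n \<Psi> G \<longleftrightarrow>
     \<Psi> \<in> borel_measurable (muN n) \<and> integrable (muN n) (\<lambda>x. (cmod (\<Psi> x))\<^sup>2) \<and>
     (\<forall>j<n. G j \<in> borel_measurable (muN n) \<and> integrable (muN n) (\<lambda>x. (cmod (G j x))\<^sup>2) \<and>
        (\<forall>m::nat \<Rightarrow> int. (\<integral>x. \<Psi> x * (\<i> * of_int (m j) * trigN n m x) \<partial>muN n)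
                = - (\<integral>x. G j x * trigN n m x \<partial>muN n)))"

definition antisymN :: "nat \<Rightarrow> ((nat \<Rightarrow> real) \<Rightarrow> complex) \<Rightarrow> bool" where
  "antisymN n \<Psi> \<longleftrightarrow>
     (\<forall>\<sigma>. \<sigma> permutes {..<n} \<longrightarrow>
        (AE x in muN n. \<Psi> (x \<circ> \<sigma>) = of_int (sign \<sigma>) * \<Psi> x))"

definition innerN :: "nat \<Rightarrow> ((nat \<Rightarrow> real) \<Rightarrow> complex) \<Rightarrow> ((nat \<Rightarrow> real) \<Rightarrow> complex) \<Rightarrow> complex" where
  "innerN n \<Psi> \<Phi> = (\<integral>x. cnj (\<Psi> x) * \<Phi> x \<partial>muN n)"

text \<open>rho_Psi(t) = n * integral of |Psi(t, x_2, ..., x_n)|^2 (first variable is index 0).\<close>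
definition densN :: "nat \<Rightarrow> ((nat \<Rightarrow> real) \<Rightarrow> complex) \<Rightarrow> real \<Rightarrow> ennreal" where
  "densN n \<Psi> t = ennreal (real n) *
     (\<integral>\<^sup>+ y. ennreal ((cmod (\<Psi> (y(0 := t))))\<^sup>2) \<partial>PiM {1..<n} (\<lambda>_. lebesgue_on Iper))"

definition energyN :: "nat \<Rightarrow> (real \<times> real \<Rightarrow> ennreal) \<Rightarrow> real \<Rightarrow> ((nat \<Rightarrow> real) \<Rightarrow> complex)
    \<Rightarrow> (nat \<Rightarrow> (nat \<Rightarrow> real) \<Rightarrow> complex) \<Rightarrow> ennreal" where
  "energyN n w \<epsilon> \<Psi> G =
     (\<integral>\<^sup>+ x. ennreal (\<epsilon> * (\<Sum>j<n. (cmod (G j x))\<^sup>2)) + cN n w x * ennreal ((cmod (\<Psi> x))\<^sup>2) \<partial>muN n)"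

definition mixed :: "nat \<Rightarrow> (real \<Rightarrow> real) \<Rightarrow> (nat \<Rightarrow> real) \<Rightarrow> (nat \<Rightarrow> (nat \<Rightarrow> real) \<Rightarrow> complex)
    \<Rightarrow> (nat \<Rightarrow> nat \<Rightarrow> (nat \<Rightarrow> real) \<Rightarrow> complex) \<Rightarrow> bool" where
  "mixed n \<rho> lam \<Psi> G \<longleftrightarrow>
     (\<forall>k. 0 \<le> lam k) \<and> lam sums 1 \<and>
     (\<forall>k. antisymN n (\<Psi> k) \<and> wgradN n (\<Psi> k) (G k)) \<and>
     (\<forall>k l. innerN n (\<Psi> k) (\<Psi> l) = (if k = l then 1 else 0)) \<and>
     (AE t in lebesgue_on Iper. (\<Sum>k. ennreal (lam k) * densN n (\<Psi> k) t) = ennreal (real n * \<rho> t))"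

definition Feps :: "nat \<Rightarrow> (real \<times> real \<Rightarrow> ennreal) \<Rightarrow> real \<Rightarrow> (real \<Rightarrow> real) \<Rightarrow> ennreal" where
  "Feps n w \<epsilon> \<rho> =
     (INF s \<in> {(lam, \<Psi>, G). mixed n \<rho> lam \<Psi> G}.
        (case s of (lam, \<Psi>, G) \<Rightarrow> (\<Sum>k. ennreal (lam k) * energyN n w \<epsilon> (\<Psi> k) (G k))))"

definition coupling :: "nat \<Rightarrow> (real \<Rightarrow> real) \<Rightarrow> (nat \<Rightarrow> real) measure \<Rightarrow> bool" where
  "coupling n \<rho> \<gamma> \<longleftrightarrow>
     sets \<gamma> = sets (PiM {..<n} (\<lambda>_. restrict_space lborel Iper)) \<and> prob_space \<gamma> \<and>
     (\<forall>j<n. distr \<gamma> (restrict_space lborel Iper) (\<lambda>x. x j)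
             = density (restrict_space lborel Iper) (\<lambda>t. ennreal (\<rho> t)))"

definition FOT :: "nat \<Rightarrow> (real \<times> real \<Rightarrow> ennreal) \<Rightarrow> (real \<Rightarrow> real) \<Rightarrow> ennreal" where
  "FOT n w \<rho> = (INF \<gamma> \<in> {\<gamma>. coupling n \<rho> \<gamma>}. \<integral>\<^sup>+ x. cN n w x \<partial>\<gamma>)"

definition kantorovich_pot :: "nat \<Rightarrow> (real \<times> real \<Rightarrow> ennreal) \<Rightarrow> (real \<Rightarrow> real) \<Rightarrow> (real \<Rightarrow> real) \<Rightarrow> bool" where
  "kantorovich_pot n w \<rho> v \<longleftrightarrow>
     integrable (lebesgue_on Iper) (\<lambda>t. \<rho> t * v t) \<and>
     enn2ereal (FOT n w \<rho>) = ereal (real n * (\<integral>t. \<rho> t * v t \<partial>lebesgue_on Iper)) \<and>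
     (\<forall>x\<in>PiE {..<n} (\<lambda>_. Iper). 0 \<le> enn2ereal (cN n w x) - ereal (\<Sum>j<n. v (x j)))"

definition regular_kantorovich_pot :: "nat \<Rightarrow> (real \<times> real \<Rightarrow> ennreal) \<Rightarrow> (real \<Rightarrow> real) \<Rightarrow> (real \<Rightarrow> real) \<Rightarrow> bool" where
  "regular_kantorovich_pot n w \<rho> v \<longleftrightarrow> kantorovich_pot n w \<rho> v \<and> continuous_on Iper v"

end

theory Submission
  imports Defs "HOL-Complex_Analysis.Great_Picard"
begin

text \<open>
Normalise the potential by a constant so that n V(rho) is the quantum energy of rho. For disjointly supported
orbitals with squares f_1, ..., f_n, multiplying each orbital by phases running through its mass coordinate gives
infinitely many orthonormal Slater determinants with the same density, so mixed states realise the density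
(f_1 + ... + f_n) / n with energy at most epsilon times a kinetic term plus the maximal cost on the product of the
supports. Minimality therefore bounds V(f_1) + ... + V(f_n) from above. A density comparable to rho can be cut into
windows of equal mass that are grouped into such families, and since V(rho) is nonnegative this yields a bound on
the normalised potentials in the dual norm that is uniform in epsilon, and hence a weak limit V.

For the limit the kinetic term disappears, and testing with narrow bumps shows that the upper envelope of V is
feasible in the dual transport problem. A maximal feasible u above the envelope (Zorn's lemma) has nearly active
constraints at every point, hence inherits the modulus of continuity of the cost away from the diagonal, and V is
dominated by integration against u. The quantum energy dominates the transport cost, so n V(rho) is at least the
transport cost, which by weak duality is at least n times the integral of rho u. Since rho is strictly positive,
equality at rho forces V to be integration against u, and u is a Kantorovich potential.

If the cost is differentiable off the diagonal, any two potentials share contact configurations, and hence a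
supergradient at every point, so their difference is constant, and the constant is zero because the values agree.
Convergence of the whole family then follows from uniqueness of the limit along subsequences.
\<close>

section \<open>Smooth periodic functions\<close>

abbreviation Lper :: "real measure" where "Lper \<equiv> lebesgue_on Iper"

lemma Iper_sets [simp, measurable]: "Iper \<in> sets lebesgue" "Iper \<in> sets borel" "Iper \<in> sets lborel"
  by (auto simp: Iper_def)

lemma compact_Iper: "compact Iper" and Iper_nonempty: "Iper \<noteq> {}"
  by (auto simp: Iper_def)

lemma finite_measure_Lper: "finite_measure Lper"
  by (rule finite_measure_lebesgue_on) (simp add: Iper_def)

lemma measure_Lper: "measure Lper Iper = 2 * pi"
  by (simp add: Iper_def measure_restrict_space)

lemma integrable_Lper_cont:
  fixes f :: "real \<Rightarrow> 'b::euclidean_space"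
  assumes "continuous_on Iper f"
  shows "integrable Lper f"
  using assms unfolding Iper_def by (rule continuous_imp_integrable_real)

lemma measurable_Lper_cont:
  fixes f :: "real \<Rightarrow> 'b::euclidean_space"
  assumes "continuous_on Iper f"
  shows "f \<in> borel_measurable Lper"
  using integrable_Lper_cont[OF assms] by auto

lemma integral_Lper_HK:
  fixes f :: "real \<Rightarrow> 'b::euclidean_space"
  assumes "continuous_on Iper f"
  shows "integral\<^sup>L Lper f = integral Iper f"
  by (rule lebesgue_integral_eq_integral[OF integrable_Lper_cont[OF assms]]) simp

lemma integral_Lper_FTC:
  fixes f :: "real \<Rightarrow> 'b::euclidean_space"
  assumes "\<And>t. (f has_vector_derivative f' t) (at t)" and f'_cont: "continuous_on UNIV f'"
  shows "integral\<^sup>L Lper f' = f (2 * pi) - f 0"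
proof -
  have "(f' has_integral (f (2 * pi) - f 0)) Iper"
    unfolding Iper_def
    by (rule fundamental_theorem_of_calculus) (auto intro: has_vector_derivative_at_within assms)
  then show ?thesis
    using integral_Lper_HK[OF continuous_on_subset[OF f'_cont subset_UNIV]] by (simp add: integral_unique)
qed

lemma integral_Lper_pos:
  fixes f :: "real \<Rightarrow> real"
  assumes "continuous_on Iper f" "\<And>t. t \<in> Iper \<Longrightarrow> 0 \<le> f t" "s \<in> Iper" "0 < f s"
  shows "0 < (\<integral>t. f t \<partial>Lper)"
proof -
  have "0 \<le> (\<integral>t. f t \<partial>Lper)"
    using assms(2) by (intro integral_nonneg_AE AE_I2) simp
  moreover have "(\<integral>t. f t \<partial>Lper) \<noteq> 0"
    using integralL_eq_0_iff[of 0 "2 * pi" f] assms by (fastforce simp: Iper_def)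
  ultimately show ?thesis by simp
qed

lemma le_integral_Lper_somewhere:
  fixes f :: "real \<Rightarrow> real"
  assumes f_cont: "continuous_on Iper f" and f_nonneg: "\<And>t. t \<in> Iper \<Longrightarrow> 0 \<le> f t"
  obtains s where "s \<in> Iper" "f s \<le> (\<integral>t. f t \<partial>Lper)"
proof -
  obtain s where s: "s \<in> Iper" and s_min: "\<And>t. t \<in> Iper \<Longrightarrow> f s \<le> f t"
    using continuous_attains_inf[OF compact_Iper Iper_nonempty f_cont] by blast
  have "1 * f s \<le> 2 * pi * f s"
    using f_nonneg[OF s] pi_gt3 by (intro mult_right_mono) auto
  also have "\<dots> = (\<integral>t. f s \<partial>Lper)" by (simp add: measure_Lper)
  also have "\<dots> \<le> (\<integral>t. f t \<partial>Lper)"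
    using s_min by (intro integral_mono integrable_Lper_cont f_cont continuous_on_const) simp
  finally show ?thesis using that s by simp
qed

lemma continuous_antiderivative:
  fixes g :: "real \<Rightarrow> 'a::euclidean_space"
  assumes "continuous_on UNIV g"
  obtains G where "\<And>t. (G has_vector_derivative g t) (at t)" "G 0 = 0"
proof -
  have "\<exists>F. \<forall>x :: real. - \<infinity> < ereal x \<longrightarrow> ereal x < \<infinity> \<longrightarrow> (F has_vector_derivative g x) (at x)"
    using assms by (intro einterval_antiderivative) (auto simp: continuous_on_eq_continuous_at)
  then obtain F where "\<And>x. (F has_vector_derivative g x) (at x)" by auto
  then show ?thesis
    by (intro that[of "\<lambda>t. F t - F 0"]) (auto intro!: derivative_eq_intros)
qed

lemma has_vector_derivative_shift:
  fixes f :: "real \<Rightarrow> 'a::real_normed_vector"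
  assumes "(f has_vector_derivative d) (at (t + a))"
  shows "((\<lambda>t. f (t + a)) has_vector_derivative d) (at t)"
proof -
  have "((\<lambda>t. t + a) has_vector_derivative 1 + 0) (at t)"
    by (intro has_vector_derivative_add has_vector_derivative_id has_vector_derivative_const)
  then show ?thesis using vector_diff_chain_at[of "\<lambda>t. t + a" 1 t f d] assms by (simp add: o_def)
qed

lemma antiderivative_add_period:
  fixes G :: "real \<Rightarrow> 'a::euclidean_space"
  assumes G_deriv: "\<And>t. (G has_vector_derivative g t) (at t)"
    and g_periodic: "\<And>t. g (t + 2 * pi) = g t" and g_cont: "continuous_on UNIV g"
  shows "G (t + 2 * pi) = G t + (\<integral>t. g t \<partial>Lper)"
proof -
  have "((\<lambda>t. G (t + 2 * pi) - G t) has_vector_derivative 0) (at x within UNIV)" for x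
    using has_vector_derivative_diff[OF has_vector_derivative_shift[OF G_deriv[of "x + 2 * pi"]] G_deriv[of x]]
    by (simp add: g_periodic)
  then obtain c where "\<And>x. G (x + 2 * pi) - G x = c"
    by (rule has_vector_derivative_zero_constant[OF convex_UNIV]) auto
  then have "G (t + 2 * pi) - G t = G (0 + 2 * pi) - G 0" by metis
  also have "\<dots> = (\<integral>t. g t \<partial>Lper)"
    using integral_Lper_FTC[of G g, OF G_deriv g_cont] by simp
  finally show ?thesis by (simp add: algebra_simps)
qed

lemma periodic_int:
  fixes f :: "real \<Rightarrow> 'a"
  assumes f_periodic: "\<And>t. f (t + 2 * pi) = f t"
  shows "f (t + 2 * pi * of_int k) = f t"
proof -
  have nat_multiple: "f (t + 2 * pi * real m) = f t" for m :: nat and t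
  proof (induction m)
    case (Suc m)
    have "t + 2 * pi * real (Suc m) = (t + 2 * pi * real m) + 2 * pi" by (simp add: algebra_simps)
    then show ?case using f_periodic[of "t + 2 * pi * real m"] Suc by metis
  qed simp
  show ?thesis
    using nat_multiple[of t "nat k"] nat_multiple[of "t + 2 * pi * of_int k" "nat (- k)"]
    by (cases "k \<ge> 0") auto
qed

lemma translate_into_Iper:
  obtains k :: int where "t + 2 * pi * of_int k \<in> Iper"
proof -
  define k where "k = \<lfloor>t / (2 * pi)\<rfloor>"
  have "of_int k \<le> t / (2 * pi)" "t / (2 * pi) < of_int k + 1" unfolding k_def by linarith+
  then have "of_int k * (2 * pi) \<le> t" "t < (of_int k + 1) * (2 * pi)"
    by (simp_all only: pos_le_divide_eq pos_divide_less_eq pi_gt_zero zero_less_mult_iff zero_less_numeral simp_thms)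
  then have "t + 2 * pi * of_int (- k) \<in> Iper" by (auto simp: Iper_def algebra_simps)
  then show ?thesis by (rule that)
qed

lemma periodic_all_if_Iper:
  assumes "\<And>t. f (t + 2 * pi) = f t" "\<And>t. t \<in> Iper \<Longrightarrow> P (f t)"
  shows "P (f t)"
proof -
  obtain k :: int where "t + 2 * pi * of_int k \<in> Iper" by (rule translate_into_Iper)
  then show ?thesis using assms(2) periodic_int[of f t k] assms(1) by metis
qed

lemma continuous_bounded_Iper:
  fixes u :: "real \<Rightarrow> real"
  assumes "continuous_on Iper u"
  obtains U where "0 \<le> U" "\<And>t. t \<in> Iper \<Longrightarrow> \<bar>u t\<bar> \<le> U"
proof -
  have "bounded (u ` Iper)" using compact_imp_bounded[OF compact_continuous_image[OF assms compact_Iper]] .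
  then obtain U where "\<And>t. t \<in> Iper \<Longrightarrow> \<bar>u t\<bar> \<le> U" by (auto simp: bounded_iff)
  then show ?thesis using that[of "max U 0"] by (auto simp: le_max_iff_disj)
qed

definition C1per :: "(real \<Rightarrow> real) \<Rightarrow> (real \<Rightarrow> real) \<Rightarrow> bool" where
  "C1per f f' \<longleftrightarrow> (\<forall>t. (f has_real_derivative f' t) (at t)) \<and> continuous_on UNIV f' \<and>
     (\<forall>t. f (t + 2 * pi) = f t)"

lemma C1per_DERIV: "C1per f f' \<Longrightarrow> (f has_real_derivative f' t) (at t)"
  and C1per_periodic: "C1per f f' \<Longrightarrow> f (t + 2 * pi) = f t"
  by (auto simp: C1per_def)

lemma C1per_cont:
  assumes "C1per f f'"
  shows "continuous_on A f" "continuous_on A f'"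
proof -
  have "continuous_on UNIV f"
    using C1per_DERIV[OF assms] by (meson DERIV_isCont continuous_at_imp_continuous_on)
  moreover have "continuous_on UNIV f'" using assms by (simp add: C1per_def)
  ultimately show "continuous_on A f" "continuous_on A f'" by (auto intro: continuous_on_subset)
qed

lemma C1per_deriv_periodic:
  assumes "C1per f f'"
  shows "f' (t + 2 * pi) = f' t"
proof -
  have "((\<lambda>t. f (t + 2 * pi)) has_real_derivative f' (t + 2 * pi)) (at t)"
    using C1per_DERIV[OF assms, of "t + 2 * pi"] has_vector_derivative_shift[of f _ t "2 * pi"]
    by (simp add: has_real_derivative_iff_has_vector_derivative)
  then show ?thesis
    using DERIV_unique[OF _ C1per_DERIV[OF assms]] C1per_periodic[OF assms] by simp
qed

lemma C1per_lin:
  assumes "C1per f f'" "C1per h h'"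
  shows "C1per (\<lambda>t. a * f t + b * h t) (\<lambda>t. a * f' t + b * h' t)"
  using assms unfolding C1per_def by (auto intro!: derivative_eq_intros continuous_intros)

lemma C1per_const: "C1per (\<lambda>t. c) (\<lambda>t. 0)"
  by (auto simp: C1per_def)

lemma C1per_cmult: "C1per f f' \<Longrightarrow> C1per (\<lambda>t. c * f t) (\<lambda>t. c * f' t)"
  and C1per_add: "C1per f f' \<Longrightarrow> C1per h h' \<Longrightarrow> C1per (\<lambda>t. f t + h t) (\<lambda>t. f' t + h' t)"
  and C1per_diff: "C1per f f' \<Longrightarrow> C1per h h' \<Longrightarrow> C1per (\<lambda>t. f t - h t) (\<lambda>t. f' t - h' t)"
  using C1per_lin[of f f' f f' c 0] C1per_lin[of f f' h h' 1 1] C1per_lin[of f f' h h' 1 "-1"] by simp_all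

lemma C1per_sum:
  assumes "finite A" "\<And>i. i \<in> A \<Longrightarrow> C1per (f i) (f' i)"
  shows "C1per (\<lambda>t. \<Sum>i\<in>A. f i t) (\<lambda>t. \<Sum>i\<in>A. f' i t)"
  using assms by (induction rule: finite_induct) (simp_all add: C1per_const C1per_add)

lemma C1per_mult:
  assumes "C1per f f'" "C1per h h'"
  shows "C1per (\<lambda>t. f t * h t) (\<lambda>t. f' t * h t + f t * h' t)"
  using assms C1per_cont[OF assms(1), of UNIV] C1per_cont[OF assms(2), of UNIV] unfolding C1per_def
  by (auto intro!: derivative_eq_intros continuous_intros)

lemma C1per_power2: "C1per f f' \<Longrightarrow> C1per (\<lambda>t. (f t)\<^sup>2) (\<lambda>t. 2 * f t * f' t)"
  using C1per_mult[of f f' f f'] by (simp add: power2_eq_square algebra_simps)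

lemma C1per_compose:
  assumes "C1per f f'" "\<And>t. (\<phi> has_real_derivative \<phi>' (f t)) (at (f t))"
    "continuous_on (range f) \<phi>'"
  shows "C1per (\<lambda>t. \<phi> (f t)) (\<lambda>t. \<phi>' (f t) * f' t)"
  unfolding C1per_def
proof (intro conjI allI)
  show "((\<lambda>t. \<phi> (f t)) has_real_derivative \<phi>' (f t) * f' t) (at t)" for t
    by (rule DERIV_chain2[where g=f, OF assms(2) C1per_DERIV[OF assms(1)]])
  show "\<phi> (f (t + 2 * pi)) = \<phi> (f t)" for t by (simp add: C1per_periodic[OF assms(1)])
  show "continuous_on UNIV (\<lambda>t. \<phi>' (f t) * f' t)"
    using C1per_cont[OF assms(1)] by (intro continuous_on_mult continuous_on_compose2[OF assms(3)]) auto
qed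

lemma C1per_sqrt:
  assumes "C1per f f'" "\<And>t. 0 < f t"
  shows "C1per (\<lambda>t. sqrt (f t)) (\<lambda>t. inverse (sqrt (f t)) / 2 * f' t)"
proof (rule C1per_compose[OF assms(1), of sqrt "\<lambda>y. inverse (sqrt y) / 2"])
  show "(sqrt has_real_derivative inverse (sqrt (f t)) / 2) (at (f t))" for t
    by (rule DERIV_real_sqrt[OF assms(2)])
  show "continuous_on (range f) (\<lambda>y. inverse (sqrt y) / 2)"
    using assms(2) by (intro continuous_intros) (auto simp: less_imp_neq[symmetric])
qed

lemma C1per_inverse:
  assumes "C1per f f'" "\<And>t. 0 < f t"
  shows "C1per (\<lambda>t. inverse (f t)) (\<lambda>t. - (inverse (f t) ^ Suc (Suc 0)) * f' t)"
proof (rule C1per_compose[OF assms(1), of inverse "\<lambda>y. - (inverse y ^ Suc (Suc 0))"])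
  show "(inverse has_real_derivative - (inverse (f t) ^ Suc (Suc 0))) (at (f t))" for t
    by (rule DERIV_inverse) (use assms(2)[of t] in simp)
  show "continuous_on (range f) (\<lambda>y. - (inverse y ^ Suc (Suc 0)))"
    using assms(2) by (intro continuous_intros) (auto simp: less_imp_neq[symmetric])
qed

lemma C1per_shift:
  assumes "C1per f f'"
  shows "C1per (\<lambda>t. f (t - a)) (\<lambda>t. f' (t - a))"
  unfolding C1per_def
proof (intro conjI allI)
  show "((\<lambda>t. f (t - a)) has_real_derivative f' (t - a)) (at t)" for t
    using C1per_DERIV[OF assms, of "t - a"] has_vector_derivative_shift[of f _ t "- a"]
    by (simp add: has_real_derivative_iff_has_vector_derivative)
  show "continuous_on UNIV (\<lambda>t. f' (t - a))"
    by (rule continuous_on_compose2[OF C1per_cont(2)[OF assms, of UNIV]]) (auto intro!: continuous_intros)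
  show "f (t + 2 * pi - a) = f (t - a)" for t
    using C1per_periodic[OF assms, of "t - a"] by (simp add: algebra_simps)
qed

lemma C1per_bounded:
  assumes "C1per f f'"
  obtains B where "0 \<le> B" "\<And>t. \<bar>f t\<bar> \<le> B" "\<And>t. \<bar>f' t\<bar> \<le> B"
proof -
  obtain A B where "\<And>t. t \<in> Iper \<Longrightarrow> \<bar>f t\<bar> \<le> A" "\<And>t. t \<in> Iper \<Longrightarrow> \<bar>f' t\<bar> \<le> B" "0 \<le> A"
    using C1per_cont[OF assms] continuous_bounded_Iper by metis
  then have "\<bar>f t\<bar> \<le> A" "\<bar>f' t\<bar> \<le> B" for t
    using periodic_all_if_Iper[of f "\<lambda>y. \<bar>y\<bar> \<le> A"] C1per_periodic[OF assms]
      periodic_all_if_Iper[of f' "\<lambda>y. \<bar>y\<bar> \<le> B"] C1per_deriv_periodic[OF assms] by auto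
  then show ?thesis using \<open>0 \<le> A\<close> by (intro that[of "max A B"]) (auto simp: le_max_iff_disj)
qed

definition H1_norm_sq :: "(real \<Rightarrow> real) \<Rightarrow> (real \<Rightarrow> real) \<Rightarrow> real" where
  "H1_norm_sq f g = (\<integral>t. (f t)\<^sup>2 \<partial>Lper) + (\<integral>t. (g t)\<^sup>2 \<partial>Lper)"

lemma H1_norm_sq_nonneg: "0 \<le> H1_norm_sq f g"
  by (simp add: H1_norm_sq_def)

lemma integral_power2_le_H1_norm_sq:
  "(\<integral>t. (f t)\<^sup>2 \<partial>Lper) \<le> H1_norm_sq f g" "(\<integral>t. (g t)\<^sup>2 \<partial>Lper) \<le> H1_norm_sq f g"
  by (simp_all add: H1_norm_sq_def)

lemma H1_norm_sq_cmult: "H1_norm_sq (\<lambda>t. c * f t) (\<lambda>t. c * g t) = c\<^sup>2 * H1_norm_sq f g"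
  by (simp add: H1_norm_sq_def power_mult_distrib distrib_left)

lemma C1per_power2_oscillation:
  assumes h: "C1per h h'" and "a \<le> b" "a \<in> Iper" "b \<in> Iper"
  shows "\<bar>(h b)\<^sup>2 - (h a)\<^sup>2\<bar> \<le> H1_norm_sq h h'"
proof -
  have h_cont: "continuous_on A h" "continuous_on A h'" for A using C1per_cont[OF h] by auto
  have HK_integrable: "(\<lambda>t. (h t)\<^sup>2 + (h' t)\<^sup>2) integrable_on {c..d}" for c d
    by (intro integrable_continuous_real continuous_intros h_cont)
  have "((\<lambda>t. 2 * h t * h' t) has_integral ((h b)\<^sup>2 - (h a)\<^sup>2)) {a..b}"
    using C1per_DERIV[OF C1per_power2[OF h]] \<open>a \<le> b\<close>
    by (intro fundamental_theorem_of_calculus)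
      (auto simp: has_real_derivative_iff_has_vector_derivative intro: has_vector_derivative_at_within)
  then have "\<bar>(h b)\<^sup>2 - (h a)\<^sup>2\<bar> = norm (integral {a..b} (\<lambda>t. 2 * h t * h' t))"
    by (simp add: integral_unique)
  also have "\<dots> \<le> integral {a..b} (\<lambda>t. (h t)\<^sup>2 + (h' t)\<^sup>2)"
  proof (rule integral_norm_bound_integral[OF _ HK_integrable])
    show "(\<lambda>t. 2 * h t * h' t) integrable_on {a..b}"
      by (intro integrable_continuous_real continuous_intros h_cont)
    show "norm (2 * h x * h' x) \<le> (h x)\<^sup>2 + (h' x)\<^sup>2" for x
      using sum_squares_bound[of "h x" "h' x"] sum_squares_bound[of "h x" "- h' x"] by (auto simp: abs_le_iff)
  qed
  also have "\<dots> \<le> integral Iper (\<lambda>t. (h t)\<^sup>2 + (h' t)\<^sup>2)"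
    using assms HK_integrable unfolding Iper_def by (intro integral_subset_le) auto
  also have "\<dots> = (\<integral>t. (h t)\<^sup>2 + (h' t)\<^sup>2 \<partial>Lper)"
    by (intro integral_Lper_HK[symmetric] continuous_intros h_cont)
  also have "\<dots> = H1_norm_sq h h'"
    unfolding H1_norm_sq_def
    by (intro Bochner_Integration.integral_add integrable_Lper_cont continuous_intros h_cont)
  finally show ?thesis .
qed

lemma C1per_sup_bound:
  assumes h: "C1per h h'"
  shows "(h t)\<^sup>2 \<le> 2 * H1_norm_sq h h'"
proof -
  obtain s where s: "s \<in> Iper" "(h s)\<^sup>2 \<le> (\<integral>t. (h t)\<^sup>2 \<partial>Lper)"
    by (rule le_integral_Lper_somewhere[of "\<lambda>t. (h t)\<^sup>2"]) (auto intro!: continuous_intros C1per_cont[OF h])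
  have "(h t)\<^sup>2 \<le> 2 * H1_norm_sq h h'" if t: "t \<in> Iper" for t
  proof -
    have "\<bar>(h t)\<^sup>2 - (h s)\<^sup>2\<bar> \<le> H1_norm_sq h h'"
      using C1per_power2_oscillation[OF h, of s t] C1per_power2_oscillation[OF h, of t s] s(1) t
      by (cases "s \<le> t") (auto simp: abs_minus_commute)
    then show ?thesis using s(2) integral_power2_le_H1_norm_sq(1)[of h h'] by linarith
  qed
  then show ?thesis
    using periodic_all_if_Iper[of h "\<lambda>y. y\<^sup>2 \<le> 2 * H1_norm_sq h h'"] C1per_periodic[OF h] by blast
qed

locale mass_coordinate =
  fixes g s :: "real \<Rightarrow> real"
  assumes g_cont_UNIV: "continuous_on UNIV g" and g_periodic: "\<And>t. g (t + 2 * pi) = g t"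
    and s_DERIV: "\<And>t. (s has_real_derivative g t) (at t)" and s_0: "s 0 = 0"
    and mass_one: "(\<integral>t. g t \<partial>Lper) = 1"
begin

lemma g_cont: "continuous_on A g"
  using g_cont_UNIV continuous_on_subset by blast

lemma s_cont: "continuous_on A s"
  using s_DERIV by (meson DERIV_isCont continuous_at_imp_continuous_on)

lemma s_add_period: "s (t + 2 * pi) = s t + 1"
  using antiderivative_add_period[of s g, OF _ g_periodic g_cont] s_DERIV
  by (simp add: has_real_derivative_iff_has_vector_derivative mass_one)

lemma s_add_int_period: "s (t + 2 * pi * of_int k) = s t + of_int k"
  using periodic_int[of "\<lambda>t. s t - t / (2 * pi)" t k] by (simp add: s_add_period add_divide_distrib)

lemma integral_substitution:
  fixes P :: "real \<Rightarrow> 'a::euclidean_space"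
  assumes P_cont: "continuous_on UNIV P" and P_periodic: "\<And>t. P (t + 2 * pi) = P t"
  shows "(\<integral>t. g t *\<^sub>R P (2 * pi * s t - a) \<partial>Lper) = (1 / (2 * pi)) *\<^sub>R (\<integral>t. P t \<partial>Lper)"
proof -
  obtain Q where Q: "\<And>t. (Q has_vector_derivative P t) (at t)"
    using continuous_antiderivative[OF P_cont] by metis
  have "((\<lambda>t. (1 / (2 * pi)) *\<^sub>R Q (2 * pi * s t - a)) has_vector_derivative
      g t *\<^sub>R P (2 * pi * s t - a)) (at t)" for t
  proof -
    have "((\<lambda>t. 2 * pi * s t - a) has_vector_derivative 2 * pi * g t) (at t)"
      using s_DERIV[of t]
      by (auto intro!: derivative_eq_intros simp: has_real_derivative_iff_has_vector_derivative[symmetric])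
    from vector_diff_chain_at[OF this Q]
    have "((\<lambda>t. Q (2 * pi * s t - a)) has_vector_derivative (2 * pi * g t) *\<^sub>R P (2 * pi * s t - a)) (at t)"
      by (simp add: o_def)
    from has_vector_derivative_scaleR[OF DERIV_const this, of "1 / (2 * pi)"] show ?thesis by simp
  qed
  then have "(\<integral>t. g t *\<^sub>R P (2 * pi * s t - a) \<partial>Lper)
    = (1 / (2 * pi)) *\<^sub>R Q (2 * pi * s (0 + 2 * pi) - a) - (1 / (2 * pi)) *\<^sub>R Q (2 * pi * s 0 - a)"
    by (subst integral_Lper_FTC) (auto intro!: continuous_intros g_cont s_cont continuous_on_compose2[OF P_cont])
  also have "\<dots> = (1 / (2 * pi)) *\<^sub>R (Q (- a + 2 * pi) - Q (- a))"
    by (simp only: s_add_period s_0) (simp add: algebra_simps)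
  also have "Q (- a + 2 * pi) - Q (- a) = (\<integral>t. P t \<partial>Lper)"
    using antiderivative_add_period[OF Q P_periodic P_cont, of "- a"] by simp
  finally show ?thesis .
qed

end

lemma mass_coordinate_exists:
  assumes "continuous_on UNIV g" "\<And>t. g (t + 2 * pi) = g t" "(\<integral>t. g t \<partial>Lper) = 1"
  shows "\<exists>s. mass_coordinate g s"
proof -
  obtain s where "\<And>t. (s has_vector_derivative g t) (at t)" "s 0 = 0"
    using continuous_antiderivative[OF assms(1)] by metis
  then show ?thesis
    using assms by (auto simp: mass_coordinate_def has_real_derivative_iff_has_vector_derivative)
qed

lemma integral_Lper_shift:
  fixes P :: "real \<Rightarrow> real"
  assumes "continuous_on UNIV P" "\<And>t. P (t + 2 * pi) = P t"
  shows "(\<integral>t. P (t - a) \<partial>Lper) = (\<integral>t. P t \<partial>Lper)"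
proof -
  interpret mass_coordinate "\<lambda>_. 1 / (2 * pi)" "\<lambda>t. t / (2 * pi)"
    by unfold_locales (auto intro!: derivative_eq_intros simp: measure_Lper)
  show ?thesis using integral_substitution[OF assms, of a] by simp
qed

lemma H1_norm_sq_shift:
  assumes "C1per f f'"
  shows "H1_norm_sq (\<lambda>t. f (t - a)) (\<lambda>t. f' (t - a)) = H1_norm_sq f f'"
  unfolding H1_norm_sq_def
  using integral_Lper_shift[of "\<lambda>t. (f t)\<^sup>2" a] integral_Lper_shift[of "\<lambda>t. (f' t)\<^sup>2" a]
  by (simp add: C1per_cont[OF assms] C1per_periodic[OF assms] C1per_deriv_periodic[OF assms] continuous_on_power)

section \<open>Fourier approximation\<close>

lemma norm_add_power2_le:
  fixes a b :: "'a::real_normed_vector"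
  shows "(norm (a + b))\<^sup>2 \<le> 2 * (norm a)\<^sup>2 + 2 * (norm b)\<^sup>2"
proof -
  have "(norm (a + b))\<^sup>2 \<le> (norm a + norm b)\<^sup>2" by (intro power_mono norm_triangle_ineq) simp
  also have "\<dots> \<le> 2 * (norm a)\<^sup>2 + 2 * (norm b)\<^sup>2"
    using sum_squares_bound[of "norm a" "norm b"] by (simp add: power2_sum)
  finally show ?thesis .
qed

definition square_integrable :: "'a measure \<Rightarrow> ('a \<Rightarrow> complex) \<Rightarrow> bool" where
  "square_integrable M f \<longleftrightarrow> f \<in> borel_measurable M \<and> integrable M (\<lambda>x. (cmod (f x))\<^sup>2)"

lemma square_integrable_of_real_iff:
  "square_integrable M (\<lambda>x. complex_of_real (f x)) \<longleftrightarrow> f \<in> borel_measurable M \<and> integrable M (\<lambda>x. (f x)\<^sup>2)"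
  by (simp add: square_integrable_def borel_measurable_complex_iff)

lemma square_integrable_lin:
  assumes "square_integrable M f" "square_integrable M g"
  shows "square_integrable M (\<lambda>x. a * f x + b * g x)"
  unfolding square_integrable_def
proof
  show meas: "(\<lambda>x. a * f x + b * g x) \<in> borel_measurable M"
    using assms by (auto simp: square_integrable_def)
  show "integrable M (\<lambda>x. (cmod (a * f x + b * g x))\<^sup>2)"
  proof (rule Bochner_Integration.integrable_bound)
    show "integrable M (\<lambda>x. 2 * (cmod a)\<^sup>2 * (cmod (f x))\<^sup>2 + 2 * (cmod b)\<^sup>2 * (cmod (g x))\<^sup>2)"
      using assms by (auto simp: square_integrable_def)
    show "(\<lambda>x. (cmod (a * f x + b * g x))\<^sup>2) \<in> borel_measurable M" using meas by measurable
    show "AE x in M. norm ((cmod (a * f x + b * g x))\<^sup>2)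
        \<le> norm (2 * (cmod a)\<^sup>2 * (cmod (f x))\<^sup>2 + 2 * (cmod b)\<^sup>2 * (cmod (g x))\<^sup>2)"
    proof (rule AE_I2)
      show "norm ((cmod (a * f x + b * g x))\<^sup>2)
        \<le> norm (2 * (cmod a)\<^sup>2 * (cmod (f x))\<^sup>2 + 2 * (cmod b)\<^sup>2 * (cmod (g x))\<^sup>2)" for x
        using norm_add_power2_le[of "a * f x" "b * g x"] by (simp add: norm_mult power_mult_distrib)
    qed
  qed
qed

lemma square_integrable_diff:
  "square_integrable M f \<Longrightarrow> square_integrable M g \<Longrightarrow> square_integrable M (\<lambda>x. f x - g x)"
  using square_integrable_lin[of M f g 1 "-1"] by simp

lemma square_integrable_cnj: "square_integrable M f \<Longrightarrow> square_integrable M (\<lambda>x. cnj (f x))"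
  by (simp add: square_integrable_def borel_measurable_complex_iff)

lemma square_integrable_Re_Im:
  assumes "square_integrable M f"
  shows "square_integrable M (\<lambda>x. complex_of_real (Re (f x)))"
    "square_integrable M (\<lambda>x. complex_of_real (Im (f x)))"
proof -
  have "(\<lambda>x. complex_of_real (Re (f x))) = (\<lambda>x. 1 / 2 * f x + 1 / 2 * cnj (f x))"
    "(\<lambda>x. complex_of_real (Im (f x))) = (\<lambda>x. - \<i> / 2 * f x + \<i> / 2 * cnj (f x))"
    by (auto simp: complex_eq_iff)
  then show "square_integrable M (\<lambda>x. complex_of_real (Re (f x)))"
    "square_integrable M (\<lambda>x. complex_of_real (Im (f x)))"
    using square_integrable_lin[OF assms square_integrable_cnj[OF assms]] by (simp_all only:)
qed

lemma integrable_mult_square_integrable: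
  assumes "square_integrable M f" "square_integrable M g"
  shows "integrable M (\<lambda>x. f x * g x)"
proof (rule Bochner_Integration.integrable_bound)
  show "integrable M (\<lambda>x. (cmod (f x))\<^sup>2 + (cmod (g x))\<^sup>2)"
    "(\<lambda>x. f x * g x) \<in> borel_measurable M"
    using assms by (auto simp: square_integrable_def)
  have "norm (f x * g x) \<le> norm ((cmod (f x))\<^sup>2 + (cmod (g x))\<^sup>2)" for x
  proof -
    have "cmod (f x) * cmod (g x) \<le> 2 * cmod (f x) * cmod (g x)" by (simp add: mult_le_cancel_right1)
    also have "\<dots> \<le> (cmod (f x))\<^sup>2 + (cmod (g x))\<^sup>2" by (rule sum_squares_bound)
    finally show ?thesis by (simp add: norm_mult)
  qed
  then show "AE x in M. norm (f x * g x) \<le> norm ((cmod (f x))\<^sup>2 + (cmod (g x))\<^sup>2)" by simp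
qed

lemma integral_cmod_diff_power2_triangle:
  assumes "square_integrable M u" "square_integrable M v" "square_integrable M h"
  shows "(\<integral>x. (cmod (u x - h x))\<^sup>2 \<partial>M) \<le> 2 * (\<integral>x. (cmod (u x - v x))\<^sup>2 \<partial>M) + 2 * (\<integral>x. (cmod (v x - h x))\<^sup>2 \<partial>M)"
proof -
  have integrable_diffs: "integrable M (\<lambda>x. (cmod (u x - v x))\<^sup>2)" "integrable M (\<lambda>x. (cmod (v x - h x))\<^sup>2)"
    "integrable M (\<lambda>x. (cmod (u x - h x))\<^sup>2)"
    using square_integrable_diff assms unfolding square_integrable_def by blast+
  have "(\<integral>x. (cmod (u x - h x))\<^sup>2 \<partial>M) \<le> (\<integral>x. 2 * (cmod (u x - v x))\<^sup>2 + 2 * (cmod (v x - h x))\<^sup>2 \<partial>M)"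
  proof (intro integral_mono)
    show "(cmod (u x - h x))\<^sup>2 \<le> 2 * (cmod (u x - v x))\<^sup>2 + 2 * (cmod (v x - h x))\<^sup>2" for x
      using norm_add_power2_le[of "u x - v x" "v x - h x"] by simp
  qed (use integrable_diffs in auto)
  then show ?thesis using integrable_diffs by simp
qed

lemma integral_diff_power2_triangle:
  fixes u v h :: "'a \<Rightarrow> real"
  assumes "square_integrable M (\<lambda>x. complex_of_real (u x))" "square_integrable M (\<lambda>x. complex_of_real (v x))"
    "square_integrable M (\<lambda>x. complex_of_real (h x))"
  shows "(\<integral>x. (u x - h x)\<^sup>2 \<partial>M) \<le> 2 * (\<integral>x. (u x - v x)\<^sup>2 \<partial>M) + 2 * (\<integral>x. (v x - h x)\<^sup>2 \<partial>M)"
  using integral_cmod_diff_power2_triangle[OF assms]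
  by (simp only: of_real_diff[symmetric] norm_of_real power2_abs)

lemma integral_cmod_add_power2_orthogonal:
  assumes "square_integrable M u" "square_integrable M v" and orthogonal: "(\<integral>x. u x * cnj (v x) \<partial>M) = 0"
  shows "(\<integral>x. (cmod (u x + v x))\<^sup>2 \<partial>M) = (\<integral>x. (cmod (u x))\<^sup>2 \<partial>M) + (\<integral>x. (cmod (v x))\<^sup>2 \<partial>M)"
proof -
  have "integrable M (\<lambda>x. Re (u x * cnj (v x)))"
    using assms by (intro integrable_Re integrable_mult_square_integrable square_integrable_cnj)
  moreover have "(\<integral>x. Re (u x * cnj (v x)) \<partial>M) = 0"
    using assms
    by (subst integral_Re) (simp_all add: orthogonal integrable_mult_square_integrable square_integrable_cnj
      del: times_complex.sel)
  moreover have "(cmod (u x + v x))\<^sup>2 = (cmod (u x))\<^sup>2 + (cmod (v x))\<^sup>2 + 2 * Re (u x * cnj (v x))" for x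
    by (simp only: cmod_power2 plus_complex.simps complex_cnj times_complex.simps cnj.simps)
      (simp add: power2_eq_square algebra_simps)
  ultimately show ?thesis
    using assms unfolding square_integrable_def by (simp del: times_complex.sel)
qed

lemma square_integrable_cont: "continuous_on Iper f \<Longrightarrow> square_integrable Lper f"
  by (auto simp: square_integrable_def intro!: measurable_Lper_cont integrable_Lper_cont continuous_intros)

lemma square_integrable_integrable_Lper: "square_integrable Lper f \<Longrightarrow> integrable Lper f"
  using integrable_mult_square_integrable[OF _ square_integrable_cont[of "\<lambda>_. 1"]] by auto

lemma trig1_vderiv: "((\<lambda>t. trig1 m t) has_vector_derivative \<i> * of_int m * trig1 m t) (at t)"
proof -
  have "((\<lambda>t. exp (\<i> * of_int m * of_real t)) has_vector_derivative
     (1 * (\<i> * of_int m)) * exp (\<i> * of_int m * of_real t)) (at t)"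
    by (rule has_vector_derivative_real_field) (auto intro!: derivative_eq_intros)
  then show ?thesis by (simp add: trig1_def cis_conv_exp mult_ac)
qed

lemma trig1_cont: "continuous_on A (trig1 m)"
  unfolding trig1_def by (intro continuous_intros)

lemma trig1_periodic: "trig1 m (t + 2 * pi) = trig1 m t"
  using cis_multiple_2pi[of "real_of_int m"]
  by (simp add: trig1_def distrib_left cis_mult[symmetric] mult_ac)

lemma trig1_mult: "trig1 m t * trig1 k t = trig1 (m + k) t"
  by (simp add: trig1_def cis_mult algebra_simps)

lemma trig1_cnj: "cnj (trig1 m t) = trig1 (- m) t"
  by (simp add: trig1_def cis_cnj)

lemma square_integrable_trig1: "square_integrable Lper (\<lambda>t. c * trig1 m t)"
  by (intro square_integrable_cont continuous_intros trig1_cont)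

lemma integral_trig1: "(\<integral>t. trig1 m t \<partial>Lper) = (if m = 0 then 2 * pi else 0)"
proof (cases "m = 0")
  case True then show ?thesis by (simp add: trig1_def measure_Lper scaleR_conv_of_real)
next
  case False
  have "integral\<^sup>L Lper (\<lambda>t. \<i> * of_int m * trig1 m t) = trig1 m (2*pi) - trig1 m 0"
    by (rule integral_Lper_FTC) (auto intro!: trig1_vderiv continuous_intros trig1_cont)
  also have "\<dots> = 0" using trig1_periodic[of m 0] by simp
  finally show ?thesis using False by simp
qed

definition trig_poly :: "nat \<Rightarrow> (int \<Rightarrow> complex) \<Rightarrow> real \<Rightarrow> complex" where
  "trig_poly k a t = (\<Sum>m\<in>{-int k..int k}. a m * trig1 m t)"

lemma trig_poly_cont: "continuous_on A (trig_poly k a)"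
  unfolding trig_poly_def by (intro continuous_intros trig1_cont)

lemma square_integrable_trig_poly: "square_integrable Lper (trig_poly k a)"
  by (rule square_integrable_cont[OF trig_poly_cont])

lemma trig_poly_extend: "k \<le> l \<Longrightarrow> trig_poly k a = trig_poly l (\<lambda>m. if \<bar>m\<bar> \<le> int k then a m else 0)"
  unfolding trig_poly_def fun_eq_iff
  by (intro allI sum.mono_neutral_cong_left) auto

lemma trig_poly_lin: "\<exists>c. (\<lambda>t. x * trig_poly k a t + y * trig_poly l b t) = trig_poly (max k l) c"
proof -
  have "(\<lambda>t. x * trig_poly j a' t + y * trig_poly j b' t) = trig_poly j (\<lambda>m. x * a' m + y * b' m)" for j a' b'
    by (auto simp: trig_poly_def fun_eq_iff sum_distrib_left sum.distrib algebra_simps)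
  then show ?thesis
    using trig_poly_extend[of k "max k l" a] trig_poly_extend[of l "max k l" b] by auto
qed

lemma trig_poly_mult: "\<exists>c. (\<lambda>t. trig_poly k a t * trig_poly l b t) = trig_poly (k + l) c"
proof -
  define summand
    where "summand = (\<lambda>i m t. if m - i \<in> {-int l..int l} then a i * b (m - i) * trig1 m t else 0)"
  let ?c = "\<lambda>m. \<Sum>i\<in>{-int k..int k}. if m - i \<in> {-int l..int l} then a i * b (m - i) else 0"
  have sum_shift: "(\<Sum>m\<in>{-int (k+l)..int (k+l)}. summand i m t) = (\<Sum>j\<in>{-int l..int l}. a i * b j * trig1 (i + j) t)"
    if "i \<in> {-int k..int k}" for i t
  proof -
    have "(\<Sum>m\<in>{-int (k+l)..int (k+l)}. summand i m t) = (\<Sum>m\<in>{i - int l..i + int l}. a i * b (m - i) * trig1 m t)"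
      using that unfolding summand_def by (intro sum.mono_neutral_cong_right) auto
    also have "\<dots> = (\<Sum>j\<in>{-int l..int l}. a i * b j * trig1 (i + j) t)"
      by (rule sum.reindex_bij_witness[of _ "\<lambda>j. i + j" "\<lambda>m. m - i"]) auto
    finally show ?thesis .
  qed
  have "trig_poly (k + l) ?c t = trig_poly k a t * trig_poly l b t" for t
  proof -
    have "trig_poly (k + l) ?c t = (\<Sum>m\<in>{-int (k+l)..int (k+l)}. \<Sum>i\<in>{-int k..int k}. summand i m t)"
      unfolding trig_poly_def sum_distrib_right summand_def by (intro sum.cong refl) auto
    also have "\<dots> = (\<Sum>i\<in>{-int k..int k}. \<Sum>j\<in>{-int l..int l}. a i * b j * trig1 (i + j) t)"
      by (subst sum.swap) (intro sum.cong refl sum_shift)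
    also have "\<dots> = trig_poly k a t * trig_poly l b t"
      unfolding trig_poly_def sum_product trig1_mult[symmetric] by (simp add: mult_ac)
    finally show ?thesis .
  qed
  then have "(\<lambda>t. trig_poly k a t * trig_poly l b t) = trig_poly (k + l) ?c" by (intro ext) (simp only:)
  then show ?thesis by blast
qed

lemma linear_on_circle_trig_poly:
  assumes "bounded_linear (f :: complex \<Rightarrow> real)"
  shows "\<exists>a. (\<lambda>t. complex_of_real (f (cis t))) = trig_poly 1 a"
proof -
  interpret bounded_linear f by fact
  let ?a = "\<lambda>m::int. if m = 1 then (f 1 - \<i> * f \<i>) / 2 else if m = - 1 then (f 1 + \<i> * f \<i>) / 2 else 0"
  have "complex_of_real (f (cis t)) = trig_poly 1 ?a t" for t
  proof -
    have "cis t = cos t *\<^sub>R 1 + sin t *\<^sub>R \<i>" by (simp add: complex_eq_iff)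
    then have "f (cis t) = cos t * f 1 + sin t * f \<i>" by (simp only: add scaleR) simp
    moreover have "{- int 1..int 1} = {-1, 0, 1}" by auto
    ultimately show ?thesis by (simp add: trig_poly_def trig1_def complex_eq_iff field_simps)
  qed
  then show ?thesis by blast
qed

lemma polynomial_on_circle_trig_poly:
  assumes "real_polynomial_function (p :: complex \<Rightarrow> real)"
  shows "\<exists>k a. (\<lambda>t. complex_of_real (p (cis t))) = trig_poly k a"
  using assms
proof (induction rule: real_polynomial_function.induct)
  case (linear f)
  then show ?case using linear_on_circle_trig_poly by blast
next
  case (const c)
  have "(\<lambda>t. complex_of_real c) = trig_poly 0 (\<lambda>_. c)" by (auto simp: trig_poly_def trig1_def)
  then show ?case by metis
next
  case (add f g)
  then obtain k a l b where "(\<lambda>t. complex_of_real (f (cis t))) = trig_poly k a"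
    "(\<lambda>t. complex_of_real (g (cis t))) = trig_poly l b" by blast
  then have "(\<lambda>t. complex_of_real (f (cis t) + g (cis t))) = (\<lambda>t. 1 * trig_poly k a t + 1 * trig_poly l b t)"
    by (auto simp: fun_eq_iff)
  then show ?case using trig_poly_lin[of 1 k a 1 l b] by metis
next
  case (mult f g)
  then obtain k a l b where "(\<lambda>t. complex_of_real (f (cis t))) = trig_poly k a"
    "(\<lambda>t. complex_of_real (g (cis t))) = trig_poly l b" by blast
  then have "(\<lambda>t. complex_of_real (f (cis t) * g (cis t))) = (\<lambda>t. trig_poly k a t * trig_poly l b t)"
    by (auto simp: fun_eq_iff)
  then show ?case using trig_poly_mult[of k a l b] by metis
qed

definition fourier_coeff :: "(real \<Rightarrow> complex) \<Rightarrow> int \<Rightarrow> complex" where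
  "fourier_coeff u m = complex_of_real (1 / (2 * pi)) * (\<integral>t. u t * trig1 (- m) t \<partial>Lper)"

lemma fourier_coeff_trig_poly:
  assumes "m \<in> {-int k..int k}"
  shows "fourier_coeff (trig_poly k a) m = a m"
proof -
  have "(\<integral>t. trig_poly k a t * trig1 (- m) t \<partial>Lper) = (\<integral>t. (\<Sum>j\<in>{-int k..int k}. a j * trig1 (j - m) t) \<partial>Lper)"
    by (simp add: trig_poly_def sum_distrib_right mult.assoc trig1_mult)
  also have "\<dots> = (\<Sum>j\<in>{-int k..int k}. a j * (\<integral>t. trig1 (j - m) t \<partial>Lper))"
    by (subst Bochner_Integration.integral_sum) (auto intro!: integrable_Lper_cont continuous_intros trig1_cont)
  also have "\<dots> = (\<Sum>j\<in>{-int k..int k}. if j = m then complex_of_real (2 * pi) * a j else 0)"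
    by (rule sum.cong) (auto simp: integral_trig1)
  also have "\<dots> = complex_of_real (2 * pi) * a m" using assms by simp
  finally show ?thesis by (simp add: fourier_coeff_def)
qed

lemma fourier_remainder_orthogonal:
  assumes u: "square_integrable Lper u"
  shows "(\<integral>t. (u t - trig_poly k (fourier_coeff u) t) * cnj (trig_poly k b t) \<partial>Lper) = 0"
proof -
  let ?r = "\<lambda>t. u t - trig_poly k (fourier_coeff u) t"
  have r: "square_integrable Lper ?r" by (intro square_integrable_diff u square_integrable_trig_poly)
  have trig1_orthogonal: "(\<integral>t. ?r t * trig1 (- m) t \<partial>Lper) = 0" if "m \<in> {-int k..int k}" for m
  proof -
    have "(\<integral>t. ?r t * trig1 (- m) t \<partial>Lper)
      = (\<integral>t. u t * trig1 (- m) t \<partial>Lper) - (\<integral>t. trig_poly k (fourier_coeff u) t * trig1 (- m) t \<partial>Lper)"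
      unfolding left_diff_distrib using square_integrable_trig1[of 1 "- m"]
      by (intro Bochner_Integration.integral_diff integrable_mult_square_integrable u square_integrable_trig_poly) auto
    then show ?thesis
      using fourier_coeff_trig_poly[OF that, of "fourier_coeff u"] by (simp add: fourier_coeff_def)
  qed
  have "(\<integral>t. ?r t * cnj (trig_poly k b t) \<partial>Lper)
    = (\<integral>t. (\<Sum>m\<in>{-int k..int k}. cnj (b m) * (?r t * trig1 (- m) t)) \<partial>Lper)"
    by (simp add: trig_poly_def[of k b] trig1_cnj sum_distrib_left mult_ac)
  also have "\<dots> = (\<Sum>m\<in>{-int k..int k}. cnj (b m) * (\<integral>t. ?r t * trig1 (- m) t \<partial>Lper))"
    using square_integrable_trig1[of 1]
    by (subst Bochner_Integration.integral_sum)
      (auto intro!: integrable_mult_right integrable_mult_square_integrable[OF r])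
  also have "\<dots> = 0" by (intro sum.neutral) (simp add: trig1_orthogonal)
  finally show ?thesis .
qed

lemma fourier_best_approx:
  assumes u: "square_integrable Lper u"
  shows "(\<integral>t. (cmod (u t - trig_poly k (fourier_coeff u) t))\<^sup>2 \<partial>Lper)
      \<le> (\<integral>t. (cmod (u t - trig_poly k a t))\<^sup>2 \<partial>Lper)"
proof -
  let ?b = "\<lambda>m. fourier_coeff u m - a m"
  have "u t - trig_poly k a t = (u t - trig_poly k (fourier_coeff u) t) + trig_poly k ?b t" for t
    by (simp add: trig_poly_def sum_subtractf left_diff_distrib)
  then have "(\<integral>t. (cmod (u t - trig_poly k a t))\<^sup>2 \<partial>Lper)
    = (\<integral>t. (cmod (u t - trig_poly k (fourier_coeff u) t))\<^sup>2 \<partial>Lper) + (\<integral>t. (cmod (trig_poly k ?b t))\<^sup>2 \<partial>Lper)"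
    using integral_cmod_add_power2_orthogonal[OF _ _ fourier_remainder_orthogonal[OF u, of k ?b]]
      square_integrable_diff[OF u] square_integrable_trig_poly by (simp only:)
  then show ?thesis by simp
qed

definition trig_approximable :: "(real \<Rightarrow> complex) \<Rightarrow> bool" where
  "trig_approximable u \<longleftrightarrow> square_integrable Lper u \<and>
     (\<forall>e>0. \<exists>k a. (\<integral>t. (cmod (u t - trig_poly k a t))\<^sup>2 \<partial>Lper) < e)"

lemma trig_approximableD:
  assumes "trig_approximable u"
  shows "square_integrable Lper u" "0 < e \<Longrightarrow> \<exists>k a. (\<integral>t. (cmod (u t - trig_poly k a t))\<^sup>2 \<partial>Lper) < e"
  using assms unfolding trig_approximable_def by blast+

lemma trig_approximable_cong:
  assumes "trig_approximable u" "\<And>t. t \<in> Iper \<Longrightarrow> u t = v t"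
  shows "trig_approximable v"
proof -
  have "square_integrable Lper u \<longleftrightarrow> square_integrable Lper v"
    unfolding square_integrable_def using assms(2)
    by (intro conj_cong measurable_cong Bochner_Integration.integrable_cong) auto
  moreover have "(\<integral>t. (cmod (u t - trig_poly k a t))\<^sup>2 \<partial>Lper)
      = (\<integral>t. (cmod (v t - trig_poly k a t))\<^sup>2 \<partial>Lper)" for k a
    using assms(2) by (intro Bochner_Integration.integral_cong) auto
  ultimately show ?thesis using assms(1) by (simp add: trig_approximable_def)
qed

lemma trig_approximable_limit:
  assumes u: "square_integrable Lper u" and h: "\<And>n. trig_approximable (h n)"
    and lim: "(\<lambda>n. \<integral>t. (cmod (u t - h n t))\<^sup>2 \<partial>Lper) \<longlonglongrightarrow> 0"
  shows "trig_approximable u"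
  unfolding trig_approximable_def
proof (intro conjI allI impI u)
  fix e :: real assume "e > 0"
  then have "\<forall>\<^sub>F n in sequentially. (\<integral>t. (cmod (u t - h n t))\<^sup>2 \<partial>Lper) < e / 4"
    using lim by (intro order_tendstoD) auto
  then obtain n where n: "(\<integral>t. (cmod (u t - h n t))\<^sup>2 \<partial>Lper) < e / 4"
    by (auto simp: eventually_sequentially)
  obtain k a where approx: "(\<integral>t. (cmod (h n t - trig_poly k a t))\<^sup>2 \<partial>Lper) < e / 4"
    using trig_approximableD(2)[OF h[of n], of "e / 4"] \<open>e > 0\<close> by auto
  have "(\<integral>t. (cmod (u t - trig_poly k a t))\<^sup>2 \<partial>Lper) < e"
    using integral_cmod_diff_power2_triangle[OF u trig_approximableD(1)[OF h[of n]]
      square_integrable_trig_poly, of k a] n approx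
    by linarith
  then show "\<exists>k a. (\<integral>t. (cmod (u t - trig_poly k a t))\<^sup>2 \<partial>Lper) < e" by blast
qed

lemma trig_approximable_add_ii:
  assumes u: "trig_approximable u" and v: "trig_approximable v"
  shows "trig_approximable (\<lambda>t. u t + \<i> * v t)"
  unfolding trig_approximable_def
proof (intro conjI allI impI)
  note u_sq = trig_approximableD(1)[OF u] and v_sq = trig_approximableD(1)[OF v]
  show uv_sq: "square_integrable Lper (\<lambda>t. u t + \<i> * v t)"
    using square_integrable_lin[OF u_sq v_sq, of 1 \<i>] by simp
  fix e :: real assume e: "e > 0"
  obtain k a where u_approx: "(\<integral>t. (cmod (u t - trig_poly k a t))\<^sup>2 \<partial>Lper) < e / 4"
    using trig_approximableD(2)[OF u, of "e / 4"] e by auto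
  obtain l b where v_approx: "(\<integral>t. (cmod (v t - trig_poly l b t))\<^sup>2 \<partial>Lper) < e / 4"
    using trig_approximableD(2)[OF v, of "e / 4"] e by auto
  obtain c where "(\<lambda>t. 1 * trig_poly k a t + \<i> * trig_poly l b t) = trig_poly (max k l) c"
    using trig_poly_lin by blast
  then have c: "trig_poly (max k l) c t = trig_poly k a t + \<i> * trig_poly l b t" for t by (metis mult_1)
  have "square_integrable Lper (\<lambda>t. trig_poly k a t + \<i> * v t)"
    using square_integrable_lin[OF square_integrable_trig_poly v_sq, of 1 k a \<i>] by simp
  from integral_cmod_diff_power2_triangle[OF uv_sq this square_integrable_trig_poly, of "max k l" c]
  have "(\<integral>t. (cmod (u t + \<i> * v t - trig_poly (max k l) c t))\<^sup>2 \<partial>Lper)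
    \<le> 2 * (\<integral>t. (cmod (u t - trig_poly k a t))\<^sup>2 \<partial>Lper) + 2 * (\<integral>t. (cmod (\<i> * (v t - trig_poly l b t)))\<^sup>2 \<partial>Lper)"
    by (simp add: c right_diff_distrib)
  also have "\<dots> < e" using u_approx v_approx by (simp add: norm_mult)
  finally show "\<exists>k a. (\<integral>t. (cmod (u t + \<i> * v t - trig_poly k a t))\<^sup>2 \<partial>Lper) < e" by blast
qed

lemma trig_approximable_circle:
  assumes F: "continuous_on (sphere 0 1) (F :: complex \<Rightarrow> real)"
  shows "trig_approximable (\<lambda>t. complex_of_real (F (cis t)))"
  unfolding trig_approximable_def
proof (intro conjI allI impI)
  have F_cont: "continuous_on A (\<lambda>t. complex_of_real (F (cis t)))" for A
    by (intro continuous_intros continuous_on_compose2[OF F]) auto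
  show "square_integrable Lper (\<lambda>t. complex_of_real (F (cis t)))" by (rule square_integrable_cont[OF F_cont])
  fix e :: real assume e: "e > 0"
  define d where "d = sqrt (e / 8)"
  have d: "d > 0" using e by (simp add: d_def)
  obtain p where p: "real_polynomial_function p" "\<And>x. x \<in> sphere 0 1 \<Longrightarrow> \<bar>F x - p x\<bar> < d"
    using Stone_Weierstrass_real_polynomial_function[OF _ F d] by auto
  obtain k a where poly_eq: "(\<lambda>t. complex_of_real (p (cis t))) = trig_poly k a"
    using polynomial_on_circle_trig_poly[OF p(1)] by blast
  have "(\<integral>t. (cmod (complex_of_real (F (cis t)) - trig_poly k a t))\<^sup>2 \<partial>Lper) \<le> (\<integral>t. d\<^sup>2 \<partial>Lper)"
  proof (intro integral_mono power_mono)
    show "cmod (complex_of_real (F (cis t)) - trig_poly k a t) \<le> d" for t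
      using p(2)[of "cis t"] unfolding poly_eq[symmetric] of_real_diff[symmetric] norm_of_real by simp
  qed (auto intro!: integrable_Lper_cont continuous_intros F_cont trig_poly_cont)
  also have "\<dots> = 2 * pi * (e / 8)" using e by (simp add: measure_Lper d_def)
  also have "\<dots> < e" using e pi_less_4 by (simp add: field_simps)
  finally show "\<exists>k a. (\<integral>t. (cmod (complex_of_real (F (cis t)) - trig_poly k a t))\<^sup>2 \<partial>Lper) < e" by blast
qed

lemma Arg2pi_cis: "0 \<le> t \<Longrightarrow> t < 2 * pi \<Longrightarrow> Arg2pi (cis t) = t"
  by (intro Arg2pi_unique[of 1]) (auto simp: cis_conv_exp)

lemma cis_Arg2pi: "norm z = 1 \<Longrightarrow> cis (Arg2pi z) = z"
  using Arg2pi[of z] by (simp add: is_Arg_def cis_conv_exp)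

lemma trig_approximable_periodic:
  assumes g_cont: "continuous_on Iper (g :: real \<Rightarrow> real)" and ends: "g (2 * pi) = g 0"
  shows "trig_approximable (\<lambda>t. complex_of_real (g t))"
proof -
  define F where "F = (\<lambda>z. g (Arg2pi z))"
  have F_cis: "F (cis t) = g t" if "t \<in> Iper" for t
    using that Arg2pi_cis[of t] Arg2pi_cis[of 0] ends by (cases "t = 2 * pi") (auto simp: F_def Iper_def)
  have "continuous_on (sphere 0 1) F"
  proof (subst continuous_on_closed_vimage, simp, intro allI impI)
    fix B :: "real set" assume "closed B"
    have "F -` B \<inter> sphere 0 1 = cis ` (Iper \<inter> g -` B)"
    proof (intro equalityI subsetI)
      fix z assume z: "z \<in> F -` B \<inter> sphere 0 1"
      then have "Arg2pi z \<in> Iper \<inter> g -` B" using Arg2pi[of z] by (auto simp: F_def Iper_def)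
      then show "z \<in> cis ` (Iper \<inter> g -` B)" using z cis_Arg2pi[of z] by (intro image_eqI) auto
    qed (use F_cis in auto)
    moreover have "compact (Iper \<inter> g -` B)"
      using continuous_closed_preimage[OF g_cont compact_imp_closed[OF compact_Iper] \<open>closed B\<close>] compact_Iper
        compact_Int_closed[OF compact_Iper] by (metis inf_left_idem)
    then have "compact (cis ` (Iper \<inter> g -` B))" by (intro compact_continuous_image continuous_intros)
    ultimately show "closed (F -` B \<inter> sphere 0 1)" by (simp add: compact_imp_closed)
  qed
  from trig_approximable_circle[OF this] show ?thesis by (rule trig_approximable_cong) (simp add: F_cis)
qed

lemma L2_dominated_convergence:
  fixes u :: "real \<Rightarrow> real"
  assumes [measurable]: "\<And>n. h n \<in> borel_measurable Lper" "u \<in> borel_measurable Lper"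
    and b: "integrable Lper b" "\<And>n t. t \<in> Iper \<Longrightarrow> (u t - h n t)\<^sup>2 \<le> b t"
    and lim: "AE t in Lper. (\<lambda>n. h n t) \<longlonglongrightarrow> u t"
  shows "(\<lambda>n. \<integral>t. (cmod (complex_of_real (u t) - complex_of_real (h n t)))\<^sup>2 \<partial>Lper) \<longlonglongrightarrow> 0"
proof -
  have "(\<lambda>n. \<integral>t. (u t - h n t)\<^sup>2 \<partial>Lper) \<longlonglongrightarrow> (\<integral>t. 0 \<partial>Lper)"
  proof (rule integral_dominated_convergence[where w=b])
    show "AE t in Lper. (\<lambda>n. (u t - h n t)\<^sup>2) \<longlonglongrightarrow> 0"
      using lim
    proof eventually_elim
      case (elim t)
      have "(\<lambda>n. (u t - h n t)\<^sup>2) \<longlonglongrightarrow> (u t - u t)\<^sup>2" by (intro tendsto_intros elim)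
      then show ?case by simp
    qed
  qed (use b in auto)
  then show ?thesis by (simp flip: of_real_diff)
qed

lemma AE_Lper_interior: "AE t in Lper. 0 < t \<and> t < 2 * pi"
proof (rule AE_I')
  show "{0, 2*pi} \<in> null_sets Lper"
    by (auto simp: null_sets_restrict_space Iper_def negligible_iff_null_sets[symmetric])
qed (auto simp: Iper_def)

lemma measurable_AE_limit_continuous:
  assumes u: "u \<in> borel_measurable Lper"
  obtains g :: "nat \<Rightarrow> real \<Rightarrow> real" where "\<And>n. continuous_on UNIV (g n)" "AE t in Lper. (\<lambda>n. g n t) \<longlonglongrightarrow> u t"
proof -
  have "(\<lambda>x. if x \<in> Iper then u x else 0) \<in> borel_measurable lebesgue"
    using u by (simp only: borel_measurable_if[OF Iper_sets(1)])
  then have "(\<lambda>x. if x \<in> Iper then u x else 0) measurable_on UNIV"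
    by (intro lebesgue_measurable_imp_measurable_on) auto
  then obtain N g where N: "negligible N" and g: "\<And>n. continuous_on UNIV (g n)"
    and g_lim: "\<And>x. x \<notin> N \<Longrightarrow> (\<lambda>n. g n x) \<longlonglongrightarrow> (if x \<in> Iper then u x else 0)"
    unfolding measurable_on_def by auto
  have "N \<inter> Iper \<in> null_sets Lper"
    using N
    by (auto simp: null_sets_restrict_space negligible_iff_null_sets[symmetric] intro: negligible_subset)
  then have "AE x in Lper. x \<notin> N" by (rule AE_I') auto
  moreover have "(\<lambda>n. g n x) \<longlonglongrightarrow> u x" if "x \<in> space Lper" "x \<notin> N" for x using g_lim[of x] that by simp
  ultimately have "AE t in Lper. (\<lambda>n. g n t) \<longlonglongrightarrow> u t" by (auto elim: AE_mp)
  with g show ?thesis by (rule that)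
qed

lemma bounded_AE_limit_continuous_periodic:
  fixes u :: "real \<Rightarrow> real"
  assumes u: "u \<in> borel_measurable Lper" and bound: "\<And>t. t \<in> Iper \<Longrightarrow> \<bar>u t\<bar> \<le> B" and "0 \<le> B"
  obtains h :: "nat \<Rightarrow> real \<Rightarrow> real" where "\<And>n. continuous_on Iper (h n)" "\<And>n. h n 0 = h n (2 * pi)"
    "\<And>n t. \<bar>h n t\<bar> \<le> B" "AE t in Lper. (\<lambda>n. h n t) \<longlonglongrightarrow> u t"
proof -
  obtain g :: "nat \<Rightarrow> real \<Rightarrow> real"
    where g: "\<And>n. continuous_on UNIV (g n)" and g_lim: "AE t in Lper. (\<lambda>n. g n t) \<longlonglongrightarrow> u t"
    by (rule measurable_AE_limit_continuous[OF u]) blast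
  define cutoff where "cutoff = (\<lambda>(n::nat) t. max 0 (min 1 (real n * (t * (2 * pi - t)))))"
  define h where "h = (\<lambda>n t. cutoff n t * max (- B) (min B (g n t)))"
  have h_cont: "continuous_on Iper (h n)" for n
    unfolding h_def cutoff_def using g[of n] by (intro continuous_intros) (auto intro: continuous_on_subset)
  have h_bound: "\<bar>h n t\<bar> \<le> B" for n t
  proof -
    have "\<bar>h n t\<bar> \<le> 1 * B" unfolding h_def abs_mult using \<open>0 \<le> B\<close> by (intro mult_mono) (auto simp: cutoff_def)
    then show ?thesis by simp
  qed
  have h_lim: "AE t in Lper. (\<lambda>n. h n t) \<longlonglongrightarrow> u t"
    using g_lim AE_Lper_interior AE_space
  proof eventually_elim
    case (elim t)
    then have "0 < t * (2 * pi - t)" by simp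
    then obtain N where N: "1 < real N * (t * (2 * pi - t))" using ex_less_of_nat_mult by blast
    have "cutoff n t = 1" if "N \<le> n" for n
    proof -
      have "real N * (t * (2 * pi - t)) \<le> real n * (t * (2 * pi - t))"
        using that \<open>0 < t * (2 * pi - t)\<close> by (intro mult_right_mono) auto
      then show ?thesis using N by (simp add: cutoff_def)
    qed
    then have "(\<lambda>n. cutoff n t) \<longlonglongrightarrow> 1" by (intro tendsto_eventually eventually_sequentiallyI[of N])
    then have "(\<lambda>n. h n t) \<longlonglongrightarrow> 1 * max (- B) (min B (u t))" unfolding h_def by (intro tendsto_intros elim)
    moreover have "max (- B) (min B (u t)) = u t" using bound[of t] elim by (auto simp: abs_le_iff)
    ultimately show ?case by simp
  qed
  have "h n 0 = h n (2 * pi)" for n by (simp add: h_def cutoff_def)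
  then show ?thesis using h_cont h_bound h_lim by (intro that[of h])
qed

lemma trig_approximable_bounded:
  assumes u: "u \<in> borel_measurable Lper" and bound: "\<And>t. t \<in> Iper \<Longrightarrow> \<bar>u t\<bar> \<le> B" and "0 \<le> B"
  shows "trig_approximable (\<lambda>t. complex_of_real (u t))"
proof -
  obtain h where h_cont: "\<And>n. continuous_on Iper (h n)" and h_periodic: "\<And>n. h n 0 = h n (2 * pi)"
    and h_bound: "\<And>n t. \<bar>h n t\<bar> \<le> B" and h_lim: "AE t in Lper. (\<lambda>n. h n t) \<longlonglongrightarrow> u t"
    using bounded_AE_limit_continuous_periodic[OF assms] by blast
  show ?thesis
  proof (rule trig_approximable_limit)
    have "integrable Lper (\<lambda>t. (u t)\<^sup>2)"
      using u bound by (intro finite_measure.integrable_const_bound[OF finite_measure_Lper, of _ "B\<^sup>2"])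
        (auto intro!: AE_I2 power2_le_iff_abs_le[THEN iffD2] simp: \<open>0 \<le> B\<close>)
    then show "square_integrable Lper (\<lambda>t. complex_of_real (u t))"
      using u by (simp add: square_integrable_of_real_iff)
    show "trig_approximable (\<lambda>t. complex_of_real (h n t))" for n
      by (rule trig_approximable_periodic[OF h_cont h_periodic[symmetric]])
    show "(\<lambda>n. \<integral>t. (cmod (complex_of_real (u t) - complex_of_real (h n t)))\<^sup>2 \<partial>Lper) \<longlonglongrightarrow> 0"
    proof (rule L2_dominated_convergence[where b = "\<lambda>_. (2 * B)\<^sup>2"])
      fix n t assume "t \<in> Iper"
      then have "\<bar>u t - h n t\<bar> \<le> 2 * B" using bound[of t] h_bound[of n t] by linarith
      then show "(u t - h n t)\<^sup>2 \<le> (2 * B)\<^sup>2" using \<open>0 \<le> B\<close> by (subst power2_le_iff_abs_le) auto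
    qed (use u h_lim in \<open>auto intro!: measurable_Lper_cont h_cont integrable_Lper_cont continuous_intros\<close>)
  qed
qed

lemma trig_approximable_real:
  assumes u: "square_integrable Lper (\<lambda>t. complex_of_real (u t))"
  shows "trig_approximable (\<lambda>t. complex_of_real (u t))"
proof (rule trig_approximable_limit[OF u])
  define h where "h = (\<lambda>(k::nat) t. max (- real k) (min (real k) (u t)))"
  have u_meas: "u \<in> borel_measurable Lper" and u_sq: "integrable Lper (\<lambda>t. (u t)\<^sup>2)"
    using u by (simp_all add: square_integrable_of_real_iff)
  then have h_meas: "h k \<in> borel_measurable Lper" for k unfolding h_def by measurable
  show "trig_approximable (\<lambda>t. complex_of_real (h k t))" for k
    by (rule trig_approximable_bounded[OF h_meas, of _ "real k"]) (auto simp: h_def)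
  show "(\<lambda>k. \<integral>t. (cmod (complex_of_real (u t) - complex_of_real (h k t)))\<^sup>2 \<partial>Lper) \<longlonglongrightarrow> 0"
  proof (rule L2_dominated_convergence[OF h_meas u_meas u_sq])
    show "(u t - h k t)\<^sup>2 \<le> (u t)\<^sup>2" for k t by (auto simp: h_def abs_le_square_iff[symmetric])
    show "AE t in Lper. (\<lambda>k. h k t) \<longlonglongrightarrow> u t"
    proof (rule AE_I2)
      fix t
      obtain K :: nat where "\<bar>u t\<bar> \<le> real K" using real_arch_simple by blast
      then show "(\<lambda>k. h k t) \<longlonglongrightarrow> u t"
        by (intro tendsto_eventually eventually_sequentiallyI[of K]) (auto simp: h_def)
    qed
  qed
qed

lemma trig_approximable_square_integrable:
  assumes "square_integrable Lper u"
  shows "trig_approximable u"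
proof -
  have "trig_approximable (\<lambda>t. complex_of_real (Re (u t)) + \<i> * complex_of_real (Im (u t)))"
    by (intro trig_approximable_add_ii trig_approximable_real square_integrable_Re_Im assms)
  then show ?thesis by (simp flip: complex_eq)
qed

lemma fourier_tendsto_L2:
  assumes u: "square_integrable Lper u"
  shows "(\<lambda>k. \<integral>t. (cmod (u t - trig_poly k (fourier_coeff u) t))\<^sup>2 \<partial>Lper) \<longlonglongrightarrow> 0"
proof (rule LIMSEQ_I)
  fix e :: real assume "0 < e"
  then obtain l a where approx: "(\<integral>t. (cmod (u t - trig_poly l a t))\<^sup>2 \<partial>Lper) < e"
    using trig_approximableD(2)[OF trig_approximable_square_integrable[OF u]] by blast
  have "(\<integral>t. (cmod (u t - trig_poly k (fourier_coeff u) t))\<^sup>2 \<partial>Lper) < e" if "l \<le> k" for k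
    using fourier_best_approx[OF u, of k "\<lambda>m. if \<bar>m\<bar> \<le> int l then a m else 0"] approx
    by (simp flip: trig_poly_extend[OF that])
  then show "\<exists>l. \<forall>k\<ge>l. norm ((\<integral>t. (cmod (u t - trig_poly k (fourier_coeff u) t))\<^sup>2 \<partial>Lper) - 0) < e"
    by (intro exI[of _ l]) simp
qed

section \<open>The periodic Sobolev space and its dual\<close>

abbreviation real_wderiv :: "(real \<Rightarrow> real) \<Rightarrow> (real \<Rightarrow> real) \<Rightarrow> bool" where
  "real_wderiv f g \<equiv> wderiv1 (\<lambda>t. complex_of_real (f t)) (\<lambda>t. complex_of_real (g t))"

lemma wderiv1_square_integrable:
  assumes "wderiv1 f g"
  shows "square_integrable Lper f" "square_integrable Lper g"
  using assms by (auto simp: wderiv1_def square_integrable_def)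

lemma wderiv1I:
  assumes "square_integrable Lper f" "square_integrable Lper g"
    "\<And>m. (\<integral>t. f t * (\<i> * of_int m * trig1 m t) \<partial>Lper) = - (\<integral>t. g t * trig1 m t \<partial>Lper)"
  shows "wderiv1 f g"
  using assms by (auto simp: wderiv1_def square_integrable_def)

lemma wderiv1D:
  assumes "wderiv1 f g"
  shows "(\<integral>t. f t * (\<i> * of_int m * trig1 m t) \<partial>Lper) = - (\<integral>t. g t * trig1 m t \<partial>Lper)"
  using assms by (simp add: wderiv1_def)

lemma wderiv1_cong:
  assumes "wderiv1 f g" "\<And>t. t \<in> Iper \<Longrightarrow> f t = f2 t" "\<And>t. t \<in> Iper \<Longrightarrow> g t = g2 t"
  shows "wderiv1 f2 g2"
proof -
  have "f \<in> borel_measurable Lper \<longleftrightarrow> f2 \<in> borel_measurable Lper"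
    "g \<in> borel_measurable Lper \<longleftrightarrow> g2 \<in> borel_measurable Lper"
    "integrable Lper (\<lambda>t. (cmod (f t))\<^sup>2) \<longleftrightarrow> integrable Lper (\<lambda>t. (cmod (f2 t))\<^sup>2)"
    "integrable Lper (\<lambda>t. (cmod (g t))\<^sup>2) \<longleftrightarrow> integrable Lper (\<lambda>t. (cmod (g2 t))\<^sup>2)"
    "\<And>h. (\<integral>t. f t * h t \<partial>Lper) = (\<integral>t. f2 t * h t \<partial>Lper)" "\<And>h. (\<integral>t. g t * h t \<partial>Lper) = (\<integral>t. g2 t * h t \<partial>Lper)"
    using assms(2,3)
    by (auto intro!: measurable_cong Bochner_Integration.integrable_cong Bochner_Integration.integral_cong)
  with assms(1) show ?thesis unfolding wderiv1_def by simp
qed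

lemma wderiv1_C1:
  fixes f f' :: "real \<Rightarrow> complex"
  assumes f_deriv: "\<And>t. (f has_vector_derivative f' t) (at t)" and f'_cont: "continuous_on UNIV f'"
    and ends: "f (2 * pi) = f 0"
  shows "wderiv1 f f'"
proof (rule wderiv1I)
  have f_cont: "continuous_on UNIV f"
    using f_deriv by (meson continuous_at_imp_continuous_on has_vector_derivative_continuous)
  have cont_Iper: "continuous_on Iper f" "continuous_on Iper f'"
    using f_cont f'_cont continuous_on_subset by blast+
  then show "square_integrable Lper f" "square_integrable Lper f'" by (auto intro: square_integrable_cont)
  fix m
  have "(\<integral>t. f t * (\<i> * of_int m * trig1 m t) \<partial>Lper) + (\<integral>t. f' t * trig1 m t \<partial>Lper)
    = (\<integral>t. f t * (\<i> * of_int m * trig1 m t) + f' t * trig1 m t \<partial>Lper)"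
    by (intro Bochner_Integration.integral_add[symmetric]
      integrable_Lper_cont continuous_intros cont_Iper trig1_cont)
  also have "\<dots> = f (2 * pi) * trig1 m (2 * pi) - f 0 * trig1 m 0"
    by (rule integral_Lper_FTC)
      (auto intro!: derivative_eq_intros f_deriv trig1_vderiv continuous_intros trig1_cont f_cont f'_cont)
  also have "\<dots> = 0" using trig1_periodic[of m 0] ends by simp
  finally show "(\<integral>t. f t * (\<i> * of_int m * trig1 m t) \<partial>Lper) = - (\<integral>t. f' t * trig1 m t \<partial>Lper)"
    by (simp add: eq_neg_iff_add_eq_0)
qed

lemma C1per_wderiv:
  assumes "C1per f f'"
  shows "real_wderiv f f'"
proof (rule wderiv1_C1)
  show "((\<lambda>t. complex_of_real (f t)) has_vector_derivative complex_of_real (f' t)) (at t)" for t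
    using C1per_DERIV[OF assms]
    by (intro has_vector_derivative_of_real) (auto simp: has_real_derivative_iff_has_vector_derivative)
  show "continuous_on UNIV (\<lambda>t. complex_of_real (f' t))" by (intro continuous_intros C1per_cont[OF assms])
  show "complex_of_real (f (2 * pi)) = complex_of_real (f 0)" using C1per_periodic[OF assms, of 0] by simp
qed

lemma wderiv1_lin:
  assumes fg: "wderiv1 f g" and hk: "wderiv1 h k"
  shows "wderiv1 (\<lambda>t. a * f t + b * h t) (\<lambda>t. a * g t + b * k t)"
proof (rule wderiv1I)
  show "square_integrable Lper (\<lambda>t. a * f t + b * h t)" "square_integrable Lper (\<lambda>t. a * g t + b * k t)"
    using assms by (auto intro: square_integrable_lin wderiv1_square_integrable)
  fix m
  have integrable_products: "integrable Lper (\<lambda>t. f t * (\<i> * of_int m * trig1 m t))"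
    "integrable Lper (\<lambda>t. h t * (\<i> * of_int m * trig1 m t))"
    "integrable Lper (\<lambda>t. g t * trig1 m t)" "integrable Lper (\<lambda>t. k t * trig1 m t)"
    using square_integrable_trig1[of 1 m] assms
    by (auto intro!: integrable_mult_square_integrable square_integrable_trig1 intro: wderiv1_square_integrable)
  have "(\<integral>t. (a * f t + b * h t) * (\<i> * of_int m * trig1 m t) \<partial>Lper) =
    a * (\<integral>t. f t * (\<i> * of_int m * trig1 m t) \<partial>Lper) + b * (\<integral>t. h t * (\<i> * of_int m * trig1 m t) \<partial>Lper)"
    using integrable_products by (simp add: distrib_right mult.assoc)
  also have "\<dots> = - (a * (\<integral>t. g t * trig1 m t \<partial>Lper) + b * (\<integral>t. k t * trig1 m t \<partial>Lper))"
    by (simp add: wderiv1D[OF fg] wderiv1D[OF hk])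
  also have "\<dots> = - (\<integral>t. (a * g t + b * k t) * trig1 m t \<partial>Lper)"
    using integrable_products by (simp add: distrib_right mult.assoc)
  finally show "(\<integral>t. (a * f t + b * h t) * (\<i> * of_int m * trig1 m t) \<partial>Lper)
      = - (\<integral>t. (a * g t + b * k t) * trig1 m t \<partial>Lper)" .
qed

lemma wderiv1_cnj:
  assumes fg: "wderiv1 f g"
  shows "wderiv1 (\<lambda>t. cnj (f t)) (\<lambda>t. cnj (g t))"
proof (rule wderiv1I)
  show "square_integrable Lper (\<lambda>t. cnj (f t))" "square_integrable Lper (\<lambda>t. cnj (g t))"
    using assms by (auto intro: square_integrable_cnj wderiv1_square_integrable)
  fix m
  have "(\<integral>t. cnj (f t) * (\<i> * of_int m * trig1 m t) \<partial>Lper)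
      = (\<integral>t. cnj (f t * (\<i> * of_int (-m) * trig1 (-m) t)) \<partial>Lper)"
    by (simp add: trig1_cnj)
  also have "\<dots> = cnj (- (\<integral>t. g t * trig1 (-m) t \<partial>Lper))"
    by (simp only: Bochner_Integration.integral_cnj wderiv1D[OF fg])
  also have "\<dots> = - (\<integral>t. cnj (g t * trig1 (-m) t) \<partial>Lper)"
    by (simp only: complex_cnj_minus Bochner_Integration.integral_cnj)
  also have "\<dots> = - (\<integral>t. cnj (g t) * trig1 m t \<partial>Lper)" by (simp add: trig1_cnj)
  finally show "(\<integral>t. cnj (f t) * (\<i> * of_int m * trig1 m t) \<partial>Lper) = - (\<integral>t. cnj (g t) * trig1 m t \<partial>Lper)" .
qed

lemma wderiv1_Re:
  assumes "wderiv1 (\<lambda>t. complex_of_real (f t)) g"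
  shows "real_wderiv f (\<lambda>t. Re (g t))"
proof -
  have "wderiv1 (\<lambda>t. 1 / 2 * complex_of_real (f t) + 1 / 2 * cnj (complex_of_real (f t)))
      (\<lambda>t. 1 / 2 * g t + 1 / 2 * cnj (g t))"
    by (rule wderiv1_lin[OF assms wderiv1_cnj[OF assms]])
  moreover have "(\<lambda>t. 1 / 2 * complex_of_real (f t) + 1 / 2 * cnj (complex_of_real (f t)))
      = (\<lambda>t. complex_of_real (f t))"
    "(\<lambda>t. 1 / 2 * g t + 1 / 2 * cnj (g t)) = (\<lambda>t. complex_of_real (Re (g t)))"
    by (auto simp: complex_eq_iff fun_eq_iff)
  ultimately show ?thesis by simp
qed

lemma real_wderiv_lin:
  assumes "real_wderiv f g" "real_wderiv h k"
  shows "real_wderiv (\<lambda>t. a * f t + b * h t) (\<lambda>t. a * g t + b * k t)"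
  using wderiv1_lin[OF assms, of "complex_of_real a" "complex_of_real b"] by simp

lemma real_wderiv_diff:
  assumes "real_wderiv f g" "real_wderiv h k"
  shows "real_wderiv (\<lambda>t. f t - h t) (\<lambda>t. g t - k t)"
  using real_wderiv_lin[OF assms, of 1 "- 1"] by simp

lemma H1per_iff_real_wderiv: "H1per f \<longleftrightarrow> (\<exists>g. real_wderiv f g)"
  unfolding H1per_def by (auto intro: wderiv1_Re)

lemma C1per_H1per: "C1per f f' \<Longrightarrow> H1per f"
  unfolding H1per_iff_real_wderiv by (intro exI C1per_wderiv)

lemma H1per_square_integrable:
  assumes "H1per f"
  shows "f \<in> borel_measurable Lper" "integrable Lper (\<lambda>t. (f t)\<^sup>2)" "integrable Lper f"
proof -
  have f_sq: "square_integrable Lper (\<lambda>t. complex_of_real (f t))"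
    using assms by (auto simp: H1per_def intro: wderiv1_square_integrable)
  then show "f \<in> borel_measurable Lper" "integrable Lper (\<lambda>t. (f t)\<^sup>2)"
    by (simp_all add: square_integrable_of_real_iff)
  show "integrable Lper f" using integrable_Re[OF square_integrable_integrable_Lper[OF f_sq]] by simp
qed

lemma H1per_lin: "H1per f \<Longrightarrow> H1per h \<Longrightarrow> H1per (\<lambda>t. a * f t + b * h t)"
  unfolding H1per_iff_real_wderiv by (elim exE) (rule exI, rule real_wderiv_lin)

lemma H1per_add: "H1per f \<Longrightarrow> H1per h \<Longrightarrow> H1per (\<lambda>t. f t + h t)"
  and H1per_cmult: "H1per f \<Longrightarrow> H1per (\<lambda>t. c * f t)"
  and H1per_zero: "H1per (\<lambda>t. 0)"
  using H1per_lin[of f h 1 1] H1per_lin[of f f c 0] C1per_H1per[OF C1per_const] by simp_all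

lemma H1per_sum:
  assumes "finite A" "\<And>i. i \<in> A \<Longrightarrow> H1per (f i)"
  shows "H1per (\<lambda>t. \<Sum>i\<in>A. f i t)"
  using assms by (induction rule: finite_induct) (simp_all add: H1per_zero H1per_add)

lemma H1_norm_sq_diff_le:
  assumes "real_wderiv f f'" "real_wderiv g g'" "real_wderiv h h'"
  shows "H1_norm_sq (\<lambda>t. f t - h t) (\<lambda>t. f' t - h' t)
    \<le> 2 * H1_norm_sq (\<lambda>t. f t - g t) (\<lambda>t. f' t - g' t) + 2 * H1_norm_sq (\<lambda>t. g t - h t) (\<lambda>t. g' t - h' t)"
  using integral_diff_power2_triangle[of Lper f g h] integral_diff_power2_triangle[of Lper f' g' h']
    wderiv1_square_integrable[OF assms(1)] wderiv1_square_integrable[OF assms(2)]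
    wderiv1_square_integrable[OF assms(3)]
  unfolding H1_norm_sq_def by (simp add: distrib_left)

lemma H1_norm_sq_commute:
  "H1_norm_sq (\<lambda>t. f t - h t) (\<lambda>t. f' t - h' t) = H1_norm_sq (\<lambda>t. h t - f t) (\<lambda>t. h' t - f' t)"
  by (simp add: H1_norm_sq_def power2_commute)

definition H1_limit :: "(nat \<Rightarrow> real \<Rightarrow> real) \<Rightarrow> (nat \<Rightarrow> real \<Rightarrow> real) \<Rightarrow> (real \<Rightarrow> real) \<Rightarrow> (real \<Rightarrow> real) \<Rightarrow> bool" where
  "H1_limit T T' f g \<longleftrightarrow> real_wderiv f g \<and> (\<forall>k. C1per (T k) (T' k)) \<and>
     (\<lambda>k. H1_norm_sq (\<lambda>t. f t - T k t) (\<lambda>t. g t - T' k t)) \<longlonglongrightarrow> 0"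

lemma H1_limitD:
  assumes "H1_limit T T' f g"
  shows "real_wderiv f g" "C1per (T k) (T' k)" "(\<lambda>k. H1_norm_sq (\<lambda>t. f t - T k t) (\<lambda>t. g t - T' k t)) \<longlonglongrightarrow> 0"
  using assms by (auto simp: H1_limit_def)

lemma H1_limit_H1per:
  assumes "H1_limit T T' f g"
  shows "H1per f" "H1per (T k)"
  using H1_limitD(1)[OF assms] C1per_H1per[OF H1_limitD(2)[OF assms]] by (auto simp: H1per_iff_real_wderiv)

lemma fourier_coeff_wderiv1:
  assumes "wderiv1 f g"
  shows "fourier_coeff g = (\<lambda>m. \<i> * of_int m * fourier_coeff f m)"
proof
  fix m
  have "(\<integral>t. f t * (\<i> * of_int (-m) * trig1 (-m) t) \<partial>Lper) = - (\<i> * of_int m * (\<integral>t. f t * trig1 (-m) t \<partial>Lper))"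
    by (simp add: mult_ac)
  then show "fourier_coeff g m = \<i> * of_int m * fourier_coeff f m"
    using wderiv1D[OF assms, of "- m"] by (simp add: fourier_coeff_def)
qed

lemma C1per_Re_trig_poly:
  "C1per (\<lambda>t. Re (trig_poly k a t)) (\<lambda>t. Re (trig_poly k (\<lambda>m. \<i> * of_int m * a m) t))"
  unfolding C1per_def
proof (intro conjI allI)
  fix t
  have "(trig_poly k a has_vector_derivative trig_poly k (\<lambda>m. \<i> * of_int m * a m) t) (at t)"
    unfolding trig_poly_def
    by (rule has_vector_derivative_sum) (auto intro!: derivative_eq_intros trig1_vderiv)
  then show "((\<lambda>t. Re (trig_poly k a t)) has_real_derivative Re (trig_poly k (\<lambda>m. \<i> * of_int m * a m) t)) (at t)"
    unfolding has_real_derivative_iff_has_vector_derivative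
    by (rule bounded_linear.has_vector_derivative[OF bounded_linear_Re])
  show "Re (trig_poly k a (t + 2 * pi)) = Re (trig_poly k a t)" by (simp add: trig_poly_def trig1_periodic)
qed (intro continuous_intros trig_poly_cont)

lemma fourier_tendsto_L2_Re:
  assumes u: "square_integrable Lper (\<lambda>t. complex_of_real (u t))"
  shows "(\<lambda>k. \<integral>t. (u t - Re (trig_poly k (fourier_coeff (\<lambda>t. complex_of_real (u t))) t))\<^sup>2 \<partial>Lper) \<longlonglongrightarrow> 0"
proof (rule tendsto_sandwich[OF _ _ tendsto_const fourier_tendsto_L2[OF u]])
  let ?S = "\<lambda>k. trig_poly k (fourier_coeff (\<lambda>t. complex_of_real (u t)))"
  have "(\<integral>t. (u t - Re (?S k t))\<^sup>2 \<partial>Lper) \<le> (\<integral>t. (cmod (complex_of_real (u t) - ?S k t))\<^sup>2 \<partial>Lper)" for k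
  proof (rule integral_mono')
    show "integrable Lper (\<lambda>t. (cmod (complex_of_real (u t) - ?S k t))\<^sup>2)"
      using square_integrable_diff[OF u square_integrable_trig_poly] by (auto simp: square_integrable_def)
    show "(u t - Re (?S k t))\<^sup>2 \<le> (cmod (complex_of_real (u t) - ?S k t))\<^sup>2" for t
      using abs_Re_le_cmod[of "complex_of_real (u t) - ?S k t"] by (simp add: abs_le_square_iff[symmetric])
  qed simp
  then show "\<forall>\<^sub>F k in sequentially. (\<integral>t. (u t - Re (?S k t))\<^sup>2 \<partial>Lper)
      \<le> (\<integral>t. (cmod (complex_of_real (u t) - ?S k t))\<^sup>2 \<partial>Lper)" by simp
qed simp

lemma H1per_limit_of_trig_sums:
  assumes w: "real_wderiv f g"
  obtains T T' a b where "H1_limit T T' f g"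
    "\<And>k. T k = (\<lambda>t. \<Sum>m\<in>{-int k..int k}. a m * cos (real_of_int m * t) + b m * sin (real_of_int m * t))"
proof -
  let ?A = "fourier_coeff (\<lambda>t. complex_of_real (f t))"
  let ?T = "\<lambda>k t. Re (trig_poly k ?A t)" and ?T' = "\<lambda>k t. Re (trig_poly k (\<lambda>m. \<i> * of_int m * ?A m) t)"
  have "(\<lambda>k. \<integral>t. (g t - ?T' k t)\<^sup>2 \<partial>Lper) \<longlonglongrightarrow> 0"
    using fourier_tendsto_L2_Re[OF wderiv1_square_integrable(2)[OF w]]
    by (simp add: fourier_coeff_wderiv1[OF w])
  from tendsto_add[OF fourier_tendsto_L2_Re[OF wderiv1_square_integrable(1)[OF w]] this]
  have "H1_limit ?T ?T' f g" using w C1per_Re_trig_poly by (simp add: H1_limit_def H1_norm_sq_def)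
  moreover have "?T k = (\<lambda>t. \<Sum>m\<in>{-int k..int k}.
      Re (?A m) * cos (real_of_int m * t) + - Im (?A m) * sin (real_of_int m * t))" for k
    by (auto simp: trig_poly_def trig1_def fun_eq_iff intro!: sum.cong)
  ultimately show ?thesis by (rule that)
qed

lemma H1_limit_uniformly_Cauchy:
  assumes "H1_limit T T' f g"
  shows "uniformly_Cauchy_on Iper T"
  unfolding uniformly_Cauchy_on_def
proof (intro allI impI)
  note lim = H1_limitD[OF assms]
  let ?d = "\<lambda>k. H1_norm_sq (\<lambda>t. f t - T k t) (\<lambda>t. g t - T' k t)"
  have sup_diff: "(T k x - T j x)\<^sup>2 \<le> 4 * ?d k + 4 * ?d j" for k j x
  proof -
    have "(T k x - T j x)\<^sup>2 \<le> 2 * H1_norm_sq (\<lambda>t. T k t - T j t) (\<lambda>t. T' k t - T' j t)"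
      by (rule C1per_sup_bound[OF C1per_diff[OF lim(2) lim(2)]])
    also have "\<dots> \<le> 2 * (2 * ?d k + 2 * ?d j)"
      using H1_norm_sq_diff_le[OF C1per_wderiv[OF lim(2)[of k]] lim(1) C1per_wderiv[OF lim(2)[of j]]]
      by (simp add: H1_norm_sq_commute[of "T k" f])
    finally show ?thesis by simp
  qed
  fix e :: real assume e: "e > 0"
  then have "\<forall>\<^sub>F k in sequentially. ?d k < e\<^sup>2 / 8" using lim(3) by (intro order_tendstoD) auto
  then obtain M where M: "\<And>k. k \<ge> M \<Longrightarrow> ?d k < e\<^sup>2 / 8" by (auto simp: eventually_sequentially)
  show "\<exists>M. \<forall>x\<in>Iper. \<forall>m\<ge>M. \<forall>n\<ge>M. dist (T m x) (T n x) < e"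
  proof (intro exI[of _ M] ballI allI impI)
    fix x m n assume "M \<le> m" "M \<le> n"
    then have "(T m x - T n x)\<^sup>2 < e\<^sup>2" using sup_diff[of m x n] M[of m] M[of n] by (simp add: field_simps)
    then show "dist (T m x) (T n x) < e" using e by (metis abs_le_square_iff abs_of_pos dist_real_def not_le)
  qed
qed

lemma uniform_limit_imp_L2:
  fixes F :: "real \<Rightarrow> real"
  assumes unif: "uniform_limit Iper T F sequentially"
    and "\<And>k. continuous_on Iper (T k)" "continuous_on Iper F"
  shows "(\<lambda>k. \<integral>t. (T k t - F t)\<^sup>2 \<partial>Lper) \<longlonglongrightarrow> 0"
proof (rule tendstoI)
  fix e :: real assume e: "0 < e"
  define d where "d = sqrt (e / (4 * pi))"
  have d: "0 < d" using e by (simp add: d_def)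
  have "\<forall>\<^sub>F k in sequentially. \<forall>t\<in>Iper. dist (T k t) (F t) < d" using unif d by (auto simp: uniform_limit_iff)
  then show "\<forall>\<^sub>F k in sequentially. dist (\<integral>t. (T k t - F t)\<^sup>2 \<partial>Lper) 0 < e"
  proof eventually_elim
    case (elim k)
    have "(\<integral>t. (T k t - F t)\<^sup>2 \<partial>Lper) \<le> (\<integral>t. d\<^sup>2 \<partial>Lper)"
    proof (rule integral_mono)
      show "(T k t - F t)\<^sup>2 \<le> d\<^sup>2" if "t \<in> space Lper" for t
        using elim that d by (subst power2_le_iff_abs_le) (auto simp: dist_real_def)
    qed (intro integrable_Lper_cont continuous_intros assms)+
    also have "\<dots> = e / 2" using e by (simp add: measure_Lper d_def)
    finally show ?case using e by simp
  qed
qed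

lemma H1_limit_uniform:
  assumes T_limit: "H1_limit T T' f g" and f_cont: "continuous_on Iper f"
  shows "uniform_limit Iper T f sequentially"
proof -
  note lim = H1_limitD[OF T_limit]
  have T_cont: "continuous_on Iper (T k)" for k by (rule C1per_cont[OF lim(2)])
  obtain F where F: "uniform_limit Iper T F sequentially"
    using Cauchy_uniformly_convergent[OF H1_limit_uniformly_Cauchy[OF T_limit]]
    by (auto simp: uniformly_convergent_on_def)
  have F_cont: "continuous_on Iper F" by (rule uniform_limit_theorem[OF _ F]) (auto simp: T_cont)
  have cont_square_integrable: "square_integrable Lper (\<lambda>t. complex_of_real (h t))"
    if "continuous_on Iper h" for h
    by (intro square_integrable_cont continuous_intros that)
  have L2_lim: "(\<lambda>k. \<integral>t. (f t - T k t)\<^sup>2 \<partial>Lper) \<longlonglongrightarrow> 0"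
    by (rule tendsto_sandwich[OF _ _ tendsto_const lim(3)]) (auto simp: integral_power2_le_H1_norm_sq)
  have "(\<integral>t. (f t - F t)\<^sup>2 \<partial>Lper) \<le> 2 * 0 + 2 * 0"
  proof (rule LIMSEQ_le_const)
    show "(\<lambda>k. 2 * (\<integral>t. (f t - T k t)\<^sup>2 \<partial>Lper) + 2 * (\<integral>t. (T k t - F t)\<^sup>2 \<partial>Lper)) \<longlonglongrightarrow> 2 * 0 + 2 * 0"
      by (intro tendsto_intros L2_lim uniform_limit_imp_L2 F T_cont F_cont)
  qed (use integral_diff_power2_triangle[OF cont_square_integrable[OF f_cont] cont_square_integrable[OF T_cont]
    cont_square_integrable[OF F_cont]] in blast)
  then have "\<not> 0 < (f t - F t)\<^sup>2" if "t \<in> Iper" for t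
    using integral_Lper_pos[of "\<lambda>t. (f t - F t)\<^sup>2" t] that f_cont F_cont by (force intro!: continuous_intros)
  then have "F t = f t" if "t \<in> Iper" for t using that by auto
  then show ?thesis using F uniform_limit_cong'[of Iper T T F f sequentially] by auto
qed

lemma HminusI:
  assumes lin: "\<And>f h a b. H1per f \<Longrightarrow> H1per h \<Longrightarrow> V (\<lambda>t. a * f t + b * h t) = a * V f + b * V h"
    and bound: "\<And>f g. real_wderiv f g \<Longrightarrow> \<bar>V f\<bar> \<le> B * sqrt (H1_norm_sq f g)"
  shows "Hminus V"
  unfolding Hminus_def
proof (intro conjI allI impI exI[of _ "\<bar>B\<bar>"])
  fix f g assume w: "wderiv1 (\<lambda>t. complex_of_real (f t)) g"
  have "(\<integral>t. (Re (g t))\<^sup>2 \<partial>Lper) \<le> (\<integral>t. (cmod (g t))\<^sup>2 \<partial>Lper)"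
    using wderiv1_square_integrable(2)[OF w] wderiv1_square_integrable(2)[OF wderiv1_Re[OF w]]
    by (intro integral_mono) (auto simp: square_integrable_def cmod_power2)
  then have "\<bar>B\<bar> * sqrt (H1_norm_sq f (\<lambda>t. Re (g t)))
    \<le> \<bar>B\<bar> * sqrt ((\<integral>t. (f t)\<^sup>2 \<partial>Lper) + (\<integral>t. (cmod (g t))\<^sup>2 \<partial>Lper))"
    by (intro mult_left_mono) (auto simp: H1_norm_sq_def)
  moreover have "\<bar>V f\<bar> \<le> \<bar>B\<bar> * sqrt (H1_norm_sq f (\<lambda>t. Re (g t)))"
    using bound[OF wderiv1_Re[OF w]] by (rule order_trans) (simp add: mult_right_mono H1_norm_sq_nonneg)
  ultimately show "\<bar>V f\<bar> \<le> \<bar>B\<bar> * sqrt ((\<integral>t. (f t)\<^sup>2 \<partial>Lper) + (\<integral>t. (cmod (g t))\<^sup>2 \<partial>Lper))" by linarith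
qed (rule lin)

lemma Hminus_lin: "Hminus V \<Longrightarrow> H1per f \<Longrightarrow> H1per h \<Longrightarrow> V (\<lambda>t. a * f t + b * h t) = a * V f + b * V h"
  unfolding Hminus_def by blast

lemma Hminus_bound:
  assumes "Hminus V"
  obtains B where "0 \<le> B" "\<And>f g. real_wderiv f g \<Longrightarrow> \<bar>V f\<bar> \<le> B * sqrt (H1_norm_sq f g)"
proof -
  obtain B where "\<And>f g. wderiv1 (\<lambda>t. complex_of_real (f t)) g \<Longrightarrow>
      \<bar>V f\<bar> \<le> B * sqrt ((\<integral>t. (f t)\<^sup>2 \<partial>Lper) + (\<integral>t. (cmod (g t))\<^sup>2 \<partial>Lper))"
    using assms unfolding Hminus_def by blast
  then have "\<bar>V f\<bar> \<le> B * sqrt (H1_norm_sq f g)" if "real_wderiv f g" for f g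
    using that by (force simp: H1_norm_sq_def)
  then have "\<bar>V f\<bar> \<le> \<bar>B\<bar> * sqrt (H1_norm_sq f g)" if "real_wderiv f g" for f g
    by (rule order_trans) (use that in \<open>auto simp: mult_right_mono H1_norm_sq_nonneg\<close>)
  then show ?thesis by (intro that[of "\<bar>B\<bar>"]) auto
qed

lemma Hminus_arith:
  assumes "Hminus V"
  shows Hminus_add: "H1per f \<Longrightarrow> H1per h \<Longrightarrow> V (\<lambda>t. f t + h t) = V f + V h"
    and Hminus_diff: "H1per f \<Longrightarrow> H1per h \<Longrightarrow> V (\<lambda>t. f t - h t) = V f - V h"
    and Hminus_cmult: "H1per f \<Longrightarrow> V (\<lambda>t. c * f t) = c * V f"
    and Hminus_zero: "V (\<lambda>t. 0) = 0"
  using Hminus_lin[OF assms, of f h 1 1] Hminus_lin[OF assms, of f h 1 "- 1"] Hminus_lin[OF assms, of f f c 0]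
    Hminus_lin[OF assms H1per_zero H1per_zero, of 0 0] by simp_all

lemma Hminus_sum:
  assumes "Hminus V" "finite A" "\<And>i. i \<in> A \<Longrightarrow> H1per (f i)"
  shows "V (\<lambda>t. \<Sum>i\<in>A. f i t) = (\<Sum>i\<in>A. V (f i))"
  using assms(2,3)
  by (induction rule: finite_induct) (simp_all add: Hminus_zero[OF assms(1)] Hminus_add[OF assms(1)] H1per_sum)

lemma Hminus_functional_lin:
  assumes V: "Hminus V" and W: "Hminus W"
  shows "Hminus (\<lambda>f. a * V f + b * W f)"
proof -
  obtain A where A: "\<And>f g. real_wderiv f g \<Longrightarrow> \<bar>V f\<bar> \<le> A * sqrt (H1_norm_sq f g)"
    using Hminus_bound[OF V] by metis
  obtain B where B: "\<And>f g. real_wderiv f g \<Longrightarrow> \<bar>W f\<bar> \<le> B * sqrt (H1_norm_sq f g)"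
    using Hminus_bound[OF W] by metis
  show ?thesis
  proof (rule HminusI)
    fix f g assume w: "real_wderiv f g"
    have "\<bar>a * V f + b * W f\<bar> \<le> \<bar>a\<bar> * \<bar>V f\<bar> + \<bar>b\<bar> * \<bar>W f\<bar>"
      using abs_triangle_ineq[of "a * V f" "b * W f"] by (simp add: abs_mult)
    also have "\<dots> \<le> \<bar>a\<bar> * (A * sqrt (H1_norm_sq f g)) + \<bar>b\<bar> * (B * sqrt (H1_norm_sq f g))"
      by (intro add_mono mult_left_mono A[OF w] B[OF w]) auto
    also have "\<dots> = (\<bar>a\<bar> * A + \<bar>b\<bar> * B) * sqrt (H1_norm_sq f g)" by (simp add: distrib_right)
    finally show "\<bar>a * V f + b * W f\<bar> \<le> (\<bar>a\<bar> * A + \<bar>b\<bar> * B) * sqrt (H1_norm_sq f g)" .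
  qed (simp add: Hminus_lin[OF V] Hminus_lin[OF W] algebra_simps)
qed

lemma abs_integral_Lper_le:
  assumes "integrable Lper f" "integrable Lper (\<lambda>t. (f t)\<^sup>2)"
  shows "\<bar>\<integral>t. f t \<partial>Lper\<bar> \<le> sqrt (2 * pi * (\<integral>t. (f t)\<^sup>2 \<partial>Lper))"
proof -
  let ?m = "\<integral>t. f t \<partial>Lper"
  have "0 \<le> (\<integral>t. (f t - ?m / (2*pi))\<^sup>2 \<partial>Lper)" by (rule Bochner_Integration.integral_nonneg) simp
  also have "\<dots> = (\<integral>t. (f t)\<^sup>2 - (?m / pi) * f t + (?m / (2 * pi))\<^sup>2 \<partial>Lper)"
    by (rule Bochner_Integration.integral_cong) (auto simp: power2_eq_square algebra_simps)
  also have "\<dots> = (\<integral>t. (f t)\<^sup>2 \<partial>Lper) - (?m / pi) * ?m + 2 * pi * (?m / (2 * pi))\<^sup>2"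
    using assms by (simp add: measure_Lper finite_measure.integrable_const[OF finite_measure_Lper])
  also have "\<dots> = (\<integral>t. (f t)\<^sup>2 \<partial>Lper) - ?m\<^sup>2 / (2 * pi)" by (simp add: power2_eq_square field_simps)
  finally have "?m\<^sup>2 \<le> 2 * pi * (\<integral>t. (f t)\<^sup>2 \<partial>Lper)" by (simp add: field_simps)
  then show ?thesis by (metis real_sqrt_abs real_sqrt_le_mono)
qed

lemma integrable_Lper_cont_mult:
  fixes u h :: "real \<Rightarrow> real"
  assumes u: "continuous_on Iper u" and h: "integrable Lper h"
  shows "integrable Lper (\<lambda>t. u t * h t)"
proof -
  obtain U where U: "0 \<le> U" "\<And>t. t \<in> Iper \<Longrightarrow> \<bar>u t\<bar> \<le> U" using continuous_bounded_Iper[OF u] by blast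
  show ?thesis
  proof (rule Bochner_Integration.integrable_bound)
    show "integrable Lper (\<lambda>t. U * h t)" using h by simp
    show "(\<lambda>t. u t * h t) \<in> borel_measurable Lper" using measurable_Lper_cont[OF u] h by measurable
    show "AE t in Lper. norm (u t * h t) \<le> norm (U * h t)"
      using U by (intro AE_I2) (auto simp: abs_mult intro!: mult_right_mono)
  qed
qed

lemma Hminus_integral:
  assumes u: "continuous_on Iper u"
  shows "Hminus (\<lambda>f. \<integral>t. u t * f t \<partial>Lper)"
proof -
  obtain U where U: "0 \<le> U" "\<And>t. t \<in> Iper \<Longrightarrow> \<bar>u t\<bar> \<le> U" using continuous_bounded_Iper[OF u] by blast
  show ?thesis
  proof (rule HminusI)
    fix f h a b assume "H1per f" "H1per h"
    then have "integrable Lper (\<lambda>t. u t * f t)" "integrable Lper (\<lambda>t. u t * h t)"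
      by (auto intro: integrable_Lper_cont_mult[OF u] H1per_square_integrable)
    moreover have "u t * (a * f t + b * h t) = a * (u t * f t) + b * (u t * h t)" for t
      by (simp add: algebra_simps)
    ultimately show "(\<integral>t. u t * (a * f t + b * h t) \<partial>Lper) = a * (\<integral>t. u t * f t \<partial>Lper) + b * (\<integral>t. u t * h t \<partial>Lper)"
      by simp
  next
    fix f g assume w: "real_wderiv f g"
    then have f: "integrable Lper f" "integrable Lper (\<lambda>t. (f t)\<^sup>2)"
      using H1per_square_integrable[of f] by (auto simp: H1per_iff_real_wderiv)
    have "\<bar>\<integral>t. u t * f t \<partial>Lper\<bar> \<le> (\<integral>t. \<bar>u t * f t\<bar> \<partial>Lper)" by (rule integral_abs_bound)
    also have "\<dots> \<le> (\<integral>t. U * \<bar>f t\<bar> \<partial>Lper)"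
    proof (rule integral_mono)
      show "integrable Lper (\<lambda>t. \<bar>u t * f t\<bar>)" by (intro integrable_abs integrable_Lper_cont_mult u f)
    qed (use f(1) U in \<open>auto simp: abs_mult intro!: mult_right_mono\<close>)
    also have "\<dots> \<le> U * sqrt (2 * pi * (\<integral>t. (f t)\<^sup>2 \<partial>Lper))"
      using abs_integral_Lper_le[of "\<lambda>t. \<bar>f t\<bar>"] f U(1) by (simp add: mult_left_mono)
    also have "\<dots> \<le> U * sqrt (2 * pi * H1_norm_sq f g)"
      using U(1) integral_power2_le_H1_norm_sq by (intro mult_left_mono real_sqrt_le_mono) auto
    also have "\<dots> = U * sqrt (2 * pi) * sqrt (H1_norm_sq f g)" by (simp add: real_sqrt_mult)
    finally show "\<bar>\<integral>t. u t * f t \<partial>Lper\<bar> \<le> U * sqrt (2 * pi) * sqrt (H1_norm_sq f g)" .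
  qed
qed

lemma Hminus_approx_error:
  assumes V: "Hminus V" and bound: "\<And>f g. real_wderiv f g \<Longrightarrow> \<bar>V f\<bar> \<le> B * sqrt (H1_norm_sq f g)"
    and T_limit: "H1_limit T T' f g"
  shows "\<bar>V f - V (T k)\<bar> \<le> B * sqrt (H1_norm_sq (\<lambda>t. f t - T k t) (\<lambda>t. g t - T' k t))"
  using bound[OF real_wderiv_diff[OF H1_limitD(1)[OF T_limit] C1per_wderiv[OF H1_limitD(2)[OF T_limit]]]]
    Hminus_diff[OF V H1_limit_H1per[OF T_limit]] by simp

lemma H1_limit_error_tendsto:
  assumes "H1_limit T T' f g"
  shows "(\<lambda>k. B * sqrt (H1_norm_sq (\<lambda>t. f t - T k t) (\<lambda>t. g t - T' k t))) \<longlonglongrightarrow> 0"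
  using tendsto_mult[OF tendsto_const tendsto_real_sqrt[OF H1_limitD(3)[OF assms]], of B] by simp

lemma Hminus_continuous:
  assumes V: "Hminus V" and T_limit: "H1_limit T T' f g"
  shows "(\<lambda>k. V (T k)) \<longlonglongrightarrow> V f"
proof -
  obtain B where "\<And>f g. real_wderiv f g \<Longrightarrow> \<bar>V f\<bar> \<le> B * sqrt (H1_norm_sq f g)"
    using Hminus_bound[OF V] by metis
  from Hminus_approx_error[OF V this T_limit]
  have "norm (V (T k) - V f) \<le> B * sqrt (H1_norm_sq (\<lambda>t. f t - T k t) (\<lambda>t. g t - T' k t))" for k
    by (simp add: abs_minus_commute)
  then have "(\<lambda>k. V (T k) - V f) \<longlonglongrightarrow> 0"
    by (intro Lim_null_comparison[OF always_eventually H1_limit_error_tendsto[OF T_limit]]) blast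
  then show ?thesis by (rule LIM_zero_cancel)
qed

lemma Hminus_eq_if_eq_on_C1per:
  assumes V: "Hminus V" and W: "Hminus W" and eq_on_C1per: "\<And>f f'. C1per f f' \<Longrightarrow> V f = W f" and f: "H1per f"
  shows "V f = W f"
proof -
  obtain g where "real_wderiv f g" using f H1per_iff_real_wderiv by blast
  then obtain T T' where T_limit: "H1_limit T T' f g" using H1per_limit_of_trig_sums by metis
  have "(\<lambda>k. V (T k)) = (\<lambda>k. W (T k))" using eq_on_C1per H1_limitD(2)[OF T_limit] by blast
  then show ?thesis
    using Hminus_continuous[OF V T_limit] Hminus_continuous[OF W T_limit] LIMSEQ_unique by metis
qed

lemma Hminus_bound_from_C1per:
  assumes V: "Hminus V" and bound: "\<And>f f'. C1per f f' \<Longrightarrow> \<bar>V f\<bar> \<le> B * sqrt (H1_norm_sq f f')" and "0 \<le> B"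
    and w: "real_wderiv f g"
  shows "\<bar>V f\<bar> \<le> B * sqrt (2 * H1_norm_sq f g)"
proof -
  obtain T T' where T_limit: "H1_limit T T' f g" using H1per_limit_of_trig_sums[OF w] by metis
  note lim = H1_limitD[OF T_limit]
  have "\<bar>V (T k)\<bar> \<le> B * sqrt (2 * H1_norm_sq (\<lambda>t. f t - T k t) (\<lambda>t. g t - T' k t) + 2 * H1_norm_sq f g)" for k
  proof -
    have "H1_norm_sq (T k) (T' k) \<le> 2 * H1_norm_sq (\<lambda>t. f t - T k t) (\<lambda>t. g t - T' k t) + 2 * H1_norm_sq f g"
      using H1_norm_sq_diff_le[OF C1per_wderiv[OF lim(2)] w C1per_wderiv[OF C1per_const[of 0]], of k]
      by (simp add: H1_norm_sq_commute[of f])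
    then have "B * sqrt (H1_norm_sq (T k) (T' k))
      \<le> B * sqrt (2 * H1_norm_sq (\<lambda>t. f t - T k t) (\<lambda>t. g t - T' k t) + 2 * H1_norm_sq f g)"
      using \<open>0 \<le> B\<close> by (intro mult_left_mono) auto
    then show ?thesis using bound[OF lim(2)] by (rule order_trans[rotated])
  qed
  moreover have "(\<lambda>k. B * sqrt (2 * H1_norm_sq (\<lambda>t. f t - T k t) (\<lambda>t. g t - T' k t) + 2 * H1_norm_sq f g))
      \<longlonglongrightarrow> B * sqrt (2 * 0 + 2 * H1_norm_sq f g)"
    by (intro tendsto_intros lim(3))
  moreover have "(\<lambda>k. \<bar>V (T k)\<bar>) \<longlonglongrightarrow> \<bar>V f\<bar>" by (intro tendsto_rabs Hminus_continuous[OF V T_limit])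
  ultimately show ?thesis using LIMSEQ_le by fastforce
qed

lemma Hminus_pointwise_limit:
  assumes V: "\<And>j. Hminus (V j)" and bound: "\<And>j f g. real_wderiv f g \<Longrightarrow> \<bar>V j f\<bar> \<le> B * sqrt (H1_norm_sq f g)"
    and lim: "\<And>f. H1per f \<Longrightarrow> (\<lambda>j. V j f) \<longlonglongrightarrow> W f"
  shows "Hminus W"
proof (rule HminusI)
  show "\<bar>W f\<bar> \<le> B * sqrt (H1_norm_sq f g)" if w: "real_wderiv f g" for f g
  proof (rule LIMSEQ_le_const2)
    show "(\<lambda>j. \<bar>V j f\<bar>) \<longlonglongrightarrow> \<bar>W f\<bar>" using w H1per_iff_real_wderiv by (intro tendsto_rabs lim) blast
  qed (use bound[OF w] in blast)
  fix f h a b assume fh: "H1per f" "H1per h"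
  have "(\<lambda>j. a * V j f + b * V j h) \<longlonglongrightarrow> a * W f + b * W h" by (intro tendsto_intros lim fh)
  then have "(\<lambda>j. V j (\<lambda>t. a * f t + b * h t)) \<longlonglongrightarrow> a * W f + b * W h" by (simp add: Hminus_lin[OF V fh])
  then show "W (\<lambda>t. a * f t + b * h t) = a * W f + b * W h"
    by (rule LIMSEQ_unique[OF lim[OF H1per_lin[OF fh]]])
qed

lemma Hminus_convergent_if_on_H1_limit:
  assumes V: "\<And>j. Hminus (V j)" and bound: "\<And>j f g. real_wderiv f g \<Longrightarrow> \<bar>V j f\<bar> \<le> B * sqrt (H1_norm_sq f g)"
    and T_limit: "H1_limit T T' f g" and conv: "\<And>k. convergent (\<lambda>j. V j (T k))"
  shows "convergent (\<lambda>j. V j f)"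
proof -
  have "Cauchy (\<lambda>j. V j f)"
  proof (rule metric_CauchyI)
    fix \<eta> :: real assume "0 < \<eta>"
    then obtain k where k: "B * sqrt (H1_norm_sq (\<lambda>t. f t - T k t) (\<lambda>t. g t - T' k t)) < \<eta> / 4"
      using order_tendstoD(2)[OF H1_limit_error_tendsto[OF T_limit], of "\<eta> / 4" B]
      by (auto simp: eventually_sequentially)
    obtain M where M: "\<And>i j. i \<ge> M \<Longrightarrow> j \<ge> M \<Longrightarrow> dist (V i (T k)) (V j (T k)) < \<eta> / 4"
      using conv[of k] \<open>0 < \<eta>\<close> unfolding Cauchy_convergent_iff[symmetric] Cauchy_def
      by (meson divide_pos_pos zero_less_numeral)
    have "dist (V i f) (V j f) < \<eta>" if "M \<le> i" "M \<le> j" for i j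
    proof -
      have close: "dist (V l f) (V l (T k)) < \<eta> / 4" for l
        using Hminus_approx_error[OF V bound T_limit, of l k] k by (simp add: dist_real_def)
      show ?thesis
        using close[of i] close[of j] M[OF that] dist_triangle[of "V i f" "V j f" "V i (T k)"]
          dist_triangle[of "V i (T k)" "V j f" "V j (T k)"] \<open>0 < \<eta>\<close> by (simp add: dist_commute)
    qed
    then show "\<exists>M. \<forall>m\<ge>M. \<forall>n\<ge>M. dist (V m f) (V n f) < \<eta>" by blast
  qed
  then show ?thesis by (simp add: Cauchy_convergent_iff)
qed

lemma C1per_cos: "C1per (\<lambda>t. cos (real_of_int m * t)) (\<lambda>t. - real_of_int m * sin (real_of_int m * t))"
  and C1per_sin: "C1per (\<lambda>t. sin (real_of_int m * t)) (\<lambda>t. real_of_int m * cos (real_of_int m * t))"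
proof -
  have "cos (real_of_int m * (t + 2 * pi)) = cos (real_of_int m * t)"
    "sin (real_of_int m * (t + 2 * pi)) = sin (real_of_int m * t)" for t
    using trig1_periodic[of m t] by (simp_all add: trig1_def complex_eq_iff)
  then show "C1per (\<lambda>t. cos (real_of_int m * t)) (\<lambda>t. - real_of_int m * sin (real_of_int m * t))"
    "C1per (\<lambda>t. sin (real_of_int m * t)) (\<lambda>t. real_of_int m * cos (real_of_int m * t))"
    by (auto simp: C1per_def intro!: derivative_eq_intros continuous_intros)
qed

lemma Hminus_convergent_subsequence_countable:
  assumes bound: "\<And>j f g. real_wderiv f g \<Longrightarrow> \<bar>V j f\<bar> \<le> B * sqrt (H1_norm_sq f g)"
    and S: "countable S" "\<And>f. f \<in> S \<Longrightarrow> H1per f"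
  obtains r where "strict_mono (r :: nat \<Rightarrow> nat)" "\<And>f. f \<in> S \<Longrightarrow> convergent (\<lambda>j. V (r j) f)"
proof -
  obtain D where D: "\<And>f. f \<in> S \<Longrightarrow> real_wderiv f (D f)" using S(2) H1per_iff_real_wderiv by metis
  define q where "q = (\<lambda>f. 1 + sqrt (H1_norm_sq f (D f)))"
  have q: "0 < q f" for f by (simp add: q_def H1_norm_sq_nonneg add_pos_nonneg)
  have "norm (V j f / q f) \<le> \<bar>B\<bar>" if "f \<in> S" for j f
  proof -
    have "\<bar>V j f\<bar> \<le> B * sqrt (H1_norm_sq f (D f))" by (rule bound[OF D[OF that]])
    also have "\<dots> \<le> \<bar>B\<bar> * q f" unfolding q_def by (intro mult_mono) (auto simp: H1_norm_sq_nonneg)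
    finally show ?thesis using q[of f] by (simp add: divide_le_eq)
  qed
  then obtain r :: "nat \<Rightarrow> nat" where r: "strict_mono r" "\<And>f. f \<in> S \<Longrightarrow> \<exists>l. (\<lambda>j. V (r j) f / q f) \<longlonglongrightarrow> l"
    using function_convergent_subsequence[OF S(1), of "\<lambda>j f. V j f / q f"] by metis
  show ?thesis
  proof (rule that[OF r(1)])
    fix f assume "f \<in> S"
    then obtain l where "(\<lambda>j. V (r j) f / q f) \<longlonglongrightarrow> l" using r(2) by blast
    from tendsto_mult[OF tendsto_const this, of "q f"] show "convergent (\<lambda>j. V (r j) f)"
      using q[of f] by (auto simp: convergent_def)
  qed
qed

lemma Hminus_weakly_convergent_subsequence:
  assumes V: "\<And>j. Hminus (V j)" and bound: "\<And>j f g. real_wderiv f g \<Longrightarrow> \<bar>V j f\<bar> \<le> B * sqrt (H1_norm_sq f g)"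
  obtains r W where "strict_mono (r :: nat \<Rightarrow> nat)" "Hminus W" "\<And>f. H1per f \<Longrightarrow> (\<lambda>j. V (r j) f) \<longlonglongrightarrow> W f"
proof -
  let ?c = "\<lambda>(m::int) t. cos (real_of_int m * t)" and ?s = "\<lambda>(m::int) t. sin (real_of_int m * t)"
  have trig_H1: "H1per (?c m)" "H1per (?s m)" for m
    by (rule C1per_H1per[OF C1per_cos] C1per_H1per[OF C1per_sin])+
  obtain r :: "nat \<Rightarrow> nat"
    where r: "strict_mono r" and conv: "\<And>f. f \<in> range ?c \<union> range ?s \<Longrightarrow> convergent (\<lambda>j. V (r j) f)"
    by (rule Hminus_convergent_subsequence_countable[where V = V and S = "range ?c \<union> range ?s", OF bound])
      (use trig_H1 in auto)
  have "convergent (\<lambda>j. V (r j) f)" if f: "H1per f" for f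
  proof -
    obtain g where "real_wderiv f g" using f H1per_iff_real_wderiv by blast
    then obtain T T' a b where T_limit: "H1_limit T T' f g"
      and T: "\<And>k. T k = (\<lambda>t. \<Sum>m\<in>{-int k..int k}. a m * ?c m t + b m * ?s m t)"
      by (rule H1per_limit_of_trig_sums) blast
    have "V (r j) (T k) = (\<Sum>m\<in>{-int k..int k}. a m * V (r j) (?c m) + b m * V (r j) (?s m))" for j k
      unfolding T using trig_H1 by (simp add: Hminus_sum[OF V] Hminus_lin[OF V] H1per_lin)
    moreover have "convergent (\<lambda>j. \<Sum>m\<in>{-int k..int k}. a m * V (r j) (?c m) + b m * V (r j) (?s m))" for k
      by (intro convergent_sum convergent_add convergent_mult convergent_const conv) auto
    ultimately have "convergent (\<lambda>j. V (r j) (T k))" for k by simp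
    from Hminus_convergent_if_on_H1_limit[OF V bound T_limit this] show ?thesis .
  qed
  then have lim: "(\<lambda>j. V (r j) f) \<longlonglongrightarrow> lim (\<lambda>j. V (r j) f)" if "H1per f" for f
    using that by (simp add: convergent_LIMSEQ_iff)
  show ?thesis by (rule that[OF r Hminus_pointwise_limit[OF V bound lim] lim])
qed

section \<open>Slater determinants of disjointly supported orbitals\<close>

interpretation Lprod: product_sigma_finite "\<lambda>_::nat. Lper"
  by (simp add: product_sigma_finite_def finite_measure.sigma_finite_measure[OF finite_measure_Lper])

definition slater_term :: "nat \<Rightarrow> (nat \<Rightarrow> nat \<Rightarrow> real \<Rightarrow> complex) \<Rightarrow> (nat \<Rightarrow> nat) \<Rightarrow> (nat \<Rightarrow> real) \<Rightarrow> complex" where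
  "slater_term n f p x = (\<Prod>i<n. f i (p i) (x i))"

text \<open>The orbitals carry a slot index i as well, so that the same sum also yields the partial derivatives.\<close>

definition slater :: "nat \<Rightarrow> (nat \<Rightarrow> nat \<Rightarrow> real \<Rightarrow> complex) \<Rightarrow> (nat \<Rightarrow> real) \<Rightarrow> complex" where
  "slater n f x = complex_of_real (1 / sqrt (fact n))
      * (\<Sum>p | p permutes {..<n}. of_int (sign p) * slater_term n f p x)"

definition slater_grad ::
    "nat \<Rightarrow> (nat \<Rightarrow> real \<Rightarrow> complex) \<Rightarrow> (nat \<Rightarrow> real \<Rightarrow> complex) \<Rightarrow> nat \<Rightarrow> (nat \<Rightarrow> real) \<Rightarrow> complex" where
  "slater_grad n f f' j = slater n (\<lambda>i. if i = j then f' else f)"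

lemma finite_perms: "finite {p. p permutes {..<n::nat}}"
  by (rule finite_permutations) simp

lemma card_perms: "card {p. p permutes {..<n::nat}} = fact n"
  by (simp add: card_permutations[of "{..<n}" n])

lemma permutes_less: "p permutes {..<n::nat} \<Longrightarrow> i < n \<Longrightarrow> p i < n"
  using permutes_in_image[of p "{..<n}" i] by auto

lemma prod_permute: "p permutes {..<n::nat} \<Longrightarrow> (\<Prod>i<n. g (p i)) = (\<Prod>i<n. g i)"
  using prod.permute[of p "{..<n}" g] by (simp add: o_def)

lemma sum_permute: "p permutes {..<n::nat} \<Longrightarrow> (\<Sum>i<n. g (p i)) = (\<Sum>i<n. g i)"
  using sum.permute[of p "{..<n}" g] by (simp add: o_def)

lemma sum_perms_slot:
  fixes \<eta> :: "nat \<Rightarrow> real"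
  assumes "j < n"
  shows "real n * (\<Sum>p | p permutes {..<n}. \<eta> (p j)) = fact n * (\<Sum>k<n. \<eta> k)"
proof -
  let ?P = "{p. p permutes {..<n}}"
  have "(\<Sum>p\<in>?P. \<eta> (p i)) = (\<Sum>p\<in>?P. \<eta> (p j))" if "i < n" for i
  proof -
    have "Transposition.transpose i j permutes {..<n}" using that assms by (intro permutes_swap_id) auto
    from sum_permutations_compose_right[OF this, of "\<lambda>p. \<eta> (p i)"] show ?thesis by simp
  qed
  then have "real n * (\<Sum>p\<in>?P. \<eta> (p j)) = (\<Sum>i<n. \<Sum>p\<in>?P. \<eta> (p i))" by simp
  also have "\<dots> = (\<Sum>p\<in>?P. \<Sum>i<n. \<eta> (p i))" by (rule sum.swap)
  also have "\<dots> = (\<Sum>p\<in>?P. \<Sum>k<n. \<eta> k)"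
    by (intro sum.cong refl sum_permute) simp
  finally show ?thesis by (simp add: card_perms)
qed

lemma trigN_prod: "trigN n m x = (\<Prod>i<n. trig1 (m i) (x i))"
  unfolding trigN_def by (induction n) (auto simp: trig1_def cis_mult[symmetric])

lemma space_muN: "space (muN n) = PiE {..<n} (\<lambda>_. Iper)"
  by (simp add: muN_def space_PiM)

lemma slater_term_square_integrable:
  assumes f: "\<And>i k. i < n \<Longrightarrow> k < n \<Longrightarrow> square_integrable Lper (f i k)" and p: "p permutes {..<n}"
  shows "square_integrable (muN n) (slater_term n f p)"
    "(\<integral>x. (cmod (slater_term n f p x))\<^sup>2 \<partial>muN n) = (\<Prod>i<n. \<integral>t. (cmod (f i (p i) t))\<^sup>2 \<partial>Lper)"
proof -
  have factor: "f i (p i) \<in> borel_measurable Lper" "integrable Lper (\<lambda>t. (cmod (f i (p i) t))\<^sup>2)"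
    if "i < n" for i
    using f[OF that permutes_less[OF p that]] by (auto simp: square_integrable_def)
  have cmod_term: "(cmod (slater_term n f p x))\<^sup>2 = (\<Prod>i<n. (cmod (f i (p i) (x i)))\<^sup>2)" for x
    by (simp add: slater_term_def prod_norm[symmetric] prod_power_distrib)
  have "slater_term n f p \<in> borel_measurable (muN n)"
    unfolding slater_term_def muN_def
    using factor(1)
    by (intro borel_measurable_prod) (auto intro: measurable_compose[OF measurable_component_singleton])
  moreover have "integrable (muN n) (\<lambda>x. (cmod (slater_term n f p x))\<^sup>2)"
    unfolding cmod_term muN_def by (rule Lprod.product_integrable_prod) (use factor in auto)
  ultimately show "square_integrable (muN n) (slater_term n f p)" by (simp add: square_integrable_def)
  show "(\<integral>x. (cmod (slater_term n f p x))\<^sup>2 \<partial>muN n) = (\<Prod>i<n. \<integral>t. (cmod (f i (p i) t))\<^sup>2 \<partial>Lper)"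
    unfolding cmod_term muN_def by (rule Lprod.product_integral_prod) (use factor in auto)
qed

lemma slater_power2_le: "(cmod (slater n f x))\<^sup>2 \<le> (\<Sum>p | p permutes {..<n}. (cmod (slater_term n f p x))\<^sup>2)"
proof -
  let ?P = "{p. p permutes {..<n}}"
  have "cmod (slater n f x) \<le> (1 / sqrt (fact n)) * (\<Sum>p\<in>?P. cmod (slater_term n f p x))"
    unfolding slater_def norm_mult norm_of_real
    using norm_sum[of "\<lambda>p. of_int (sign p) * slater_term n f p x" ?P]
    by (auto simp: norm_mult sign_def if_distrib[of abs] if_distrib[of real_of_int] cong: if_cong
      intro!: divide_right_mono)
  then have "(cmod (slater n f x))\<^sup>2 \<le> ((1 / sqrt (fact n)) * (\<Sum>p\<in>?P. cmod (slater_term n f p x)))\<^sup>2"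
    by (intro power_mono) auto
  also have "\<dots> = (1 / fact n) * (\<Sum>p\<in>?P. cmod (slater_term n f p x))\<^sup>2"
    by (simp add: power_mult_distrib power_divide)
  also have "\<dots> \<le> (1 / fact n) * ((\<Sum>p\<in>?P. (cmod (slater_term n f p x))\<^sup>2) * real (card ?P))"
    by (intro mult_left_mono sum_squared_le_sum_of_squares finite_perms) auto
  also have "\<dots> = (\<Sum>p\<in>?P. (cmod (slater_term n f p x))\<^sup>2)" by (simp add: card_perms)
  finally show ?thesis .
qed

lemma slater_square_integrable:
  assumes f: "\<And>i k. i < n \<Longrightarrow> k < n \<Longrightarrow> square_integrable Lper (f i k)"
  shows "square_integrable (muN n) (slater n f)"
    "(\<integral>x. (cmod (slater n f x))\<^sup>2 \<partial>muN n) \<le> (\<Sum>p | p permutes {..<n}. \<Prod>i<n. \<integral>t. (cmod (f i (p i) t))\<^sup>2 \<partial>Lper)"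
proof -
  note term_integrable = slater_term_square_integrable[OF f, unfolded square_integrable_def]
  have terms_integrable: "integrable (muN n) (\<lambda>x. \<Sum>p | p permutes {..<n}. (cmod (slater_term n f p x))\<^sup>2)"
    using term_integrable by (intro Bochner_Integration.integrable_sum) auto
  have meas: "slater n f \<in> borel_measurable (muN n)"
    unfolding slater_def using term_integrable
    by (intro borel_measurable_times borel_measurable_const borel_measurable_sum) auto
  have slater_integrable: "integrable (muN n) (\<lambda>x. (cmod (slater n f x))\<^sup>2)"
    by (rule Bochner_Integration.integrable_bound[OF terms_integrable])
      (use meas in \<open>auto intro!: AE_I2 order_trans[OF slater_power2_le] abs_ge_self\<close>)
  with meas show "square_integrable (muN n) (slater n f)" by (simp add: square_integrable_def)
  have "(\<integral>x. (cmod (slater n f x))\<^sup>2 \<partial>muN n)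
      \<le> (\<integral>x. (\<Sum>p | p permutes {..<n}. (cmod (slater_term n f p x))\<^sup>2) \<partial>muN n)"
    by (intro integral_mono slater_integrable terms_integrable slater_power2_le)
  also have "\<dots> = (\<Sum>p | p permutes {..<n}. \<Prod>i<n. \<integral>t. (cmod (f i (p i) t))\<^sup>2 \<partial>Lper)"
    using term_integrable by (subst Bochner_Integration.integral_sum) auto
  finally show "(\<integral>x. (cmod (slater n f x))\<^sup>2 \<partial>muN n)
      \<le> (\<Sum>p | p permutes {..<n}. \<Prod>i<n. \<integral>t. (cmod (f i (p i) t))\<^sup>2 \<partial>Lper)" .
qed

lemma slater_integral_product:
  assumes f: "\<And>i k. i < n \<Longrightarrow> k < n \<Longrightarrow> square_integrable Lper (f i k)"
    and h: "\<And>i. i < n \<Longrightarrow> square_integrable Lper (h i)"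
  shows "(\<integral>x. slater n f x * (\<Prod>i<n. h i (x i)) \<partial>muN n) =
    complex_of_real (1 / sqrt (fact n))
      * (\<Sum>p | p permutes {..<n}. of_int (sign p) * (\<Prod>i<n. \<integral>t. f i (p i) t * h i t \<partial>Lper))"
proof -
  let ?c = "complex_of_real (1 / sqrt (fact n))"
  have term_prod: "slater_term n f p x * (\<Prod>i<n. h i (x i)) = (\<Prod>i<n. f i (p i) (x i) * h i (x i))" for p x
    by (simp add: slater_term_def prod.distrib)
  have factor: "integrable Lper (\<lambda>t. f i (p i) t * h i t)" if "p permutes {..<n}" "i < n" for p i
    using assms that permutes_less by (intro integrable_mult_square_integrable) auto
  have term_integrable: "integrable (muN n) (\<lambda>x. slater_term n f p x * (\<Prod>i<n. h i (x i)))"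
    and term_integral: "(\<integral>x. slater_term n f p x * (\<Prod>i<n. h i (x i)) \<partial>muN n)
        = (\<Prod>i<n. \<integral>t. f i (p i) t * h i t \<partial>Lper)"
    if "p permutes {..<n}" for p
    unfolding term_prod muN_def using factor[OF that]
    by (auto intro!: Lprod.product_integrable_prod Lprod.product_integral_prod)
  have "(\<integral>x. slater n f x * (\<Prod>i<n. h i (x i)) \<partial>muN n) =
    (\<integral>x. ?c * (\<Sum>p | p permutes {..<n}. of_int (sign p) * (slater_term n f p x * (\<Prod>i<n. h i (x i)))) \<partial>muN n)"
    unfolding slater_def by (simp add: sum_distrib_right mult.assoc)
  also have "\<dots> = ?c
      * (\<Sum>p | p permutes {..<n}. of_int (sign p) * (\<integral>x. slater_term n f p x * (\<Prod>i<n. h i (x i)) \<partial>muN n))"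
    using term_integrable by (simp add: Bochner_Integration.integral_sum)
  finally show ?thesis using term_integral by simp
qed

lemma prod_integral_by_parts:
  fixes f f' :: "nat \<Rightarrow> real \<Rightarrow> complex"
  assumes w: "wderiv1 (f j) (f' j)" and j: "j < n"
  shows "(\<Prod>i<n. \<integral>t. f i t * ((if i = j then \<i> * of_int (m j) else 1) * trig1 (m i) t) \<partial>Lper)
    = - (\<Prod>i<n. \<integral>t. (if i = j then f' i else f i) t * trig1 (m i) t \<partial>Lper)"
proof -
  let ?lhs = "\<lambda>i. \<integral>t. f i t * ((if i = j then \<i> * of_int (m j) else 1) * trig1 (m i) t) \<partial>Lper"
  let ?rhs = "\<lambda>i. \<integral>t. (if i = j then f' i else f i) t * trig1 (m i) t \<partial>Lper"
  have "(\<Prod>i<n. ?lhs i) = ?lhs j * (\<Prod>i\<in>{..<n}-{j}. ?lhs i)" using j by (subst prod.remove[of _ j]) auto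
  also have "?lhs j = - ?rhs j" using wderiv1D[OF w, of "m j"] by simp
  also have "(\<Prod>i\<in>{..<n}-{j}. ?lhs i) = (\<Prod>i\<in>{..<n}-{j}. ?rhs i)" by (intro prod.cong) auto
  also have "- ?rhs j * (\<Prod>i\<in>{..<n}-{j}. ?rhs i) = - (\<Prod>i<n. ?rhs i)"
    using j by (subst prod.remove[of "{..<n}" j]) auto
  finally show ?thesis .
qed

lemma wgradN_iff:
  "wgradN n \<Psi> G \<longleftrightarrow> square_integrable (muN n) \<Psi> \<and> (\<forall>j<n. square_integrable (muN n) (G j) \<and>
     (\<forall>m. (\<integral>x. \<Psi> x * (\<i> * of_int (m j) * trigN n m x) \<partial>muN n) = - (\<integral>x. G j x * trigN n m x \<partial>muN n)))"
  unfolding wgradN_def square_integrable_def by blast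

lemma slater_wgradN:
  assumes w: "\<And>k. k < n \<Longrightarrow> wderiv1 (f k) (f' k)"
  shows "wgradN n (slater n (\<lambda>i. f)) (slater_grad n f f')"
  unfolding wgradN_iff
proof (intro conjI allI impI)
  have f_sq: "square_integrable Lper (f k)" "square_integrable Lper (f' k)" if "k < n" for k
    using w[OF that] by (auto intro: wderiv1_square_integrable)
  show "square_integrable (muN n) (slater n (\<lambda>i. f))" by (intro slater_square_integrable f_sq)
  fix j assume j: "j < n"
  show "square_integrable (muN n) (slater_grad n f f' j)" unfolding slater_grad_def
    by (intro slater_square_integrable) (use f_sq in auto)
  fix m :: "nat \<Rightarrow> int"
  let ?c = "complex_of_real (1 / sqrt (fact n))"
  let ?h = "\<lambda>i t. (if i = j then \<i> * of_int (m j) else 1) * trig1 (m i) t"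
  have "\<i> * of_int (m j) * trigN n m x = (\<Prod>i<n. ?h i (x i))" for x
    using j by (simp add: trigN_prod prod.distrib prod.delta)
  then have "(\<integral>x. slater n (\<lambda>i. f) x * (\<i> * of_int (m j) * trigN n m x) \<partial>muN n)
    = (\<integral>x. slater n (\<lambda>i. f) x * (\<Prod>i<n. ?h i (x i)) \<partial>muN n)" by simp
  also have "\<dots> = ?c * (\<Sum>p | p permutes {..<n}. of_int (sign p) * (\<Prod>i<n. \<integral>t. f (p i) t * ?h i t \<partial>Lper))"
    by (intro slater_integral_product f_sq square_integrable_trig1)
  also have "\<dots> = ?c * (\<Sum>p | p permutes {..<n}. of_int (sign p) *
      - (\<Prod>i<n. \<integral>t. (if i = j then f' (p i) else f (p i)) t * trig1 (m i) t \<partial>Lper))"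
  proof (intro arg_cong2[where f="(*)"] refl sum.cong)
    fix p assume "p \<in> {p. p permutes {..<n}}"
    then have "wderiv1 (f (p j)) (f' (p j))" using permutes_less j by (intro w) auto
    from prod_integral_by_parts[where f = "\<lambda>i. f (p i)" and f' = "\<lambda>i. f' (p i)", OF this j]
    show "(\<Prod>i<n. \<integral>t. f (p i) t * ?h i t \<partial>Lper)
      = - (\<Prod>i<n. \<integral>t. (if i = j then f' (p i) else f (p i)) t * trig1 (m i) t \<partial>Lper)" .
  qed
  also have "\<dots> = - (?c * (\<Sum>p | p permutes {..<n}. of_int (sign p)
      * (\<Prod>i<n. \<integral>t. (if i = j then f' else f) (p i) t * trig1 (m i) t \<partial>Lper)))"
    by (simp add: sum_negf if_distrib[of "\<lambda>h. h (p _)" for p])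
  also have "\<dots> = - (\<integral>x. slater_grad n f f' j x * trigN n m x \<partial>muN n)"
    unfolding slater_grad_def trigN_prod using square_integrable_trig1[of 1]
    by (subst slater_integral_product) (use f_sq in auto)
  finally show "(\<integral>x. slater n (\<lambda>i. f) x * (\<i> * of_int (m j) * trigN n m x) \<partial>muN n)
    = - (\<integral>x. slater_grad n f f' j x * trigN n m x \<partial>muN n)" .
qed

lemma slater_antisym: "antisymN n (slater n (\<lambda>i. f))"
  unfolding antisymN_def
proof (intro allI impI AE_I2)
  fix \<tau> x assume \<tau>: "\<tau> permutes {..<n}"
  have term_compose: "slater_term n (\<lambda>i. f) (p \<circ> \<tau>) (x \<circ> \<tau>) = slater_term n (\<lambda>i. f) p x" for p
    using prod_permute[OF \<tau>, of "\<lambda>k. f (p k) (x k)"] by (simp add: slater_term_def)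
  have "(\<Sum>p | p permutes {..<n}. of_int (sign p) * slater_term n (\<lambda>i. f) p (x \<circ> \<tau>)) =
    (\<Sum>p | p permutes {..<n}. of_int (sign (p \<circ> \<tau>)) * slater_term n (\<lambda>i. f) (p \<circ> \<tau>) (x \<circ> \<tau>))"
    by (rule sum_permutations_compose_right[OF \<tau>])
  also have "\<dots> = (\<Sum>p | p permutes {..<n}. of_int (sign \<tau>) * (of_int (sign p) * slater_term n (\<lambda>i. f) p x))"
  proof (rule sum.cong[OF refl])
    fix p assume "p \<in> {p. p permutes {..<n}}"
    then have "sign (p \<circ> \<tau>) = sign p * sign \<tau>"
      using \<tau> by (intro sign_compose) (auto simp: permutation_permutes)
    then show "of_int (sign (p \<circ> \<tau>)) * slater_term n (\<lambda>i. f) (p \<circ> \<tau>) (x \<circ> \<tau>)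
      = of_int (sign \<tau>) * (of_int (sign p) * slater_term n (\<lambda>i. f) p x)"
      by (simp add: term_compose)
  qed
  finally show "slater n (\<lambda>i. f) (x \<circ> \<tau>) = of_int (sign \<tau>) * slater n (\<lambda>i. f) x"
    unfolding slater_def by (simp add: sum_distrib_left mult_ac)
qed

lemma slater_term_disjoint:
  assumes disjoint: "\<And>k l t. k < n \<Longrightarrow> l < n \<Longrightarrow> k \<noteq> l \<Longrightarrow> t \<in> Iper \<Longrightarrow> f k t * h l t = 0"
    and x: "\<And>i. i < n \<Longrightarrow> x i \<in> Iper" and perms: "p permutes {..<n}" "q permutes {..<n}" and "p \<noteq> q"
  shows "cnj (slater_term n (\<lambda>i. f) p x) * slater_term n (\<lambda>i. h) q x = 0"
proof -
  obtain i where "p i \<noteq> q i" using \<open>p \<noteq> q\<close> by auto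
  moreover have i: "i < n" using \<open>p i \<noteq> q i\<close> perms by (metis lessThan_iff permutes_not_in)
  ultimately have "f (p i) (x i) * h (q i) (x i) = 0" using perms permutes_less x by (intro disjoint) auto
  then have "\<exists>i\<in>{..<n}. cnj (f (p i) (x i)) * h (q i) (x i) = 0" using i by auto
  then show ?thesis by (simp add: slater_term_def prod.distrib[symmetric])
qed

lemma slater_disjoint_product:
  assumes disjoint: "\<And>k l t. k < n \<Longrightarrow> l < n \<Longrightarrow> k \<noteq> l \<Longrightarrow> t \<in> Iper \<Longrightarrow> f k t * h l t = 0"
    and x: "\<And>i. i < n \<Longrightarrow> x i \<in> Iper"
  shows "cnj (slater n (\<lambda>i. f) x) * slater n (\<lambda>i. h) x =
    complex_of_real (1 / fact n) * (\<Sum>p | p permutes {..<n}. \<Prod>i<n. cnj (f (p i) (x i)) * h (p i) (x i))"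
proof -
  let ?P = "{p. p permutes {..<n}}" and ?c = "complex_of_real (1 / sqrt (fact n))"
  have c_square: "?c * ?c = complex_of_real (1 / fact n)"
    unfolding of_real_mult[symmetric] by (simp add: real_sqrt_mult_self)
  have sign_square: "of_int (sign p) * of_int (sign p) = (1::complex)" for p :: "nat \<Rightarrow> nat"
    by (metis of_int_1 of_int_mult sign_idempotent)
  have "cnj (slater n (\<lambda>i. f) x) * slater n (\<lambda>i. h) x = (?c * ?c) *
      ((\<Sum>p\<in>?P. of_int (sign p) * cnj (slater_term n (\<lambda>i. f) p x))
        * (\<Sum>q\<in>?P. of_int (sign q) * slater_term n (\<lambda>i. h) q x))"
    by (simp add: slater_def)
  also have "\<dots> = complex_of_real (1 / fact n) *
     (\<Sum>p\<in>?P. \<Sum>q\<in>?P. of_int (sign p * sign q) * (cnj (slater_term n (\<lambda>i. f) p x) * slater_term n (\<lambda>i. h) q x))"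
    unfolding c_square sum_product by (simp add: mult_ac)
  also have "(\<Sum>p\<in>?P. \<Sum>q\<in>?P. of_int (sign p * sign q)
      * (cnj (slater_term n (\<lambda>i. f) p x) * slater_term n (\<lambda>i. h) q x))
    = (\<Sum>p\<in>?P. \<Sum>q\<in>?P. if q = p then (\<Prod>i<n. cnj (f (p i) (x i)) * h (p i) (x i)) else 0)"
    using slater_term_disjoint[of n f h x, OF disjoint x]
    by (intro sum.cong refl) (auto simp: sign_square slater_term_def prod.distrib)
  also have "\<dots> = (\<Sum>p\<in>?P. \<Prod>i<n. cnj (f (p i) (x i)) * h (p i) (x i))"
    using finite_perms by (intro sum.cong refl) (simp add: sum.delta')
  finally show ?thesis .
qed

lemma slater_inner:
  assumes f: "\<And>k. k < n \<Longrightarrow> square_integrable Lper (f k)" and h: "\<And>k. k < n \<Longrightarrow> square_integrable Lper (h k)"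
    and disjoint: "\<And>k l t. k < n \<Longrightarrow> l < n \<Longrightarrow> k \<noteq> l \<Longrightarrow> t \<in> Iper \<Longrightarrow> f k t * h l t = 0"
  shows "innerN n (slater n (\<lambda>i. f)) (slater n (\<lambda>i. h)) = (\<Prod>k<n. \<integral>t. cnj (f k t) * h k t \<partial>Lper)"
proof -
  let ?P = "{p. p permutes {..<n}}"
  have factor: "integrable Lper (\<lambda>t. cnj (f (p i) t) * h (p i) t)" if "p \<in> ?P" "i < n" for p i
    using f h that permutes_less by (intro integrable_mult_square_integrable square_integrable_cnj) auto
  have term_integrable: "integrable (muN n) (\<lambda>x. \<Prod>i<n. cnj (f (p i) (x i)) * h (p i) (x i))"
    and term_integral: "(\<integral>x. (\<Prod>i<n. cnj (f (p i) (x i)) * h (p i) (x i)) \<partial>muN n)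
        = (\<Prod>k<n. \<integral>t. cnj (f k t) * h k t \<partial>Lper)"
    if p: "p \<in> ?P" for p
  proof -
    show "integrable (muN n) (\<lambda>x. \<Prod>i<n. cnj (f (p i) (x i)) * h (p i) (x i))"
      unfolding muN_def using factor[OF p] by (intro Lprod.product_integrable_prod) auto
    have "(\<integral>x. (\<Prod>i<n. cnj (f (p i) (x i)) * h (p i) (x i)) \<partial>muN n) = (\<Prod>i<n. \<integral>t. cnj (f (p i) t) * h (p i) t \<partial>Lper)"
      unfolding muN_def using factor[OF p] by (intro Lprod.product_integral_prod) auto
    then show "(\<integral>x. (\<Prod>i<n. cnj (f (p i) (x i)) * h (p i) (x i)) \<partial>muN n) = (\<Prod>k<n. \<integral>t. cnj (f k t) * h k t \<partial>Lper)"
      using p prod_permute[of p n "\<lambda>k. \<integral>t. cnj (f k t) * h k t \<partial>Lper"] by simp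
  qed
  have "innerN n (slater n (\<lambda>i. f)) (slater n (\<lambda>i. h)) =
    (\<integral>x. complex_of_real (1 / fact n) * (\<Sum>p\<in>?P. \<Prod>i<n. cnj (f (p i) (x i)) * h (p i) (x i)) \<partial>muN n)"
    unfolding innerN_def
    by (intro Bochner_Integration.integral_cong refl slater_disjoint_product disjoint) (auto simp: space_muN)
  also have "\<dots> = complex_of_real (1 / fact n) * (\<Sum>p\<in>?P. \<Prod>k<n. \<integral>t. cnj (f k t) * h k t \<partial>Lper)"
    using term_integrable term_integral by (simp add: Bochner_Integration.integral_sum)
  finally show ?thesis by (simp add: card_perms)
qed

lemma innerN_self: "innerN n \<Psi> \<Psi> = complex_of_real (\<integral>x. (cmod (\<Psi> x))\<^sup>2 \<partial>muN n)"
proof -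
  have "complex_of_real (\<integral>x. (cmod (\<Psi> x))\<^sup>2 \<partial>muN n) = (\<integral>x. complex_of_real ((cmod (\<Psi> x))\<^sup>2) \<partial>muN n)"
    by (rule integral_complex_of_real[symmetric])
  also have "\<dots> = innerN n \<Psi> \<Psi>" unfolding innerN_def complex_norm_square by (simp add: mult.commute)
  finally show ?thesis by simp
qed

lemma slater_disjoint_power2:
  assumes disjoint: "\<And>k l t. k < n \<Longrightarrow> l < n \<Longrightarrow> k \<noteq> l \<Longrightarrow> t \<in> Iper \<Longrightarrow> f k t * f l t = 0"
    and x: "\<And>i. i < n \<Longrightarrow> x i \<in> Iper"
  shows "ennreal ((cmod (slater n (\<lambda>i. f) x))\<^sup>2) =
    (\<Sum>p | p permutes {..<n}. ennreal (1 / fact n) * (\<Prod>i<n. ennreal ((cmod (f (p i) (x i)))\<^sup>2)))"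
proof -
  have "complex_of_real ((cmod (slater n (\<lambda>i. f) x))\<^sup>2) = cnj (slater n (\<lambda>i. f) x) * slater n (\<lambda>i. f) x"
    by (simp add: complex_norm_square mult.commute del: of_real_power)
  also have "\<dots> = complex_of_real (1 / fact n) * (\<Sum>p | p permutes {..<n}. \<Prod>i<n. cnj (f (p i) (x i)) * f (p i) (x i))"
    by (rule slater_disjoint_product[OF disjoint x])
  also have "\<dots> = complex_of_real (1 / fact n * (\<Sum>p | p permutes {..<n}. \<Prod>i<n. (cmod (f (p i) (x i)))\<^sup>2))"
    by (simp add: complex_norm_square mult.commute del: of_real_power)
  finally have "(cmod (slater n (\<lambda>i. f) x))\<^sup>2
      = (\<Sum>p | p permutes {..<n}. 1 / fact n * (\<Prod>i<n. (cmod (f (p i) (x i)))\<^sup>2))"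
    unfolding of_real_eq_iff sum_distrib_left .
  also have "ennreal \<dots> = (\<Sum>p | p permutes {..<n}. ennreal (1 / fact n * (\<Prod>i<n. (cmod (f (p i) (x i)))\<^sup>2)))"
    by (rule sum_ennreal[symmetric]) (simp add: prod_nonneg)
  also have "\<dots> = (\<Sum>p | p permutes {..<n}. ennreal (1 / fact n) * (\<Prod>i<n. ennreal ((cmod (f (p i) (x i)))\<^sup>2)))"
    by (rule sum.cong[OF refl], subst ennreal_mult) (auto simp: prod_nonneg prod_ennreal)
  finally show ?thesis .
qed

lemma nn_integral_prod_normalized:
  fixes h :: "nat \<Rightarrow> real \<Rightarrow> ennreal"
  assumes "finite J" and meas: "\<And>i. i \<in> J \<Longrightarrow> h i \<in> borel_measurable Lper"
    and one: "\<And>i. i \<in> J \<Longrightarrow> (\<integral>\<^sup>+s. h i s \<partial>Lper) = 1"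
  shows "(\<lambda>y. \<Prod>i\<in>J. h i (y i)) \<in> borel_measurable (PiM J (\<lambda>_. Lper))"
    "(\<integral>\<^sup>+y. (\<Prod>i\<in>J. h i (y i)) \<partial>PiM J (\<lambda>_. Lper)) = 1"
  using meas one Lprod.product_nn_integral_prod[OF \<open>finite J\<close>, of h]
  by (auto intro!: borel_measurable_prod_ennreal measurable_compose[OF measurable_component_singleton])

lemma slater_density:
  assumes n: "1 \<le> n" and f: "\<And>k. k < n \<Longrightarrow> square_integrable Lper (f k)"
    and disjoint: "\<And>k l t. k < n \<Longrightarrow> l < n \<Longrightarrow> k \<noteq> l \<Longrightarrow> t \<in> Iper \<Longrightarrow> f k t * f l t = 0"
    and one: "\<And>k. k < n \<Longrightarrow> (\<integral>t. (cmod (f k t))\<^sup>2 \<partial>Lper) = 1" and t: "t \<in> Iper"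
  shows "densN n (slater n (\<lambda>i. f)) t = ennreal (\<Sum>k<n. (cmod (f k t))\<^sup>2)"
proof -
  let ?P = "{p. p permutes {..<n}}" and ?M = "PiM {1..<n} (\<lambda>_. Lper)"
  let ?a = "\<lambda>p. ennreal (1 / fact n * (cmod (f (p 0) t))\<^sup>2)"
  let ?b = "\<lambda>p y. \<Prod>i\<in>{1..<n}. ennreal ((cmod (f (p i) (y i)))\<^sup>2)"
  have "{..<n} = insert 0 {1..<n}" using n by auto
  then have prod_split: "(\<Prod>i<n. g i) = g 0 * (\<Prod>i\<in>{1..<n}. g i)" for g :: "nat \<Rightarrow> ennreal" by simp
  have factor: "(\<lambda>s. ennreal ((cmod (f k s))\<^sup>2)) \<in> borel_measurable Lper"
    "(\<integral>\<^sup>+s. ennreal ((cmod (f k s))\<^sup>2) \<partial>Lper) = 1"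
    if "k < n" for k
    using f[OF that] one[OF that] by (auto simp: square_integrable_def nn_integral_eq_integral)
  have rest: "?b p \<in> borel_measurable ?M" "(\<integral>\<^sup>+y. ?b p y \<partial>?M) = 1" if "p \<in> ?P" for p
    using that permutes_less by (auto intro!: nn_integral_prod_normalized factor)
  have "(\<integral>\<^sup>+ y. ennreal ((cmod (slater n (\<lambda>i. f) (y(0 := t))))\<^sup>2) \<partial>?M) = (\<integral>\<^sup>+ y. (\<Sum>p\<in>?P. ?a p * ?b p y) \<partial>?M)"
  proof (rule nn_integral_cong)
    fix y assume y: "y \<in> space ?M"
    have in_Iper: "(y(0 := t)) i \<in> Iper" if "i < n" for i
      using y t that by (auto simp: space_PiM PiE_def Pi_def)
    have "ennreal ((cmod (slater n (\<lambda>i. f) (y(0 := t))))\<^sup>2) =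
      (\<Sum>p\<in>?P. ennreal (1 / fact n) * (\<Prod>i<n. ennreal ((cmod (f (p i) ((y(0 := t)) i)))\<^sup>2)))"
      by (rule slater_disjoint_power2[OF disjoint in_Iper])
    also have "\<dots> = (\<Sum>p\<in>?P. ?a p * ?b p y)"
      unfolding prod_split by (intro sum.cong refl) (simp add: mult.assoc[symmetric] ennreal_mult[symmetric])
    finally show "ennreal ((cmod (slater n (\<lambda>i. f) (y(0 := t))))\<^sup>2) = (\<Sum>p\<in>?P. ?a p * ?b p y)" .
  qed
  also have "\<dots> = (\<Sum>p\<in>?P. ?a p)"
    using rest by (subst nn_integral_sum) (auto simp: nn_integral_cmult)
  also have "\<dots> = ennreal (1 / fact n * (\<Sum>p\<in>?P. (cmod (f (p 0) t))\<^sup>2))"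
    by (simp add: sum_ennreal sum_distrib_left)
  finally have "densN n (slater n (\<lambda>i. f)) t
      = ennreal (real n) * ennreal (1 / fact n * (\<Sum>p\<in>?P. (cmod (f (p 0) t))\<^sup>2))"
    unfolding densN_def by (simp only:)
  also have "\<dots> = ennreal (1 / fact n * (real n * (\<Sum>p\<in>?P. (cmod (f (p 0) t))\<^sup>2)))"
    by (subst ennreal_mult[symmetric]) (auto simp: sum_nonneg)
  finally show ?thesis using sum_perms_slot[of 0 n "\<lambda>k. (cmod (f k t))\<^sup>2"] n by simp
qed

lemma slater_kinetic_le:
  assumes n: "1 \<le> n"
    and f: "\<And>k. k < n \<Longrightarrow> square_integrable Lper (f k)" "\<And>k. k < n \<Longrightarrow> square_integrable Lper (f' k)"
    and one: "\<And>k. k < n \<Longrightarrow> (\<integral>t. (cmod (f k t))\<^sup>2 \<partial>Lper) = 1"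
  shows "(\<Sum>j<n. \<integral>x. (cmod (slater_grad n f f' j x))\<^sup>2 \<partial>muN n) \<le> fact n * (\<Sum>j<n. \<integral>t. (cmod (f' j t))\<^sup>2 \<partial>Lper)"
proof -
  let ?P = "{p. p permutes {..<n}}" and ?K = "\<lambda>k. \<integral>t. (cmod (f' k t))\<^sup>2 \<partial>Lper"
  have "(\<integral>x. (cmod (slater_grad n f f' j x))\<^sup>2 \<partial>muN n) \<le> (\<Sum>p\<in>?P. ?K (p j))" if j: "j < n" for j
  proof -
    have "(\<integral>x. (cmod (slater_grad n f f' j x))\<^sup>2 \<partial>muN n)
      \<le> (\<Sum>p\<in>?P. \<Prod>i<n. \<integral>t. (cmod ((if i = j then f' else f) (p i) t))\<^sup>2 \<partial>Lper)"
      unfolding slater_grad_def by (rule slater_square_integrable(2)) (use f in auto)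
    also have "\<dots> = (\<Sum>p\<in>?P. \<Prod>i<n. if i = j then ?K (p j) else 1)"
      using permutes_less one by (intro sum.cong prod.cong refl) auto
    finally show ?thesis using j by (simp add: prod.delta)
  qed
  then have "(\<Sum>j<n. \<integral>x. (cmod (slater_grad n f f' j x))\<^sup>2 \<partial>muN n) \<le> (\<Sum>j<n. \<Sum>p\<in>?P. ?K (p j))"
    by (intro sum_mono) auto
  also have "\<dots> = (\<Sum>j<n. (1 / real n) * (real n * (\<Sum>p\<in>?P. ?K (p j))))" using n by (intro sum.cong) auto
  also have "\<dots> = (\<Sum>j<n. (1 / real n) * (fact n * (\<Sum>k<n. ?K k)))"
    by (intro sum.cong arg_cong2[where f="(*)"] refl sum_perms_slot) auto
  finally show ?thesis using n by simp
qed

lemma cN_permute: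
  assumes \<sigma>: "\<sigma> permutes {..<n}"
  shows "cN n w (x \<circ> \<sigma>) = cN n w x"
proof -
  let ?g = "\<lambda>k. \<Sum>j\<in>{..<n} - {k}. w (x k, x j)"
  have "(\<Sum>j\<in>{..<n} - {i}. w ((x \<circ> \<sigma>) i, (x \<circ> \<sigma>) j)) = ?g (\<sigma> i)" if "i < n" for i
  proof -
    have "bij_betw \<sigma> ({..<n} - {i}) ({..<n} - {\<sigma> i})"
      using permutes_imp_bij[OF \<sigma>] that by (intro bij_betw_DiffI) (auto simp: bij_betw_def inj_on_def)
    from sum.reindex_bij_betw[OF this, of "\<lambda>l. w (x (\<sigma> i), x l)"] show ?thesis by simp
  qed
  then have "cN n w (x \<circ> \<sigma>) = (\<Sum>i<n. ?g (\<sigma> i))" unfolding cN_def by simp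
  also have "\<dots> = (\<Sum>i<n. ?g i)" by (rule sum_permute[OF \<sigma>])
  finally show ?thesis by (simp add: cN_def)
qed

lemma slater_cost_le:
  assumes cost_le: "\<And>y. (\<And>j. j < n \<Longrightarrow> y j \<in> Iper) \<Longrightarrow> (\<And>j. j < n \<Longrightarrow> f j (y j) \<noteq> 0) \<Longrightarrow> cN n w y \<le> ennreal S"
    and x: "x \<in> space (muN n)"
  shows "cN n w x * ennreal ((cmod (slater n (\<lambda>i. f) x))\<^sup>2) \<le> ennreal S * ennreal ((cmod (slater n (\<lambda>i. f) x))\<^sup>2)"
proof (cases "slater n (\<lambda>i. f) x = 0")
  case False
  then obtain p where p: "p permutes {..<n}" "slater_term n (\<lambda>i. f) p x \<noteq> 0"
    unfolding slater_def by (metis (mono_tags, lifting) mem_Collect_eq mult_eq_0_iff sum.neutral)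
  have inv_p: "inv p permutes {..<n}" by (rule permutes_inv[OF p(1)])
  define y where "y = x \<circ> inv p"
  have "y j \<in> Iper" "f j (y j) \<noteq> 0" if j: "j < n" for j
  proof -
    have i: "inv p j < n" by (rule permutes_less[OF inv_p j])
    then show "y j \<in> Iper" using x by (auto simp: y_def space_muN)
    have "f (p (inv p j)) (x (inv p j)) \<noteq> 0" using p(2) i by (auto simp: slater_term_def)
    then show "f j (y j) \<noteq> 0" using permutes_inverses(1)[OF p(1)] by (simp add: y_def)
  qed
  then have "cN n w y \<le> ennreal S" by (rule cost_le)
  then have "cN n w x \<le> ennreal S" unfolding y_def by (simp add: cN_permute[OF inv_p])
  then show ?thesis by (intro mult_right_mono) auto
qed simp

lemma energyN_le:
  assumes grad: "wgradN n \<Psi> G" and normalized: "innerN n \<Psi> \<Psi> = 1" and "0 < \<epsilon>" "0 \<le> S"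
    and potential: "\<And>x. x \<in> space (muN n) \<Longrightarrow> cN n w x * ennreal ((cmod (\<Psi> x))\<^sup>2)
        \<le> ennreal S * ennreal ((cmod (\<Psi> x))\<^sup>2)"
    and kinetic: "(\<Sum>j<n. \<integral>x. (cmod (G j x))\<^sup>2 \<partial>muN n) \<le> K"
  shows "energyN n w \<epsilon> \<Psi> G \<le> ennreal (\<epsilon> * K + S)"
proof -
  have G_integrable: "integrable (muN n) (\<lambda>x. (cmod (G j x))\<^sup>2)" if "j < n" for j
    using grad that by (simp add: wgradN_def)
  have \<Psi>_integrable: "integrable (muN n) (\<lambda>x. (cmod (\<Psi> x))\<^sup>2)" using grad by (simp add: wgradN_def)
  have \<Psi>_one: "(\<integral>x. (cmod (\<Psi> x))\<^sup>2 \<partial>muN n) = 1"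
    using normalized unfolding innerN_self by (simp only: of_real_eq_1_iff)
  let ?e = "\<lambda>x. \<epsilon> * (\<Sum>j<n. (cmod (G j x))\<^sup>2) + S * (cmod (\<Psi> x))\<^sup>2"
  have kinetic_integrable: "integrable (muN n) (\<lambda>x. \<epsilon> * (\<Sum>j<n. (cmod (G j x))\<^sup>2))"
    by (intro integrable_mult_right Bochner_Integration.integrable_sum G_integrable) simp
  have "energyN n w \<epsilon> \<Psi> G \<le> (\<integral>\<^sup>+ x. ennreal (?e x) \<partial>muN n)"
    unfolding energyN_def
  proof (rule nn_integral_mono)
    fix x assume x: "x \<in> space (muN n)"
    have "ennreal (?e x) = ennreal (\<epsilon> * (\<Sum>j<n. (cmod (G j x))\<^sup>2)) + ennreal S * ennreal ((cmod (\<Psi> x))\<^sup>2)"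
      using \<open>0 < \<epsilon>\<close> \<open>0 \<le> S\<close> by (simp add: ennreal_plus ennreal_mult sum_nonneg)
    then show "ennreal (\<epsilon> * (\<Sum>j<n. (cmod (G j x))\<^sup>2)) + cN n w x * ennreal ((cmod (\<Psi> x))\<^sup>2) \<le> ennreal (?e x)"
      using potential[OF x] by (simp add: add_left_mono)
  qed
  also have "\<dots> = ennreal (\<integral>x. ?e x \<partial>muN n)"
    using kinetic_integrable \<Psi>_integrable \<open>0 < \<epsilon>\<close> \<open>0 \<le> S\<close>
    by (intro nn_integral_eq_integral AE_I2 Bochner_Integration.integrable_add integrable_mult_right)
      (simp add: sum_nonneg)+
  also have "(\<integral>x. ?e x \<partial>muN n) = \<epsilon> * (\<Sum>j<n. \<integral>x. (cmod (G j x))\<^sup>2 \<partial>muN n) + S"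
    using kinetic_integrable \<Psi>_integrable G_integrable by (simp add: \<Psi>_one Bochner_Integration.integral_sum)
  also have "ennreal \<dots> \<le> ennreal (\<epsilon> * K + S)"
    using kinetic \<open>0 < \<epsilon>\<close> by (intro ennreal_leI) simp
  finally show ?thesis .
qed

section \<open>Mixed states with a prescribed density\<close>

definition orbital :: "(real \<Rightarrow> real) \<Rightarrow> (real \<Rightarrow> real) \<Rightarrow> bool" where
  "orbital \<phi> \<phi>' \<longleftrightarrow> C1per \<phi> \<phi>' \<and> (\<forall>t. 0 \<le> \<phi> t) \<and> (\<integral>t. (\<phi> t)\<^sup>2 \<partial>Lper) = 1"

lemma orbitalD:
  assumes "orbital \<phi> \<phi>'"
  shows "C1per \<phi> \<phi>'" "0 \<le> \<phi> t" "(\<integral>t. (\<phi> t)\<^sup>2 \<partial>Lper) = 1"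
  using assms by (auto simp: orbital_def)

lemma orbital_shift:
  assumes "orbital \<phi> \<phi>'"
  shows "orbital (\<lambda>t. \<phi> (t - a)) (\<lambda>t. \<phi>' (t - a))"
  using orbitalD[OF assms] integral_Lper_shift[of "\<lambda>t. (\<phi> t)\<^sup>2" a] C1per_cont[of \<phi> \<phi>' UNIV] C1per_periodic[of \<phi> \<phi>']
  by (auto simp: orbital_def C1per_shift continuous_on_power)

definition disjoint_orbitals :: "nat \<Rightarrow> (nat \<Rightarrow> real \<Rightarrow> real) \<Rightarrow> (nat \<Rightarrow> real \<Rightarrow> real) \<Rightarrow> bool" where
  "disjoint_orbitals n \<phi> \<phi>' \<longleftrightarrow> (\<forall>j<n. orbital (\<phi> j) (\<phi>' j)) \<and>
     (\<forall>i<n. \<forall>j<n. \<forall>t\<in>Iper. i \<noteq> j \<longrightarrow> \<phi> i t * \<phi> j t = 0)"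

definition orbital_density :: "nat \<Rightarrow> (nat \<Rightarrow> real \<Rightarrow> real) \<Rightarrow> real \<Rightarrow> real" where
  "orbital_density n \<phi> t = 1 / real n * (\<Sum>j<n. (\<phi> j t)\<^sup>2)"

definition support_cost_le :: "nat \<Rightarrow> (real \<times> real \<Rightarrow> ennreal) \<Rightarrow> (nat \<Rightarrow> real \<Rightarrow> real) \<Rightarrow> real \<Rightarrow> bool" where
  "support_cost_le n w \<phi> S \<longleftrightarrow> (\<forall>x. (\<forall>j<n. x j \<in> Iper \<and> \<phi> j (x j) \<noteq> 0) \<longrightarrow> cN n w x \<le> ennreal S)"

definition kinetic_bound :: "nat \<Rightarrow> (nat \<Rightarrow> real \<Rightarrow> real) \<Rightarrow> real" where
  "kinetic_bound n \<phi>' = fact n * (\<Sum>j<n. \<integral>t. (\<phi>' j t)\<^sup>2 \<partial>Lper)"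

lemma kinetic_bound_nonneg: "0 \<le> kinetic_bound n \<phi>'"
  by (simp add: kinetic_bound_def sum_nonneg)

lemma power2_sum_disjoint:
  fixes a :: "nat \<Rightarrow> real"
  assumes "\<And>i j. i < n \<Longrightarrow> j < n \<Longrightarrow> i \<noteq> j \<Longrightarrow> a i * a j = 0"
  shows "(\<Sum>i<n. a i)\<^sup>2 = (\<Sum>i<n. (a i)\<^sup>2)"
proof -
  have "(\<Sum>i<n. a i)\<^sup>2 = (\<Sum>i<n. \<Sum>j<n. a i * a j)" by (simp add: power2_eq_square sum_product)
  also have "\<dots> = (\<Sum>i<n. \<Sum>j<n. if j = i then (a i)\<^sup>2 else 0)"
    using assms by (intro sum.cong refl) (auto simp: power2_eq_square)
  finally show ?thesis by (simp add: sum.delta')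
qed

lemma adm_orbital_density:
  assumes n: "1 \<le> n" and \<phi>: "disjoint_orbitals n \<phi> \<phi>'"
  shows "adm (orbital_density n \<phi>)"
  unfolding adm_def
proof (intro conjI ballI)
  have orb: "orbital (\<phi> j) (\<phi>' j)" if "j < n" for j using \<phi> that by (simp add: disjoint_orbitals_def)
  have "C1per (\<lambda>t. (1 / sqrt (real n)) * (\<Sum>j<n. \<phi> j t)) (\<lambda>t. (1 / sqrt (real n)) * (\<Sum>j<n. \<phi>' j t))"
    using orb by (intro C1per_cmult C1per_sum) (auto simp: orbital_def)
  from C1per_wderiv[OF this]
  have "real_wderiv (\<lambda>t. sqrt (orbital_density n \<phi> t)) (\<lambda>t. (1 / sqrt (real n)) * (\<Sum>j<n. \<phi>' j t))"
  proof (rule wderiv1_cong)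
    fix t assume t: "t \<in> Iper"
    have "orbital_density n \<phi> t = 1 / real n * (\<Sum>j<n. \<phi> j t)\<^sup>2"
      using \<phi> t unfolding orbital_density_def disjoint_orbitals_def by (subst power2_sum_disjoint) auto
    moreover have "0 \<le> (\<Sum>j<n. \<phi> j t)" using orb by (auto simp: orbital_def intro: sum_nonneg)
    ultimately show "complex_of_real ((1 / sqrt (real n)) * (\<Sum>j<n. \<phi> j t))
        = complex_of_real (sqrt (orbital_density n \<phi> t))"
      by (simp add: real_sqrt_divide)
  qed simp
  then show "H1per (\<lambda>t. sqrt (orbital_density n \<phi> t))" unfolding H1per_def by blast
  have "integrable Lper (\<lambda>t. (\<phi> j t)\<^sup>2)" if "j < n" for j
    by (intro integrable_Lper_cont continuous_intros C1per_cont[OF orbitalD(1)[OF orb[OF that]]])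
  then show "(\<integral>t. orbital_density n \<phi> t \<partial>Lper) = 1"
    using orb n by (simp add: orbital_density_def orbital_def Bochner_Integration.integral_sum)
qed (simp add: orbital_density_def sum_nonneg)

text \<open>Multiplying an orbital by a phase running through its mass coordinate produces infinitely many
  orthonormal orbitals with the same density.\<close>

definition phase_orbital :: "(real \<Rightarrow> real) \<Rightarrow> (real \<Rightarrow> real) \<Rightarrow> nat \<Rightarrow> real \<Rightarrow> complex" where
  "phase_orbital \<phi> s k t = complex_of_real (\<phi> t) * trig1 (int k) (2 * pi * s t)"

definition phase_orbital_deriv :: "(real \<Rightarrow> real) \<Rightarrow> (real \<Rightarrow> real) \<Rightarrow> (real \<Rightarrow> real) \<Rightarrow> nat \<Rightarrow> real \<Rightarrow> complex" where
  "phase_orbital_deriv \<phi> \<phi>' s k t = complex_of_real (\<phi>' t) * trig1 (int k) (2 * pi * s t)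
     + complex_of_real (\<phi> t) * (complex_of_real (2 * pi * (\<phi> t)\<^sup>2) * (\<i> * of_nat k * trig1 (int k) (2 * pi * s t)))"

lemma phase_orbital_0: "phase_orbital \<phi> s 0 = (\<lambda>t. complex_of_real (\<phi> t))"
  and phase_orbital_deriv_0: "phase_orbital_deriv \<phi> \<phi>' s 0 = (\<lambda>t. complex_of_real (\<phi>' t))"
  by (simp_all add: phase_orbital_def phase_orbital_deriv_def trig1_def fun_eq_iff)

lemma phase_orbital_wderiv1:
  assumes \<phi>: "C1per \<phi> \<phi>'" and s: "mass_coordinate (\<lambda>t. (\<phi> t)\<^sup>2) s"
  shows "wderiv1 (phase_orbital \<phi> s k) (phase_orbital_deriv \<phi> \<phi>' s k)"
proof (rule wderiv1_C1)
  interpret mass_coordinate "\<lambda>t. (\<phi> t)\<^sup>2" s by (rule s)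
  fix t
  have "((\<lambda>t. 2 * pi * s t) has_vector_derivative 2 * pi * (\<phi> t)\<^sup>2) (at t)"
    using s_DERIV[of t]
    by (auto intro!: derivative_eq_intros simp: has_real_derivative_iff_has_vector_derivative[symmetric])
  from vector_diff_chain_at[OF this trig1_vderiv[of "int k"]]
  have phase_deriv: "((\<lambda>t. trig1 (int k) (2 * pi * s t)) has_vector_derivative
      complex_of_real (2 * pi * (\<phi> t)\<^sup>2) * (\<i> * of_nat k * trig1 (int k) (2 * pi * s t))) (at t)"
    by (simp add: o_def scaleR_conv_of_real)
  have "((\<lambda>t. complex_of_real (\<phi> t)) has_vector_derivative complex_of_real (\<phi>' t)) (at t)"
    using C1per_DERIV[OF \<phi>]
    by (intro has_vector_derivative_of_real) (auto simp: has_real_derivative_iff_has_vector_derivative)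
  from has_vector_derivative_mult[OF this phase_deriv]
  show "(phase_orbital \<phi> s k has_vector_derivative phase_orbital_deriv \<phi> \<phi>' s k t) (at t)"
    unfolding phase_orbital_def phase_orbital_deriv_def by (simp add: add.commute)
  show "continuous_on UNIV (phase_orbital_deriv \<phi> \<phi>' s k)" unfolding phase_orbital_deriv_def
    by (intro continuous_intros C1per_cont[OF \<phi>] continuous_on_compose2[OF trig1_cont[of UNIV]] s_cont) auto
  show "phase_orbital \<phi> s k (2 * pi) = phase_orbital \<phi> s k 0"
    using C1per_periodic[OF \<phi>, of 0] s_add_period[of 0] trig1_periodic[of "int k" 0]
    by (simp add: phase_orbital_def s_0)
qed

lemma phase_orbital_inner:
  assumes s: "mass_coordinate (\<lambda>t. (\<phi> t)\<^sup>2) s"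
  shows "(\<integral>t. cnj (phase_orbital \<phi> s k t) * phase_orbital \<phi> s l t \<partial>Lper) = (if k = l then 1 else 0)"
proof -
  interpret mass_coordinate "\<lambda>t. (\<phi> t)\<^sup>2" s by (rule s)
  have "cnj (phase_orbital \<phi> s k t) * phase_orbital \<phi> s l t
      = (\<phi> t)\<^sup>2 *\<^sub>R trig1 (int l - int k) (2 * pi * s t - 0)" for t
  proof -
    have "cnj (phase_orbital \<phi> s k t) * phase_orbital \<phi> s l t
      = complex_of_real ((\<phi> t)\<^sup>2) * (trig1 (int l) (2 * pi * s t) * trig1 (- int k) (2 * pi * s t))"
      by (simp add: phase_orbital_def trig1_cnj power2_eq_square mult_ac)
    then show ?thesis unfolding trig1_mult by (simp add: scaleR_conv_of_real)
  qed
  then have "(\<integral>t. cnj (phase_orbital \<phi> s k t) * phase_orbital \<phi> s l t \<partial>Lper)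
    = (1 / (2 * pi)) *\<^sub>R (\<integral>t. trig1 (int l - int k) t \<partial>Lper)"
    using integral_substitution[OF trig1_cont trig1_periodic, of "int l - int k" 0] by simp
  then show ?thesis by (simp add: integral_trig1 scaleR_conv_of_real)
qed

lemma orbital_mass_coordinate:
  assumes "orbital \<phi> \<phi>'"
  shows "\<exists>s. mass_coordinate (\<lambda>t. (\<phi> t)\<^sup>2) s"
  using orbitalD[OF assms] C1per_cont(1)[of \<phi> \<phi>' UNIV] C1per_periodic[of \<phi> \<phi>']
  by (intro mass_coordinate_exists continuous_on_power) auto

lemma disjoint_phase_orbitals:
  assumes "disjoint_orbitals n \<phi> \<phi>'" "i < n" "j < n" "i \<noteq> j" "t \<in> Iper"
  shows "phase_orbital (\<phi> i) (s i) k t * phase_orbital (\<phi> j) (s j) l t = 0"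
  using assms by (auto simp: phase_orbital_def disjoint_orbitals_def)

lemma slater_phase_orbitals_orthonormal:
  assumes n: "1 \<le> n" and \<phi>: "disjoint_orbitals n \<phi> \<phi>'"
    and s: "\<And>j. j < n \<Longrightarrow> mass_coordinate (\<lambda>t. (\<phi> j t)\<^sup>2) (s j)"
  shows "innerN n (slater n (\<lambda>i j. phase_orbital (\<phi> j) (s j) k)) (slater n (\<lambda>i j. phase_orbital (\<phi> j) (s j) l))
    = (if k = l then 1 else 0)"
proof -
  have "square_integrable Lper (phase_orbital (\<phi> j) (s j) k)" if "j < n" for k j
    using \<phi> that by (intro wderiv1_square_integrable(1)[OF phase_orbital_wderiv1[OF orbitalD(1) s]])
      (auto simp: disjoint_orbitals_def)
  then have "innerN n (slater n (\<lambda>i j. phase_orbital (\<phi> j) (s j) k)) (slater n (\<lambda>i j. phase_orbital (\<phi> j) (s j) l))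
    = (\<Prod>j<n. \<integral>t. cnj (phase_orbital (\<phi> j) (s j) k t) * phase_orbital (\<phi> j) (s j) l t \<partial>Lper)"
    by (intro slater_inner disjoint_phase_orbitals[OF \<phi>])
  also have "\<dots> = (\<Prod>j<n. if k = l then 1 else 0)" by (intro prod.cong refl phase_orbital_inner[OF s]) auto
  finally show ?thesis using n by (auto simp: power_0_left)
qed

lemma orbitals_mixed_state:
  assumes n: "1 \<le> n" and \<phi>: "disjoint_orbitals n \<phi> \<phi>'"
  obtains \<Psi> G where "mixed n (orbital_density n \<phi>) (\<lambda>k. if k = 0 then 1 else 0) \<Psi> G"
    "\<Psi> 0 = slater n (\<lambda>i j t. complex_of_real (\<phi> j t))"
    "G 0 = slater_grad n (\<lambda>j t. complex_of_real (\<phi> j t)) (\<lambda>j t. complex_of_real (\<phi>' j t))"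
proof -
  have orb: "orbital (\<phi> j) (\<phi>' j)" if "j < n" for j using \<phi> that by (simp add: disjoint_orbitals_def)
  define s where "s = (\<lambda>j. SOME s. mass_coordinate (\<lambda>t. (\<phi> j t)\<^sup>2) s)"
  have s: "mass_coordinate (\<lambda>t. (\<phi> j t)\<^sup>2) (s j)" if "j < n" for j
    unfolding s_def using orbital_mass_coordinate[OF orb[OF that]] by (rule someI_ex)
  define f where "f = (\<lambda>k j. phase_orbital (\<phi> j) (s j) k)"
  define f' where "f' = (\<lambda>k j. phase_orbital_deriv (\<phi> j) (\<phi>' j) (s j) k)"
  define \<Psi> where "\<Psi> = (\<lambda>k. slater n (\<lambda>i. f k))"
  define G where "G = (\<lambda>k. slater_grad n (f k) (f' k))"
  have w: "wderiv1 (f k j) (f' k j)" if "j < n" for k j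
    unfolding f_def f'_def by (rule phase_orbital_wderiv1[OF orbitalD(1)[OF orb[OF that]] s[OF that]])
  have disjoint: "f k i t * f l j t = 0" if "i < n" "j < n" "i \<noteq> j" "t \<in> Iper" for k l i j t
    unfolding f_def using disjoint_phase_orbitals[OF \<phi> that] .
  have f_0: "f 0 = (\<lambda>j t. complex_of_real (\<phi> j t))" by (simp add: f_def phase_orbital_0)
  have dens: "densN n (\<Psi> 0) t = ennreal (real n * orbital_density n \<phi> t)" if t: "t \<in> Iper" for t
    unfolding \<Psi>_def using n orbitalD(3)[OF orb]
    by (subst slater_density[OF n wderiv1_square_integrable(1)[OF w] disjoint _ t])
      (auto simp: f_0 orbital_density_def)
  have "mixed n (orbital_density n \<phi>) (\<lambda>k. if k = 0 then 1 else 0) \<Psi> G"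
    unfolding mixed_def
  proof (intro conjI allI)
    show "(\<lambda>k. if k = 0 then 1 else 0) sums (1::real)" using sums_single[of 0 "\<lambda>_. 1::real"] by simp
    show "antisymN n (\<Psi> k)" "wgradN n (\<Psi> k) (G k)" for k
      unfolding \<Psi>_def G_def by (intro slater_antisym, intro slater_wgradN w)
    show "innerN n (\<Psi> k) (\<Psi> l) = (if k = l then 1 else 0)" for k l
      unfolding \<Psi>_def f_def by (rule slater_phase_orbitals_orthonormal[OF n \<phi> s])
    show "AE t in Lper. (\<Sum>k. ennreal (if k = 0 then 1 else 0) * densN n (\<Psi> k) t)
        = ennreal (real n * orbital_density n \<phi> t)"
      by (intro AE_I2, subst suminf_finite[of "{0}"]) (auto simp: dens)
  qed simp
  then show ?thesis
    by (rule that) (simp_all add: \<Psi>_def G_def f_0 f'_def phase_orbital_deriv_0)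
qed

lemma Feps_orbital_density_le:
  assumes n: "1 \<le> n" and \<phi>: "disjoint_orbitals n \<phi> \<phi>'" and cost_le: "support_cost_le n w \<phi> S"
    and "0 \<le> S" "0 < \<epsilon>"
  shows "Feps n w \<epsilon> (orbital_density n \<phi>) \<le> ennreal (\<epsilon> * kinetic_bound n \<phi>' + S)"
proof -
  let ?f = "\<lambda>j t. complex_of_real (\<phi> j t)" and ?f' = "\<lambda>j t. complex_of_real (\<phi>' j t)"
  let ?lam = "\<lambda>k::nat. if k = 0 then 1 else 0::real"
  obtain \<Psi> G where mix: "mixed n (orbital_density n \<phi>) ?lam \<Psi> G"
    and \<Psi>_0: "\<Psi> 0 = slater n (\<lambda>i. ?f)" and G_0: "G 0 = slater_grad n ?f ?f'"
    by (rule orbitals_mixed_state[OF n \<phi>])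
  have "Feps n w \<epsilon> (orbital_density n \<phi>) \<le> (\<Sum>k. ennreal (?lam k) * energyN n w \<epsilon> (\<Psi> k) (G k))"
    unfolding Feps_def by (rule INF_lower2[of "(?lam, \<Psi>, G)"]) (use mix in auto)
  also have "\<dots> = energyN n w \<epsilon> (\<Psi> 0) (G 0)" by (subst suminf_finite[of "{0}"]) auto
  also have "\<dots> \<le> ennreal (\<epsilon> * kinetic_bound n \<phi>' + S)"
  proof (rule energyN_le)
    show "wgradN n (\<Psi> 0) (G 0)" "innerN n (\<Psi> 0) (\<Psi> 0) = 1" using mix by (auto simp: mixed_def)
    show "cN n w x * ennreal ((cmod (\<Psi> 0 x))\<^sup>2) \<le> ennreal S * ennreal ((cmod (\<Psi> 0 x))\<^sup>2)"
      if "x \<in> space (muN n)" for x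
      unfolding \<Psi>_0 using cost_le that by (intro slater_cost_le) (auto simp: support_cost_le_def)
    have "square_integrable Lper (?f k)" "square_integrable Lper (?f' k)" "(\<integral>t. (cmod (?f k t))\<^sup>2 \<partial>Lper) = 1"
      if "k < n" for k
    proof -
      have "orbital (\<phi> k) (\<phi>' k)" using \<phi> that by (simp add: disjoint_orbitals_def)
      note orb = orbitalD[OF this]
      show "square_integrable Lper (?f k)" "square_integrable Lper (?f' k)"
        by (intro square_integrable_cont continuous_intros C1per_cont[OF orb(1)])+
      show "(\<integral>t. (cmod (?f k t))\<^sup>2 \<partial>Lper) = 1" using orb(3) by simp
    qed
    then show "(\<Sum>j<n. \<integral>x. (cmod (G 0 j x))\<^sup>2 \<partial>muN n) \<le> kinetic_bound n \<phi>'"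
      using slater_kinetic_le[OF n, of ?f ?f'] by (simp add: G_0 kinetic_bound_def)
  qed (use assms in auto)
  finally show ?thesis .
qed

section \<open>Comparison of the quantum and the classical energy\<close>

abbreviation Bper :: "real measure" where "Bper \<equiv> restrict_space lborel Iper"

lemma nn_integral_Bper: "nn_integral Bper f = nn_integral Lper f"
  by (simp add: nn_integral_restrict_space nn_integral_completion)

lemma space_Bper [simp]: "space Bper = Iper" by (simp add: space_restrict_space)

lemma Lper_to_Bper: "(\<lambda>x. x) \<in> measurable Lper Bper"
proof (rule measurable_restrict_space3)
  show "(\<lambda>x. x) \<in> measurable lebesgue lborel" by (rule measurable_completion) simp
qed auto

lemma Bper_to_borel: "(\<lambda>x. x) \<in> measurable Bper borel"
  by (rule measurable_restrict_space1) simp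

lemma Bper_cont_measurable:
  fixes f :: "real \<Rightarrow> 'a :: topological_space"
  assumes "continuous_on Iper f"
  shows "f \<in> borel_measurable Bper"
proof -
  have "f \<in> borel_measurable (restrict_space borel Iper)"
    by (rule borel_measurable_continuous_on_restrict[OF assms])
  moreover have "sets (restrict_space borel Iper) = sets Bper" by (simp add: sets_restrict_space)
  ultimately show ?thesis using measurable_cong_sets by blast
qed

lemma muN_to_Bper: "(\<lambda>x. x) \<in> measurable (muN n) (Pi\<^sub>M {..<n} (\<lambda>_. Bper))"
proof (rule measurable_PiM_single'[where f="\<lambda>i x. x i"])
  show "(\<lambda>x. x i) \<in> measurable (muN n) Bper" if "i \<in> {..<n}" for i
    unfolding muN_def by (rule measurable_compose[OF measurable_component_singleton[OF that] Lper_to_Bper])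
  show "(\<lambda>x i. x i) \<in> space (muN n) \<rightarrow> (\<Pi>\<^sub>E i\<in>{..<n}. space Bper)" by (simp add: space_muN)
qed

lemma cN_measurable:
  assumes "assumptionA w"
  shows "cN n w \<in> borel_measurable (Pi\<^sub>M {..<n} (\<lambda>_. Bper))"
proof -
  have w: "w \<in> borel_measurable (restrict_space borel (Iper \<times> Iper))"
    using assms by (intro borel_measurable_continuous_on_restrict) (simp add: assumptionA_def)
  have "(\<lambda>x. w (x i, x j)) \<in> borel_measurable (Pi\<^sub>M {..<n} (\<lambda>_. Bper))" if ij: "i < n" "j < n" for i j
  proof (rule measurable_compose[OF _ w], rule measurable_restrict_space2)
    show "(\<lambda>x. (x i, x j)) \<in> space (Pi\<^sub>M {..<n} (\<lambda>_. Bper)) \<rightarrow> Iper \<times> Iper"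
      using ij by (auto simp: space_PiM)
    have "(\<lambda>x. x k) \<in> borel_measurable (Pi\<^sub>M {..<n} (\<lambda>_. Bper))" if "k < n" for k
      using that
      by (intro measurable_compose[OF measurable_component_singleton[of k "{..<n}" "\<lambda>_. Bper"] Bper_to_borel]) auto
    then show "(\<lambda>x. (x i, x j)) \<in> borel_measurable (Pi\<^sub>M {..<n} (\<lambda>_. Bper))"
      using ij by (intro borel_measurable_Pair) auto
  qed
  then show ?thesis unfolding cN_def by (intro borel_measurable_sum) auto
qed

lemma measurable_permute_PiM:
  assumes \<sigma>: "\<sigma> permutes I"
  shows "(\<lambda>x. x \<circ> \<sigma>) \<in> measurable (Pi\<^sub>M I (\<lambda>_. M)) (Pi\<^sub>M I (\<lambda>_. M))"
  unfolding o_def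
proof (rule measurable_PiM_single')
  show "(\<lambda>x. x (\<sigma> i)) \<in> measurable (Pi\<^sub>M I (\<lambda>_. M)) M" if "i \<in> I" for i
    using permutes_in_image[OF \<sigma>] that by (intro measurable_component_singleton) simp
  show "(\<lambda>x i. x (\<sigma> i)) \<in> space (Pi\<^sub>M I (\<lambda>_. M)) \<rightarrow> (\<Pi>\<^sub>E i\<in>I. space M)"
    using permutes_in_image[OF \<sigma>] permutes_not_in[OF \<sigma>]
    by (auto simp: space_PiM PiE_def Pi_def extensional_def)
qed

lemma permute_in_PiE_iff:
  assumes \<sigma>: "\<sigma> permutes I"
  shows "x \<circ> \<sigma> \<in> Pi\<^sub>E I A \<longleftrightarrow> x \<in> Pi\<^sub>E I (A \<circ> inv \<sigma>)"
proof -
  have "(\<forall>i\<in>I. x (\<sigma> i) \<in> A i) \<longleftrightarrow> (\<forall>i\<in>I. x i \<in> A (inv \<sigma> i))"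
    using permutes_in_image[OF \<sigma>] permutes_in_image[OF permutes_inv[OF \<sigma>]] permutes_inverses[OF \<sigma>] by metis
  moreover have "x \<circ> \<sigma> \<in> extensional I \<longleftrightarrow> x \<in> extensional I"
    using permutes_not_in[OF \<sigma>] by (auto simp: extensional_def)
  ultimately show ?thesis by (auto simp: PiE_def Pi_def)
qed

lemma distr_permute_PiM:
  assumes "sigma_finite_measure M" "finite I" and \<sigma>: "\<sigma> permutes I"
  shows "distr (Pi\<^sub>M I (\<lambda>_. M)) (Pi\<^sub>M I (\<lambda>_. M)) (\<lambda>x. x \<circ> \<sigma>) = Pi\<^sub>M I (\<lambda>_. M)" (is "distr ?P ?P _ = _")
proof -
  interpret product_sigma_finite "\<lambda>_. M" using assms(1) by (simp add: product_sigma_finite_def)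
  show ?thesis
  proof (rule PiM_eqI)
    fix A assume A: "\<And>i. i \<in> I \<Longrightarrow> A i \<in> sets M"
    note inv_in = permutes_in_image[OF permutes_inv[OF \<sigma>]]
    have A_inv: "(A \<circ> inv \<sigma>) i \<in> sets M" if "i \<in> I" for i using A inv_in that by simp
    have "Pi\<^sub>E I (A \<circ> inv \<sigma>) \<subseteq> space ?P"
      unfolding space_PiM using sets.sets_into_space[OF A_inv] by (intro PiE_mono)
    then have preimage: "(\<lambda>x. x \<circ> \<sigma>) -` Pi\<^sub>E I A \<inter> space ?P = Pi\<^sub>E I (A \<circ> inv \<sigma>)"
      unfolding vimage_def permute_in_PiE_iff[OF \<sigma>] by auto
    have "emeasure (distr ?P ?P (\<lambda>x. x \<circ> \<sigma>)) (Pi\<^sub>E I A) = emeasure ?P (Pi\<^sub>E I (A \<circ> inv \<sigma>))"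
      unfolding preimage[symmetric]
      using measurable_permute_PiM[OF \<sigma>] A \<open>finite I\<close> by (intro emeasure_distr sets_PiM_I_finite) auto
    also have "\<dots> = (\<Prod>i\<in>I. emeasure M ((A \<circ> inv \<sigma>) i))"
      using A_inv by (intro emeasure_PiM \<open>finite I\<close>) auto
    also have "\<dots> = (\<Prod>i\<in>I. emeasure M (A i))"
      using prod.permute[OF permutes_inv[OF \<sigma>], of "\<lambda>i. emeasure M (A i)"] by (simp add: o_def)
    finally show "emeasure (distr ?P ?P (\<lambda>x. x \<circ> \<sigma>)) (Pi\<^sub>E I A) = (\<Prod>i\<in>I. emeasure M (A i))" .
  qed (use \<open>finite I\<close> in auto)
qed

lemma nn_integral_muN_permute:
  assumes "\<sigma> permutes {..<n}" and "f \<in> borel_measurable (muN n)"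
  shows "(\<integral>\<^sup>+x. f (x \<circ> \<sigma>) \<partial>muN n) = (\<integral>\<^sup>+x. f x \<partial>muN n)"
proof -
  have "distr (muN n) (muN n) (\<lambda>x. x \<circ> \<sigma>) = muN n"
    unfolding muN_def
    by (intro distr_permute_PiM finite_measure.sigma_finite_measure finite_measure_Lper assms(1)) simp
  moreover have "(\<integral>\<^sup>+x. f x \<partial>distr (muN n) (muN n) (\<lambda>x. x \<circ> \<sigma>)) = (\<integral>\<^sup>+x. f (x \<circ> \<sigma>) \<partial>muN n)"
    using assms by (intro nn_integral_distr) (auto simp: muN_def measurable_permute_PiM)
  ultimately show ?thesis by simp
qed

lemma measurable_muN_slot:
  assumes "g \<in> measurable Lper N" "j < n"
  shows "(\<lambda>x. g (x j)) \<in> measurable (muN n) N"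
  unfolding muN_def using assms by (intro measurable_compose[OF measurable_component_singleton]) auto

lemma antisymN_nn_integral_slot:
  assumes anti: "antisymN n \<Psi>" and [measurable]: "\<Psi> \<in> borel_measurable (muN n)"
    and g: "g \<in> borel_measurable Lper" and "i < n" "j < n"
  shows "(\<integral>\<^sup>+x. g (x i) * ennreal ((cmod (\<Psi> x))\<^sup>2) \<partial>muN n) = (\<integral>\<^sup>+x. g (x j) * ennreal ((cmod (\<Psi> x))\<^sup>2) \<partial>muN n)"
proof -
  let ?\<tau> = "Transposition.transpose i j"
  have \<tau>: "?\<tau> permutes {..<n}" using assms by (intro permutes_swap_id) auto
  have [measurable]: "(\<lambda>x. g (x i)) \<in> borel_measurable (muN n)" by (rule measurable_muN_slot[OF g \<open>i < n\<close>])
  have "(\<integral>\<^sup>+x. g (x i) * ennreal ((cmod (\<Psi> x))\<^sup>2) \<partial>muN n)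
    = (\<integral>\<^sup>+x. g ((x \<circ> ?\<tau>) i) * ennreal ((cmod (\<Psi> (x \<circ> ?\<tau>)))\<^sup>2) \<partial>muN n)"
    by (rule nn_integral_muN_permute[OF \<tau>, symmetric]) measurable
  also have "\<dots> = (\<integral>\<^sup>+x. g (x j) * ennreal ((cmod (\<Psi> x))\<^sup>2) \<partial>muN n)"
  proof (rule nn_integral_cong_AE)
    have "AE x in muN n. \<Psi> (x \<circ> ?\<tau>) = of_int (sign ?\<tau>) * \<Psi> x" using anti \<tau> unfolding antisymN_def by blast
    then show "AE x in muN n. g ((x \<circ> ?\<tau>) i) * ennreal ((cmod (\<Psi> (x \<circ> ?\<tau>)))\<^sup>2) = g (x j) * ennreal ((cmod (\<Psi> x))\<^sup>2)"
      by eventually_elim (simp add: norm_mult sign_def)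
  qed
  finally show ?thesis .
qed

lemma densN_nn_integral:
  assumes n: "1 \<le> n" and \<Psi>: "\<Psi> \<in> borel_measurable (muN n)" and g: "g \<in> borel_measurable Lper"
  shows "densN n \<Psi> \<in> borel_measurable Lper"
    "ennreal (real n) * (\<integral>\<^sup>+x. g (x 0) * ennreal ((cmod (\<Psi> x))\<^sup>2) \<partial>muN n) = (\<integral>\<^sup>+t. densN n \<Psi> t * g t \<partial>Lper)"
proof -
  let ?C = "Pi\<^sub>M {1..<n} (\<lambda>_. Lper)"
  have split: "{..<n} = insert 0 {1..<n}" using n by auto
  interpret C: sigma_finite_measure ?C by (rule Lprod.sigma_finite) simp
  have "(\<lambda>(t, y). y(0 := t)) \<in> measurable (Lper \<Otimes>\<^sub>M ?C) (muN n)"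
    unfolding muN_def split case_prod_beta' by (rule measurable_fun_upd[where J="{1..<n}"]) auto
  from measurable_compose[OF this \<Psi>]
  have \<Psi>_pair [measurable]: "(\<lambda>(t, y). \<Psi> (y(0 := t))) \<in> borel_measurable (Lper \<Otimes>\<^sub>M ?C)"
    by (simp add: case_prod_beta')
  have slice_meas [measurable]: "(\<lambda>t. \<integral>\<^sup>+y. ennreal ((cmod (\<Psi> (y(0 := t))))\<^sup>2) \<partial>?C) \<in> borel_measurable Lper"
    by (rule C.borel_measurable_nn_integral) measurable
  then show "densN n \<Psi> \<in> borel_measurable Lper" unfolding densN_def by measurable
  note [measurable] = \<Psi>
  have [measurable]: "(\<lambda>x. g (x 0)) \<in> borel_measurable (muN n)"
    using n by (intro measurable_muN_slot[OF g]) simp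
  have "(\<lambda>x. g (x 0) * ennreal ((cmod (\<Psi> x))\<^sup>2)) \<in> borel_measurable (muN n)" by measurable
  then have "(\<integral>\<^sup>+x. g (x 0) * ennreal ((cmod (\<Psi> x))\<^sup>2) \<partial>muN n)
    = (\<integral>\<^sup>+t. (\<integral>\<^sup>+y. g ((y(0 := t)) 0) * ennreal ((cmod (\<Psi> (y(0 := t))))\<^sup>2) \<partial>?C) \<partial>Lper)"
    unfolding muN_def split by (intro Lprod.product_nn_integral_insert_rev) auto
  also have "\<dots> = (\<integral>\<^sup>+t. g t * (\<integral>\<^sup>+y. ennreal ((cmod (\<Psi> (y(0 := t))))\<^sup>2) \<partial>?C) \<partial>Lper)"
  proof (rule nn_integral_cong)
    fix t assume t: "t \<in> space Lper"
    have [measurable]: "(\<lambda>y. \<Psi> (y(0 := t))) \<in> borel_measurable ?C"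
      using measurable_compose[OF measurable_Pair1'[OF t] \<Psi>_pair] by simp
    show "(\<integral>\<^sup>+y. g ((y(0 := t)) 0) * ennreal ((cmod (\<Psi> (y(0 := t))))\<^sup>2) \<partial>?C)
      = g t * (\<integral>\<^sup>+y. ennreal ((cmod (\<Psi> (y(0 := t))))\<^sup>2) \<partial>?C)"
      unfolding fun_upd_same by (rule nn_integral_cmult) measurable
  qed
  finally have "ennreal (real n) * (\<integral>\<^sup>+x. g (x 0) * ennreal ((cmod (\<Psi> x))\<^sup>2) \<partial>muN n)
    = ennreal (real n) * (\<integral>\<^sup>+t. g t * (\<integral>\<^sup>+y. ennreal ((cmod (\<Psi> (y(0 := t))))\<^sup>2) \<partial>?C) \<partial>Lper)" by (simp only:)
  also have "\<dots> = (\<integral>\<^sup>+t. ennreal (real n) * (g t * (\<integral>\<^sup>+y. ennreal ((cmod (\<Psi> (y(0 := t))))\<^sup>2) \<partial>?C)) \<partial>Lper)"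
    by (intro nn_integral_cmult[symmetric] borel_measurable_times_ennreal g slice_meas)
  finally show "ennreal (real n) * (\<integral>\<^sup>+x. g (x 0) * ennreal ((cmod (\<Psi> x))\<^sup>2) \<partial>muN n)
      = (\<integral>\<^sup>+t. densN n \<Psi> t * g t \<partial>Lper)"
    by (simp only: densN_def mult_ac)
qed

text \<open>The squared modulus of a mixed state with one-particle density n * rho is a coupling of rho,
  all marginals agreeing by antisymmetry.\<close>

definition mixed_coupling :: "nat \<Rightarrow> (nat \<Rightarrow> real) \<Rightarrow> (nat \<Rightarrow> (nat \<Rightarrow> real) \<Rightarrow> complex) \<Rightarrow> (nat \<Rightarrow> real) measure" where
  "mixed_coupling n lam \<Psi> =
     distr (density (muN n) (\<lambda>x. \<Sum>k. ennreal (lam k) * ennreal ((cmod (\<Psi> k x))\<^sup>2)))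
       (Pi\<^sub>M {..<n} (\<lambda>_. Bper)) (\<lambda>x. x)"

lemma mixedD:
  assumes "mixed n \<rho> lam \<Psi> G"
  shows "(\<Sum>k. ennreal (lam k)) = 1" "antisymN n (\<Psi> k)" "\<Psi> k \<in> borel_measurable (muN n)"
    "(\<integral>\<^sup>+x. ennreal ((cmod (\<Psi> k x))\<^sup>2) \<partial>muN n) = 1"
    "AE t in Lper. (\<Sum>k. ennreal (lam k) * densN n (\<Psi> k) t) = ennreal (real n * \<rho> t)"
proof -
  have "lam sums 1" "\<And>k. 0 \<le> lam k" using assms by (simp_all add: mixed_def)
  then show "(\<Sum>k. ennreal (lam k)) = 1" by (simp add: sums_iff suminf_ennreal2)
  have "innerN n (\<Psi> k) (\<Psi> k) = 1" using assms by (simp add: mixed_def)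
  then have "(\<integral>x. (cmod (\<Psi> k x))\<^sup>2 \<partial>muN n) = 1" unfolding innerN_self by (simp only: of_real_eq_1_iff)
  then show "(\<integral>\<^sup>+x. ennreal ((cmod (\<Psi> k x))\<^sup>2) \<partial>muN n) = 1"
    using assms by (subst nn_integral_eq_integral) (simp_all add: mixed_def wgradN_def)
qed (use assms in \<open>simp_all add: mixed_def wgradN_def\<close>)

lemma nn_integral_mixed_coupling:
  assumes [measurable]: "\<And>k. \<Psi> k \<in> borel_measurable (muN n)"
    and f: "f \<in> borel_measurable (Pi\<^sub>M {..<n} (\<lambda>_. Bper))"
  shows "(\<integral>\<^sup>+x. f x \<partial>mixed_coupling n lam \<Psi>)
      = (\<Sum>k. ennreal (lam k) * (\<integral>\<^sup>+x. f x * ennreal ((cmod (\<Psi> k x))\<^sup>2) \<partial>muN n))"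
proof -
  let ?D = "\<lambda>x. \<Sum>k. ennreal (lam k) * ennreal ((cmod (\<Psi> k x))\<^sup>2)"
  have [measurable]: "f \<in> borel_measurable (muN n)" using measurable_compose[OF muN_to_Bper f] by simp
  have "(\<integral>\<^sup>+x. f x \<partial>mixed_coupling n lam \<Psi>) = (\<integral>\<^sup>+x. f x \<partial>density (muN n) ?D)"
    unfolding mixed_coupling_def using muN_to_Bper f by (intro nn_integral_distr) simp_all
  also have "\<dots> = (\<integral>\<^sup>+x. ?D x * f x \<partial>muN n)" by (intro nn_integral_density) measurable
  also have "\<dots> = (\<integral>\<^sup>+x. (\<Sum>k. ennreal (lam k) * (f x * ennreal ((cmod (\<Psi> k x))\<^sup>2))) \<partial>muN n)"
    by (intro nn_integral_cong) (simp add: ennreal_suminf_multc[symmetric] mult_ac)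
  also have "\<dots> = (\<Sum>k. \<integral>\<^sup>+x. ennreal (lam k) * (f x * ennreal ((cmod (\<Psi> k x))\<^sup>2)) \<partial>muN n)"
    by (intro nn_integral_suminf) measurable
  also have "\<dots> = (\<Sum>k. ennreal (lam k) * (\<integral>\<^sup>+x. f x * ennreal ((cmod (\<Psi> k x))\<^sup>2) \<partial>muN n))"
    by (intro suminf_cong nn_integral_cmult) measurable
  finally show ?thesis .
qed

lemma nn_integral_mixed_coupling_slot:
  assumes n: "1 \<le> n" and mix: "mixed n \<rho> lam \<Psi> G" and g: "g \<in> borel_measurable Bper"
    and \<rho>: "\<rho> \<in> borel_measurable Bper"
    and j: "j < n"
  shows "(\<integral>\<^sup>+x. g (x j) \<partial>mixed_coupling n lam \<Psi>) = (\<integral>\<^sup>+t. ennreal (\<rho> t) * g t \<partial>Lper)"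
proof -
  have g_Lper [measurable]: "g \<in> borel_measurable Lper" and [measurable]: "\<rho> \<in> borel_measurable Lper"
    using measurable_compose[OF Lper_to_Bper g] measurable_compose[OF Lper_to_Bper \<rho>] by simp_all
  note densN_facts = densN_nn_integral[OF n mixedD(3)[OF mix] g_Lper]
  note [measurable] = densN_facts(1)
  have "(\<lambda>x. g (x j)) \<in> borel_measurable (Pi\<^sub>M {..<n} (\<lambda>_. Bper))"
    using j by (intro measurable_compose[OF measurable_component_singleton[of j "{..<n}" "\<lambda>_. Bper"] g]) simp
  then have "(\<integral>\<^sup>+x. g (x j) \<partial>mixed_coupling n lam \<Psi>)
    = (\<Sum>k. ennreal (lam k) * (\<integral>\<^sup>+x. g (x j) * ennreal ((cmod (\<Psi> k x))\<^sup>2) \<partial>muN n))"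
    by (rule nn_integral_mixed_coupling[OF mixedD(3)[OF mix]])
  also have "\<dots> = (\<Sum>k. ennreal (lam k) * (\<integral>\<^sup>+x. g (x 0) * ennreal ((cmod (\<Psi> k x))\<^sup>2) \<partial>muN n))"
    using n antisymN_nn_integral_slot[OF mixedD(2,3)[OF mix] g_Lper j, of 0] by simp
  finally have "ennreal (real n) * (\<integral>\<^sup>+x. g (x j) \<partial>mixed_coupling n lam \<Psi>)
    = (\<Sum>k. ennreal (lam k) * (ennreal (real n) * (\<integral>\<^sup>+x. g (x 0) * ennreal ((cmod (\<Psi> k x))\<^sup>2) \<partial>muN n)))"
    by (simp only: ennreal_suminf_cmult[symmetric] mult.left_commute)
  also have "\<dots> = (\<Sum>k. \<integral>\<^sup>+t. ennreal (lam k) * (densN n (\<Psi> k) t * g t) \<partial>Lper)"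
    unfolding densN_facts(2) by (intro suminf_cong nn_integral_cmult[symmetric]) measurable
  also have "\<dots> = (\<integral>\<^sup>+t. (\<Sum>k. ennreal (lam k) * (densN n (\<Psi> k) t * g t)) \<partial>Lper)"
    by (rule nn_integral_suminf[symmetric]) measurable
  also have "\<dots> = (\<integral>\<^sup>+t. ennreal (real n) * (ennreal (\<rho> t) * g t) \<partial>Lper)"
  proof (rule nn_integral_cong_AE)
    show "AE t in Lper. (\<Sum>k. ennreal (lam k) * (densN n (\<Psi> k) t * g t)) = ennreal (real n) * (ennreal (\<rho> t) * g t)"
      using mixedD(5)[OF mix]
      by eventually_elim (simp add: mult.assoc[symmetric] ennreal_suminf_multc ennreal_mult')
  qed
  also have "\<dots> = ennreal (real n) * (\<integral>\<^sup>+t. ennreal (\<rho> t) * g t \<partial>Lper)" by (rule nn_integral_cmult) measurable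
  finally show ?thesis using n by (simp add: ennreal_mult_cancel_left)
qed

lemma mixed_coupling_coupling:
  assumes n: "1 \<le> n" and mix: "mixed n \<rho> lam \<Psi> G" and cont: "continuous_on Iper \<rho>"
  shows "coupling n \<rho> (mixed_coupling n lam \<Psi>)" (is "coupling n \<rho> ?\<gamma>")
  unfolding coupling_def
proof (intro conjI allI impI)
  show "sets ?\<gamma> = sets (Pi\<^sub>M {..<n} (\<lambda>_. Bper))" by (simp add: mixed_coupling_def)
  show "prob_space ?\<gamma>"
  proof
    have "emeasure ?\<gamma> (space ?\<gamma>) = (\<integral>\<^sup>+x. 1 \<partial>?\<gamma>)" by simp
    also have "\<dots> = 1"
      by (subst nn_integral_mixed_coupling[OF mixedD(3)[OF mix]]) (auto simp: mixedD(1,4)[OF mix])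
    finally show "emeasure ?\<gamma> (space ?\<gamma>) = 1" .
  qed
  fix j assume j: "j < n"
  have \<rho>_meas: "\<rho> \<in> borel_measurable Bper" by (rule Bper_cont_measurable[OF cont])
  have slot_meas: "(\<lambda>x. x j) \<in> measurable ?\<gamma> Bper"
    using j by (simp add: mixed_coupling_def measurable_component_singleton)
  show "distr ?\<gamma> Bper (\<lambda>x. x j) = density Bper (\<lambda>t. ennreal (\<rho> t))"
  proof (rule measure_eqI)
    fix E assume "E \<in> sets (distr ?\<gamma> Bper (\<lambda>x. x j))"
    then have E: "E \<in> sets Bper" by simp
    have "emeasure (distr ?\<gamma> Bper (\<lambda>x. x j)) E = (\<integral>\<^sup>+t. indicator E t \<partial>distr ?\<gamma> Bper (\<lambda>x. x j))"
      using E by simp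
    also have "\<dots> = (\<integral>\<^sup>+x. indicator E (x j) \<partial>?\<gamma>)" using slot_meas E by (intro nn_integral_distr) auto
    also have "\<dots> = (\<integral>\<^sup>+t. ennreal (\<rho> t) * indicator E t \<partial>Bper)"
      unfolding nn_integral_Bper
      by (rule nn_integral_mixed_coupling_slot[OF n mix _ \<rho>_meas j]) (use E in simp)
    also have "\<dots> = emeasure (density Bper (\<lambda>t. ennreal (\<rho> t))) E"
      using E \<rho>_meas by (intro emeasure_density[symmetric]) auto
    finally show "emeasure (distr ?\<gamma> Bper (\<lambda>x. x j)) E = emeasure (density Bper (\<lambda>t. ennreal (\<rho> t))) E" .
  qed simp
qed

lemma FOT_le_Feps:
  assumes n: "1 \<le> n" and A: "assumptionA w" and cont: "continuous_on Iper \<rho>"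
  shows "FOT n w \<rho> \<le> Feps n w \<epsilon> \<rho>"
  unfolding Feps_def
proof (rule INF_greatest, clarify)
  fix lam \<Psi> G assume mix: "mixed n \<rho> lam \<Psi> G"
  have "FOT n w \<rho> \<le> (\<integral>\<^sup>+x. cN n w x \<partial>mixed_coupling n lam \<Psi>)"
    unfolding FOT_def using mixed_coupling_coupling[OF n mix cont] by (intro INF_lower) simp
  also have "\<dots> = (\<Sum>k. ennreal (lam k) * (\<integral>\<^sup>+x. cN n w x * ennreal ((cmod (\<Psi> k x))\<^sup>2) \<partial>muN n))"
    by (rule nn_integral_mixed_coupling[OF mixedD(3)[OF mix] cN_measurable[OF A]])
  also have "\<dots> \<le> (\<Sum>k. ennreal (lam k) * energyN n w \<epsilon> (\<Psi> k) (G k))"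
    unfolding energyN_def by (intro suminf_le mult_left_mono nn_integral_mono) auto
  finally show "FOT n w \<rho> \<le> (\<Sum>k. ennreal (lam k) * energyN n w \<epsilon> (\<Psi> k) (G k))" .
qed

section \<open>The distance on the circle\<close>

lemma distT_bdd: "bdd_below {\<bar>t - 2 * pi * real_of_int k\<bar> | k. True}"
  by (rule bdd_belowI[of _ 0]) auto

lemma distT_le: "distT t \<le> \<bar>t - 2 * pi * real_of_int k\<bar>"
  unfolding distT_def by (rule cInf_lower[OF _ distT_bdd]) auto

lemma distT_le_abs: "distT t \<le> \<bar>t\<bar>" using distT_le[of t 0] by simp

lemma distT_attained:
  obtains k :: int where "distT t = \<bar>t - 2 * pi * of_int k\<bar>" "\<bar>t - 2 * pi * of_int k\<bar> \<le> pi"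
proof -
  define k where "k = round (t / (2 * pi))"
  define s where "s = t - 2 * pi * of_int k"
  have "\<bar>of_int k - t / (2 * pi)\<bar> \<le> 1/2" unfolding k_def by (rule of_int_round_abs_le)
  then have "\<bar>of_int k - t / (2 * pi)\<bar> * (2 * pi) \<le> (1/2) * (2 * pi)" by (intro mult_right_mono) auto
  moreover have "\<bar>of_int k - t / (2 * pi)\<bar> * (2 * pi) = \<bar>s\<bar>"
    unfolding s_def
    using abs_mult_pos[of "2 * pi" "of_int k - t / (2 * pi)"] by (simp add: field_simps abs_minus_commute)
  ultimately have s_le: "\<bar>s\<bar> \<le> pi" by simp
  have "distT t = \<bar>s\<bar>" unfolding distT_def
  proof (rule cInf_eq_minimum)
    show "\<bar>s\<bar> \<in> {\<bar>t - 2 * pi * real_of_int k\<bar> | k. True}" by (auto simp: s_def)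
    fix x assume "x \<in> {\<bar>t - 2 * pi * real_of_int k\<bar> | k. True}"
    then obtain j :: int where x: "x = \<bar>t - 2 * pi * real_of_int j\<bar>" by auto
    show "\<bar>s\<bar> \<le> x"
    proof (cases "j = k")
      case False
      then have "1 \<le> \<bar>real_of_int k - real_of_int j\<bar>" by linarith
      then have "2 * pi \<le> \<bar>2 * pi * (real_of_int k - real_of_int j)\<bar>" by (simp add: abs_mult)
      moreover have "t - 2 * pi * real_of_int j = s + 2 * pi * (real_of_int k - real_of_int j)"
        by (simp add: s_def algebra_simps)
      ultimately show ?thesis using s_le x by linarith
    qed (simp add: x s_def)
  qed
  then show ?thesis using s_le unfolding s_def by (rule that)
qed

lemma distT_arccos: "distT t = arccos (cos t)"
proof -
  obtain k :: int where k: "distT t = \<bar>t - 2 * pi * of_int k\<bar>" "\<bar>t - 2 * pi * of_int k\<bar> \<le> pi"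
    by (rule distT_attained)
  have "cos \<bar>t - 2 * pi * of_int k\<bar> = cos t"
    using cos_diff[of t "2 * pi * of_int k"] cos_int_2pin[of k] sin_int_2pin[of k] by (simp add: mult_ac)
  then show ?thesis using k arccos_cos[of "\<bar>t - 2 * pi * of_int k\<bar>"] by simp
qed

lemma distT_0 [simp]: "distT 0 = 0" by (simp add: distT_arccos)

lemma distT_nonneg: "0 \<le> distT t"
  unfolding distT_arccos by (auto intro: arccos_lbound)

lemma distT_minus: "distT (- t) = distT t" by (simp add: distT_arccos)

lemma distT_commute: "distT (x - y) = distT (y - x)"
  using distT_minus[of "x - y"] by simp

lemma distT_periodic: "distT (t + 2 * pi * of_int k) = distT t"
  by (rule periodic_int) (simp add: distT_arccos)

lemma distT_triangle: "distT (x - z) \<le> distT (x - y) + distT (y - z)"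
proof -
  obtain k l :: int
    where "distT (x - y) = \<bar>x - y - 2 * pi * of_int k\<bar>" "distT (y - z) = \<bar>y - z - 2 * pi * of_int l\<bar>"
    using distT_attained by metis
  moreover have "distT (x - z) \<le> \<bar>x - z - 2 * pi * of_int (k + l)\<bar>" by (rule distT_le)
  moreover have "x - z - 2 * pi * of_int (k + l) = (x - y - 2 * pi * of_int k) + (y - z - 2 * pi * of_int l)"
    by (simp add: algebra_simps)
  ultimately show ?thesis by linarith
qed

lemma distT_cont:
  fixes f :: "'a::t2_space \<Rightarrow> real"
  shows "continuous_on A f \<Longrightarrow> continuous_on A (\<lambda>x. distT (f x))"
  unfolding distT_arccos by (intro continuous_intros) (auto simp: abs_le_iff)

lemma distT_less_iff_cos:
  assumes "0 \<le> b" "b \<le> pi"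
  shows "distT t < b \<longleftrightarrow> cos b < cos t"
  using assms arccos_less_mono[of "cos t" "cos b"] by (simp add: distT_arccos arccos_cos)

definition node :: "nat \<Rightarrow> nat \<Rightarrow> real" where
  "node N i = 2 * pi * real i / real N"

lemma distT_nodes:
  assumes "j < N" "k < N" "j \<noteq> k"
  shows "2 * pi / real N \<le> distT (node N j - node N k)"
proof -
  have ordered: "2 * pi / real N \<le> distT (node N j - node N k)" if "j < N" "k < j" for j k
  proof -
    define h s where "h = 2 * pi / real N" and "s = real (j - k) * h"
    have difference: "node N j - node N k = s"
      using that by (simp add: node_def h_def s_def of_nat_diff field_simps)
    have "1 * h \<le> s" "s \<le> (real N - 1) * h"
      unfolding s_def using that by (intro mult_right_mono; simp add: h_def)+
    moreover have "real N * h = 2 * pi" using that by (simp add: h_def)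
    ultimately have s_bounds: "h \<le> s" "s \<le> 2 * pi - h" by (simp_all add: algebra_simps)
    obtain i :: int where i: "distT s = \<bar>s - 2 * pi * of_int i\<bar>" by (rule distT_attained)
    have "h \<le> distT s"
    proof (cases "i \<le> 0")
      case True
      then have "2 * pi * real_of_int i \<le> 0" by (simp add: mult_le_0_iff)
      then show ?thesis unfolding i using s_bounds by linarith
    next
      case False
      then have "2 * pi * 1 \<le> 2 * pi * real_of_int i" by (intro mult_left_mono) auto
      then show ?thesis unfolding i using s_bounds by linarith
    qed
    then show ?thesis by (simp only: difference h_def)
  qed
  show ?thesis using ordered[of j k] ordered[of k j] assms distT_commute[of "node N j" "node N k"] by linarith
qed

lemma distT_near_distinct_nodes:
  assumes "j < N" "k < N" "j \<noteq> k"
    and x: "distT (x - (a + node N j)) < 2 * pi / (3 * real N)"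
    and y: "distT (y - (a + node N k)) < 2 * pi / (3 * real N)"
  shows "2 * pi / (3 * real N) \<le> distT (x - y)"
proof -
  let ?p = "a + node N j" and ?q = "a + node N k"
  have "2 * pi / real N \<le> distT (?p - ?q)" using distT_nodes[OF assms(1-3)] by simp
  moreover have "distT (?p - ?q) \<le> distT (x - ?p) + distT (x - y) + distT (y - ?q)"
    using distT_triangle[of ?p ?q x] distT_triangle[of x ?q y] distT_commute[of ?p x] by linarith
  moreover have "2 * pi / real N = 3 * (2 * pi / (3 * real N))" by simp
  ultimately show ?thesis using x y by linarith
qed

section \<open>The cost of separated configurations\<close>

lemma compact_preimage:
  fixes f :: "'a::t2_space \<Rightarrow> 'b::topological_space"
  assumes "compact S" "continuous_on S f" "closed T"
  shows "compact {x \<in> S. f x \<in> T}"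
proof -
  have "closed (S \<inter> f -` T)"
    by (rule continuous_closed_preimage[OF assms(2) compact_imp_closed[OF assms(1)] assms(3)])
  moreover have "S \<inter> (S \<inter> f -` T) = {x \<in> S. f x \<in> T}" by blast
  ultimately show ?thesis using compact_Int_closed[OF assms(1)] by metis
qed

locale cost =
  fixes n :: nat and w :: "real \<times> real \<Rightarrow> ennreal"
  assumes n_pos: "1 \<le> n" and A: "assumptionA w"
begin

lemma w_sym: "x \<in> Iper \<Longrightarrow> y \<in> Iper \<Longrightarrow> w (x, y) = w (y, x)"
  using A by (simp add: assumptionA_def)

lemma w_cont: "continuous_on (Iper \<times> Iper) w"
  using A by (simp add: assumptionA_def)

lemma w_eq_top_iff:
  assumes "x \<in> Iper" "y \<in> Iper"
  shows "w (x, y) = top \<longleftrightarrow> distT (x - y) = 0"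
proof -
  have "{p \<in> Iper \<times> Iper. w p = \<infinity>} = {(x, y) \<in> Iper \<times> Iper. distT (x - y) = 0}"
    using A by (simp add: assumptionA_def)
  then show ?thesis using assms by (auto simp: infinity_ennreal_def set_eq_iff)
qed

definition separated_pairs :: "real \<Rightarrow> (real \<times> real) set" where
  "separated_pairs a = {p \<in> Iper \<times> Iper. a \<le> distT (fst p - snd p)}"

lemma compact_separated_pairs: "compact (separated_pairs a)"
proof -
  have "compact {p \<in> Iper \<times> Iper. distT (fst p - snd p) \<in> {a..}}"
    by (intro compact_preimage compact_Times compact_Iper distT_cont continuous_intros closed_atLeast)
  then show ?thesis by (simp add: separated_pairs_def)
qed

lemma w_finite: "0 < a \<Longrightarrow> (x, y) \<in> separated_pairs a \<Longrightarrow> w (x, y) < top"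
  using w_eq_top_iff[of x y] by (auto simp: separated_pairs_def less_top[symmetric])

lemma real_w_cont:
  assumes "0 < a"
  shows "continuous_on (separated_pairs a) (\<lambda>p. enn2real (w p))"
  unfolding continuous_on_def
proof
  fix p assume p: "p \<in> separated_pairs a"
  then have "w p < top" using w_finite[OF assms, of "fst p" "snd p"] by simp
  then obtain r where r: "w p = ennreal r" "0 \<le> r" by (cases "w p") auto
  have "continuous_on (separated_pairs a) w"
    by (rule continuous_on_subset[OF w_cont]) (auto simp: separated_pairs_def)
  then have "(w \<longlongrightarrow> ennreal r) (at p within separated_pairs a)"
    using p r(1) unfolding continuous_on_def by metis
  from tendsto_enn2real[OF this r(2)]
  show "((\<lambda>p. enn2real (w p)) \<longlongrightarrow> enn2real (w p)) (at p within separated_pairs a)" using r by simp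
qed

lemma w_bounded_separated:
  assumes a: "0 < a"
  obtains W where "0 \<le> W" "\<And>p. p \<in> separated_pairs a \<Longrightarrow> w p \<le> ennreal W"
proof -
  have "bounded ((\<lambda>p. enn2real (w p)) ` separated_pairs a)"
    by (intro compact_imp_bounded compact_continuous_image real_w_cont a compact_separated_pairs)
  then obtain B where B: "\<And>p. p \<in> separated_pairs a \<Longrightarrow> \<bar>enn2real (w p)\<bar> \<le> B" by (auto simp: bounded_iff)
  show ?thesis
  proof (rule that[of "max B 0"])
    fix p assume p: "p \<in> separated_pairs a"
    have "w p = ennreal (enn2real (w p))" using w_finite[OF a, of "fst p" "snd p"] p by simp
    also have "\<dots> \<le> ennreal (max B 0)" using B[OF p] by (intro ennreal_leI) auto
    finally show "w p \<le> ennreal (max B 0)" .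
  qed simp
qed

lemma separated_pairs_if_w_bounded:
  obtains a where "0 < a" "\<And>p. p \<in> Iper \<times> Iper \<Longrightarrow> w p \<le> ennreal C \<Longrightarrow> p \<in> separated_pairs a"
proof -
  define T where "T = {p \<in> Iper \<times> Iper. w p \<le> ennreal C}"
  have "compact {p \<in> Iper \<times> Iper. w p \<in> {..ennreal C}}"
    by (intro compact_preimage compact_Times compact_Iper w_cont closed_atMost)
  then have T: "compact T" by (simp add: T_def)
  show ?thesis
  proof (cases "T = {}")
    case True
    show ?thesis by (rule that[of 1]) (use True in \<open>auto simp: T_def\<close>)
  next
    case False
    have "continuous_on T (\<lambda>p. distT (fst p - snd p))" by (intro distT_cont continuous_intros)
    then obtain p where p: "p \<in> T" "\<And>q. q \<in> T \<Longrightarrow> distT (fst p - snd p) \<le> distT (fst q - snd q)"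
      using continuous_attains_inf[OF T False] by blast
    have "w (fst p, snd p) \<noteq> top" using p(1) by (auto simp: T_def top_unique)
    then have "distT (fst p - snd p) \<noteq> 0" using w_eq_top_iff[of "fst p" "snd p"] p(1) by (auto simp: T_def)
    then have "0 < distT (fst p - snd p)" using distT_nonneg[of "fst p - snd p"] by simp
    then show ?thesis by (rule that) (use p(2) in \<open>auto simp: T_def separated_pairs_def\<close>)
  qed
qed

lemma separated_pairs_perturb:
  assumes "p \<in> separated_pairs a" "q \<in> Iper \<times> Iper" "\<bar>fst q - fst p\<bar> < a / 4" "\<bar>snd q - snd p\<bar> < a / 4"
  shows "q \<in> separated_pairs (a / 2)"
proof -
  have "distT (fst p - snd p) \<le> distT (fst p - fst q) + distT (fst q - snd q) + distT (snd q - snd p)"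
    using distT_triangle[of "fst p" "snd p" "fst q"] distT_triangle[of "fst q" "snd p" "snd q"] by linarith
  moreover have "distT (fst p - fst q) \<le> \<bar>fst q - fst p\<bar>" "distT (snd q - snd p) \<le> \<bar>snd q - snd p\<bar>"
    using distT_le_abs[of "fst p - fst q"] distT_le_abs[of "snd q - snd p"]
    by (simp_all add: abs_minus_commute)
  ultimately show ?thesis using assms by (auto simp: separated_pairs_def)
qed

lemma w_uniformly_continuous_separated:
  assumes a: "0 < a" and "0 < e"
  obtains d where "0 < d"
    "\<And>p q. p \<in> separated_pairs a \<Longrightarrow> q \<in> Iper \<times> Iper \<Longrightarrow> \<bar>fst q - fst p\<bar> < d \<Longrightarrow> \<bar>snd q - snd p\<bar> < d \<Longrightarrow>
       q \<in> separated_pairs (a / 2) \<and> \<bar>enn2real (w q) - enn2real (w p)\<bar> < e"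
proof -
  have "uniformly_continuous_on (separated_pairs (a/2)) (\<lambda>p. enn2real (w p))"
    using a by (intro compact_uniformly_continuous real_w_cont compact_separated_pairs) simp
  then obtain d where d: "0 < d" "\<And>p q. p \<in> separated_pairs (a/2) \<Longrightarrow> q \<in> separated_pairs (a/2) \<Longrightarrow>
      dist q p < d \<Longrightarrow> dist (enn2real (w q)) (enn2real (w p)) < e"
    using \<open>0 < e\<close> unfolding uniformly_continuous_on_def by metis
  show ?thesis
  proof (rule that[of "min (d/2) (a/4)"])
    show "0 < min (d/2) (a/4)" using d a by simp
    fix p q assume p: "p \<in> separated_pairs a" and q: "q \<in> Iper \<times> Iper"
      and close: "\<bar>fst q - fst p\<bar> < min (d/2) (a/4)" "\<bar>snd q - snd p\<bar> < min (d/2) (a/4)"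
    have q_separated: "q \<in> separated_pairs (a / 2)"
      by (rule separated_pairs_perturb[OF p q]) (use close in auto)
    have "dist q p \<le> dist (fst q) (fst p) + dist (snd q) (snd p)"
      unfolding dist_prod_def by (rule sqrt_sum_squares_le_sum) auto
    also have "\<dots> < d" using close by (simp add: dist_real_def)
    finally have "dist (enn2real (w q)) (enn2real (w p)) < e"
      using p q_separated a by (intro d) (auto simp: separated_pairs_def)
    then show "q \<in> separated_pairs (a / 2) \<and> \<bar>enn2real (w q) - enn2real (w p)\<bar> < e"
      using q_separated by (simp add: dist_real_def)
  qed
qed

definition real_cost :: "(nat \<Rightarrow> real) \<Rightarrow> real" where
  "real_cost x = (\<Sum>i<n. \<Sum>j\<in>{..<n} - {i}. enn2real (w (x i, x j)))"

definition separated :: "real \<Rightarrow> (nat \<Rightarrow> real) set" where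
  "separated a = {x. (\<forall>i<n. x i \<in> Iper) \<and> (\<forall>i<n. \<forall>j<n. i \<noteq> j \<longrightarrow> a \<le> distT (x i - x j))}"

definition noncolliding :: "(nat \<Rightarrow> real) set" where
  "noncolliding = {x. (\<forall>i<n. x i \<in> Iper) \<and> (\<forall>i<n. \<forall>j<n. i \<noteq> j \<longrightarrow> 0 < distT (x i - x j))}"

lemma real_cost_nonneg: "0 \<le> real_cost x"
  by (simp add: real_cost_def sum_nonneg)

lemma separated_iff:
  "x \<in> separated a \<longleftrightarrow> (\<forall>i<n. x i \<in> Iper) \<and> (\<forall>i<n. \<forall>j<n. i \<noteq> j \<longrightarrow> (x i, x j) \<in> separated_pairs a)"
  by (auto simp: separated_def separated_pairs_def)

lemma noncolliding_Iper: "x \<in> noncolliding \<Longrightarrow> i < n \<Longrightarrow> x i \<in> Iper"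
  by (simp add: noncolliding_def)

lemma separated_imp_noncolliding: "x \<in> separated a \<Longrightarrow> 0 < a \<Longrightarrow> x \<in> noncolliding"
  by (auto simp: separated_def noncolliding_def intro: less_le_trans)

lemma noncolliding_imp_separated:
  assumes "x \<in> noncolliding"
  obtains a where "0 < a" "x \<in> separated a"
proof -
  let ?D = "(\<lambda>(i, j). distT (x i - x j)) ` {(i, j). i < n \<and> j < n \<and> i \<noteq> j}"
  have "finite {(i, j). i < n \<and> j < n \<and> i \<noteq> j}" by (rule finite_subset[of _ "{..<n} \<times> {..<n}"]) auto
  then have D: "finite (insert 1 ?D)" by simp
  show ?thesis
  proof (rule that[of "Min (insert 1 ?D)"])
    show "0 < Min (insert 1 ?D)" using D assms by (subst Min_gr_iff) (auto simp: noncolliding_def)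
    show "x \<in> separated (Min (insert 1 ?D))" unfolding separated_def
    proof safe
      fix i j assume "i < n" "j < n" "i \<noteq> j"
      then show "Min (insert 1 ?D) \<le> distT (x i - x j)" by (intro Min_le D) auto
    qed (use assms in \<open>simp add: noncolliding_def\<close>)
  qed
qed

lemma cN_noncolliding:
  assumes "x \<in> noncolliding"
  shows "cN n w x = ennreal (real_cost x)"
proof -
  have "cN n w x = (\<Sum>i<n. \<Sum>j\<in>{..<n} - {i}. ennreal (enn2real (w (x i, x j))))"
    unfolding cN_def
  proof (intro sum.cong refl)
    fix i j assume "i \<in> {..<n}" "j \<in> {..<n} - {i}"
    then have "x i \<in> Iper" "x j \<in> Iper" "distT (x i - x j) \<noteq> 0"
      using assms by (fastforce simp: noncolliding_def)+
    then show "w (x i, x j) = ennreal (enn2real (w (x i, x j)))"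
      by (simp add: w_eq_top_iff less_top[symmetric])
  qed
  also have "\<dots> = ennreal (real_cost x)" unfolding real_cost_def by (simp add: sum_ennreal sum_nonneg)
  finally show ?thesis .
qed

lemma w_le_cN:
  assumes "i < n" "j < n" "i \<noteq> j"
  shows "w (x i, x j) \<le> cN n w x"
proof -
  have "w (x i, x j) \<le> (\<Sum>j\<in>{..<n} - {i}. w (x i, x j))"
    using assms by (intro member_le_sum) auto
  also have "\<dots> \<le> cN n w x" unfolding cN_def
    using assms by (intro member_le_sum[where f="\<lambda>i. \<Sum>j\<in>{..<n} - {i}. w (x i, x j)"]) auto
  finally show ?thesis .
qed

lemma cN_colliding:
  assumes "\<And>i. i < n \<Longrightarrow> x i \<in> Iper" "x \<notin> noncolliding"
  shows "cN n w x = top"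
proof -
  obtain i j where ij: "i < n" "j < n" "i \<noteq> j" "\<not> 0 < distT (x i - x j)"
    using assms by (auto simp: noncolliding_def)
  then have "w (x i, x j) = top" using w_eq_top_iff assms(1) distT_nonneg[of "x i - x j"] by simp
  then show ?thesis using w_le_cN[OF ij(1-3), of x] by (simp add: top_unique)
qed

lemma cN_bounded_separated:
  assumes a: "0 < a"
  obtains S where "0 \<le> S" "\<And>x. x \<in> separated a \<Longrightarrow> cN n w x \<le> ennreal S"
proof -
  obtain W where W: "0 \<le> W" "\<And>p. p \<in> separated_pairs a \<Longrightarrow> w p \<le> ennreal W"
    using w_bounded_separated[OF a] by metis
  show ?thesis
  proof (rule that[of "real n * (real n * W)"])
    fix x assume x: "x \<in> separated a"
    have "cN n w x \<le> (\<Sum>i<n. \<Sum>j\<in>{..<n} - {i}. ennreal W)"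
      unfolding cN_def using x by (intro sum_mono W(2)) (auto simp: separated_iff)
    also have "\<dots> \<le> (\<Sum>i<n. \<Sum>j<n. ennreal W)" by (intro sum_mono sum_mono2) auto
    also have "\<dots> = ennreal (real n * (real n * W))"
      using W(1) by (simp add: ennreal_mult ennreal_of_nat_eq_real_of_nat)
    finally show "cN n w x \<le> ennreal (real n * (real n * W))" .
  qed (use W in simp)
qed

lemma separated_if_cN_bounded:
  obtains a where "0 < a" "\<And>x. (\<And>i. i < n \<Longrightarrow> x i \<in> Iper) \<Longrightarrow> cN n w x \<le> ennreal C \<Longrightarrow> x \<in> separated a"
proof -
  obtain a where a: "0 < a" "\<And>p. p \<in> Iper \<times> Iper \<Longrightarrow> w p \<le> ennreal C \<Longrightarrow> p \<in> separated_pairs a"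
    using separated_pairs_if_w_bounded by metis
  show ?thesis
  proof (rule that[OF a(1)])
    fix x assume x: "\<And>i. i < n \<Longrightarrow> x i \<in> Iper" "cN n w x \<le> ennreal C"
    have "(x i, x j) \<in> separated_pairs a" if "i < n" "j < n" "i \<noteq> j" for i j
      using x w_le_cN[OF that, of x] that by (intro a(2)) (auto intro: order_trans)
    then show "x \<in> separated a" using x(1) by (simp add: separated_iff)
  qed
qed

definition cost_modulus :: "real \<Rightarrow> real \<Rightarrow> real \<Rightarrow> bool" where
  "cost_modulus a e d \<longleftrightarrow> 0 < d \<and> (\<forall>x\<in>separated a. \<forall>y. (\<forall>i<n. y i \<in> Iper \<and> \<bar>y i - x i\<bar> < d) \<longrightarrow>
     y \<in> separated (a / 2) \<and> \<bar>real_cost y - real_cost x\<bar> < e)"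

lemma cost_modulusD:
  assumes "cost_modulus a e d" "x \<in> separated a" "\<And>i. i < n \<Longrightarrow> y i \<in> Iper" "\<And>i. i < n \<Longrightarrow> \<bar>y i - x i\<bar> < d"
  shows "y \<in> separated (a / 2)" "\<bar>real_cost y - real_cost x\<bar> < e"
  using assms by (auto simp: cost_modulus_def)

lemma cost_modulus_exists:
  assumes a: "0 < a" and e: "0 < e"
  obtains d where "cost_modulus a e d"
proof -
  define e' where "e' = e / (real n * real n + 1)"
  have e': "0 < e'" using e by (simp add: e'_def add_nonneg_pos)
  obtain d where d: "0 < d"
    "\<And>p q. p \<in> separated_pairs a \<Longrightarrow> q \<in> Iper \<times> Iper \<Longrightarrow> \<bar>fst q - fst p\<bar> < d \<Longrightarrow> \<bar>snd q - snd p\<bar> < d \<Longrightarrow>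
       q \<in> separated_pairs (a / 2) \<and> \<bar>enn2real (w q) - enn2real (w p)\<bar> < e'"
    using w_uniformly_continuous_separated[OF a e'] by metis
  have "y \<in> separated (a / 2) \<and> \<bar>real_cost y - real_cost x\<bar> < e"
    if x: "x \<in> separated a" and y: "\<forall>i<n. y i \<in> Iper \<and> \<bar>y i - x i\<bar> < d" for x y
  proof -
    have pairs: "(y i, y j) \<in> separated_pairs (a / 2) \<and> \<bar>enn2real (w (y i, y j)) - enn2real (w (x i, x j))\<bar> < e'"
      if "i < n" "j < n" "i \<noteq> j" for i j
      using x y that by (intro d(2)) (auto simp: separated_iff)
    have "\<bar>real_cost y - real_cost x\<bar>
        \<le> (\<Sum>i<n. \<Sum>j\<in>{..<n} - {i}. \<bar>enn2real (w (y i, y j)) - enn2real (w (x i, x j))\<bar>)"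
      unfolding real_cost_def sum_subtractf[symmetric]
      by (intro order_trans[OF sum_abs] sum_mono) (auto intro: sum_abs)
    also have "\<dots> \<le> (\<Sum>i<n. \<Sum>j\<in>{..<n} - {i}. e')" using pairs by (intro sum_mono) (auto intro: less_imp_le)
    also have "\<dots> \<le> (\<Sum>i<n. \<Sum>j<n. e')" using e' by (intro sum_mono sum_mono2) auto
    also have "\<dots> < (real n * real n + 1) * e'" using e' by (simp add: algebra_simps)
    also have "\<dots> = e" unfolding e'_def by (simp add: add_nonneg_eq_0_iff)
    finally show ?thesis using pairs y by (simp add: separated_iff)
  qed
  then show ?thesis using d(1) by (intro that[of d]) (simp add: cost_modulus_def)
qed

end

section \<open>Partitions of unity on the circle\<close>

definition bump :: "real \<Rightarrow> real \<Rightarrow> real" where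
  "bump b t = (max 0 (cos t - cos b))\<^sup>2"

definition bump_deriv :: "real \<Rightarrow> real \<Rightarrow> real" where
  "bump_deriv b t = 2 * max 0 (cos t - cos b) * (- sin t)"

lemma DERIV_pos_part_power2: "((\<lambda>y. (max 0 y)\<^sup>2) has_real_derivative 2 * max 0 y) (at (y::real))"
proof (cases y "0::real" rule: linorder_cases)
  case less
  have "((\<lambda>y. 0) has_real_derivative 2 * max 0 y) (at y)" using less by simp
  then show ?thesis
    by (rule has_field_derivative_transform_within_open[where S="{..<0}"]) (use less in auto)
next
  case greater
  have "((\<lambda>y. y\<^sup>2) has_real_derivative 2 * max 0 y) (at y)"
    using greater by (auto intro!: derivative_eq_intros)
  then show ?thesis
    by (rule has_field_derivative_transform_within_open[where S="{0<..}"]) (use greater in auto)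
next
  case equal
  have "((\<lambda>h. ((max 0 (0 + h))\<^sup>2 - (max 0 0)\<^sup>2) / h) \<longlongrightarrow> 0) (at (0::real))"
  proof (rule Lim_null_comparison[where g="\<lambda>h. \<bar>h\<bar>"])
    show "\<forall>\<^sub>F h in at (0::real). norm (((max 0 (0 + h))\<^sup>2 - (max 0 0)\<^sup>2) / h) \<le> \<bar>h\<bar>"
      by (rule always_eventually) (auto simp: max_def power2_eq_square)
    show "((\<lambda>h. \<bar>h\<bar>) \<longlongrightarrow> 0) (at (0::real))" by (rule tendsto_eq_intros | simp)+
  qed
  then show ?thesis unfolding equal DERIV_def by simp
qed

lemma bump_C1per: "C1per (bump b) (bump_deriv b)"
  unfolding C1per_def
proof (intro conjI allI)
  fix t
  have "((\<lambda>t. (max 0 (cos t - cos b))\<^sup>2) has_real_derivative 2 * max 0 (cos t - cos b) * (- sin t)) (at t)"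
    by (rule DERIV_chain2[OF DERIV_pos_part_power2]) (auto intro!: derivative_eq_intros)
  then show "(bump b has_real_derivative bump_deriv b t) (at t)" unfolding bump_def bump_deriv_def .
  show "continuous_on UNIV (bump_deriv b)" unfolding bump_deriv_def by (intro continuous_intros)
  show "bump b (t + 2 * pi) = bump b t" by (simp add: bump_def)
qed

lemma bump_nonneg: "0 \<le> bump b t" by (simp add: bump_def)

lemma bump_neq_0_iff:
  assumes "0 \<le> b" "b \<le> pi"
  shows "bump b t \<noteq> 0 \<longleftrightarrow> distT t < b"
  unfolding distT_less_iff_cos[OF assms] by (auto simp: bump_def)

definition window_radius :: "nat \<Rightarrow> real" where
  "window_radius N = 4 * pi / (3 * real N)"

definition window_norm :: "nat \<Rightarrow> real \<Rightarrow> real" where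
  "window_norm N t = (\<Sum>i<N. (bump (window_radius N) (t - node N i))\<^sup>2)"

definition window :: "nat \<Rightarrow> nat \<Rightarrow> real \<Rightarrow> real" where
  "window N i t = bump (window_radius N) (t - node N i) / sqrt (window_norm N t)"

lemma window_radius_bounds:
  assumes "2 \<le> N"
  shows "0 \<le> window_radius N" "window_radius N \<le> pi"
proof -
  have N: "2 \<le> real N" using assms by simp
  then have "4 * pi \<le> pi * (3 * real N)" using pi_gt_zero by simp
  then show "0 \<le> window_radius N" "window_radius N \<le> pi"
    using N by (auto simp: window_radius_def divide_le_eq)
qed

lemma distT_nearest_node:
  assumes N: "0 < N"
  obtains i where "i < N" "distT (t - node N i) \<le> pi / real N"
proof -
  define j where "j = round (t * real N / (2 * pi))"
  define i where "i = nat (j mod int N)"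
  define q where "q = j div int N"
  have i: "i < N" using N by (simp add: i_def nat_less_iff)
  have j_eq: "real_of_int j = real i + real N * real_of_int q"
  proof -
    have "j = int i + int N * q" using N by (simp add: i_def q_def)
    then show ?thesis by simp
  qed
  have "\<bar>of_int j - t * real N / (2 * pi)\<bar> \<le> 1/2" unfolding j_def by (rule of_int_round_abs_le)
  then have "\<bar>of_int j - t * real N / (2 * pi)\<bar> * (2 * pi / real N) \<le> 1/2 * (2 * pi / real N)"
    using N by (intro mult_right_mono) auto
  then have "\<bar>(of_int j - t * real N / (2 * pi)) * (2 * pi / real N)\<bar> \<le> pi / real N"
    using N by (simp only: abs_mult) simp
  moreover have "(of_int j - t * real N / (2 * pi)) * (2 * pi / real N) = - ((t - node N i) - 2 * pi * of_int q)"
    using N by (simp add: j_eq node_def field_simps)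
  ultimately have "\<bar>(t - node N i) - 2 * pi * of_int q\<bar> \<le> pi / real N" by (simp only: abs_minus_cancel)
  then have "distT (t - node N i) \<le> pi / real N" using distT_le[of "t - node N i" q] by linarith
  with i show ?thesis by (rule that)
qed

lemma window_norm_pos:
  assumes N: "2 \<le> N"
  shows "0 < window_norm N t"
proof -
  obtain i where i: "i < N" "distT (t - node N i) \<le> pi / real N" using distT_nearest_node[of N t] N by auto
  note i(2)
  also have "pi / real N < window_radius N" using N by (simp add: window_radius_def field_simps)
  finally have "bump (window_radius N) (t - node N i) \<noteq> 0"
    by (simp add: bump_neq_0_iff window_radius_bounds N)
  then have "0 < (bump (window_radius N) (t - node N i))\<^sup>2" by simp
  also have "\<dots> \<le> window_norm N t" unfolding window_norm_def using i(1) by (intro member_le_sum) auto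
  finally show ?thesis .
qed

lemma window_C1per:
  assumes N: "2 \<le> N"
  shows "\<exists>f'. C1per (window N i) f'"
proof -
  let ?r = "window_radius N"
  define Z' where "Z' = (\<lambda>t. \<Sum>i<N. 2 * bump ?r (t - node N i) * bump_deriv ?r (t - node N i))"
  have Z': "C1per (window_norm N) Z'" unfolding window_norm_def[abs_def] Z'_def
    by (intro C1per_sum C1per_power2 C1per_shift bump_C1per) simp
  have "C1per (\<lambda>t. bump ?r (t - node N i) * inverse (sqrt (window_norm N t)))
    (\<lambda>t. bump_deriv ?r (t - node N i) * inverse (sqrt (window_norm N t))
       + bump ?r (t - node N i) * (- (inverse (sqrt (window_norm N t)) ^ Suc (Suc 0))
         * (inverse (sqrt (window_norm N t)) / 2 * Z' t)))"
    using window_norm_pos[OF N]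
    by (intro C1per_mult C1per_shift bump_C1per C1per_inverse C1per_sqrt Z') simp_all
  then show ?thesis unfolding window_def[abs_def] divide_inverse by blast
qed

lemma window_nonneg: "2 \<le> N \<Longrightarrow> 0 \<le> window N i t"
  using window_norm_pos[of N t] by (simp add: window_def bump_nonneg less_imp_le)

lemma sum_window_power2:
  assumes N: "2 \<le> N"
  shows "(\<Sum>i<N. (window N i t)\<^sup>2) = 1"
proof -
  have "(\<Sum>i<N. (window N i t)\<^sup>2) = (\<Sum>i<N. (bump (window_radius N) (t - node N i))\<^sup>2 / window_norm N t)"
    using window_norm_pos[OF N, of t] by (simp add: window_def power_divide)
  also have "\<dots> = window_norm N t / window_norm N t"
    unfolding sum_divide_distrib[symmetric] window_norm_def[of N t, symmetric] ..
  finally show ?thesis using window_norm_pos[OF N, of t] by simp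
qed

lemma window_le_1:
  assumes N: "2 \<le> N" and "i < N"
  shows "window N i t \<le> 1"
proof -
  have "(window N i t)\<^sup>2 \<le> (\<Sum>i<N. (window N i t)\<^sup>2)" using assms by (intro member_le_sum) auto
  then have "(window N i t)\<^sup>2 \<le> 1\<^sup>2" by (simp add: sum_window_power2[OF N])
  then show ?thesis by (rule power2_le_imp_le) simp
qed

lemma window_neq_0_iff:
  assumes N: "2 \<le> N"
  shows "window N i t \<noteq> 0 \<longleftrightarrow> distT (t - node N i) < window_radius N"
  using window_norm_pos[OF N, of t]
  by (simp add: window_def bump_neq_0_iff[OF window_radius_bounds[OF N], symmetric])

lemma window_norm_shift:
  assumes N: "2 \<le> N"
  shows "window_norm N (t - node N i) = window_norm N t"
proof -
  let ?F = "\<lambda>t i. (bump (window_radius N) (t - node N i))\<^sup>2"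
  have shift_one: "window_norm N (t - node N 1) = window_norm N t" for t
  proof -
    have "t - node N 1 - node N i = t - node N (Suc i)" for i using N by (simp add: node_def field_simps)
    then have "window_norm N (t - node N 1) = (\<Sum>i<N. ?F t (Suc i))" unfolding window_norm_def by (simp only:)
    moreover have "(\<Sum>i<Suc N. ?F t i) = ?F t 0 + (\<Sum>i<N. ?F t (Suc i))" by (rule sum.lessThan_Suc_shift)
    moreover have "(\<Sum>i<Suc N. ?F t i) = (\<Sum>i<N. ?F t i) + ?F t N" by simp
    moreover have "?F t N = ?F t 0"
      using N C1per_periodic[OF bump_C1per, of "window_radius N" "t - 2 * pi"] by (simp add: node_def)
    ultimately show ?thesis unfolding window_norm_def by linarith
  qed
  show ?thesis
  proof (induction i)
    case 0 then show ?case by (simp add: node_def)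
  next
    case (Suc i)
    have "t - node N (Suc i) = (t - node N i) - node N 1" using N by (simp add: node_def field_simps)
    then show ?case using shift_one[of "t - node N i"] Suc by (simp only:)
  qed
qed

lemma window_shift: "2 \<le> N \<Longrightarrow> window N i t = window N 0 (t - node N i)"
  by (simp add: window_def window_norm_shift) (simp add: node_def)

lemma integral_window_power2:
  assumes N: "2 \<le> N"
  shows "(\<integral>t. (window N i t)\<^sup>2 \<partial>Lper) = 2 * pi / real N"
proof -
  have cont: "continuous_on B (\<lambda>t. (window N i t)\<^sup>2)" for i B
    using window_C1per[OF N, of i] C1per_cont(1) by (auto intro!: continuous_intros)
  have periodic: "(window N 0 (t + 2 * pi))\<^sup>2 = (window N 0 t)\<^sup>2" for t
    using window_C1per[OF N, of 0] C1per_periodic by fastforce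
  have same_integral: "(\<integral>t. (window N i t)\<^sup>2 \<partial>Lper) = (\<integral>t. (window N 0 t)\<^sup>2 \<partial>Lper)" for i
    unfolding window_shift[OF N, of i] by (rule integral_Lper_shift[OF cont periodic])
  have "real N * (\<integral>t. (window N 0 t)\<^sup>2 \<partial>Lper) = (\<Sum>i<N. \<integral>t. (window N 0 t)\<^sup>2 \<partial>Lper)" by simp
  also have "\<dots> = (\<Sum>i<N. \<integral>t. (window N i t)\<^sup>2 \<partial>Lper)" by (intro sum.cong refl same_integral[symmetric])
  also have "\<dots> = (\<integral>t. (\<Sum>i<N. (window N i t)\<^sup>2) \<partial>Lper)"
    by (rule Bochner_Integration.integral_sum[symmetric]) (intro integrable_Lper_cont cont)
  also have "\<dots> = 2 * pi" by (simp add: sum_window_power2[OF N] measure_Lper)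
  finally show ?thesis unfolding same_integral[of i] using N by (simp add: field_simps)
qed

section \<open>Orbitals cut out by windows\<close>

context mass_coordinate
begin

lemma C1per_mass_coordinate:
  assumes P: "C1per P P'"
  shows "C1per (\<lambda>t. P (2 * pi * s t)) (\<lambda>t. P' (2 * pi * s t) * (2 * pi * g t))"
  unfolding C1per_def
proof (intro conjI allI)
  fix t
  show "((\<lambda>t. P (2 * pi * s t)) has_real_derivative P' (2 * pi * s t) * (2 * pi * g t)) (at t)"
    by (rule DERIV_chain2[OF C1per_DERIV[OF P]]) (auto intro!: derivative_eq_intros s_DERIV)
  show "continuous_on UNIV (\<lambda>t. P' (2 * pi * s t) * (2 * pi * g t))"
    by (intro continuous_intros continuous_on_compose2[OF C1per_cont(2)[OF P, of UNIV]] g_cont s_cont) auto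
  have "2 * pi * s (t + 2 * pi) = 2 * pi * s t + 2 * pi" by (simp add: s_add_period distrib_left)
  then show "P (2 * pi * s (t + 2 * pi)) = P (2 * pi * s t)" using C1per_periodic[OF P] by simp
qed

lemma distT_mass_coordinate_le:
  assumes g_bounds: "\<And>t. 0 \<le> g t" "\<And>t. g t \<le> M"
  shows "distT (2 * pi * s x - 2 * pi * s y) \<le> 2 * pi * M * distT (x - y)"
proof -
  obtain k :: int where k: "distT (x - y) = \<bar>x - y - 2 * pi * of_int k\<bar>" by (rule distT_attained)
  have lipschitz: "\<bar>s a - s b\<bar> \<le> M * \<bar>a - b\<bar>" for a b
    using field_differentiable_bound[of UNIV s g M a b] s_DERIV g_bounds by simp
  have "distT (2 * pi * s x - 2 * pi * s y) \<le> \<bar>2 * pi * s x - 2 * pi * s y - 2 * pi * of_int k\<bar>"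
    by (rule distT_le)
  also have "2 * pi * s x - 2 * pi * s y - 2 * pi * of_int k = 2 * pi * (s x - s (y + 2 * pi * of_int k))"
    by (simp only: s_add_int_period) (simp add: algebra_simps)
  also have "\<bar>\<dots>\<bar> = 2 * pi * \<bar>s x - s (y + 2 * pi * of_int k)\<bar>" by (simp add: abs_mult)
  also have "\<dots> \<le> 2 * pi * (M * \<bar>x - (y + 2 * pi * of_int k)\<bar>)" by (intro mult_left_mono lipschitz) simp
  also have "\<dots> = 2 * pi * M * distT (x - y)" by (simp add: k diff_diff_eq)
  finally show ?thesis .
qed

definition window_orbital :: "nat \<Rightarrow> nat \<Rightarrow> real \<Rightarrow> real" where
  "window_orbital N i t = sqrt (real N) * (sqrt (g t) * window N i (2 * pi * s t))"

definition window_orbital_deriv :: "(real \<Rightarrow> real) \<Rightarrow> (real \<Rightarrow> real) \<Rightarrow> nat \<Rightarrow> nat \<Rightarrow> real \<Rightarrow> real" where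
  "window_orbital_deriv g' W' N i t = sqrt (real N) *
     ((inverse (sqrt (g t)) / 2 * g' t) * window N i (2 * pi * s t)
       + sqrt (g t) * (W' (2 * pi * s t) * (2 * pi * g t)))"

lemma window_orbital_power2:
  assumes "0 < g t"
  shows "(window_orbital N i t)\<^sup>2 = real N * (g t * (window N i (2 * pi * s t))\<^sup>2)"
  using assms by (simp add: window_orbital_def power_mult_distrib less_imp_le)

lemma orbital_window_orbital:
  assumes N: "2 \<le> N" and g_C1: "C1per g g'" and g_pos: "\<And>t. 0 < g t" and W': "C1per (window N i) W'"
  shows "orbital (window_orbital N i) (window_orbital_deriv g' W' N i)"
  unfolding orbital_def
proof (intro conjI allI)
  show "C1per (window_orbital N i) (window_orbital_deriv g' W' N i)"
    unfolding window_orbital_def window_orbital_deriv_def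
    by (intro C1per_cmult C1per_mult C1per_sqrt g_C1 g_pos C1per_mass_coordinate W')
  show "0 \<le> window_orbital N i t" for t
    using window_nonneg[OF N] g_pos[of t] by (simp add: window_orbital_def less_imp_le)
  have "(\<integral>t. g t * (window N i (2 * pi * s t - 0))\<^sup>2 \<partial>Lper) = 1 / (2 * pi) * (\<integral>t. (window N i t)\<^sup>2 \<partial>Lper)"
    using integral_substitution[of "\<lambda>t. (window N i t)\<^sup>2" 0] C1per_cont[OF W'] C1per_periodic[OF W']
    by (simp add: continuous_on_power)
  then show "(\<integral>t. (window_orbital N i t)\<^sup>2 \<partial>Lper) = 1"
    using N by (simp add: window_orbital_power2[OF g_pos] integral_window_power2)
qed

lemma sum_window_orbital_power2:
  assumes "2 \<le> N" "0 < g t"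
  shows "(\<Sum>i<N. 1 / real N * (window_orbital N i t)\<^sup>2) = g t"
  using assms by (simp add: window_orbital_power2 sum_window_power2 flip: sum_distrib_left)

lemma window_orbital_separated:
  assumes g_bounds: "\<And>t. 0 < g t" "\<And>t. g t \<le> M" and jk: "j < n" "k < n" "j \<noteq> k"
    and x: "window_orbital (2 * n) (2 * j + r) x \<noteq> 0" and y: "window_orbital (2 * n) (2 * k + r) y \<noteq> 0"
  shows "1 / (3 * real n * M) \<le> distT (x - y)"
proof -
  let ?N = "2 * n"
  have N: "2 \<le> ?N" using jk by simp
  have node_split: "node ?N (2 * i + r) = node ?N r + node n i" for i
    by (simp add: node_def add_divide_distrib distrib_left)
  have radius: "window_radius ?N = 2 * pi / (3 * real n)" by (simp add: window_radius_def)
  have "distT (2 * pi * s x - (node ?N r + node n j)) < 2 * pi / (3 * real n)"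
    "distT (2 * pi * s y - (node ?N r + node n k)) < 2 * pi / (3 * real n)"
    using x y unfolding node_split[symmetric] radius[symmetric]
    by (auto simp: window_orbital_def simp flip: window_neq_0_iff[OF N])
  then have "2 * pi / (3 * real n) \<le> distT (2 * pi * s x - 2 * pi * s y)"
    by (rule distT_near_distinct_nodes[OF jk])
  also have "\<dots> \<le> 2 * pi * M * distT (x - y)"
    using g_bounds by (intro distT_mass_coordinate_le) (auto intro: less_imp_le)
  finally show ?thesis using g_bounds(1)[of 0] g_bounds(2)[of 0] jk by (simp add: field_simps)
qed

lemma window_orbital_deriv_power2_le:
  assumes g_bounds: "0 < m" "m \<le> g t" "g t \<le> M" and W'_le: "\<bar>W' (2 * pi * s t)\<bar> \<le> \<Lambda>" and "2 \<le> N" "i < N"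
  shows "(window_orbital_deriv g' W' N i t)\<^sup>2 \<le> real N * (1 / (2 * m) * (g' t)\<^sup>2 + 2 * M * (\<Lambda> * (2 * pi * M))\<^sup>2)"
proof -
  let ?W = "window N i (2 * pi * s t)"
  let ?a = "(inverse (sqrt (g t)) / 2 * g' t) * ?W"
    and ?b = "sqrt (g t) * (W' (2 * pi * s t) * (2 * pi * g t))"
  have "?W\<^sup>2 \<le> 1" using window_le_1 window_nonneg assms by (simp add: power_le_one)
  moreover have "(inverse (sqrt (g t)) / 2)\<^sup>2 \<le> 1 / (4 * m)"
    using g_bounds by (simp add: power_divide power_inverse field_simps)
  ultimately have "(inverse (sqrt (g t)) / 2)\<^sup>2 * ?W\<^sup>2 \<le> 1 / (4 * m) * 1"
    using g_bounds by (intro mult_mono) auto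
  then have "(inverse (sqrt (g t)) / 2)\<^sup>2 * ?W\<^sup>2 * (g' t)\<^sup>2 \<le> 1 / (4 * m) * (g' t)\<^sup>2"
    by (intro mult_right_mono) auto
  then have a_le: "?a\<^sup>2 \<le> 1 / (4 * m) * (g' t)\<^sup>2" by (simp only: power_mult_distrib mult_ac)
  have "\<bar>W' (2 * pi * s t) * (2 * pi * g t)\<bar> \<le> \<Lambda> * (2 * pi * M)"
    unfolding abs_mult using W'_le g_bounds by (intro mult_mono) auto
  then have "(W' (2 * pi * s t) * (2 * pi * g t))\<^sup>2 \<le> (\<Lambda> * (2 * pi * M))\<^sup>2"
    using power_mono[of "\<bar>_\<bar>" _ 2] by fastforce
  then have "g t * (W' (2 * pi * s t) * (2 * pi * g t))\<^sup>2 \<le> M * (\<Lambda> * (2 * pi * M))\<^sup>2"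
    using g_bounds by (intro mult_mono) auto
  then have b_le: "?b\<^sup>2 \<le> M * (\<Lambda> * (2 * pi * M))\<^sup>2" using g_bounds by (simp add: power_mult_distrib)
  have "(?a + ?b)\<^sup>2 \<le> 2 * ?a\<^sup>2 + 2 * ?b\<^sup>2" using sum_squares_bound[of ?a ?b] by (simp add: power2_sum)
  also have "\<dots> \<le> 2 * (1 / (4 * m) * (g' t)\<^sup>2) + 2 * (M * (\<Lambda> * (2 * pi * M))\<^sup>2)" using a_le b_le by linarith
  also have "\<dots> = 1 / (2 * m) * (g' t)\<^sup>2 + 2 * M * (\<Lambda> * (2 * pi * M))\<^sup>2" by simp
  finally have "real N * (?a + ?b)\<^sup>2 \<le> real N * (1 / (2 * m) * (g' t)\<^sup>2 + 2 * M * (\<Lambda> * (2 * pi * M))\<^sup>2)"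
    by (intro mult_left_mono) auto
  then show ?thesis by (simp add: window_orbital_deriv_def power_mult_distrib)
qed

lemma window_orbital_kinetic_le:
  assumes N: "2 \<le> N" "i < N" and g_C1: "C1per g g'" and W': "C1per (window N i) W'" "\<And>t. \<bar>W' t\<bar> \<le> \<Lambda>"
    and g_bounds: "0 < m" "\<And>t. m \<le> g t" "\<And>t. g t \<le> M"
  shows "(\<integral>t. (window_orbital_deriv g' W' N i t)\<^sup>2 \<partial>Lper)
    \<le> real N * (1 / (2 * m) + 4 * pi * M * (\<Lambda> * (2 * pi * M))\<^sup>2) * (1 + (\<integral>t. (g' t)\<^sup>2 \<partial>Lper))"
proof -
  let ?q = "2 * M * (\<Lambda> * (2 * pi * M))\<^sup>2" and ?I = "\<integral>t. (g' t)\<^sup>2 \<partial>Lper"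
  have g_pos: "0 < g t" for t using g_bounds(1) g_bounds(2)[of t] by linarith
  then have M: "0 < M" using g_bounds(3) less_le_trans by blast
  have "(\<integral>t. (window_orbital_deriv g' W' N i t)\<^sup>2 \<partial>Lper) \<le> (\<integral>t. real N * (1 / (2 * m) * (g' t)\<^sup>2 + ?q) \<partial>Lper)"
    by (intro integral_mono integrable_Lper_cont continuous_intros C1per_cont[OF g_C1]
        C1per_cont[OF orbitalD(1)[OF orbital_window_orbital[OF N(1) g_C1 g_pos W'(1)]]]
        window_orbital_deriv_power2_le g_bounds W'(2) N)
  also have "\<dots> = real N * (1 / (2 * m) * ?I + 2 * pi * ?q)"
    by (simp add: measure_Lper integrable_Lper_cont continuous_on_power C1per_cont[OF g_C1])
  also have "\<dots> \<le> real N * ((1 / (2 * m) + 2 * pi * ?q) * (1 + ?I))"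
  proof (rule mult_left_mono)
    have "0 \<le> ?I" "0 \<le> 1 / (2 * m)" "0 \<le> 2 * pi * ?q * ?I" using g_bounds(1) M by simp_all
    then show "1 / (2 * m) * ?I + 2 * pi * ?q \<le> (1 / (2 * m) + 2 * pi * ?q) * (1 + ?I)"
      by (simp add: algebra_simps)
  qed simp
  finally show ?thesis by (simp add: mult_ac)
qed

lemma Hminus_window_orbitals:
  assumes n: "1 \<le> n" and V: "Hminus V" and g_C1: "C1per g g'" and g_pos: "\<And>t. 0 < g t"
    and W': "\<And>i. C1per (window (2 * n) i) (W' i)"
  shows "2 * (real n * V g) = (\<Sum>j<n. V (\<lambda>t. (window_orbital (2 * n) (2 * j) t)\<^sup>2)) +
    (\<Sum>j<n. V (\<lambda>t. (window_orbital (2 * n) (2 * j + 1) t)\<^sup>2))"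
proof -
  let ?N = "2 * n"
  have N: "2 \<le> ?N" using n by simp
  have squares: "H1per (\<lambda>t. (window_orbital ?N i t)\<^sup>2)" for i
    by (rule C1per_H1per[OF C1per_power2[OF orbitalD(1)[OF orbital_window_orbital[OF N g_C1 g_pos W']]]])
  have "V g = V (\<lambda>t. \<Sum>i<?N. 1 / real ?N * (window_orbital ?N i t)\<^sup>2)"
    by (simp only: sum_window_orbital_power2[OF N g_pos])
  also have "\<dots> = (\<Sum>i<?N. 1 / real ?N * V (\<lambda>t. (window_orbital ?N i t)\<^sup>2))"
    by (simp only: Hminus_sum[OF V finite_lessThan H1per_cmult[OF squares]] Hminus_cmult[OF V squares])
  finally have "2 * (real n * V g) = (\<Sum>i<?N. V (\<lambda>t. (window_orbital ?N i t)\<^sup>2))"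
    using n by (simp flip: sum_divide_distrib)
  then show ?thesis
    using sum_split_even_odd[of "\<lambda>i. V (\<lambda>t. (window_orbital ?N i t)\<^sup>2)"
      "\<lambda>i. V (\<lambda>t. (window_orbital ?N i t)\<^sup>2)" n] by simp
qed

end

lemma window_derivs:
  assumes N: "2 \<le> N"
  obtains W' \<Lambda> where "\<And>i. C1per (window N i) (W' i)" "\<And>i t. \<bar>W' i t\<bar> \<le> \<Lambda>"
proof -
  obtain W' where W': "C1per (window N 0) W'" using window_C1per[OF N] by blast
  obtain \<Lambda> where \<Lambda>: "\<And>t. \<bar>W' t\<bar> \<le> \<Lambda>" using C1per_bounded[OF W'] by metis
  have "C1per (window N i) (\<lambda>t. W' (t - node N i))" for i
  proof -
    have "window N i = (\<lambda>t. window N 0 (t - node N i))" using window_shift[OF N] by blast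
    then show ?thesis using C1per_shift[OF W'] by metis
  qed
  then show ?thesis using \<Lambda> by (rule that)
qed

section \<open>Bounds on potentials from trial states\<close>

context cost
begin

definition orbital_bound :: "real \<Rightarrow> ((real \<Rightarrow> real) \<Rightarrow> real) \<Rightarrow> bool" where
  "orbital_bound \<epsilon> V \<longleftrightarrow> (\<forall>\<phi> \<phi>' S. disjoint_orbitals n \<phi> \<phi>' \<longrightarrow> support_cost_le n w \<phi> S \<longrightarrow> 0 \<le> S \<longrightarrow>
     (\<Sum>j<n. V (\<lambda>t. (\<phi> j t)\<^sup>2)) \<le> \<epsilon> * kinetic_bound n \<phi>' + S)"

lemma orbital_boundD:
  assumes "orbital_bound \<epsilon> V" "disjoint_orbitals n \<phi> \<phi>'" "support_cost_le n w \<phi> S" "0 \<le> S"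
  shows "(\<Sum>j<n. V (\<lambda>t. (\<phi> j t)\<^sup>2)) \<le> \<epsilon> * kinetic_bound n \<phi>' + S"
  using assms unfolding orbital_bound_def by blast

definition separated_supports :: "real \<Rightarrow> (nat \<Rightarrow> real \<Rightarrow> real) \<Rightarrow> bool" where
  "separated_supports a \<phi> \<longleftrightarrow> (\<forall>i<n. \<forall>j<n. \<forall>x\<in>Iper. \<forall>y\<in>Iper. i \<noteq> j \<longrightarrow> \<phi> i x \<noteq> 0 \<longrightarrow> \<phi> j y \<noteq> 0 \<longrightarrow> a \<le> distT (x - y))"

lemma separated_supports_disjoint_orbitals:
  assumes "\<And>j. j < n \<Longrightarrow> orbital (\<phi> j) (\<phi>' j)" "separated_supports a \<phi>" "0 < a"
  shows "disjoint_orbitals n \<phi> \<phi>'"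
  unfolding disjoint_orbitals_def
proof (intro conjI allI impI ballI)
  fix i j t assume "i < n" "j < n" "t \<in> Iper" "i \<noteq> j"
  then show "\<phi> i t * \<phi> j t = 0" using assms(2,3) unfolding separated_supports_def by force
qed (rule assms(1))

lemma separated_supports_cost_le:
  assumes "separated_supports a \<phi>" "\<And>x. x \<in> separated a \<Longrightarrow> cN n w x \<le> ennreal S"
  shows "support_cost_le n w \<phi> S"
  unfolding support_cost_le_def using assms by (auto simp: separated_supports_def separated_def)

text \<open>A density bounded above and below is cut into 2n windows of equal mass, equally spaced in its mass coordinate;
  the n windows of equal parity are separated, and each such class is the density of one Slater determinant.\<close>

lemma orbital_bound_density:
  assumes m: "0 < m" and M: "0 < M"
  obtains K S where "0 \<le> K" "0 \<le> S"
    "\<And>\<epsilon> V g g'. 0 \<le> \<epsilon> \<Longrightarrow> Hminus V \<Longrightarrow> orbital_bound \<epsilon> V \<Longrightarrow> C1per g g' \<Longrightarrow> (\<And>t. m \<le> g t) \<Longrightarrow> (\<And>t. g t \<le> M) \<Longrightarrow>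
       (\<integral>t. g t \<partial>Lper) = 1 \<Longrightarrow> real n * V g \<le> \<epsilon> * (K * (1 + (\<integral>t. (g' t)\<^sup>2 \<partial>Lper))) + S"
proof -
  let ?N = "2 * n"
  have N: "2 \<le> ?N" using n_pos by simp
  obtain W' \<Lambda> where W': "\<And>i. C1per (window ?N i) (W' i)" "\<And>i t. \<bar>W' i t\<bar> \<le> \<Lambda>"
    using window_derivs[OF N] by metis
  define a where "a = 1 / (3 * real n * M)"
  have a: "0 < a" using n_pos M by (simp add: a_def)
  obtain S where S: "0 \<le> S" "\<And>x. x \<in> separated a \<Longrightarrow> cN n w x \<le> ennreal S"
    using cN_bounded_separated[OF a] by metis
  define K where "K = real ?N * (1 / (2 * m) + 4 * pi * M * (\<Lambda> * (2 * pi * M))\<^sup>2)"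
  have K: "0 \<le> K" using m M by (simp add: K_def)
  show ?thesis
  proof (rule that[of "fact n * (real n * K)" S])
    fix \<epsilon> V g g' assume \<epsilon>: "0 \<le> \<epsilon>" and V: "Hminus V" and bound: "orbital_bound \<epsilon> V" and g: "C1per g g'"
      and g_bounds: "\<And>t. m \<le> g t" "\<And>t. g t \<le> M" and g_one: "(\<integral>t. g t \<partial>Lper) = 1"
    have g_pos: "0 < g t" for t using g_bounds(1)[of t] m by linarith
    obtain s where "mass_coordinate g s"
      using mass_coordinate_exists[OF C1per_cont(1)[OF g] C1per_periodic[OF g] g_one] by blast
    then interpret mass_coordinate g s .
    let ?I = "\<integral>t. (g' t)\<^sup>2 \<partial>Lper"
    have parity_class: "(\<Sum>j<n. V (\<lambda>t. (window_orbital ?N (2 * j + r) t)\<^sup>2))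
        \<le> \<epsilon> * (fact n * (real n * K) * (1 + ?I)) + S"
      if r: "r < 2" for r
    proof -
      let ?\<phi> = "\<lambda>j. window_orbital ?N (2 * j + r)"
        and ?\<phi>' = "\<lambda>j. window_orbital_deriv g' (W' (2 * j + r)) ?N (2 * j + r)"
      have supports: "separated_supports a ?\<phi>"
        unfolding separated_supports_def a_def using window_orbital_separated[OF g_pos g_bounds(2)] by blast
      have "(\<Sum>j<n. V (\<lambda>t. (?\<phi> j t)\<^sup>2)) \<le> \<epsilon> * kinetic_bound n ?\<phi>' + S"
        by (intro orbital_boundD[OF bound] separated_supports_disjoint_orbitals[OF _ supports a]
            separated_supports_cost_le[OF supports S(2)] orbital_window_orbital N g g_pos W'(1) S(1))
      also have "kinetic_bound n ?\<phi>' \<le> fact n * (\<Sum>j<n. K * (1 + ?I))"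
        unfolding kinetic_bound_def K_def using r
        by (intro mult_left_mono sum_mono window_orbital_kinetic_le N g W' m g_bounds) auto
      also have "\<dots> = fact n * (real n * K) * (1 + ?I)" by simp
      finally show ?thesis using \<epsilon> by (simp only: mult_left_mono add_right_mono)
    qed
    show "real n * V g \<le> \<epsilon> * (fact n * (real n * K) * (1 + ?I)) + S"
      using Hminus_window_orbitals[OF n_pos V g g_pos W'(1)] parity_class[of 0] parity_class[of 1] by simp
  qed (use K S(1) in simp_all)
qed

lemma C1per_normalize:
  assumes m: "0 < m" and h: "C1per h h'" and h_bounds: "\<And>t. m \<le> h t" "\<And>t. h t \<le> M"
  defines "c \<equiv> \<integral>t. h t \<partial>Lper"
  shows "2 * pi * m \<le> c" "c \<le> 2 * pi * M" "m / (2 * pi * M) \<le> 1 / c * h t" "1 / c * h t \<le> M / (2 * pi * m)"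
    "(\<integral>t. 1 / c * h t \<partial>Lper) = 1" "(\<integral>t. (1 / c * h' t)\<^sup>2 \<partial>Lper) \<le> (\<integral>t. (h' t)\<^sup>2 \<partial>Lper) / (2 * pi * m)\<^sup>2"
proof -
  have "(\<integral>t. m \<partial>Lper) \<le> c" "c \<le> (\<integral>t. M \<partial>Lper)" unfolding c_def
    by (intro integral_mono integrable_Lper_cont C1per_cont[OF h] h_bounds continuous_on_const)+
  then show c: "2 * pi * m \<le> c" "c \<le> 2 * pi * M" by (simp_all add: measure_Lper)
  have lower_pos: "0 < 2 * pi * m" using m by simp
  then have c_pos: "0 < c" using c(1) by linarith
  show "m / (2 * pi * M) \<le> 1 / c * h t" "1 / c * h t \<le> M / (2 * pi * m)"
    using frac_le[of "h t" m c "2 * pi * M"] frac_le[of M "h t" "2 * pi * m" c]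
      h_bounds[of t] c c_pos lower_pos m by simp_all
  show "(\<integral>t. 1 / c * h t \<partial>Lper) = 1" using c_pos by (simp add: c_def[symmetric])
  have "(1 / c)\<^sup>2 \<le> (1 / (2 * pi * m))\<^sup>2"
    using c(1) c_pos lower_pos by (intro power_mono divide_left_mono) auto
  then have "(1 / c)\<^sup>2 * (\<integral>t. (h' t)\<^sup>2 \<partial>Lper) \<le> (1 / (2 * pi * m))\<^sup>2 * (\<integral>t. (h' t)\<^sup>2 \<partial>Lper)"
    by (intro mult_right_mono) auto
  then show "(\<integral>t. (1 / c * h' t)\<^sup>2 \<partial>Lper) \<le> (\<integral>t. (h' t)\<^sup>2 \<partial>Lper) / (2 * pi * m)\<^sup>2"
    by (simp add: power_mult_distrib power_divide)
qed

lemma positive_C1_bound: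
  assumes m: "0 < m" "m \<le> M" and D: "0 \<le> D"
  obtains B where "0 \<le> B"
    "\<And>\<epsilon> V h h'. 0 \<le> \<epsilon> \<Longrightarrow> \<epsilon> \<le> 1 \<Longrightarrow> Hminus V \<Longrightarrow> orbital_bound \<epsilon> V \<Longrightarrow> C1per h h' \<Longrightarrow> (\<And>t. m \<le> h t) \<Longrightarrow> (\<And>t. h t \<le> M) \<Longrightarrow>
       (\<integral>t. (h' t)\<^sup>2 \<partial>Lper) \<le> D \<Longrightarrow> V h \<le> B"
proof -
  let ?c0 = "2 * pi * m" and ?c1 = "2 * pi * M"
  have M: "0 < M" using m by linarith
  then have density_bounds_pos: "0 < m / ?c1" "0 < M / ?c0" using m by simp_all
  obtain K S where K: "0 \<le> K" and S: "0 \<le> S"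
    and density: "\<And>\<epsilon> V g g'. 0 \<le> \<epsilon> \<Longrightarrow> Hminus V \<Longrightarrow> orbital_bound \<epsilon> V \<Longrightarrow> C1per g g' \<Longrightarrow>
       (\<And>t. m / ?c1 \<le> g t) \<Longrightarrow> (\<And>t. g t \<le> M / ?c0) \<Longrightarrow>
       (\<integral>t. g t \<partial>Lper) = 1 \<Longrightarrow> real n * V g \<le> \<epsilon> * (K * (1 + (\<integral>t. (g' t)\<^sup>2 \<partial>Lper))) + S"
    by (rule orbital_bound_density[OF density_bounds_pos]) blast
  define E where "E = K * (1 + D / ?c0\<^sup>2) + S"
  have E: "0 \<le> E" using K S D by (simp add: E_def)
  show ?thesis
  proof (rule that[of "?c1 * E"])
    show "0 \<le> ?c1 * E" using M E by simp
    fix \<epsilon> V h h' assume \<epsilon>: "0 \<le> \<epsilon>" "\<epsilon> \<le> 1" and V: "Hminus V" "orbital_bound \<epsilon> V" and h: "C1per h h'"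
      and h_bounds: "\<And>t. m \<le> h t" "\<And>t. h t \<le> M" and h'_le: "(\<integral>t. (h' t)\<^sup>2 \<partial>Lper) \<le> D"
    define c where "c = (\<integral>t. h t \<partial>Lper)"
    note normalized = C1per_normalize[OF m(1) h h_bounds, folded c_def]
    have c_pos: "0 < c" using normalized(1) m(1) by (smt (verit) mult_pos_pos pi_gt_zero)
    have g'_le: "(\<integral>t. (1 / c * h' t)\<^sup>2 \<partial>Lper) \<le> D / ?c0\<^sup>2"
      using normalized(6) h'_le by (rule order_trans[OF _ divide_right_mono]) simp
    have "real n * V (\<lambda>t. 1 / c * h t) \<le> \<epsilon> * (K * (1 + (\<integral>t. (1 / c * h' t)\<^sup>2 \<partial>Lper))) + S"
      by (rule density[OF \<epsilon>(1) V C1per_cmult[OF h] normalized(3-5)])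
    also have "\<dots> \<le> 1 * (K * (1 + D / ?c0\<^sup>2)) + S"
      using \<epsilon> K by (intro add_right_mono mult_mono add_left_mono g'_le) simp_all
    finally have "real n * V (\<lambda>t. (1 / c) * h t) \<le> E" by (simp add: E_def)
    then have "V (\<lambda>t. (1 / c) * h t) \<le> E / real n" using n_pos by (simp add: field_simps)
    also have "\<dots> \<le> E" using E n_pos by (simp add: divide_le_eq mult_le_cancel_left1)
    finally have "V h / c \<le> E" using Hminus_cmult[OF V(1) C1per_H1per[OF h], of "1 / c"] by simp
    then have "V h \<le> c * E" using c_pos by (simp add: field_simps)
    also have "\<dots> \<le> ?c1 * E" using normalized(2) E by (intro mult_right_mono) auto
    finally show "V h \<le> ?c1 * E" .
  qed
qed

end

lemma H1_limit_eventually_between: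
  assumes T_limit: "H1_limit T T' f g" and f_cont: "continuous_on Iper f"
    and bounds: "\<And>t. t \<in> Iper \<Longrightarrow> a < f t" "\<And>t. t \<in> Iper \<Longrightarrow> f t < b"
  shows "\<forall>\<^sub>F k in sequentially. \<forall>t. a < T k t \<and> T k t < b"
proof -
  obtain p where p: "p \<in> Iper" "\<And>t. t \<in> Iper \<Longrightarrow> f p \<le> f t"
    using continuous_attains_inf[OF compact_Iper Iper_nonempty f_cont] by auto
  obtain q where q: "q \<in> Iper" "\<And>t. t \<in> Iper \<Longrightarrow> f t \<le> f q"
    using continuous_attains_sup[OF compact_Iper Iper_nonempty f_cont] by auto
  define e where "e = min (f p - a) (b - f q)"
  have "0 < e" using bounds p(1) q(1) by (simp add: e_def)
  then have "\<forall>\<^sub>F k in sequentially. \<forall>t\<in>Iper. dist (T k t) (f t) < e"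
    using H1_limit_uniform[OF T_limit f_cont] by (simp add: uniform_limit_iff)
  then show ?thesis
  proof (rule eventually_mono)
    fix k assume close: "\<forall>t\<in>Iper. dist (T k t) (f t) < e"
    show "\<forall>t. a < T k t \<and> T k t < b"
    proof
      fix t
      show "a < T k t \<and> T k t < b"
      proof (rule periodic_all_if_Iper[of "T k" "\<lambda>y. a < y \<and> y < b"])
        show "T k (t + 2 * pi) = T k t" for t by (rule C1per_periodic[OF H1_limitD(2)[OF T_limit]])
        fix t assume t: "t \<in> Iper"
        then have "\<bar>T k t - f t\<bar> < e" using close by (simp add: dist_real_def)
        then show "a < T k t \<and> T k t < b" using p(2)[OF t] q(2)[OF t] unfolding e_def by linarith
      qed
    qed
  qed
qed

lemma H1_limit_eventually_deriv_le:
  assumes T_limit: "H1_limit T T' f g"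
  shows "\<forall>\<^sub>F k in sequentially. (\<integral>t. (T' k t)\<^sup>2 \<partial>Lper) \<le> 2 * (\<integral>t. (g t)\<^sup>2 \<partial>Lper) + 2"
proof -
  have "\<forall>\<^sub>F k in sequentially. H1_norm_sq (\<lambda>t. f t - T k t) (\<lambda>t. g t - T' k t) < 1"
    by (rule order_tendstoD(2)[OF H1_limitD(3)[OF T_limit]]) simp
  then show ?thesis
  proof (rule eventually_mono)
    fix k assume "H1_norm_sq (\<lambda>t. f t - T k t) (\<lambda>t. g t - T' k t) < 1"
    then have "(\<integral>t. (g t - T' k t)\<^sup>2 \<partial>Lper) \<le> 1"
      using integral_power2_le_H1_norm_sq(2)[of "\<lambda>t. g t - T' k t" "\<lambda>t. f t - T k t"] by linarith
    moreover have "(\<integral>t. (T' k t - 0)\<^sup>2 \<partial>Lper) \<le> 2 * (\<integral>t. (T' k t - g t)\<^sup>2 \<partial>Lper) + 2 * (\<integral>t. (g t - 0)\<^sup>2 \<partial>Lper)"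
      using C1per_wderiv[OF H1_limitD(2)[OF T_limit]] H1_limitD(1)[OF T_limit]
      by (intro integral_diff_power2_triangle wderiv1_square_integrable(2) square_integrable_cont continuous_intros)
    ultimately show "(\<integral>t. (T' k t)\<^sup>2 \<partial>Lper) \<le> 2 * (\<integral>t. (g t)\<^sup>2 \<partial>Lper) + 2"
      by (simp add: power2_commute[of "T' k _" "g _"])
  qed
qed

lemma integral_add_power2_le:
  fixes f h :: "real \<Rightarrow> real"
  assumes cont: "continuous_on Iper f" "continuous_on Iper h"
  shows "(\<integral>t. (f t + c * h t)\<^sup>2 \<partial>Lper) \<le> 2 * (\<integral>t. (f t)\<^sup>2 \<partial>Lper) + 2 * c\<^sup>2 * (\<integral>t. (h t)\<^sup>2 \<partial>Lper)"
proof -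
  have "(\<integral>t. (f t + c * h t)\<^sup>2 \<partial>Lper) \<le> (\<integral>t. 2 * (f t)\<^sup>2 + 2 * c\<^sup>2 * (h t)\<^sup>2 \<partial>Lper)"
  proof (rule integral_mono)
    show "(f t + c * h t)\<^sup>2 \<le> 2 * (f t)\<^sup>2 + 2 * c\<^sup>2 * (h t)\<^sup>2" for t
      using norm_add_power2_le[of "f t" "c * h t"] by (simp add: power_mult_distrib)
  qed (intro integrable_Lper_cont continuous_intros cont)+
  also have "\<dots> = 2 * (\<integral>t. (f t)\<^sup>2 \<partial>Lper) + 2 * c\<^sup>2 * (\<integral>t. (h t)\<^sup>2 \<partial>Lper)"
    by (simp add: integrable_Lper_cont continuous_on_power cont)
  finally show ?thesis .
qed

lemma Hminus_bound_from_unit_ball: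
  assumes V: "Hminus V" and unit: "\<And>h h'. C1per h h' \<Longrightarrow> H1_norm_sq h h' \<le> 1 \<Longrightarrow> V h \<le> C" and f: "C1per f f'"
  shows "\<bar>V f\<bar> \<le> C * sqrt (H1_norm_sq f f')"
proof -
  define q where "q = sqrt (H1_norm_sq f f')"
  have q: "0 \<le> q" by (simp add: q_def H1_norm_sq_nonneg)
  have scaled: "\<sigma> * V f \<le> C * s" if s: "0 < s" "q \<le> s" and \<sigma>: "\<sigma>\<^sup>2 = 1" for \<sigma> s :: real
  proof -
    have "H1_norm_sq f f' = q\<^sup>2" by (simp add: q_def H1_norm_sq_nonneg)
    also have "\<dots> \<le> s\<^sup>2" using q s by (intro power_mono) auto
    finally have "H1_norm_sq (\<lambda>t. (\<sigma> / s) * f t) (\<lambda>t. (\<sigma> / s) * f' t) \<le> 1"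
      unfolding H1_norm_sq_cmult power_divide \<sigma> using s by (simp add: field_simps)
    then have "V (\<lambda>t. (\<sigma> / s) * f t) \<le> C" by (rule unit[OF C1per_cmult[OF f]])
    then have "\<sigma> / s * V f \<le> C" unfolding Hminus_cmult[OF V C1per_H1per[OF f]] .
    then show ?thesis using s by (simp add: field_simps)
  qed
  have C: "0 \<le> C" using unit[OF C1per_const, of 0] Hminus_zero[OF V] by (simp add: H1_norm_sq_def)
  show ?thesis unfolding q_def[symmetric]
  proof (rule field_le_epsilon)
    fix e :: real assume e: "0 < e"
    define s where "s = q + e / (C + 1)"
    have "\<bar>V f\<bar> \<le> C * s" using scaled[of s 1] scaled[of s "-1"] q e C by (auto simp: s_def add_nonneg_pos)
    also have "\<dots> = C * q + C / (C + 1) * e" by (simp add: s_def distrib_left)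
    also have "\<dots> \<le> C * q + 1 * e" using C e by (intro add_left_mono mult_right_mono) auto
    finally show "\<bar>V f\<bar> \<le> C * q + e" by simp
  qed
qed

context cost
begin

lemma unit_ball_perturbation_bounds:
  assumes T: "C1per T T'" "\<And>t. a \<le> T t" "\<And>t. T t \<le> b" "(\<integral>t. (T' t)\<^sup>2 \<partial>Lper) \<le> R"
    and f: "C1per f f'" "H1_norm_sq f f' \<le> 1" and "0 \<le> c"
  shows "a - 2 * c \<le> T t + c * f t" "T t + c * f t \<le> b + 2 * c" "(\<integral>t. (T' t + c * f' t)\<^sup>2 \<partial>Lper) \<le> 2 * R + 2 * c\<^sup>2"
proof -
  have "\<bar>f t\<bar> \<le> 2" using C1per_sup_bound[OF f(1), of t] f(2) abs_le_square_iff[of "f t" 2] by simp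
  then have "\<bar>c * f t\<bar> \<le> c * 2" unfolding abs_mult using \<open>0 \<le> c\<close> by (intro mult_mono) auto
  then show "a - 2 * c \<le> T t + c * f t" "T t + c * f t \<le> b + 2 * c"
    using T(2,3)[of t] unfolding abs_le_iff by linarith+
  have "(\<integral>t. (T' t + c * f' t)\<^sup>2 \<partial>Lper) \<le> 2 * (\<integral>t. (T' t)\<^sup>2 \<partial>Lper) + 2 * c\<^sup>2 * (\<integral>t. (f' t)\<^sup>2 \<partial>Lper)"
    using integral_add_power2_le[of T' f' c] C1per_cont[OF T(1)] C1per_cont[OF f(1)] by simp
  also have "\<dots> \<le> 2 * R + 2 * c\<^sup>2 * 1"
    using T(4) integral_power2_le_H1_norm_sq(2)[of f' f] f(2) by (intro add_mono mult_left_mono) auto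
  finally show "(\<integral>t. (T' t + c * f' t)\<^sup>2 \<partial>Lper) \<le> 2 * R + 2 * c\<^sup>2" by simp
qed

lemma orbital_bound_H1_perturbation:
  assumes \<rho>: "Dper \<rho>"
  obtains \<delta> B where "0 < \<delta>" "0 \<le> B"
    "\<And>\<epsilon> V f f'. 0 \<le> \<epsilon> \<Longrightarrow> \<epsilon> \<le> 1 \<Longrightarrow> Hminus V \<Longrightarrow> orbital_bound \<epsilon> V \<Longrightarrow> C1per f f' \<Longrightarrow> H1_norm_sq f f' \<le> 1 \<Longrightarrow> V \<rho> + \<delta> * V f \<le> B"
proof -
  have \<rho>_facts: "H1per \<rho>" "continuous_on Iper \<rho>" "\<And>x. x \<in> Iper \<Longrightarrow> 0 < \<rho> x" using \<rho> by (auto simp: Dper_def)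
  obtain g T T' where T_limit: "H1_limit T T' \<rho> g"
    using \<rho>_facts(1) H1per_iff_real_wderiv H1per_limit_of_trig_sums by metis
  obtain m where m: "0 < m" "\<And>t. t \<in> Iper \<Longrightarrow> m \<le> \<rho> t"
    using continuous_attains_inf[OF compact_Iper Iper_nonempty \<rho>_facts(2)] \<rho>_facts(3) by metis
  obtain M where M: "0 \<le> M" "\<And>t. t \<in> Iper \<Longrightarrow> \<bar>\<rho> t\<bar> \<le> M" using continuous_bounded_Iper[OF \<rho>_facts(2)] by metis
  define R where "R = 2 * (\<integral>t. (g t)\<^sup>2 \<partial>Lper) + 2"
  have "0 \<le> R" by (simp add: R_def)
  obtain B where B: "0 \<le> B"
    and bound: "\<And>\<epsilon> V h h'. 0 \<le> \<epsilon> \<Longrightarrow> \<epsilon> \<le> 1 \<Longrightarrow> Hminus V \<Longrightarrow> orbital_bound \<epsilon> V \<Longrightarrow> C1per h h' \<Longrightarrow> (\<And>t. m / 4 \<le> h t) \<Longrightarrow>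
       (\<And>t. h t \<le> M + 1 + m / 4) \<Longrightarrow> (\<integral>t. (h' t)\<^sup>2 \<partial>Lper) \<le> 2 * R + 2 * (m / 8)\<^sup>2 \<Longrightarrow> V h \<le> B"
    using positive_C1_bound[of "m / 4" "M + 1 + m / 4" "2 * R + 2 * (m / 8)\<^sup>2"] m M(1) \<open>0 \<le> R\<close> by auto
  show ?thesis
  proof (rule that[of "m / 8" B])
    fix \<epsilon> V f f' assume V: "0 \<le> \<epsilon>" "\<epsilon> \<le> 1" "Hminus V" "orbital_bound \<epsilon> V"
      and f: "C1per f f'" "H1_norm_sq f f' \<le> 1"
    have "\<forall>\<^sub>F k in sequentially. \<forall>t. m / 2 < T k t \<and> T k t < M + 1"
      by (rule H1_limit_eventually_between[OF T_limit \<rho>_facts(2)]) (use m M in force)+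
    then have "\<forall>\<^sub>F k in sequentially. V (T k) + m / 8 * V f \<le> B"
      using H1_limit_eventually_deriv_le[OF T_limit]
    proof eventually_elim
      case (elim k)
      note T = H1_limitD(2)[OF T_limit, of k]
      have "m / 2 \<le> T k t" "T k t \<le> M + 1" for t using elim(1) less_imp_le by blast+
      note perturbed = unit_ball_perturbation_bounds[OF T this _ f, of R "m / 8"]
      have h: "C1per (\<lambda>t. T k t + m / 8 * f t) (\<lambda>t. T' k t + m / 8 * f' t)"
        using C1per_lin[OF T f(1), of 1 "m / 8"] by simp
      have "V (\<lambda>t. T k t + m / 8 * f t) \<le> B"
        by (rule bound[OF V h]) (use perturbed elim(2) m in \<open>auto simp: R_def\<close>)
      then show ?case
        using Hminus_lin[OF V(3) H1_limit_H1per(2)[OF T_limit] C1per_H1per[OF f(1)], of 1 k "m / 8"] by simp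
    qed
    moreover have "(\<lambda>k. V (T k) + m / 8 * V f) \<longlonglongrightarrow> V \<rho> + m / 8 * V f"
      by (intro tendsto_intros Hminus_continuous[OF V(3) T_limit])
    ultimately show "V \<rho> + m / 8 * V f \<le> B" by (intro tendsto_upperbound) auto
  qed (use m B in simp_all)
qed

lemma orbital_bound_uniform_H1_bound:
  assumes \<rho>: "Dper \<rho>"
  obtains C where "\<And>\<epsilon> V f g. 0 \<le> \<epsilon> \<Longrightarrow> \<epsilon> \<le> 1 \<Longrightarrow> Hminus V \<Longrightarrow> orbital_bound \<epsilon> V \<Longrightarrow> 0 \<le> V \<rho> \<Longrightarrow>
     real_wderiv f g \<Longrightarrow> \<bar>V f\<bar> \<le> C * sqrt (H1_norm_sq f g)"
proof -
  obtain \<delta> B where \<delta>: "0 < \<delta>" and B: "0 \<le> B"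
    and bound: "\<And>\<epsilon> V f f'. 0 \<le> \<epsilon> \<Longrightarrow> \<epsilon> \<le> 1 \<Longrightarrow> Hminus V \<Longrightarrow> orbital_bound \<epsilon> V \<Longrightarrow> C1per f f' \<Longrightarrow>
       H1_norm_sq f f' \<le> 1 \<Longrightarrow> V \<rho> + \<delta> * V f \<le> B"
    using orbital_bound_H1_perturbation[OF \<rho>] by metis
  show ?thesis
  proof (rule that[of "B / \<delta> * sqrt 2"])
    fix \<epsilon> V f g assume V: "0 \<le> \<epsilon>" "\<epsilon> \<le> 1" "Hminus V" "orbital_bound \<epsilon> V" and "0 \<le> V \<rho>"
      and w: "real_wderiv f g"
    have "V h \<le> B / \<delta>" if "C1per h h'" "H1_norm_sq h h' \<le> 1" for h h'
      using bound[OF V that] \<open>0 \<le> V \<rho>\<close> \<delta> by (simp add: field_simps)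
    from Hminus_bound_from_unit_ball[OF V(3) this]
    have "\<bar>V f\<bar> \<le> B / \<delta> * sqrt (2 * H1_norm_sq f g)"
      using B \<delta> by (intro Hminus_bound_from_C1per[OF V(3) _ _ w]) auto
    then show "\<bar>V f\<bar> \<le> B / \<delta> * sqrt 2 * sqrt (H1_norm_sq f g)" by (simp add: real_sqrt_mult)
  qed
qed

lemma orbital_bound_weak_limit:
  assumes \<rho>: "Dper \<rho>" and e: "\<And>j. 0 < e j" "\<And>j. e j \<le> 1" "e \<longlonglongrightarrow> 0"
    and V: "\<And>j. Hminus (V j)" "\<And>j. orbital_bound (e j) (V j)" "\<And>j. 0 \<le> V j \<rho>"
  obtains r W where "strict_mono r" "Hminus W" "\<And>f. H1per f \<Longrightarrow> (\<lambda>j. V (r j) f) \<longlonglongrightarrow> W f" "orbital_bound 0 W"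
proof -
  obtain C where "\<And>\<epsilon> V f g. 0 \<le> \<epsilon> \<Longrightarrow> \<epsilon> \<le> 1 \<Longrightarrow> Hminus V \<Longrightarrow> orbital_bound \<epsilon> V \<Longrightarrow> 0 \<le> V \<rho> \<Longrightarrow>
     real_wderiv f g \<Longrightarrow> \<bar>V f\<bar> \<le> C * sqrt (H1_norm_sq f g)"
    using orbital_bound_uniform_H1_bound[OF \<rho>] by metis
  then have bound: "\<bar>V j f\<bar> \<le> C * sqrt (H1_norm_sq f g)" if "real_wderiv f g" for j f g
    using V e(1,2) that less_imp_le by blast
  obtain r W where r: "strict_mono r" and W: "Hminus W" and lim: "\<And>f. H1per f \<Longrightarrow> (\<lambda>j. V (r j) f) \<longlonglongrightarrow> W f"
    using Hminus_weakly_convergent_subsequence[of V C] V(1) bound by blast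
  have e_lim: "(\<lambda>j. e (r j)) \<longlonglongrightarrow> 0" using LIMSEQ_subseq_LIMSEQ[OF e(3) r] by (simp add: o_def)
  have "orbital_bound 0 W" unfolding orbital_bound_def
  proof (intro allI impI)
    fix \<phi> \<phi>' S assume \<phi>: "disjoint_orbitals n \<phi> \<phi>'" "support_cost_le n w \<phi> S" "0 \<le> S"
    have "H1per (\<lambda>t. (\<phi> j t)\<^sup>2)" if "j < n" for j
      using \<phi>(1) that C1per_H1per[OF C1per_power2] by (auto simp: disjoint_orbitals_def orbital_def)
    then have "(\<lambda>i. \<Sum>j<n. V (r i) (\<lambda>t. (\<phi> j t)\<^sup>2)) \<longlonglongrightarrow> (\<Sum>j<n. W (\<lambda>t. (\<phi> j t)\<^sup>2))"
      by (intro tendsto_sum lim) auto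
    moreover have "(\<lambda>i. e (r i) * kinetic_bound n \<phi>' + S) \<longlonglongrightarrow> 0 * kinetic_bound n \<phi>' + S"
      by (intro tendsto_intros e_lim)
    ultimately show "(\<Sum>j<n. W (\<lambda>t. (\<phi> j t)\<^sup>2)) \<le> 0 * kinetic_bound n \<phi>' + S"
      using orbital_boundD[OF V(2) \<phi>] by (intro LIMSEQ_le) auto
  qed
  with r W lim show ?thesis by (rule that)
qed

end

section \<open>Maximal feasible potentials\<close>

lemma sum_fun_upd_point:
  fixes u :: "'b \<Rightarrow> real"
  assumes "finite A" "i \<in> A"
  shows "(\<Sum>j\<in>A. u ((x(i := s)) j)) = (\<Sum>j\<in>A. u (x j)) + u s - u (x i)"
proof -
  have "(\<Sum>j\<in>A. u ((x(i := s)) j)) = u s + (\<Sum>j\<in>A - {i}. u (x j))"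
    using assms by (subst sum.remove[of A i]) (auto intro: sum.cong)
  then show ?thesis using assms by (simp add: sum.remove[of A i "\<lambda>j. u (x j)"])
qed

context cost
begin

definition dual_feasible :: "(real \<Rightarrow> real) \<Rightarrow> bool" where
  "dual_feasible u \<longleftrightarrow> (\<forall>x\<in>noncolliding. (\<Sum>i<n. u (x i)) \<le> real_cost x)"

lemma dual_feasibleD: "dual_feasible u \<Longrightarrow> x \<in> noncolliding \<Longrightarrow> (\<Sum>i<n. u (x i)) \<le> real_cost x"
  by (simp add: dual_feasible_def)

lemma equally_spaced_tuple:
  assumes t: "t \<in> Iper"
  obtains x where "x 0 = t" "x \<in> separated (2 * pi / real n)"
proof -
  have "\<exists>y. y \<in> Iper \<and> (\<exists>k::int. y = t + node n i + 2 * pi * of_int k) \<and> (i = 0 \<longrightarrow> y = t)" for i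
  proof (cases "i = 0")
    case True
    then show ?thesis using t by (intro exI[of _ t]) (auto simp: node_def intro: exI[of _ 0])
  next
    case False
    then show ?thesis using translate_into_Iper[of "t + node n i"] by blast
  qed
  then obtain x where x: "\<And>i. x i \<in> Iper" "\<And>i. \<exists>k::int. x i = t + node n i + 2 * pi * of_int k" "x 0 = t"
    by metis
  have "2 * pi / real n \<le> distT (x i - x j)" if ij: "i < n" "j < n" "i \<noteq> j" for i j
  proof -
    obtain k l where "x i = t + node n i + 2 * pi * of_int k" "x j = t + node n j + 2 * pi * of_int l"
      using x(2) by metis
    then have "x i - x j = (node n i - node n j) + 2 * pi * of_int (k - l)" by (simp add: algebra_simps)
    then have "distT (x i - x j) = distT (node n i - node n j)" by (simp only: distT_periodic)
    then show ?thesis using distT_nodes[OF ij] by simp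
  qed
  then have "x \<in> separated (2 * pi / real n)" using x(1) by (simp add: separated_def)
  with x(3) show ?thesis by (rule that)
qed

lemma dual_feasible_upper_bound:
  obtains S where "0 \<le> S"
    "\<And>u M t. dual_feasible u \<Longrightarrow> (\<And>s. s \<in> Iper \<Longrightarrow> - M \<le> u s) \<Longrightarrow> 0 \<le> M \<Longrightarrow> t \<in> Iper \<Longrightarrow> u t \<le> S + real n * M"
proof -
  have a: "0 < 2 * pi / real n" using n_pos by simp
  obtain S where S: "0 \<le> S" "\<And>x. x \<in> separated (2 * pi / real n) \<Longrightarrow> cN n w x \<le> ennreal S"
    using cN_bounded_separated[OF a] by blast
  show ?thesis
  proof (rule that[OF S(1)])
    fix u M t assume u: "dual_feasible u" "\<And>s. s \<in> Iper \<Longrightarrow> - M \<le> u s" and "0 \<le> M" "t \<in> Iper"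
    obtain x where x: "x 0 = t" "x \<in> separated (2 * pi / real n)"
      using equally_spaced_tuple[OF \<open>t \<in> Iper\<close>] by blast
    have x_noncolliding: "x \<in> noncolliding" by (rule separated_imp_noncolliding[OF x(2) a])
    have "ennreal (real_cost x) \<le> ennreal S" using S(2)[OF x(2)] cN_noncolliding[OF x_noncolliding] by simp
    then have "real_cost x \<le> S" using S(1) by (simp add: ennreal_le_iff)
    then have "(\<Sum>i<n. u (x i)) \<le> S" using dual_feasibleD[OF u(1) x_noncolliding] by linarith
    moreover have "(\<Sum>i<n. u (x i)) = u t + (\<Sum>i\<in>{..<n} - {0}. u (x i))"
      using n_pos x(1) by (subst sum.remove[of _ 0]) auto
    moreover have "(\<Sum>i\<in>{..<n} - {0}. - M) \<le> (\<Sum>i\<in>{..<n} - {0}. u (x i))"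
      using u(2) noncolliding_Iper[OF x_noncolliding] by (intro sum_mono) auto
    moreover have "(\<Sum>i\<in>{..<n} - {0}. - M) = M - real n * M"
      using n_pos by (simp add: of_nat_diff algebra_simps)
    ultimately show "u t \<le> S + real n * M" using \<open>0 \<le> M\<close> by linarith
  qed
qed

lemma dual_feasible_Sup_chain:
  assumes chain: "\<And>a b. a \<in> F \<Longrightarrow> b \<in> F \<Longrightarrow> a \<le> b \<or> b \<le> a" and "F \<noteq> {}"
    and feasible: "\<And>a. a \<in> F \<Longrightarrow> dual_feasible a"
    and u: "\<And>t. t \<in> Iper \<Longrightarrow> u t = Sup ((\<lambda>a. a t) ` F)"
  shows "dual_feasible u"
  unfolding dual_feasible_def
proof (intro ballI, rule field_le_epsilon)
  fix x e assume x: "x \<in> noncolliding" and e: "(0::real) < e"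
  have "\<exists>a\<in>F. u (x i) < a (x i) + e / real n" if i: "i < n" for i
  proof -
    have "u (x i) - e / real n < Sup ((\<lambda>a. a (x i)) ` F)"
      using u noncolliding_Iper[OF x i] e n_pos by simp
    then obtain y where "y \<in> (\<lambda>a. a (x i)) ` F" "u (x i) - e / real n < y" using less_cSupE \<open>F \<noteq> {}\<close> by blast
    then show ?thesis by (auto simp only: diff_less_eq image_iff)
  qed
  then obtain a where a: "\<And>i. i < n \<Longrightarrow> a i \<in> F" "\<And>i. i < n \<Longrightarrow> u (x i) < a i (x i) + e / real n" by metis
  have "finite (a ` {..<n})" "a ` {..<n} \<noteq> {}" using n_pos by (auto simp: lessThan_empty_iff)
  from finite_has_maximal[OF this] obtain m where m: "m \<in> a ` {..<n}" "\<And>b. b \<in> a ` {..<n} \<Longrightarrow> m \<le> b \<Longrightarrow> m = b"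
    by blast
  have m_in: "m \<in> F" using m(1) a(1) by auto
  have a_le: "a i \<le> m" if "i < n" for i using chain[OF a(1)[OF that] m_in] m(2)[of "a i"] that by auto
  have "(\<Sum>i<n. u (x i)) \<le> (\<Sum>i<n. m (x i) + e / real n)"
  proof (rule sum_mono)
    fix i assume "i \<in> {..<n}"
    then show "u (x i) \<le> m (x i) + e / real n" using a(2)[of i] le_funD[OF a_le[of i], of "x i"] by auto
  qed
  also have "\<dots> = (\<Sum>i<n. m (x i)) + e" using n_pos by (simp add: sum.distrib)
  also have "\<dots> \<le> real_cost x + e" using dual_feasibleD[OF feasible[OF m_in] x] by simp
  finally show "(\<Sum>i<n. u (x i)) \<le> real_cost x + e" .
qed

definition feasible_above :: "(real \<Rightarrow> real) \<Rightarrow> (real \<Rightarrow> real) set" where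
  "feasible_above v = {u. dual_feasible u \<and> (\<forall>t\<in>Iper. v t \<le> u t) \<and> (\<forall>t. t \<notin> Iper \<longrightarrow> u t = 0)}"

lemma feasible_above_nonempty:
  assumes "dual_feasible v"
  shows "(\<lambda>t. if t \<in> Iper then v t else 0) \<in> feasible_above v"
  unfolding feasible_above_def dual_feasible_def
proof (intro CollectI conjI ballI allI impI)
  fix x assume x: "x \<in> noncolliding"
  have "(\<Sum>i<n. if x i \<in> Iper then v (x i) else 0) = (\<Sum>i<n. v (x i))"
    using noncolliding_Iper[OF x] by (intro sum.cong) auto
  then show "(\<Sum>i<n. if x i \<in> Iper then v (x i) else 0) \<le> real_cost x" using dual_feasibleD[OF assms x] by simp
qed auto

lemma feasible_above_chain_bounded:
  assumes chain: "\<And>a b. a \<in> F \<Longrightarrow> b \<in> F \<Longrightarrow> a \<le> b \<or> b \<le> a" and F: "F \<subseteq> feasible_above v" "F \<noteq> {}"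
    and upper: "\<And>a t. a \<in> feasible_above v \<Longrightarrow> t \<in> Iper \<Longrightarrow> a t \<le> B"
  obtains u where "u \<in> feasible_above v" "\<And>a. a \<in> F \<Longrightarrow> a \<le> u"
proof -
  define u where "u = (\<lambda>t. if t \<in> Iper then Sup ((\<lambda>a. a t) ` F) else 0)"
  have a_le: "a t \<le> u t" if "a \<in> F" for a t
  proof (cases "t \<in> Iper")
    case True
    have "bdd_above ((\<lambda>a. a t) ` F)" using upper F(1) True by (intro bdd_aboveI[of _ B]) auto
    then show ?thesis using that True by (auto simp: u_def intro: cSup_upper)
  next
    case False
    then show ?thesis using that F(1) by (auto simp: u_def feasible_above_def)
  qed
  have "u \<in> feasible_above v" unfolding feasible_above_def
  proof (intro CollectI conjI ballI allI impI)
    show "dual_feasible u"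
    proof (rule dual_feasible_Sup_chain[OF chain F(2)])
      show "dual_feasible a" if "a \<in> F" for a using that F(1) by (auto simp: feasible_above_def)
      show "u t = Sup ((\<lambda>a. a t) ` F)" if "t \<in> Iper" for t using that by (simp add: u_def)
    qed
    obtain a where a: "a \<in> F" using F(2) by blast
    show "v t \<le> u t" if "t \<in> Iper" for t
      using a_le[OF a, of t] a F(1) that by (force simp: feasible_above_def)
    show "u t = 0" if "t \<notin> Iper" for t using that by (simp add: u_def)
  qed
  then show ?thesis using a_le by (intro that) (auto simp: le_fun_def)
qed

lemma feasible_above_maximal:
  assumes v: "dual_feasible v" and upper: "\<And>a t. a \<in> feasible_above v \<Longrightarrow> t \<in> Iper \<Longrightarrow> a t \<le> B"
  obtains u where "u \<in> feasible_above v" "\<And>a. a \<in> feasible_above v \<Longrightarrow> u \<le> a \<Longrightarrow> a = u"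
proof -
  have "\<exists>u\<in>feasible_above v. \<forall>a\<in>feasible_above v. u \<le> a \<longrightarrow> a = u"
  proof (rule predicate_Zorn)
    show "partial_order_on (feasible_above v) (relation_of (\<le>) (feasible_above v))"
      by (rule partial_order_on_relation_ofI) auto
    fix F assume F: "F \<in> Chains (relation_of (\<le>) (feasible_above v))"
    show "\<exists>u\<in>feasible_above v. \<forall>a\<in>F. a \<le> u"
    proof (cases "F = {}")
      case True
      then show ?thesis using feasible_above_nonempty[OF v] by blast
    next
      case False
      have "a \<le> b \<or> b \<le> a" if "a \<in> F" "b \<in> F" for a b using F that by (auto simp: Chains_def relation_of_def)
      moreover have "F \<subseteq> feasible_above v" using F by (auto simp: Chains_def relation_of_def)
      ultimately show ?thesis using feasible_above_chain_bounded[of F v B] False upper by metis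
    qed
  qed
  then show ?thesis using that by blast
qed

text \<open>A maximal feasible potential is c-conjugate: at every point the constraint is nearly active along some
  configuration, where the point occurs only once because the cost is infinite on the diagonal.\<close>

definition nearly_active :: "(real \<Rightarrow> real) \<Rightarrow> bool" where
  "nearly_active u \<longleftrightarrow> (\<forall>t\<in>Iper. \<forall>e>0. \<exists>x\<in>noncolliding. \<exists>i<n. x i = t \<and> real_cost x - e < (\<Sum>j<n. u (x j)))"

lemma maximal_imp_nearly_active:
  assumes u: "u \<in> feasible_above v" and maximal: "\<And>a. a \<in> feasible_above v \<Longrightarrow> u \<le> a \<Longrightarrow> a = u"
  shows "nearly_active u"
  unfolding nearly_active_def
proof (intro ballI allI impI, rule ccontr)
  fix t e assume t: "t \<in> Iper" and e: "(0::real) < e"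
    and "\<not> (\<exists>x\<in>noncolliding. \<exists>i<n. x i = t \<and> real_cost x - e < (\<Sum>j<n. u (x j)))"
  then have slack: "(\<Sum>j<n. u (x j)) \<le> real_cost x - e" if "x \<in> noncolliding" "i < n" "x i = t" for x i
    using that by force
  let ?u = "u(t := u t + e)"
  have "dual_feasible ?u" unfolding dual_feasible_def
  proof
    fix x assume x: "x \<in> noncolliding"
    show "(\<Sum>i<n. ?u (x i)) \<le> real_cost x"
    proof (cases "\<exists>i<n. x i = t")
      case False
      then have "(\<Sum>i<n. ?u (x i)) = (\<Sum>i<n. u (x i))" by (intro sum.cong) auto
      then show ?thesis using u x by (simp add: feasible_above_def dual_feasibleD)
    next
      case True
      then obtain i where i: "i < n" "x i = t" by blast
      have "x j \<noteq> t" if "j < n" "j \<noteq> i" for j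
        using x i that unfolding noncolliding_def by fastforce
      then have "(\<Sum>j<n. ?u (x j)) = (\<Sum>j<n. u (x j) + (if j = i then e else 0))"
        using i(2) by (intro sum.cong) auto
      also have "\<dots> = (\<Sum>j<n. u (x j)) + e" using i(1) by (simp add: sum.distrib)
      finally show ?thesis using slack[OF x i] by simp
    qed
  qed
  moreover have "v s \<le> ?u s" if "s \<in> Iper" for s
    using u that e by (auto simp: feasible_above_def intro: order_trans)
  ultimately have "?u \<in> feasible_above v" using u t by (auto simp: feasible_above_def)
  moreover have "u \<le> ?u" using e by (auto simp: le_fun_def)
  ultimately have "?u = u" by (rule maximal)
  then have "?u t = u t" by metis
  then show False using e by simp
qed

lemma nearly_active_difference:
  assumes feasible: "dual_feasible u" and active: "nearly_active u" and upper: "\<And>t. t \<in> Iper \<Longrightarrow> u t \<le> B"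
    and e: "0 < e" "e \<le> 1"
  obtains d where "0 < d" "\<And>s t. s \<in> Iper \<Longrightarrow> t \<in> Iper \<Longrightarrow> \<bar>s - t\<bar> < d \<Longrightarrow> u s - u t < 2 * e"
proof -
  obtain a
    where a: "0 < a" "\<And>x. (\<And>i. i < n \<Longrightarrow> x i \<in> Iper) \<Longrightarrow> cN n w x \<le> ennreal (real n * B + 1) \<Longrightarrow> x \<in> separated a"
    using separated_if_cN_bounded[of "real n * B + 1"] by blast
  obtain d where d: "cost_modulus a e d" using cost_modulus_exists[OF a(1) e(1)] by blast
  have "u s - u t < 2 * e" if st: "s \<in> Iper" "t \<in> Iper" "\<bar>s - t\<bar> < d" for s t
  proof -
    obtain x i where x: "x \<in> noncolliding" "i < n" "x i = t" "real_cost x - e < (\<Sum>j<n. u (x j))"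
      using active e(1) st(2) unfolding nearly_active_def by blast
    have "(\<Sum>j<n. u (x j)) \<le> (\<Sum>j<n. B)" using upper noncolliding_Iper[OF x(1)] by (intro sum_mono) auto
    then have "cN n w x \<le> ennreal (real n * B + 1)"
      unfolding cN_noncolliding[OF x(1)] using x(4) e(2) by (intro ennreal_leI) simp
    then have x_separated: "x \<in> separated a" by (intro a(2) noncolliding_Iper[OF x(1)])
    let ?y = "x(i := s)"
    have y: "?y j \<in> Iper" "\<bar>?y j - x j\<bar> < d" if "j < n" for j
      using noncolliding_Iper[OF x(1) that] st x(3) d by (auto simp: cost_modulus_def)
    note y_facts = cost_modulusD[OF d x_separated y]
    have "(\<Sum>j<n. u (?y j)) \<le> real_cost ?y"
      using y_facts(1) a(1)
      by (intro dual_feasibleD[OF feasible] separated_imp_noncolliding[of _ "a / 2"]) auto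
    moreover have "(\<Sum>j<n. u (?y j)) = (\<Sum>j<n. u (x j)) + u s - u t"
      using x(2,3) by (subst sum_fun_upd_point) auto
    ultimately show ?thesis using y_facts(2) x(4) unfolding abs_less_iff by linarith
  qed
  then show ?thesis using d by (intro that[of d]) (simp add: cost_modulus_def)
qed

lemma nearly_active_continuous:
  assumes "dual_feasible u" "nearly_active u" "\<And>t. t \<in> Iper \<Longrightarrow> u t \<le> B"
  shows "continuous_on Iper u"
  unfolding continuous_on_iff
proof (intro ballI allI impI)
  fix t e :: real assume t: "t \<in> Iper" and e: "0 < e"
  obtain d where d: "0 < d" "\<And>s t. s \<in> Iper \<Longrightarrow> t \<in> Iper \<Longrightarrow> \<bar>s - t\<bar> < d \<Longrightarrow> u s - u t < 2 * min 1 (e / 3)"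
    using nearly_active_difference[OF assms, of "min 1 (e / 3)"] e by auto
  have "dist (u s) (u t) < e" if "s \<in> Iper" "dist s t < d" for s
    using d(2)[OF that(1) t] d(2)[OF t that(1)] that(2) e unfolding dist_real_def by linarith
  then show "\<exists>d>0. \<forall>s\<in>Iper. dist s t < d \<longrightarrow> dist (u s) (u t) < e" using d(1) by blast
qed

lemma continuous_dual_feasible_above:
  assumes v: "dual_feasible v" and lower: "\<And>t. t \<in> Iper \<Longrightarrow> - M \<le> v t" "0 \<le> M"
  obtains u where "dual_feasible u" "\<And>t. t \<in> Iper \<Longrightarrow> v t \<le> u t" "continuous_on Iper u"
proof -
  obtain S where S: "\<And>u t. dual_feasible u \<Longrightarrow> (\<And>s. s \<in> Iper \<Longrightarrow> - M \<le> u s) \<Longrightarrow> t \<in> Iper \<Longrightarrow> u t \<le> S + real n * M"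
    using dual_feasible_upper_bound lower(2) by metis
  have upper: "a t \<le> S + real n * M" if "a \<in> feasible_above v" "t \<in> Iper" for a t
    using that lower(1) by (intro S) (auto simp: feasible_above_def intro: order_trans)
  obtain u where u: "u \<in> feasible_above v" "\<And>a. a \<in> feasible_above v \<Longrightarrow> u \<le> a \<Longrightarrow> a = u"
    using feasible_above_maximal[of v "S + real n * M"] v upper by blast
  have "continuous_on Iper u"
    using nearly_active_continuous[of u] maximal_imp_nearly_active[of u v] u upper[OF u(1)]
    unfolding feasible_above_def by blast
  then show ?thesis using u(1) by (intro that) (auto simp: feasible_above_def)
qed

end

section \<open>Localised orbitals\<close>

lemma orbital_normalize:
  assumes "C1per \<phi> \<phi>'" "\<And>t. 0 \<le> \<phi> t" and mass: "0 < (\<integral>t. (\<phi> t)\<^sup>2 \<partial>Lper)" (is "0 < ?\<mu>")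
  shows "orbital (\<lambda>t. 1 / sqrt ?\<mu> * \<phi> t) (\<lambda>t. 1 / sqrt ?\<mu> * \<phi>' t)"
  unfolding orbital_def
proof (intro conjI allI C1per_cmult assms(1))
  show "0 \<le> 1 / sqrt ?\<mu> * \<phi> t" for t using assms(2) mass by simp
  show "(\<integral>t. (1 / sqrt ?\<mu> * \<phi> t)\<^sup>2 \<partial>Lper) = 1" using mass by (simp add: power_divide)
qed

lemma narrow_orbital_exists:
  assumes b: "0 < b" "b \<le> pi"
  obtains \<beta> \<beta>' where "orbital \<beta> \<beta>'" "\<And>t. \<beta> t \<noteq> 0 \<Longrightarrow> distT t < b"
proof -
  have "bump b 0 \<noteq> 0" using b by (simp add: bump_neq_0_iff)
  then have "0 < (\<integral>t. (bump b t)\<^sup>2 \<partial>Lper)"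
    by (intro integral_Lper_pos[of _ 0] continuous_intros C1per_cont[OF bump_C1per]) (auto simp: Iper_def)
  note orbital_normalize[OF bump_C1per bump_nonneg this]
  moreover have "distT t < b" if "1 / sqrt (\<integral>t. (bump b t)\<^sup>2 \<partial>Lper) * bump b t \<noteq> 0" for t
    using that b bump_neq_0_iff[of b t] by simp
  ultimately show ?thesis by (rule that)
qed

definition narrow_orbitals :: "real \<Rightarrow> real \<Rightarrow> (real \<Rightarrow> real) set" where
  "narrow_orbitals x d = {\<phi>. (\<exists>\<phi>'. orbital \<phi> \<phi>') \<and> (\<forall>t\<in>Iper. \<phi> t \<noteq> 0 \<longrightarrow> \<bar>t - x\<bar> < d)}"

lemma narrow_orbitalsD: "\<phi> \<in> narrow_orbitals x d \<Longrightarrow> t \<in> Iper \<Longrightarrow> \<phi> t \<noteq> 0 \<Longrightarrow> \<bar>t - x\<bar> < d"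
  by (simp add: narrow_orbitals_def)

lemma narrow_orbitals_mono: "d \<le> d' \<Longrightarrow> narrow_orbitals x d \<subseteq> narrow_orbitals x d'"
  by (auto simp: narrow_orbitals_def intro: less_le_trans)

lemma Hminus_shifts_bounded:
  assumes V: "Hminus V" and f: "C1per f f'"
  obtains q where "0 \<le> q" "\<And>a. \<bar>V (\<lambda>t. f (t - a))\<bar> \<le> q"
proof -
  obtain B where B: "0 \<le> B" "\<And>f g. real_wderiv f g \<Longrightarrow> \<bar>V f\<bar> \<le> B * sqrt (H1_norm_sq f g)"
    using Hminus_bound[OF V] by metis
  show ?thesis
  proof (rule that[of "B * sqrt (H1_norm_sq f f')"])
    show "\<bar>V (\<lambda>t. f (t - a))\<bar> \<le> B * sqrt (H1_norm_sq f f')" for a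
      using B(2)[OF C1per_wderiv[OF C1per_shift[OF f, of a]]] by (simp add: H1_norm_sq_shift[OF f])
  qed (simp add: B(1) H1_norm_sq_nonneg)
qed

context cost
begin

definition cell_radius :: real where
  "cell_radius = 2 * pi / (3 * real n)"

lemma cell_radius_bounds: "0 < cell_radius" "cell_radius \<le> pi"
proof -
  show "0 < cell_radius" using n_pos by (simp add: cell_radius_def)
  have "2 * pi \<le> pi * (3 * real n)" using n_pos pi_gt_zero by simp
  then show "cell_radius \<le> pi" using n_pos by (simp add: cell_radius_def divide_le_eq)
qed

lemma separated_supports_near_nodes:
  assumes "\<And>j t. j < n \<Longrightarrow> t \<in> Iper \<Longrightarrow> \<phi> j t \<noteq> 0 \<Longrightarrow> distT (t - (a + node n j)) < cell_radius"
  shows "separated_supports cell_radius \<phi>"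
  unfolding separated_supports_def
proof (intro allI ballI impI)
  fix i j x y assume "i < n" "j < n" "x \<in> Iper" "y \<in> Iper" "i \<noteq> j" "\<phi> i x \<noteq> 0" "\<phi> j y \<noteq> 0"
  then show "cell_radius \<le> distT (x - y)"
    unfolding cell_radius_def
    by (intro distT_near_distinct_nodes[of i n j x a y] assms[unfolded cell_radius_def])
qed

lemma Feps_finite_somewhere:
  obtains \<zeta> where "adm \<zeta>" "\<And>\<epsilon>. 0 < \<epsilon> \<Longrightarrow> Feps n w \<epsilon> \<zeta> < top"
proof -
  obtain \<beta> \<beta>' where \<beta>: "orbital \<beta> \<beta>'" and \<beta>_support: "\<And>t. \<beta> t \<noteq> 0 \<Longrightarrow> distT t < cell_radius"
    using narrow_orbital_exists[OF cell_radius_bounds] by metis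
  define \<phi> where "\<phi> = (\<lambda>j t. \<beta> (t - (0 + node n j)))"
  define \<phi>' where "\<phi>' = (\<lambda>j t. \<beta>' (t - (0 + node n j)))"
  obtain S where S: "0 \<le> S" "\<And>x. x \<in> separated cell_radius \<Longrightarrow> cN n w x \<le> ennreal S"
    using cN_bounded_separated[OF cell_radius_bounds(1)] by blast
  have supports: "separated_supports cell_radius \<phi>"
    by (rule separated_supports_near_nodes[of \<phi> 0]) (use \<beta>_support in \<open>simp add: \<phi>_def\<close>)
  have disjoint: "disjoint_orbitals n \<phi> \<phi>'"
  proof (rule separated_supports_disjoint_orbitals[OF _ supports cell_radius_bounds(1)])
    show "orbital (\<phi> j) (\<phi>' j)" for j unfolding \<phi>_def \<phi>'_def by (rule orbital_shift[OF \<beta>])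
  qed
  show ?thesis
  proof (rule that)
    show "adm (orbital_density n \<phi>)" by (rule adm_orbital_density[OF n_pos disjoint])
    fix \<epsilon> :: real assume "0 < \<epsilon>"
    then have "Feps n w \<epsilon> (orbital_density n \<phi>) \<le> ennreal (\<epsilon> * kinetic_bound n \<phi>' + S)"
      by (intro Feps_orbital_density_le n_pos disjoint separated_supports_cost_le[OF supports S(2)] S(1))
    then show "Feps n w \<epsilon> (orbital_density n \<phi>) < top" by (rule le_less_trans) simp
  qed
qed

end

section \<open>The upper envelope of the limit functional\<close>

locale limit_potential = cost +
  fixes \<rho> :: "real \<Rightarrow> real" and V :: "(real \<Rightarrow> real) \<Rightarrow> real"
  assumes \<rho>_Dper: "Dper \<rho>" and V_Hminus: "Hminus V" and V_orbital_bound: "orbital_bound 0 V"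
    and FOT_le_V: "FOT n w \<rho> \<le> ennreal (real n * V \<rho>)" and V_\<rho>_nonneg: "0 \<le> V \<rho>"
begin

definition localized_bound :: "real \<Rightarrow> bool" where
  "localized_bound C \<longleftrightarrow> 0 \<le> C \<and> (\<forall>\<phi> \<phi>' a. orbital \<phi> \<phi>' \<longrightarrow> (\<forall>t\<in>Iper. \<phi> t \<noteq> 0 \<longrightarrow> distT (t - a) < cell_radius) \<longrightarrow>
     V (\<lambda>t. (\<phi> t)\<^sup>2) \<le> C)"

text \<open>Complete a localised orbital to an n-tuple by translates of a fixed bump; their values under V are
  bounded below, so the value of the localised density is bounded above.\<close>

lemma localized_bound_exists: obtains C where "localized_bound C"
proof -
  obtain S where S: "0 \<le> S" "\<And>x. x \<in> separated cell_radius \<Longrightarrow> cN n w x \<le> ennreal S"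
    using cN_bounded_separated[OF cell_radius_bounds(1)] by blast
  obtain \<beta> \<beta>' where \<beta>: "orbital \<beta> \<beta>'" and \<beta>_support: "\<And>t. \<beta> t \<noteq> 0 \<Longrightarrow> distT t < cell_radius"
    using narrow_orbital_exists[OF cell_radius_bounds] by metis
  obtain q where q: "0 \<le> q" "\<And>a. \<bar>V (\<lambda>t. (\<beta> (t - a))\<^sup>2)\<bar> \<le> q"
    using Hminus_shifts_bounded[OF V_Hminus C1per_power2[OF orbitalD(1)[OF \<beta>]]] by metis
  have "V (\<lambda>t. (\<phi> t)\<^sup>2) \<le> S + real n * q"
    if \<phi>: "orbital \<phi> \<phi>'" and \<phi>_support: "\<forall>t\<in>Iper. \<phi> t \<noteq> 0 \<longrightarrow> distT (t - a) < cell_radius" for \<phi> \<phi>' a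
  proof -
    define \<Phi> where "\<Phi> = (\<lambda>j. if j = 0 then \<phi> else (\<lambda>t. \<beta> (t - (a + node n j))))"
    define \<Phi>' where "\<Phi>' = (\<lambda>j. if j = 0 then \<phi>' else (\<lambda>t. \<beta>' (t - (a + node n j))))"
    have supports: "separated_supports cell_radius \<Phi>"
    proof (rule separated_supports_near_nodes)
      fix j t assume "t \<in> Iper" "\<Phi> j t \<noteq> 0"
      then show "distT (t - (a + node n j)) < cell_radius"
        using \<phi>_support \<beta>_support[of "t - (a + node n j)"] by (cases "j = 0") (auto simp: \<Phi>_def node_def)
    qed
    have "orbital (\<Phi> j) (\<Phi>' j)" for j using \<phi> orbital_shift[OF \<beta>] by (simp add: \<Phi>_def \<Phi>'_def)
    then have "(\<Sum>j<n. V (\<lambda>t. (\<Phi> j t)\<^sup>2)) \<le> 0 * kinetic_bound n \<Phi>' + S"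
      by (intro orbital_boundD[OF V_orbital_bound] S(1) separated_supports_cost_le[OF supports S(2)]
          separated_supports_disjoint_orbitals[OF _ supports cell_radius_bounds(1)])
    moreover have "(\<Sum>j<n. V (\<lambda>t. (\<Phi> j t)\<^sup>2)) = V (\<lambda>t. (\<phi> t)\<^sup>2) + (\<Sum>j\<in>{..<n} - {0}. V (\<lambda>t. (\<Phi> j t)\<^sup>2))"
      using n_pos by (subst sum.remove[of _ 0]) (auto simp: \<Phi>_def)
    moreover have "(\<Sum>j\<in>{..<n} - {0}. - q) \<le> (\<Sum>j\<in>{..<n} - {0}. V (\<lambda>t. (\<Phi> j t)\<^sup>2))"
      using q(2) by (intro sum_mono) (auto simp: \<Phi>_def abs_le_iff minus_le_iff)
    moreover have "(\<Sum>j\<in>{..<n} - {0}. - q) = q - real n * q"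
      using n_pos by (simp add: of_nat_diff algebra_simps)
    ultimately show ?thesis using q(1) by linarith
  qed
  then show ?thesis using S(1) q(1) by (intro that[of "S + real n * q"]) (auto simp: localized_bound_def)
qed

lemma localized_boundD:
  assumes "localized_bound C"
  shows "0 \<le> C" "orbital \<phi> \<phi>' \<Longrightarrow> (\<And>t. t \<in> Iper \<Longrightarrow> \<phi> t \<noteq> 0 \<Longrightarrow> distT (t - a) < cell_radius) \<Longrightarrow> V (\<lambda>t. (\<phi> t)\<^sup>2) \<le> C"
  using assms unfolding localized_bound_def by blast+

lemma narrow_orbitals_cost:
  assumes x: "x \<in> noncolliding" and e: "0 < e"
  obtains d
    where "0 < d" "\<And>\<phi>. (\<And>i. i < n \<Longrightarrow> \<phi> i \<in> narrow_orbitals (x i) d) \<Longrightarrow> (\<Sum>i<n. V (\<lambda>t. (\<phi> i t)\<^sup>2)) \<le> real_cost x + e"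
proof -
  obtain a where a: "0 < a" "x \<in> separated a" using noncolliding_imp_separated[OF x] by blast
  obtain d where d: "cost_modulus a e d" using cost_modulus_exists[OF a(1) e] by blast
  define r where "r = min d (a / 2)"
  have r: "0 < r" "r \<le> d" "2 * r \<le> a" using d a(1) by (auto simp: r_def cost_modulus_def)
  have "(\<Sum>i<n. V (\<lambda>t. (\<phi> i t)\<^sup>2)) \<le> real_cost x + e" if \<phi>: "\<And>i. i < n \<Longrightarrow> \<phi> i \<in> narrow_orbitals (x i) r" for \<phi>
  proof -
    have "\<forall>i. \<exists>\<phi>'. i < n \<longrightarrow> orbital (\<phi> i) \<phi>'" using \<phi> by (auto simp: narrow_orbitals_def)
    then obtain \<phi>' where \<phi>': "\<And>i. i < n \<Longrightarrow> orbital (\<phi> i) (\<phi>' i)" by metis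
    note near = narrow_orbitalsD[OF \<phi>]
    have "disjoint_orbitals n \<phi> \<phi>'" unfolding disjoint_orbitals_def
    proof (intro conjI allI impI ballI, rule \<phi>', assumption)
      fix i j t assume ij: "i < n" "j < n" "t \<in> Iper" "i \<noteq> j"
      have "a \<le> \<bar>x i - x j\<bar>" using a(2) ij distT_le_abs[of "x i - x j"] by (force simp: separated_def)
      then have "\<not> (\<bar>t - x i\<bar> < r \<and> \<bar>t - x j\<bar> < r)" using r(3) by linarith
      then show "\<phi> i t * \<phi> j t = 0" using near[of i t] near[of j t] ij by auto
    qed
    moreover have "support_cost_le n w \<phi> (real_cost x + e)" unfolding support_cost_le_def
    proof (intro allI impI)
      fix y assume y: "\<forall>j<n. y j \<in> Iper \<and> \<phi> j (y j) \<noteq> 0"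
      then have close: "y i \<in> Iper" "\<bar>y i - x i\<bar> < d" if "i < n" for i
        using near[OF that, of "y i"] that r(2) by auto
      note y_facts = cost_modulusD[OF d a(2) close]
      have "cN n w y = ennreal (real_cost y)"
        using y_facts(1) a(1) by (intro cN_noncolliding separated_imp_noncolliding[of _ "a / 2"]) auto
      then show "cN n w y \<le> ennreal (real_cost x + e)" using y_facts(2) by (simp add: ennreal_leI)
    qed
    ultimately have "(\<Sum>i<n. V (\<lambda>t. (\<phi> i t)\<^sup>2)) \<le> 0 * kinetic_bound n \<phi>' + (real_cost x + e)"
      using real_cost_nonneg[of x] e by (intro orbital_boundD[OF V_orbital_bound]) auto
    then show ?thesis by simp
  qed
  with r(1) show ?thesis by (rule that)
qed

text \<open>Truncating the values at -n C keeps the envelope bounded below.\<close>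

definition bump_values :: "real \<Rightarrow> real \<Rightarrow> real \<Rightarrow> real set" where
  "bump_values C x d = insert (- (real n * C)) ((\<lambda>\<phi>. V (\<lambda>t. (\<phi> t)\<^sup>2)) ` narrow_orbitals x d)"

definition envelope :: "real \<Rightarrow> real \<Rightarrow> real" where
  "envelope C x = (INF d\<in>{0<..cell_radius}. Sup (bump_values C x d))"

lemma bump_values_le:
  assumes C: "localized_bound C" and "d \<le> cell_radius" "s \<in> bump_values C x d"
  shows "s \<le> C"
proof (cases "s = - (real n * C)")
  case True
  have "0 \<le> real n * C" using localized_boundD(1)[OF C] by simp
  then show ?thesis unfolding True using localized_boundD(1)[OF C] by linarith
next
  case False
  then obtain \<phi> \<phi>' where \<phi>: "s = V (\<lambda>t. (\<phi> t)\<^sup>2)" "\<phi> \<in> narrow_orbitals x d" "orbital \<phi> \<phi>'"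
    using assms(3) by (auto simp: bump_values_def narrow_orbitals_def)
  have "distT (t - x) < cell_radius" if "t \<in> Iper" "\<phi> t \<noteq> 0" for t
    using narrow_orbitalsD[OF \<phi>(2) that] distT_le_abs[of "t - x"] assms(2) by linarith
  then show ?thesis unfolding \<phi>(1) by (rule localized_boundD(2)[OF C \<phi>(3)])
qed

lemma bdd_above_bump_values: "localized_bound C \<Longrightarrow> d \<le> cell_radius \<Longrightarrow> bdd_above (bump_values C x d)"
  using bump_values_le by (intro bdd_aboveI)

lemma Sup_bump_values_ge:
  assumes "localized_bound C" "d \<le> cell_radius"
  shows "- (real n * C) \<le> Sup (bump_values C x d)"
  by (rule cSup_upper[OF _ bdd_above_bump_values[OF assms]]) (simp add: bump_values_def)

lemma envelope_ge:
  assumes "localized_bound C"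
  shows "- (real n * C) \<le> envelope C x"
  unfolding envelope_def
  using Sup_bump_values_ge[OF assms] cell_radius_bounds(1) by (intro cINF_greatest) auto

lemma envelope_le_Sup:
  assumes "localized_bound C" "0 < d" "d \<le> cell_radius"
  shows "envelope C x \<le> Sup (bump_values C x d)"
  unfolding envelope_def
proof (rule cINF_lower)
  show "bdd_below ((\<lambda>d. Sup (bump_values C x d)) ` {0<..cell_radius})"
    using Sup_bump_values_ge[OF assms(1)] by (intro bdd_belowI[of _ "- (real n * C)"]) auto
qed (use assms in auto)

lemma V_le_envelope:
  assumes C: "localized_bound C" and e: "0 < e"
  obtains d where "0 < d" "\<And>\<phi>. \<phi> \<in> narrow_orbitals x d \<Longrightarrow> V (\<lambda>t. (\<phi> t)\<^sup>2) \<le> envelope C x + e"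
proof -
  have "\<exists>s\<in>(\<lambda>d. Sup (bump_values C x d)) ` {0<..cell_radius}. s < envelope C x + e"
    by (rule cInf_lessD) (use e cell_radius_bounds(1) in \<open>auto simp: envelope_def\<close>)
  then obtain d where d: "0 < d" "d \<le> cell_radius" "Sup (bump_values C x d) < envelope C x + e" by auto
  have "V (\<lambda>t. (\<phi> t)\<^sup>2) \<le> envelope C x + e" if "\<phi> \<in> narrow_orbitals x d" for \<phi>
  proof -
    have "V (\<lambda>t. (\<phi> t)\<^sup>2) \<le> Sup (bump_values C x d)"
      using that by (intro cSup_upper[OF _ bdd_above_bump_values[OF C d(2)]]) (auto simp: bump_values_def)
    then show ?thesis using d(3) by linarith
  qed
  with d(1) show ?thesis by (rule that)
qed

lemma sum_bump_values_le:
  assumes C: "localized_bound C" and x: "x \<in> noncolliding" and e: "0 < e"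
  obtains d where "0 < d" "d \<le> cell_radius"
    "\<And>s. (\<And>i. i < n \<Longrightarrow> s i \<in> bump_values C (x i) d) \<Longrightarrow> (\<Sum>i<n. s i) \<le> real_cost x + e"
proof -
  obtain r
    where r: "0 < r" "\<And>\<phi>. (\<And>i. i < n \<Longrightarrow> \<phi> i \<in> narrow_orbitals (x i) r) \<Longrightarrow> (\<Sum>i<n. V (\<lambda>t. (\<phi> i t)\<^sup>2)) \<le> real_cost x + e"
    using narrow_orbitals_cost[OF x e] by blast
  define d where "d = min r cell_radius"
  have d: "0 < d" "d \<le> r" "d \<le> cell_radius" using r(1) cell_radius_bounds(1) by (auto simp: d_def)
  have "(\<Sum>i<n. s i) \<le> real_cost x + e" if s: "\<And>i. i < n \<Longrightarrow> s i \<in> bump_values C (x i) d" for s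
  proof (cases "\<exists>i<n. s i = - (real n * C)")
    case True
    then obtain i where i: "i < n" "s i = - (real n * C)" by blast
    have "(\<Sum>j<n. s j) = - (real n * C) + (\<Sum>j\<in>{..<n} - {i}. s j)" using i by (subst sum.remove[of _ i]) auto
    also have "(\<Sum>j\<in>{..<n} - {i}. s j) \<le> (\<Sum>j\<in>{..<n} - {i}. C)"
      using s by (intro sum_mono bump_values_le[OF C d(3)]) auto
    also have "\<dots> = real n * C - C" using i by (simp add: of_nat_diff algebra_simps)
    finally show ?thesis using localized_boundD(1)[OF C] real_cost_nonneg[of x] e by linarith
  next
    case False
    then have "\<exists>\<phi>\<in>narrow_orbitals (x i) r. s i = V (\<lambda>t. (\<phi> t)\<^sup>2)" if "i < n" for i
      using s[OF that] that narrow_orbitals_mono[OF d(2), of "x i"] by (auto simp: bump_values_def)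
    then obtain \<phi> where \<phi>: "\<And>i. i < n \<Longrightarrow> \<phi> i \<in> narrow_orbitals (x i) r" "\<And>i. i < n \<Longrightarrow> s i = V (\<lambda>t. (\<phi> i t)\<^sup>2)"
      by metis
    then show ?thesis using r(2)[of \<phi>] by simp
  qed
  with d(1,3) show ?thesis by (rule that)
qed

lemma dual_feasible_envelope:
  assumes C: "localized_bound C"
  shows "dual_feasible (envelope C)"
  unfolding dual_feasible_def
proof (intro ballI, rule field_le_epsilon)
  fix x e assume x: "x \<in> noncolliding" and e: "(0::real) < e"
  have half_e: "0 < e / 2" using e by simp
  obtain d where d: "0 < d" "d \<le> cell_radius"
    and d_sum: "\<And>s. (\<And>i. i < n \<Longrightarrow> s i \<in> bump_values C (x i) d) \<Longrightarrow> (\<Sum>i<n. s i) \<le> real_cost x + e / 2"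
    using sum_bump_values_le[OF C x half_e] by metis
  have "\<exists>s\<in>bump_values C (x i) d. envelope C (x i) < s + e / 2 / real n" for i
  proof -
    have "0 < e / 2 / real n" using half_e n_pos by simp
    then have "envelope C (x i) - e / 2 / real n < Sup (bump_values C (x i) d)"
      using envelope_le_Sup[OF C d, of "x i"] by linarith
    moreover have "bump_values C (x i) d \<noteq> {}" by (simp add: bump_values_def)
    ultimately show ?thesis using less_cSupE by (metis diff_less_eq)
  qed
  then obtain s where s: "\<And>i. s i \<in> bump_values C (x i) d" "\<And>i. envelope C (x i) < s i + e / 2 / real n"
    by metis
  have "(\<Sum>i<n. envelope C (x i)) \<le> (\<Sum>i<n. s i + e / 2 / real n)"
    using s(2) by (intro sum_mono less_imp_le) auto
  also have "\<dots> = (\<Sum>i<n. s i) + e / 2" using n_pos by (simp add: sum.distrib)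
  finally show "(\<Sum>i<n. envelope C (x i)) \<le> real_cost x + e" using d_sum[OF s(1)] by linarith
qed

end

section \<open>Weak duality\<close>

lemma DperD:
  assumes "Dper \<rho>"
  shows "H1per \<rho>" "continuous_on Iper \<rho>" "t \<in> Iper \<Longrightarrow> 0 < \<rho> t" "(\<integral>t. \<rho> t \<partial>Lper) = 1"
  using assms by (auto simp: Dper_def)

lemma coupling_measurable:
  assumes "coupling n \<rho> \<gamma>" "f \<in> measurable (Pi\<^sub>M {..<n} (\<lambda>_. Bper)) N"
  shows "f \<in> measurable \<gamma> N"
proof -
  have "sets \<gamma> = sets (Pi\<^sub>M {..<n} (\<lambda>_. Bper))" using assms(1) by (simp add: coupling_def)
  then show ?thesis using assms(2) measurable_cong_sets by blast
qed

lemma coupling_component: "coupling n \<rho> \<gamma> \<Longrightarrow> i < n \<Longrightarrow> (\<lambda>x. x i) \<in> measurable \<gamma> Bper"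
  by (rule coupling_measurable[OF _ measurable_component_singleton]) auto

lemma coupling_space:
  assumes "coupling n \<rho> \<gamma>"
  shows "space \<gamma> = PiE {..<n} (\<lambda>_. Iper)"
proof -
  have "sets \<gamma> = sets (Pi\<^sub>M {..<n} (\<lambda>_. Bper))" using assms by (simp add: coupling_def)
  then show ?thesis by (subst sets_eq_imp_space_eq) (auto simp: space_PiM)
qed

lemma coupling_integral:
  assumes \<gamma>: "coupling n \<rho> \<gamma>" and \<rho>: "Dper \<rho>" and h: "continuous_on Iper h" "\<And>t. t \<in> Iper \<Longrightarrow> 0 \<le> h t"
    and i: "i < n"
  shows "(\<integral>\<^sup>+x. ennreal (h (x i)) \<partial>\<gamma>) = ennreal (\<integral>t. \<rho> t * h t \<partial>Lper)"
proof -
  have [measurable]: "h \<in> borel_measurable Bper" "\<rho> \<in> borel_measurable Bper"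
    using DperD(2)[OF \<rho>] h(1) Bper_cont_measurable by auto
  have "(\<integral>\<^sup>+x. ennreal (h (x i)) \<partial>\<gamma>) = (\<integral>\<^sup>+t. ennreal (h t) \<partial>distr \<gamma> Bper (\<lambda>x. x i))"
    using coupling_component[OF \<gamma> i] by (intro nn_integral_distr[symmetric]) auto
  also have "\<dots> = (\<integral>\<^sup>+t. ennreal (h t) \<partial>density Bper (\<lambda>t. ennreal (\<rho> t)))"
    using \<gamma> i by (simp add: coupling_def)
  also have "\<dots> = (\<integral>\<^sup>+t. ennreal (\<rho> t) * ennreal (h t) \<partial>Lper)"
    unfolding nn_integral_Bper[symmetric] by (intro nn_integral_density) measurable
  also have "\<dots> = (\<integral>\<^sup>+t. ennreal (\<rho> t * h t) \<partial>Lper)"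
    using DperD(3)[OF \<rho>] h(2) by (intro nn_integral_cong) (simp add: ennreal_mult less_imp_le)
  also have "\<dots> = ennreal (\<integral>t. \<rho> t * h t \<partial>Lper)"
    using DperD(2,3)[OF \<rho>] h
    by (intro nn_integral_eq_integral integrable_Lper_cont continuous_intros AE_I2) (auto simp: less_imp_le)
  finally show ?thesis .
qed

lemma coupling_sum_integral:
  assumes \<gamma>: "coupling n \<rho> \<gamma>" and \<rho>: "Dper \<rho>"
    and h: "\<And>i. i < n \<Longrightarrow> continuous_on Iper (h i)" "\<And>i t. i < n \<Longrightarrow> t \<in> Iper \<Longrightarrow> 0 \<le> h i t"
  shows "(\<integral>\<^sup>+x. ennreal (\<Sum>i<n. h i (x i)) \<partial>\<gamma>) = ennreal (\<Sum>i<n. \<integral>t. \<rho> t * h i t \<partial>Lper)"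
proof -
  have meas: "(\<lambda>x. ennreal (h i (x i))) \<in> borel_measurable \<gamma>" if "i \<in> {..<n}" for i
    using measurable_compose[OF coupling_component[OF \<gamma>] Bper_cont_measurable[OF h(1)]] that by simp
  have "(\<integral>\<^sup>+x. ennreal (\<Sum>i<n. h i (x i)) \<partial>\<gamma>) = (\<integral>\<^sup>+x. (\<Sum>i<n. ennreal (h i (x i))) \<partial>\<gamma>)"
    using h(2) coupling_space[OF \<gamma>] by (intro nn_integral_cong sum_ennreal[symmetric]) auto
  also have "\<dots> = (\<Sum>i<n. \<integral>\<^sup>+x. ennreal (h i (x i)) \<partial>\<gamma>)" by (rule nn_integral_sum[OF meas])
  also have "\<dots> = (\<Sum>i<n. ennreal (\<integral>t. \<rho> t * h i t \<partial>Lper))"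
    by (intro sum.cong refl coupling_integral[OF \<gamma> \<rho> h]) auto
  also have "\<dots> = ennreal (\<Sum>i<n. \<integral>t. \<rho> t * h i t \<partial>Lper)"
    using h(2) DperD(3)[OF \<rho>] by (intro sum_ennreal integral_nonneg_AE AE_I2) (simp add: less_imp_le)
  finally show ?thesis .
qed

context cost
begin

lemma coupling_cost_lower_bound:
  assumes \<gamma>: "coupling n \<rho> \<gamma>" and \<rho>: "Dper \<rho>"
    and h: "\<And>i. i < n \<Longrightarrow> continuous_on Iper (h i)" "\<And>i t. i < n \<Longrightarrow> t \<in> Iper \<Longrightarrow> 0 \<le> h i t" and "0 \<le> K"
    and feasible: "\<And>x. x \<in> noncolliding \<Longrightarrow> (\<Sum>i<n. h i (x i)) \<le> real_cost x + K"
  shows "ennreal (\<Sum>i<n. \<integral>t. \<rho> t * h i t \<partial>Lper) \<le> (\<integral>\<^sup>+x. cN n w x \<partial>\<gamma>) + ennreal K"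
proof -
  interpret prob_space \<gamma> using \<gamma> by (simp add: coupling_def)
  have "ennreal (\<Sum>i<n. \<integral>t. \<rho> t * h i t \<partial>Lper) = (\<integral>\<^sup>+x. ennreal (\<Sum>i<n. h i (x i)) \<partial>\<gamma>)"
    by (rule coupling_sum_integral[OF \<gamma> \<rho> h, symmetric])
  also have "\<dots> \<le> (\<integral>\<^sup>+x. cN n w x + ennreal K \<partial>\<gamma>)"
  proof (rule nn_integral_mono)
    fix x assume x: "x \<in> space \<gamma>"
    show "ennreal (\<Sum>i<n. h i (x i)) \<le> cN n w x + ennreal K"
    proof (cases "x \<in> noncolliding")
      case True
      then show ?thesis using feasible[OF True] real_cost_nonneg[of x] \<open>0 \<le> K\<close>
        by (simp add: cN_noncolliding ennreal_leI flip: ennreal_plus)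
    next
      case False
      have "cN n w x = top" by (rule cN_colliding[OF _ False]) (use x coupling_space[OF \<gamma>] in auto)
      then show ?thesis by simp
    qed
  qed
  also have "\<dots> = (\<integral>\<^sup>+x. cN n w x \<partial>\<gamma>) + ennreal K"
    using coupling_measurable[OF \<gamma> cN_measurable[OF A]]
    by (subst nn_integral_add) (auto simp: emeasure_space_1)
  finally show ?thesis .
qed

lemma weak_duality:
  assumes \<rho>: "Dper \<rho>" and f: "\<And>i. i < n \<Longrightarrow> continuous_on Iper (f i)"
    and feasible: "\<And>x. x \<in> noncolliding \<Longrightarrow> (\<Sum>i<n. f i (x i)) \<le> real_cost x"
  shows "ennreal (\<Sum>i<n. \<integral>t. \<rho> t * f i t \<partial>Lper) \<le> FOT n w \<rho>" (is "ennreal ?I \<le> _")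
proof (cases "0 \<le> ?I")
  case True
  have "\<forall>i. \<exists>B. i < n \<longrightarrow> 0 \<le> B \<and> (\<forall>t\<in>Iper. \<bar>f i t\<bar> \<le> B)" using continuous_bounded_Iper[OF f] by metis
  then obtain B where B: "\<And>i t. i < n \<Longrightarrow> t \<in> Iper \<Longrightarrow> \<bar>f i t\<bar> \<le> B i" "\<And>i. i < n \<Longrightarrow> 0 \<le> B i" by metis
  define U where "U = (\<Sum>i<n. B i)"
  have U: "0 \<le> U" unfolding U_def using B(2) by (intro sum_nonneg) auto
  have shifted_nonneg: "0 \<le> f i t + U" if "i < n" "t \<in> Iper" for i t
  proof -
    have "\<bar>f i t\<bar> \<le> U" unfolding U_def
      using B that member_le_sum[of i "{..<n}" B] by (fastforce intro: order_trans)
    then show ?thesis by linarith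
  qed
  have shifted_integral: "(\<Sum>i<n. \<integral>t. \<rho> t * (f i t + U) \<partial>Lper) = ?I + real n * U"
  proof -
    have "(\<integral>t. \<rho> t * (f i t + U) \<partial>Lper) = (\<integral>t. \<rho> t * f i t \<partial>Lper) + U" if "i < n" for i
      using DperD(2,4)[OF \<rho>] f[OF that] by (simp add: distrib_left integrable_Lper_cont continuous_on_mult)
    then show ?thesis by (simp add: sum.distrib)
  qed
  show ?thesis unfolding FOT_def
  proof (rule INF_greatest)
    fix \<gamma> assume "\<gamma> \<in> {\<gamma>. coupling n \<rho> \<gamma>}"
    then have \<gamma>: "coupling n \<rho> \<gamma>" by simp
    have "ennreal ?I + ennreal (real n * U) = ennreal (\<Sum>i<n. \<integral>t. \<rho> t * (f i t + U) \<partial>Lper)"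
      using True U by (simp add: shifted_integral)
    also have "\<dots> \<le> (\<integral>\<^sup>+x. cN n w x \<partial>\<gamma>) + ennreal (real n * U)"
      using U feasible f
      by (intro coupling_cost_lower_bound[OF \<gamma> \<rho>] continuous_intros shifted_nonneg) (auto simp: sum.distrib)
    finally show "ennreal ?I \<le> (\<integral>\<^sup>+x. cN n w x \<partial>\<gamma>)"
      by (simp add: ennreal_add_left_cancel_le add.commute[of _ "ennreal (real n * U)"])
  qed
qed (simp add: ennreal_neg)

lemma dual_feasible_regular_kantorovich_pot:
  assumes "continuous_on Iper u" "dual_feasible u" "Dper \<rho>"
    and FOT: "FOT n w \<rho> = ennreal (real n * (\<integral>t. \<rho> t * u t \<partial>Lper))" and nonneg: "0 \<le> (\<integral>t. \<rho> t * u t \<partial>Lper)"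
  shows "regular_kantorovich_pot n w \<rho> u"
  unfolding regular_kantorovich_pot_def kantorovich_pot_def
proof (intro conjI ballI)
  show "integrable Lper (\<lambda>t. \<rho> t * u t)"
    by (intro integrable_Lper_cont continuous_on_mult DperD(2)[OF assms(3)] assms(1))
  show "enn2ereal (FOT n w \<rho>) = ereal (real n * (\<integral>t. \<rho> t * u t \<partial>Lper))" unfolding FOT using nonneg by simp
  fix x assume x: "x \<in> PiE {..<n} (\<lambda>_. Iper)"
  show "0 \<le> enn2ereal (cN n w x) - ereal (\<Sum>j<n. u (x j))"
  proof (cases "x \<in> noncolliding")
    case True
    then show ?thesis
      using dual_feasibleD[OF assms(2) True] real_cost_nonneg[of x] by (simp add: cN_noncolliding)
  next
    case False
    have "cN n w x = top" by (rule cN_colliding[OF _ False]) (use x in auto)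
    then show ?thesis by simp
  qed
qed (rule assms(1))

end

section \<open>Functionals dominated by a continuous potential\<close>

lemma Hminus_nonneg_if_positive_C1:
  assumes L: "Hminus L" and nonneg: "\<And>f f'. C1per f f' \<Longrightarrow> (\<And>t. 0 < f t) \<Longrightarrow> 0 \<le> L f"
    and f: "H1per f" "continuous_on Iper f" "\<And>t. t \<in> Iper \<Longrightarrow> 0 < f t"
  shows "0 \<le> L f"
proof -
  obtain g T T' where T_limit: "H1_limit T T' f g"
    using f(1) H1per_iff_real_wderiv H1per_limit_of_trig_sums by metis
  obtain U where U: "\<And>t. t \<in> Iper \<Longrightarrow> \<bar>f t\<bar> \<le> U" using continuous_bounded_Iper[OF f(2)] by metis
  have "\<forall>\<^sub>F k in sequentially. \<forall>t. 0 < T k t \<and> T k t < U + 1"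
    by (rule H1_limit_eventually_between[OF T_limit f(2)]) (use f(3) U in force)+
  then have "\<forall>\<^sub>F k in sequentially. 0 \<le> L (T k)"
    by eventually_elim (use nonneg[OF H1_limitD(2)[OF T_limit]] in blast)
  then show ?thesis using Hminus_continuous[OF L T_limit] by (intro tendsto_lowerbound) auto
qed

lemma Hminus_eq_if_dominated_touching:
  assumes V: "Hminus V" and W: "Hminus W" and dominated: "\<And>f f'. C1per f f' \<Longrightarrow> (\<And>t. 0 < f t) \<Longrightarrow> V f \<le> W f"
    and \<rho>: "Dper \<rho>" and touching: "W \<rho> \<le> V \<rho>" and f: "H1per f"
  shows "V f = W f"
proof (rule Hminus_eq_if_eq_on_C1per[OF V W _ f])
  fix h h' assume h: "C1per h h'"
  define L where "L = (\<lambda>f. 1 * W f + (-1) * V f)"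
  have L: "Hminus L" unfolding L_def by (rule Hminus_functional_lin[OF W V])
  obtain m where m: "0 < m" "\<And>t. t \<in> Iper \<Longrightarrow> m \<le> \<rho> t"
    using continuous_attains_inf[OF compact_Iper Iper_nonempty DperD(2)[OF \<rho>]] DperD(3)[OF \<rho>] by metis
  obtain B where B: "0 \<le> B" "\<And>t. \<bar>h t\<bar> \<le> B" using C1per_bounded[OF h] by metis
  define c where "c = m / (B + 1)"
  have c: "0 < c" "c * B < m" using m(1) B(1) by (simp_all add: c_def divide_less_eq)
  have perturbed: "0 \<le> L \<rho> + \<sigma> * L h" if "\<bar>\<sigma>\<bar> = c" for \<sigma>
  proof -
    have "0 \<le> L (\<lambda>t. 1 * \<rho> t + \<sigma> * h t)"
    proof (rule Hminus_nonneg_if_positive_C1[OF L])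
      show "0 \<le> L f" if "C1per f f'" "\<And>t. 0 < f t" for f f' using dominated[OF that] by (simp add: L_def)
      show "H1per (\<lambda>t. 1 * \<rho> t + \<sigma> * h t)" by (rule H1per_lin[OF DperD(1)[OF \<rho>] C1per_H1per[OF h]])
      show "continuous_on Iper (\<lambda>t. 1 * \<rho> t + \<sigma> * h t)"
        by (intro continuous_intros DperD(2)[OF \<rho>] C1per_cont[OF h])
      fix t assume t: "t \<in> Iper"
      have "\<bar>\<sigma> * h t\<bar> \<le> c * B" unfolding abs_mult that using c(1) B(2) by (intro mult_left_mono) auto
      then show "0 < 1 * \<rho> t + \<sigma> * h t" using m(2)[OF t] c(2) by linarith
    qed
    then show ?thesis using Hminus_lin[OF L DperD(1)[OF \<rho>] C1per_H1per[OF h], of 1 \<sigma>] by simp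
  qed
  have "L \<rho> \<le> 0" using touching by (simp add: L_def)
  then have "0 \<le> c * L h" "c * L h \<le> 0" using perturbed[of c] perturbed[of "- c"] c(1) by auto
  then have "L h = 0" using c(1) by (simp add: zero_le_mult_iff mult_le_0_iff)
  then show "V h = W h" by (simp add: L_def)
qed

lemma distT_inner_node_eq_abs:
  assumes i: "0 < i" "i < N" and t: "t \<in> Iper" and near: "distT (t - node N i) < 2 * pi / real N"
  shows "\<bar>t - node N i\<bar> = distT (t - node N i)"
proof -
  obtain k :: int where k: "distT (t - node N i) = \<bar>t - node N i - 2 * pi * of_int k\<bar>"
    by (rule distT_attained)
  have node_eq: "node N i = real i * (2 * pi / real N)" by (simp add: node_def)
  have "1 * (2 * pi / real N) \<le> node N i" "node N i \<le> (real N - 1) * (2 * pi / real N)"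
    unfolding node_eq using i by (intro mult_right_mono; simp)+
  moreover have "(real N - 1) * (2 * pi / real N) = 2 * pi - 2 * pi / real N"
    using i by (simp add: field_simps)
  ultimately have inner: "2 * pi / real N \<le> node N i" "node N i \<le> 2 * pi - 2 * pi / real N" by simp_all
  have bounds: "0 \<le> t" "t \<le> 2 * pi" using t by (auto simp: Iper_def)
  have "k = 0"
  proof (rule ccontr)
    assume "k \<noteq> 0"
    then consider "1 \<le> k" | "k \<le> - 1" by linarith
    then show False
    proof cases
      case 1
      then have "2 * pi * 1 \<le> 2 * pi * real_of_int k" by (intro mult_left_mono) auto
      then show False using near inner bounds unfolding k abs_less_iff by linarith
    next
      case 2
      then have "2 * pi * real_of_int k \<le> 2 * pi * (- 1)" by (intro mult_left_mono) auto
      then show False using near inner bounds unfolding k abs_less_iff by linarith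
    qed
  qed
  then show ?thesis by (simp add: k)
qed

lemma node_in_Iper:
  assumes "i < N"
  shows "node N i \<in> Iper"
proof -
  have "2 * pi * real i \<le> 2 * pi * real N" using assms by (intro mult_left_mono) auto
  then show ?thesis using assms by (simp add: node_def Iper_def divide_le_eq)
qed

definition window_piece :: "(real \<Rightarrow> real) \<Rightarrow> nat \<Rightarrow> nat \<Rightarrow> real \<Rightarrow> real" where
  "window_piece f N i t = sqrt (f t) * window N i t"

definition piece_mass :: "(real \<Rightarrow> real) \<Rightarrow> nat \<Rightarrow> nat \<Rightarrow> real" where
  "piece_mass f N i = (\<integral>t. (window_piece f N i t)\<^sup>2 \<partial>Lper)"

locale positive_C1 =
  fixes f f' :: "real \<Rightarrow> real" and N :: nat
  assumes f_C1per: "C1per f f'" and f_pos: "\<And>t. 0 < f t" and two_le_N: "2 \<le> N"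
begin

lemma window_piece_power2: "(window_piece f N i t)\<^sup>2 = f t * (window N i t)\<^sup>2"
  using f_pos[of t] by (simp add: window_piece_def power_mult_distrib less_imp_le)

lemma sum_window_piece_power2: "(\<Sum>i<N. (window_piece f N i t)\<^sup>2) = f t"
  by (simp add: window_piece_power2 sum_window_power2[OF two_le_N] flip: sum_distrib_left)

lemma window_piece_C1per: "\<exists>\<phi>'. C1per (window_piece f N i) \<phi>'"
proof -
  obtain W' where "C1per (window N i) W'" using window_C1per[OF two_le_N] by blast
  from C1per_mult[OF C1per_sqrt[OF f_C1per f_pos] this] show ?thesis
    unfolding window_piece_def[abs_def] by blast
qed

lemma window_piece_cont: "continuous_on A (window_piece f N i)"
  using window_piece_C1per[of i] C1per_cont(1) by blast

lemma integrable_mult_window_piece: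
  assumes "continuous_on Iper u"
  shows "integrable Lper (\<lambda>t. u t * (window_piece f N i t)\<^sup>2)"
  by (intro integrable_Lper_cont continuous_intros window_piece_cont assms)

lemma piece_mass_pos:
  assumes "i < N"
  shows "0 < piece_mass f N i"
  unfolding piece_mass_def
proof (rule integral_Lper_pos[OF _ _ node_in_Iper[OF assms]])
  have "window N i (node N i) \<noteq> 0" using two_le_N by (simp add: window_neq_0_iff window_radius_def)
  then show "0 < (window_piece f N i (node N i))\<^sup>2" using f_pos[of "node N i"] by (simp add: window_piece_def)
qed (intro continuous_intros window_piece_cont, simp)

lemma normalized_window_piece:
  assumes i: "i < N" and V: "Hminus V"
  obtains \<xi> \<xi>' where "orbital \<xi> \<xi>'" "\<And>t. \<xi> t \<noteq> 0 \<Longrightarrow> distT (t - node N i) < window_radius N"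
    "V (\<lambda>t. (window_piece f N i t)\<^sup>2) = piece_mass f N i * V (\<lambda>t. (\<xi> t)\<^sup>2)"
proof -
  let ?\<mu> = "piece_mass f N i" and ?\<phi> = "window_piece f N i"
  obtain \<phi>' where \<phi>': "C1per ?\<phi> \<phi>'" using window_piece_C1per by blast
  define \<xi> where "\<xi> = (\<lambda>t. 1 / sqrt ?\<mu> * ?\<phi> t)"
  have nonneg: "0 \<le> ?\<phi> t" for t
    using window_nonneg[OF two_le_N] f_pos[of t] by (simp add: window_piece_def less_imp_le)
  have \<xi>: "orbital \<xi> (\<lambda>t. 1 / sqrt ?\<mu> * \<phi>' t)"
    unfolding \<xi>_def piece_mass_def
    by (rule orbital_normalize[OF \<phi>' nonneg piece_mass_pos[OF i, unfolded piece_mass_def]])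
  have "(?\<phi> t)\<^sup>2 = ?\<mu> * (\<xi> t)\<^sup>2" for t
    using piece_mass_pos[OF i] by (simp add: \<xi>_def power_mult_distrib power_divide)
  then have "V (\<lambda>t. (?\<phi> t)\<^sup>2) = ?\<mu> * V (\<lambda>t. (\<xi> t)\<^sup>2)"
    using Hminus_cmult[OF V C1per_H1per[OF C1per_power2[OF orbitalD(1)[OF \<xi>]]]] by simp
  moreover have "distT (t - node N i) < window_radius N" if "\<xi> t \<noteq> 0" for t
    using that by (simp add: \<xi>_def window_piece_def flip: window_neq_0_iff[OF two_le_N])
  ultimately show ?thesis using \<xi> by (intro that)
qed

lemma sum_piece_mass: "(\<Sum>i<N. piece_mass f N i) = (\<integral>t. f t \<partial>Lper)"
proof -
  have "(\<Sum>i<N. piece_mass f N i) = (\<integral>t. (\<Sum>i<N. (window_piece f N i t)\<^sup>2) \<partial>Lper)" unfolding piece_mass_def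
    by (intro Bochner_Integration.integral_sum[symmetric] integrable_Lper_cont continuous_intros window_piece_cont)
  then show ?thesis by (simp add: sum_window_piece_power2)
qed

lemma piece_mass_le:
  assumes "\<And>t. f t \<le> F"
  shows "piece_mass f N i \<le> F * (2 * pi / real N)"
proof -
  have "continuous_on B (window N i)" for B using window_C1per[OF two_le_N, of i] C1per_cont(1) by blast
  then have "piece_mass f N i \<le> (\<integral>t. F * (window N i t)\<^sup>2 \<partial>Lper)"
    unfolding piece_mass_def
    by (intro integral_mono integrable_Lper_cont continuous_intros window_piece_cont)
      (auto simp: window_piece_power2 intro!: mult_right_mono assms)
  then show ?thesis by (simp add: integral_window_power2[OF two_le_N])
qed

lemma integral_mult_window_piece_ge:
  assumes u: "continuous_on Iper u" and lower: "\<And>t. t \<in> Iper \<Longrightarrow> window_piece f N i t \<noteq> 0 \<Longrightarrow> c \<le> u t"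
  shows "c * piece_mass f N i \<le> (\<integral>t. u t * (window_piece f N i t)\<^sup>2 \<partial>Lper)"
proof -
  have "c * piece_mass f N i = (\<integral>t. c * (window_piece f N i t)\<^sup>2 \<partial>Lper)" by (simp add: piece_mass_def)
  also have "\<dots> \<le> (\<integral>t. u t * (window_piece f N i t)\<^sup>2 \<partial>Lper)"
  proof (rule integral_mono)
    show "c * (window_piece f N i t)\<^sup>2 \<le> u t * (window_piece f N i t)\<^sup>2" if "t \<in> space Lper" for t
      using lower[of t] that by (cases "window_piece f N i t = 0") (auto intro: mult_right_mono)
  qed (intro integrable_mult_window_piece continuous_on_const u)+
  finally show ?thesis .
qed

end

context limit_potential
begin

lemma uniform_narrow_bound:
  assumes u: "continuous_on Iper u"
    and narrow: "\<And>t e. t \<in> Iper \<Longrightarrow> 0 < e \<Longrightarrow> \<exists>d>0. \<forall>\<phi>\<in>narrow_orbitals t d. V (\<lambda>t. (\<phi> t)\<^sup>2) \<le> u t + e"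
    and \<kappa>: "0 < \<kappa>"
  obtains \<eta> where "0 < \<eta>" "\<And>c \<phi>. c \<in> Iper \<Longrightarrow> \<phi> \<in> narrow_orbitals c \<eta> \<Longrightarrow> V (\<lambda>t. (\<phi> t)\<^sup>2) \<le> u c + \<kappa>"
    "\<And>s t. s \<in> Iper \<Longrightarrow> t \<in> Iper \<Longrightarrow> \<bar>s - t\<bar> < \<eta> \<Longrightarrow> \<bar>u s - u t\<bar> < \<kappa>"
proof -
  have half: "0 < \<kappa> / 2" using \<kappa> by simp
  have "uniformly_continuous_on Iper u" by (rule compact_uniformly_continuous[OF u compact_Iper])
  then obtain \<delta> where \<delta>: "0 < \<delta>" "\<And>s t. s \<in> Iper \<Longrightarrow> t \<in> Iper \<Longrightarrow> \<bar>s - t\<bar> < \<delta> \<Longrightarrow> \<bar>u s - u t\<bar> < \<kappa> / 2"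
    using half unfolding uniformly_continuous_on_def dist_real_def by metis
  have "\<exists>d>0. d \<le> \<delta> \<and> (\<forall>\<phi>\<in>narrow_orbitals x d. V (\<lambda>t. (\<phi> t)\<^sup>2) \<le> u x + \<kappa> / 2)" if x: "x \<in> Iper" for x
  proof -
    obtain d where "0 < d" "\<forall>\<phi>\<in>narrow_orbitals x d. V (\<lambda>t. (\<phi> t)\<^sup>2) \<le> u x + \<kappa> / 2"
      using narrow[OF x half] by blast
    then show ?thesis using \<delta>(1) narrow_orbitals_mono[of "min d \<delta>" d x] by (intro exI[of _ "min d \<delta>"]) auto
  qed
  then obtain r where r: "\<And>x. x \<in> Iper \<Longrightarrow> 0 < r x \<and> r x \<le> \<delta>"
    "\<And>x \<phi>. x \<in> Iper \<Longrightarrow> \<phi> \<in> narrow_orbitals x (r x) \<Longrightarrow> V (\<lambda>t. (\<phi> t)\<^sup>2) \<le> u x + \<kappa> / 2" by metis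
  have "Iper \<subseteq> \<Union>((\<lambda>x. ball x (r x)) ` Iper)" using r(1) by force
  then obtain \<eta> where \<eta>: "0 < \<eta>" "\<And>c. c \<in> Iper \<Longrightarrow> \<exists>G\<in>(\<lambda>x. ball x (r x)) ` Iper. ball c \<eta> \<subseteq> G"
    by (rule Heine_Borel_lemma[OF compact_Iper]) auto
  show ?thesis
  proof (rule that[of "min \<eta> \<delta>"])
    show "0 < min \<eta> \<delta>" using \<eta>(1) \<delta>(1) by simp
    show "\<bar>u s - u t\<bar> < \<kappa>" if "s \<in> Iper" "t \<in> Iper" "\<bar>s - t\<bar> < min \<eta> \<delta>" for s t
      using \<delta>(2)[OF that(1,2)] that(3) \<kappa> by simp
    fix c \<phi> assume c: "c \<in> Iper" and \<phi>: "\<phi> \<in> narrow_orbitals c (min \<eta> \<delta>)"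
    obtain x where x: "x \<in> Iper" "ball c \<eta> \<subseteq> ball x (r x)" using \<eta>(2)[OF c] by blast
    have "\<phi> \<in> narrow_orbitals x (r x)"
      using \<phi> x(2) by (fastforce simp: narrow_orbitals_def dist_real_def abs_minus_commute subset_iff)
    then have "V (\<lambda>t. (\<phi> t)\<^sup>2) \<le> u x + \<kappa> / 2" by (rule r(2)[OF x(1)])
    moreover have "c \<in> ball x (r x)" using x(2) \<eta>(1) by (meson centre_in_ball subsetD)
    then have "\<bar>u c - u x\<bar> < \<kappa> / 2"
      using r(1)[OF x(1)] by (intro \<delta>(2) c x(1)) (simp add: dist_real_def abs_minus_commute)
    ultimately show "V (\<lambda>t. (\<phi> t)\<^sup>2) \<le> u c + \<kappa>" unfolding abs_less_iff by linarith
  qed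
qed

text \<open>The piece at node 0 straddles the seam between 0 and 2 pi, across which u need not be continuous, so only the
  crude bound C is available there.\<close>

lemma V_window_piece_0_le:
  assumes "positive_C1 f f' N" and u: "continuous_on Iper u" "\<And>t. t \<in> Iper \<Longrightarrow> \<bar>u t\<bar> \<le> U"
    and C: "localized_bound C" and radius: "window_radius N < cell_radius"
  shows "V (\<lambda>t. (window_piece f N 0 t)\<^sup>2)
    \<le> (\<integral>t. u t * (window_piece f N 0 t)\<^sup>2 \<partial>Lper) + (C + U) * piece_mass f N 0"
proof -
  interpret positive_C1 f f' N by (rule assms(1))
  have N: "0 < N" using two_le_N by simp
  obtain \<xi> \<xi>' where \<xi>: "orbital \<xi> \<xi>'" and support: "\<And>t. \<xi> t \<noteq> 0 \<Longrightarrow> distT (t - node N 0) < window_radius N"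
    and V_scale: "V (\<lambda>t. (window_piece f N 0 t)\<^sup>2) = piece_mass f N 0 * V (\<lambda>t. (\<xi> t)\<^sup>2)"
    using normalized_window_piece[OF N V_Hminus] by metis
  have "V (\<lambda>t. (\<xi> t)\<^sup>2) \<le> C" by (rule localized_boundD(2)[OF C \<xi>, of "node N 0"]) (use support radius in force)
  then have "V (\<lambda>t. (window_piece f N 0 t)\<^sup>2) \<le> piece_mass f N 0 * C"
    unfolding V_scale using piece_mass_pos[OF N] by (intro mult_left_mono) auto
  moreover have "- U * piece_mass f N 0 \<le> (\<integral>t. u t * (window_piece f N 0 t)\<^sup>2 \<partial>Lper)"
    using u(2) by (intro integral_mult_window_piece_ge[OF u(1)]) (force simp: abs_le_iff)
  ultimately show ?thesis by (simp add: algebra_simps)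
qed

lemma V_inner_window_piece_le:
  assumes "positive_C1 f f' N" and u: "continuous_on Iper u" and i: "0 < i" "i < N" and radius: "window_radius N < \<eta>"
    and \<eta>: "\<And>c \<phi>. c \<in> Iper \<Longrightarrow> \<phi> \<in> narrow_orbitals c \<eta> \<Longrightarrow> V (\<lambda>t. (\<phi> t)\<^sup>2) \<le> u c + \<kappa>"
      "\<And>s t. s \<in> Iper \<Longrightarrow> t \<in> Iper \<Longrightarrow> \<bar>s - t\<bar> < \<eta> \<Longrightarrow> \<bar>u s - u t\<bar> < \<kappa>"
  shows "V (\<lambda>t. (window_piece f N i t)\<^sup>2)
    \<le> (\<integral>t. u t * (window_piece f N i t)\<^sup>2 \<partial>Lper) + 2 * \<kappa> * piece_mass f N i"
proof -
  interpret positive_C1 f f' N by (rule assms(1))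
  let ?\<mu> = "piece_mass f N i" and ?c = "node N i"
  obtain \<xi> \<xi>' where \<xi>: "orbital \<xi> \<xi>'" and support: "\<And>t. \<xi> t \<noteq> 0 \<Longrightarrow> distT (t - ?c) < window_radius N"
    and V_scale: "V (\<lambda>t. (window_piece f N i t)\<^sup>2) = ?\<mu> * V (\<lambda>t. (\<xi> t)\<^sup>2)"
    using normalized_window_piece[OF i(2) V_Hminus] by metis
  have "window_radius N < 2 * pi / real N" using i by (simp add: window_radius_def field_simps)
  then have near: "\<bar>t - ?c\<bar> < \<eta>" if "t \<in> Iper" "distT (t - ?c) < window_radius N" for t
    using distT_inner_node_eq_abs[of i N t] i that radius by linarith
  then have "\<xi> \<in> narrow_orbitals ?c \<eta>" using \<xi> support by (auto simp: narrow_orbitals_def)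
  then have "V (\<lambda>t. (\<xi> t)\<^sup>2) \<le> u ?c + \<kappa>" by (rule \<eta>(1)[OF node_in_Iper[OF i(2)]])
  then have "V (\<lambda>t. (window_piece f N i t)\<^sup>2) \<le> ?\<mu> * (u ?c + \<kappa>)"
    unfolding V_scale using piece_mass_pos[OF i(2)] by (intro mult_left_mono) auto
  moreover have "(u ?c - \<kappa>) * ?\<mu> \<le> (\<integral>t. u t * (window_piece f N i t)\<^sup>2 \<partial>Lper)"
  proof (rule integral_mult_window_piece_ge[OF u])
    fix t assume t: "t \<in> Iper" "window_piece f N i t \<noteq> 0"
    then have "distT (t - ?c) < window_radius N"
      by (simp add: window_piece_def flip: window_neq_0_iff[OF two_le_N])
    then show "u ?c - \<kappa> \<le> u t"
      using \<eta>(2)[OF t(1) node_in_Iper[OF i(2)] near[OF t(1)]] unfolding abs_less_iff by linarith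
  qed
  moreover have "?\<mu> * (u ?c + \<kappa>) = (u ?c - \<kappa>) * ?\<mu> + 2 * \<kappa> * ?\<mu>" by (simp add: algebra_simps)
  ultimately show ?thesis by simp
qed

lemma V_window_pieces_le:
  assumes "positive_C1 f f' N" and f_le: "\<And>t. f t \<le> F"
    and u: "continuous_on Iper u" "\<And>t. t \<in> Iper \<Longrightarrow> \<bar>u t\<bar> \<le> U" "0 \<le> U" and C: "localized_bound C"
    and \<eta>: "\<And>c \<phi>. c \<in> Iper \<Longrightarrow> \<phi> \<in> narrow_orbitals c \<eta> \<Longrightarrow> V (\<lambda>t. (\<phi> t)\<^sup>2) \<le> u c + \<kappa>"
      "\<And>s t. s \<in> Iper \<Longrightarrow> t \<in> Iper \<Longrightarrow> \<bar>s - t\<bar> < \<eta> \<Longrightarrow> \<bar>u s - u t\<bar> < \<kappa>"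
    and radius: "window_radius N < \<eta>" "window_radius N < cell_radius" and "0 \<le> \<kappa>"
  shows "V f \<le> (\<integral>t. u t * f t \<partial>Lper) + 2 * \<kappa> * (\<integral>t. f t \<partial>Lper) + (C + U) * (F * (2 * pi / real N))"
proof -
  interpret positive_C1 f f' N by (rule assms(1))
  let ?sq = "\<lambda>i t. (window_piece f N i t)\<^sup>2"
  have squares: "H1per (?sq i)" for i using window_piece_C1per[of i] C1per_power2 C1per_H1per by blast
  have "V f = V (\<lambda>t. \<Sum>i<N. ?sq i t)" by (simp only: sum_window_piece_power2)
  also have "\<dots> = (\<Sum>i<N. V (?sq i))" by (rule Hminus_sum[OF V_Hminus finite_lessThan squares])
  also have "\<dots> \<le> (\<Sum>i<N. (\<integral>t. u t * ?sq i t \<partial>Lper) + 2 * \<kappa> * piece_mass f N i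
      + (if i = 0 then (C + U) * piece_mass f N 0 else 0))"
  proof (rule sum_mono)
    fix i assume "i \<in> {..<N}"
    then have i: "i < N" by simp
    show "V (?sq i) \<le> (\<integral>t. u t * ?sq i t \<partial>Lper) + 2 * \<kappa> * piece_mass f N i
        + (if i = 0 then (C + U) * piece_mass f N 0 else 0)"
    proof (cases "i = 0")
      case True
      have "V (?sq 0) \<le> (\<integral>t. u t * ?sq 0 t \<partial>Lper) + (C + U) * piece_mass f N 0"
        by (rule V_window_piece_0_le[OF assms(1) u(1,2) C radius(2)])
      moreover have "0 \<le> 2 * \<kappa> * piece_mass f N 0" using piece_mass_pos[of 0] two_le_N \<open>0 \<le> \<kappa>\<close> by simp
      ultimately show ?thesis unfolding True by simp
    next
      case False
      have "V (?sq i) \<le> (\<integral>t. u t * ?sq i t \<partial>Lper) + 2 * \<kappa> * piece_mass f N i"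
        by (rule V_inner_window_piece_le[OF assms(1) u(1) _ i radius(1) \<eta>]) (use False in simp)
      then show ?thesis using False by simp
    qed
  qed
  also have "\<dots> = (\<Sum>i<N. \<integral>t. u t * ?sq i t \<partial>Lper) + 2 * \<kappa> * (\<Sum>i<N. piece_mass f N i) + (C + U) * piece_mass f N 0"
    using two_le_N by (simp add: sum.distrib sum_distrib_left)
  also have "(\<Sum>i<N. \<integral>t. u t * ?sq i t \<partial>Lper) = (\<integral>t. (\<Sum>i<N. u t * ?sq i t) \<partial>Lper)"
    by (intro Bochner_Integration.integral_sum[symmetric] integrable_mult_window_piece u(1))
  also have "\<dots> = (\<integral>t. u t * f t \<partial>Lper)" by (simp add: sum_window_piece_power2 flip: sum_distrib_left)
  also have "(\<Sum>i<N. piece_mass f N i) = (\<integral>t. f t \<partial>Lper)" by (rule sum_piece_mass)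
  also have "(C + U) * piece_mass f N 0 \<le> (C + U) * (F * (2 * pi / real N))"
    using localized_boundD(1)[OF C] u(3) by (intro mult_left_mono piece_mass_le f_le) auto
  finally show ?thesis by simp
qed

lemma V_le_integral:
  assumes C: "localized_bound C" and u: "continuous_on Iper u"
    and narrow: "\<And>t e. t \<in> Iper \<Longrightarrow> 0 < e \<Longrightarrow> \<exists>d>0. \<forall>\<phi>\<in>narrow_orbitals t d. V (\<lambda>t. (\<phi> t)\<^sup>2) \<le> u t + e"
    and f: "C1per f f'" "\<And>t. 0 < f t"
  shows "V f \<le> (\<integral>t. u t * f t \<partial>Lper)"
proof (rule field_le_epsilon)
  fix e :: real assume e: "0 < e"
  obtain U where U: "0 \<le> U" "\<And>t. t \<in> Iper \<Longrightarrow> \<bar>u t\<bar> \<le> U" using continuous_bounded_Iper[OF u] by blast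
  obtain F where F: "\<And>t. \<bar>f t\<bar> \<le> F" using C1per_bounded[OF f(1)] by metis
  let ?I = "\<integral>t. f t \<partial>Lper"
  have I: "0 \<le> ?I" using f(2) by (intro integral_nonneg_AE AE_I2) (simp add: less_imp_le)
  define \<kappa> where "\<kappa> = e / (2 * (1 + ?I))"
  have \<kappa>: "0 < \<kappa>" using e I by (simp add: \<kappa>_def)
  have \<kappa>_small: "2 * \<kappa> * ?I \<le> e" using e I by (simp add: \<kappa>_def field_simps)
  obtain \<eta> where \<eta>: "0 < \<eta>" "\<And>c \<phi>. c \<in> Iper \<Longrightarrow> \<phi> \<in> narrow_orbitals c \<eta> \<Longrightarrow> V (\<lambda>t. (\<phi> t)\<^sup>2) \<le> u c + \<kappa>"
    "\<And>s t. s \<in> Iper \<Longrightarrow> t \<in> Iper \<Longrightarrow> \<bar>s - t\<bar> < \<eta> \<Longrightarrow> \<bar>u s - u t\<bar> < \<kappa>"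
    using uniform_narrow_bound[OF u narrow \<kappa>] by blast
  have "window_radius \<longlonglongrightarrow> 0" "(\<lambda>N. (C + U) * (F * (2 * pi / real N))) \<longlonglongrightarrow> 0"
    unfolding window_radius_def[abs_def] by real_asymp+
  then have "\<forall>\<^sub>F N in sequentially. window_radius N < \<eta>" "\<forall>\<^sub>F N in sequentially. window_radius N < cell_radius"
    using \<eta>(1) cell_radius_bounds(1) by (auto intro: order_tendstoD(2))
  then have "\<forall>\<^sub>F N in sequentially. V f \<le> (\<integral>t. u t * f t \<partial>Lper) + 2 * \<kappa> * ?I + (C + U) * (F * (2 * pi / real N))"
    using eventually_ge_at_top[of 2]
  proof eventually_elim
    case (elim N)
    have f_positive: "positive_C1 f f' N" using f elim(3) by (simp add: positive_C1_def)
    have f_le: "f t \<le> F" for t using F[of t] by (simp add: abs_le_iff)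
    show ?case by (rule V_window_pieces_le[OF f_positive f_le u U(2,1) C \<eta>(2,3) elim(1,2) less_imp_le[OF \<kappa>]])
  qed
  moreover have "(\<lambda>N. (\<integral>t. u t * f t \<partial>Lper) + 2 * \<kappa> * ?I + (C + U) * (F * (2 * pi / real N)))
      \<longlonglongrightarrow> (\<integral>t. u t * f t \<partial>Lper) + 2 * \<kappa> * ?I + 0"
    by (intro tendsto_intros) real_asymp
  ultimately have "V f \<le> (\<integral>t. u t * f t \<partial>Lper) + 2 * \<kappa> * ?I + 0" by (intro tendsto_lowerbound) auto
  then show "V f \<le> (\<integral>t. u t * f t \<partial>Lper) + e" using \<kappa>_small by linarith
qed

lemma exists_potential:
  obtains u where "regular_kantorovich_pot n w \<rho> u" "\<And>f. H1per f \<Longrightarrow> V f = (\<integral>t. u t * f t \<partial>Lper)"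
proof -
  obtain C where C: "localized_bound C" using localized_bound_exists by blast
  obtain u where u: "dual_feasible u" "\<And>t. t \<in> Iper \<Longrightarrow> envelope C t \<le> u t" "continuous_on Iper u"
    using continuous_dual_feasible_above[OF dual_feasible_envelope[OF C] envelope_ge[OF C]]
      localized_boundD(1)[OF C] by auto
  have narrow: "\<exists>d>0. \<forall>\<phi>\<in>narrow_orbitals t d. V (\<lambda>t. (\<phi> t)\<^sup>2) \<le> u t + e" if "t \<in> Iper" "0 < e" for t e
    using V_le_envelope[OF C that(2), of t] u(2)[OF that(1)] by (metis add_right_mono order_trans)
  have dominated: "V f \<le> (\<integral>t. u t * f t \<partial>Lper)" if "C1per f f'" "\<And>t. 0 < f t" for f f'
    by (rule V_le_integral[OF C u(3) narrow that])
  define L where "L = (\<lambda>f. 1 * (\<integral>t. u t * f t \<partial>Lper) + (-1) * V f)"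
  have "0 \<le> L \<rho>"
  proof (rule Hminus_nonneg_if_positive_C1[of L])
    show "Hminus L" unfolding L_def by (rule Hminus_functional_lin[OF Hminus_integral[OF u(3)] V_Hminus])
  qed (use dominated DperD[OF \<rho>_Dper] in \<open>auto simp: L_def\<close>)
  then have V_\<rho>_le: "V \<rho> \<le> (\<integral>t. \<rho> t * u t \<partial>Lper)" by (simp add: L_def mult.commute)
  have duality: "ennreal (real n * (\<integral>t. \<rho> t * u t \<partial>Lper)) \<le> FOT n w \<rho>"
    using weak_duality[OF \<rho>_Dper, of "\<lambda>_. u"] u(3) dual_feasibleD[OF u(1)] by simp
  then have "ennreal (real n * (\<integral>t. \<rho> t * u t \<partial>Lper)) \<le> ennreal (real n * V \<rho>)"
    using FOT_le_V by (rule order_trans)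
  then have "(\<integral>t. \<rho> t * u t \<partial>Lper) \<le> V \<rho>" using V_\<rho>_nonneg n_pos by (simp add: ennreal_le_iff)
  then have V_\<rho>_eq: "V \<rho> = (\<integral>t. \<rho> t * u t \<partial>Lper)" using V_\<rho>_le by simp
  show ?thesis
  proof (rule that)
    have "FOT n w \<rho> = ennreal (real n * (\<integral>t. \<rho> t * u t \<partial>Lper))"
      using FOT_le_V duality by (simp add: V_\<rho>_eq antisym)
    then show "regular_kantorovich_pot n w \<rho> u"
      using V_\<rho>_nonneg by (intro dual_feasible_regular_kantorovich_pot u \<rho>_Dper) (simp_all add: V_\<rho>_eq)
    show "V f = (\<integral>t. u t * f t \<partial>Lper)" if "H1per f" for f
      by (rule Hminus_eq_if_dominated_touching[OF V_Hminus Hminus_integral[OF u(3)] dominated \<rho>_Dper _ that])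
        (simp_all add: V_\<rho>_eq mult.commute)
  qed
qed

end

section \<open>Contact sets of regular potentials\<close>

lemma cN_cong: "(\<And>i. i < n \<Longrightarrow> x i = y i) \<Longrightarrow> cN n w x = cN n w y"
  unfolding cN_def by (intro sum.cong) auto

context cost
begin

lemma regular_kantorovich_potD:
  assumes "regular_kantorovich_pot n w \<rho> u"
  shows "continuous_on Iper u" "dual_feasible u" "0 \<le> (\<integral>t. \<rho> t * u t \<partial>Lper)"
    "FOT n w \<rho> = ennreal (real n * (\<integral>t. \<rho> t * u t \<partial>Lper))"
proof -
  let ?r = "real n * (\<integral>t. \<rho> t * u t \<partial>Lper)"
  have FOT: "enn2ereal (FOT n w \<rho>) = ereal ?r"
    using assms by (simp add: regular_kantorovich_pot_def kantorovich_pot_def)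
  have "0 \<le> enn2ereal (FOT n w \<rho>)" by simp
  then have r: "0 \<le> ?r" unfolding FOT by simp
  then show "0 \<le> (\<integral>t. \<rho> t * u t \<partial>Lper)" using n_pos by (simp add: zero_le_mult_iff)
  have "enn2ereal (FOT n w \<rho>) = enn2ereal (ennreal ?r)" using FOT r by (simp add: enn2ereal_ennreal)
  then show "FOT n w \<rho> = ennreal ?r" by (simp only: enn2ereal_inject)
  show "continuous_on Iper u" using assms by (simp add: regular_kantorovich_pot_def)
  show "dual_feasible u" unfolding dual_feasible_def
  proof
    fix x assume x: "x \<in> noncolliding"
    let ?y = "restrict x {..<n}"
    have "?y \<in> PiE {..<n} (\<lambda>_. Iper)" using noncolliding_Iper[OF x] by auto
    then have "0 \<le> enn2ereal (cN n w ?y) - ereal (\<Sum>j<n. u (?y j))"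
      using assms unfolding regular_kantorovich_pot_def kantorovich_pot_def by blast
    moreover have "cN n w ?y = ennreal (real_cost x)" using cN_cong[of n ?y x w] cN_noncolliding[OF x] by simp
    moreover have "(\<Sum>j<n. u (?y j)) = (\<Sum>j<n. u (x j))" by (rule sum.cong) auto
    ultimately show "(\<Sum>i<n. u (x i)) \<le> real_cost x"
      using real_cost_nonneg[of x] by (simp add: enn2ereal_ennreal)
  qed
qed

lemma regular_kantorovich_pot_integral_eq:
  assumes "regular_kantorovich_pot n w \<rho> u" "regular_kantorovich_pot n w \<rho> v"
  shows "(\<integral>t. \<rho> t * u t \<partial>Lper) = (\<integral>t. \<rho> t * v t \<partial>Lper)"
  using regular_kantorovich_potD(3,4)[OF assms(1)] regular_kantorovich_potD(3,4)[OF assms(2)] n_pos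
  by (simp add: ennreal_inj)

lemma regular_kantorovich_pot_average:
  assumes \<rho>: "Dper \<rho>" and u: "regular_kantorovich_pot n w \<rho> u" and v: "regular_kantorovich_pot n w \<rho> v"
  shows "regular_kantorovich_pot n w \<rho> (\<lambda>t. (u t + v t) / 2)"
proof -
  note u_facts = regular_kantorovich_potD[OF u] and v_facts = regular_kantorovich_potD[OF v]
  have "(\<integral>t. \<rho> t * ((u t + v t) / 2) \<partial>Lper) = ((\<integral>t. \<rho> t * u t \<partial>Lper) + (\<integral>t. \<rho> t * v t \<partial>Lper)) / 2"
    using DperD(2)[OF \<rho>] u_facts(1) v_facts(1)
    by (simp add: distrib_left integrable_Lper_cont continuous_on_mult)
  then have integral: "(\<integral>t. \<rho> t * ((u t + v t) / 2) \<partial>Lper) = (\<integral>t. \<rho> t * u t \<partial>Lper)"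
    using regular_kantorovich_pot_integral_eq[OF u v] by simp
  have "dual_feasible (\<lambda>t. (u t + v t) / 2)" unfolding dual_feasible_def
  proof
    fix x assume x: "x \<in> noncolliding"
    show "(\<Sum>i<n. (u (x i) + v (x i)) / 2) \<le> real_cost x"
      using dual_feasibleD[OF u_facts(2) x] dual_feasibleD[OF v_facts(2) x]
      by (simp add: sum.distrib flip: sum_divide_distrib)
  qed
  then show ?thesis using u_facts v_facts \<rho> integral
    by (intro dual_feasible_regular_kantorovich_pot continuous_intros) auto
qed

lemma approximate_contact_exists:
  assumes \<rho>: "Dper \<rho>" and u: "regular_kantorovich_pot n w \<rho> u" and t: "t \<in> Iper" and \<delta>: "0 < \<delta>"
  shows "\<exists>x\<in>noncolliding. \<bar>x 0 - t\<bar> < \<delta> \<and> real_cost x \<le> (\<Sum>i<n. u (x i)) + \<delta>"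
proof (rule ccontr)
  assume "\<not> ?thesis"
  then have slack: "(\<Sum>i<n. u (x i)) + \<delta> < real_cost x" if "x \<in> noncolliding" "\<bar>x 0 - t\<bar> < \<delta>" for x
    using that by force
  note u_facts = regular_kantorovich_potD[OF u]
  define h where "h = (\<lambda>s. max 0 (\<delta> - \<bar>s - t\<bar>))"
  have h_cont: "continuous_on B h" for B unfolding h_def by (intro continuous_intros)
  let ?f = "\<lambda>i s. u s + (if i = 0 then h s else 0)"
  have "0 < (\<integral>s. \<rho> s * h s \<partial>Lper)"
    using DperD(3)[OF \<rho>] t \<delta>
    by (intro integral_Lper_pos[OF _ _ t] continuous_intros DperD(2)[OF \<rho>] h_cont) (auto simp: h_def less_imp_le)
  moreover have "ennreal (\<Sum>i<n. \<integral>s. \<rho> s * ?f i s \<partial>Lper) \<le> FOT n w \<rho>"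
  proof (rule weak_duality[OF \<rho>])
    show "continuous_on Iper (?f i)" for i
      using u_facts(1) h_cont by (cases "i = 0") (auto intro!: continuous_intros)
    fix x assume x: "x \<in> noncolliding"
    have "(\<Sum>i<n. ?f i (x i)) = (\<Sum>i<n. u (x i)) + h (x 0)" using n_pos by (simp add: sum.distrib)
    also have "\<dots> \<le> real_cost x"
      using slack[OF x] dual_feasibleD[OF u_facts(2) x] by (cases "\<bar>x 0 - t\<bar> < \<delta>") (auto simp: h_def)
    finally show "(\<Sum>i<n. ?f i (x i)) \<le> real_cost x" .
  qed
  moreover have "(\<Sum>i<n. \<integral>s. \<rho> s * ?f i s \<partial>Lper) = real n * (\<integral>s. \<rho> s * u s \<partial>Lper) + (\<integral>s. \<rho> s * h s \<partial>Lper)"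
  proof -
    have slot_integral: "(\<integral>s. \<rho> s * ?f i s \<partial>Lper)
        = (\<integral>s. \<rho> s * u s \<partial>Lper) + (if i = 0 then \<integral>s. \<rho> s * h s \<partial>Lper else 0)" for i
      using DperD(2)[OF \<rho>] u_facts(1) h_cont
      by (simp add: distrib_left integrable_Lper_cont continuous_on_mult)
    show ?thesis unfolding slot_integral using n_pos by (simp add: sum.distrib)
  qed
  ultimately show False using u_facts(3) by (simp add: u_facts(4) ennreal_le_iff)
qed

lemma separated_convergent_subsequence:
  assumes y: "\<And>k. y k \<in> separated a"
  obtains r x where "strict_mono (r :: nat \<Rightarrow> nat)" "x \<in> separated a" "\<And>i. i < n \<Longrightarrow> (\<lambda>k. y (r k) i) \<longlonglongrightarrow> x i"
proof -
  have y_Iper: "y k i \<in> Iper" if "i < n" for k i using y[of k] that by (simp add: separated_def)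
  obtain r where r: "strict_mono (r :: nat \<Rightarrow> nat)" "\<And>i. i \<in> {..<n} \<Longrightarrow> \<exists>l. (\<lambda>k. y (r k) i) \<longlonglongrightarrow> l"
    by (rule function_convergent_subsequence[of "{..<n}" y "2 * pi"]) (use y_Iper in \<open>force simp: Iper_def\<close>)+
  then obtain x where x: "\<And>i. i < n \<Longrightarrow> (\<lambda>k. y (r k) i) \<longlonglongrightarrow> x i" by (metis lessThan_iff)
  have "x \<in> separated a" unfolding separated_def
  proof (intro CollectI conjI allI impI)
    show "x i \<in> Iper" if "i < n" for i
      using closed_sequentially[OF compact_imp_closed[OF compact_Iper] _ x[OF that]] y_Iper[OF that] by blast
    fix i j assume ij: "i < n" "j < n" "i \<noteq> j"
    have "isCont distT z" for z
      using distT_cont[OF continuous_on_id, of UNIV] by (simp add: continuous_on_eq_continuous_at)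
    then have "(\<lambda>k. distT (y (r k) i - y (r k) j)) \<longlonglongrightarrow> distT (x i - x j)"
      by (rule isCont_tendsto_compose) (intro tendsto_intros x ij)
    then show "a \<le> distT (x i - x j)" by (rule LIMSEQ_le_const) (use y ij in \<open>auto simp: separated_def\<close>)
  qed
  with r(1) show ?thesis using x by (rule that)
qed

lemma real_cost_tendsto:
  assumes a: "0 < a" and x: "x \<in> separated a" and y: "\<And>k i. i < n \<Longrightarrow> y k i \<in> Iper"
    and lim: "\<And>i. i < n \<Longrightarrow> (\<lambda>k. y k i) \<longlonglongrightarrow> x i"
  shows "(\<lambda>k. real_cost (y k)) \<longlonglongrightarrow> real_cost x"
proof (rule tendstoI)
  fix e :: real assume "0 < e"
  then obtain d where d: "cost_modulus a e d" using cost_modulus_exists[OF a] by blast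
  then have "\<forall>\<^sub>F k in sequentially. \<forall>i\<in>{..<n}. dist (y k i) (x i) < d"
    using lim by (intro eventually_ball_finite) (auto simp: tendsto_iff cost_modulus_def)
  then show "\<forall>\<^sub>F k in sequentially. dist (real_cost (y k)) (real_cost x) < e"
    by eventually_elim (use cost_modulusD(2)[OF d x y] in \<open>auto simp: dist_real_def\<close>)
qed

lemma contact_imp_separated:
  assumes u: "continuous_on Iper u"
  obtains a where "0 < a" "\<And>x. x \<in> noncolliding \<Longrightarrow> real_cost x \<le> (\<Sum>i<n. u (x i)) + 1 \<Longrightarrow> x \<in> separated a"
proof -
  obtain U where U: "\<And>t. t \<in> Iper \<Longrightarrow> \<bar>u t\<bar> \<le> U" using continuous_bounded_Iper[OF u] by metis
  obtain a
    where a: "0 < a" "\<And>x. (\<And>i. i < n \<Longrightarrow> x i \<in> Iper) \<Longrightarrow> cN n w x \<le> ennreal (real n * U + 1) \<Longrightarrow> x \<in> separated a"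
    using separated_if_cN_bounded[of "real n * U + 1"] by blast
  have "x \<in> separated a" if x: "x \<in> noncolliding" and near: "real_cost x \<le> (\<Sum>i<n. u (x i)) + 1" for x
  proof (rule a(2)[OF noncolliding_Iper[OF x]])
    have "(\<Sum>i<n. u (x i)) \<le> (\<Sum>i<n. U)"
      using U[OF noncolliding_Iper[OF x]] by (intro sum_mono) (auto simp: abs_le_iff)
    then show "cN n w x \<le> ennreal (real n * U + 1)"
      unfolding cN_noncolliding[OF x] using near by (intro ennreal_leI) simp
  qed
  with a(1) show ?thesis by (rule that)
qed

lemma contact_exists:
  assumes \<rho>: "Dper \<rho>" and u: "regular_kantorovich_pot n w \<rho> u" and t: "t \<in> Iper"
  shows "\<exists>x\<in>noncolliding. x 0 = t \<and> (\<Sum>i<n. u (x i)) = real_cost x"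
proof -
  note u_facts = regular_kantorovich_potD[OF u]
  define \<delta> where "\<delta> = (\<lambda>k::nat. inverse (real (Suc k)))"
  have \<delta>: "0 < \<delta> k" "\<delta> k \<le> 1" for k by (auto simp: \<delta>_def inverse_le_1_iff)
  obtain y
    where y: "\<And>k. y k \<in> noncolliding" "\<And>k. \<bar>y k 0 - t\<bar> < \<delta> k" "\<And>k. real_cost (y k) \<le> (\<Sum>i<n. u (y k i)) + \<delta> k"
    using approximate_contact_exists[OF \<rho> u t \<delta>(1)] by metis
  obtain a where a: "0 < a" "\<And>x. x \<in> noncolliding \<Longrightarrow> real_cost x \<le> (\<Sum>i<n. u (x i)) + 1 \<Longrightarrow> x \<in> separated a"
    using contact_imp_separated[OF u_facts(1)] by metis
  have "y k \<in> separated a" for k using y(1,3)[of k] \<delta>(2)[of k] by (intro a(2)) auto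
  then obtain r x where r: "strict_mono r" and x: "x \<in> separated a" "\<And>i. i < n \<Longrightarrow> (\<lambda>k. y (r k) i) \<longlonglongrightarrow> x i"
    using separated_convergent_subsequence by blast
  have y_Iper: "y (r k) i \<in> Iper" if "i < n" for k i using noncolliding_Iper[OF y(1) that] .
  have x_noncolliding: "x \<in> noncolliding" by (rule separated_imp_noncolliding[OF x(1) a(1)])
  have \<delta>_lim: "(\<lambda>k. \<delta> (r k)) \<longlonglongrightarrow> 0"
    using LIMSEQ_subseq_LIMSEQ[OF LIMSEQ_inverse_real_of_nat r] by (simp add: o_def \<delta>_def)
  have "(\<lambda>k. \<bar>y (r k) 0 - t\<bar>) \<longlonglongrightarrow> \<bar>x 0 - t\<bar>" using n_pos by (intro tendsto_intros x(2)) simp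
  then have "\<bar>x 0 - t\<bar> \<le> 0" by (rule LIMSEQ_le[OF _ \<delta>_lim]) (use y(2) less_imp_le in blast)
  moreover have "(\<lambda>k. \<Sum>i<n. u (y (r k) i)) \<longlonglongrightarrow> (\<Sum>i<n. u (x i))"
  proof (rule tendsto_sum)
    show "(\<lambda>k. u (y (r k) i)) \<longlonglongrightarrow> u (x i)" if "i \<in> {..<n}" for i
      using that y_Iper noncolliding_Iper[OF x_noncolliding]
      by (intro continuous_on_tendsto_compose[OF u_facts(1) x(2)]) auto
  qed
  then have "(\<lambda>k. (\<Sum>i<n. u (y (r k) i)) + \<delta> (r k)) \<longlonglongrightarrow> (\<Sum>i<n. u (x i)) + 0" by (intro tendsto_add \<delta>_lim)
  from LIMSEQ_le[OF real_cost_tendsto[OF a(1) x(1), of "\<lambda>k. y (r k)", OF y_Iper x(2)] this]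
  have "real_cost x \<le> (\<Sum>i<n. u (x i)) + 0" using y(3) by auto
  ultimately show ?thesis using dual_feasibleD[OF u_facts(2) x_noncolliding] x_noncolliding by force
qed

lemma common_contact_exists:
  assumes \<rho>: "Dper \<rho>" and u: "regular_kantorovich_pot n w \<rho> u" and v: "regular_kantorovich_pot n w \<rho> v"
    and t: "t \<in> Iper"
  shows "\<exists>x\<in>noncolliding. x 0 = t \<and> (\<Sum>i<n. u (x i)) = real_cost x \<and> (\<Sum>i<n. v (x i)) = real_cost x"
proof -
  obtain x where x: "x \<in> noncolliding" "x 0 = t" "(\<Sum>i<n. (u (x i) + v (x i)) / 2) = real_cost x"
    using contact_exists[OF \<rho> regular_kantorovich_pot_average[OF \<rho> u v] t] by blast
  then have "(\<Sum>i<n. u (x i)) + (\<Sum>i<n. v (x i)) = 2 * real_cost x"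
    by (simp add: sum.distrib flip: sum_divide_distrib)
  moreover have "(\<Sum>i<n. u (x i)) \<le> real_cost x" "(\<Sum>i<n. v (x i)) \<le> real_cost x"
    using u v x(1) by (auto intro!: dual_feasibleD regular_kantorovich_potD)
  ultimately show ?thesis using x(1,2) by (intro bexI[of _ x]) auto
qed

end

section \<open>Uniqueness of the regular potential\<close>

definition uniform_supergradient_on :: "real set \<Rightarrow> (real \<Rightarrow> real) \<Rightarrow> (real \<Rightarrow> real) \<Rightarrow> bool" where
  "uniform_supergradient_on S u p \<longleftrightarrow>
     (\<forall>e>0. \<exists>d>0. \<forall>s\<in>S. \<forall>t\<in>S. \<bar>s - t\<bar> < d \<longrightarrow> u s - u t \<le> p t * (s - t) + e * \<bar>s - t\<bar>)"


text \<open>If two functions share the supergradient p, then their difference changes along a partition of mesh h by at most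
  h times a telescoping sum of differences of p, which is negligible.\<close>

lemma supergradient_telescope:
  assumes "a < b" and N: "0 < N" "(b - a) / real N < d"
    and u: "\<And>s t. s \<in> {a..b} \<Longrightarrow> t \<in> {a..b} \<Longrightarrow> \<bar>s - t\<bar> < d \<Longrightarrow> u s - u t \<le> p t * (s - t) + e * \<bar>s - t\<bar>"
    and v: "\<And>s t. s \<in> {a..b} \<Longrightarrow> t \<in> {a..b} \<Longrightarrow> \<bar>s - t\<bar> < d \<Longrightarrow> v s - v t \<le> p t * (s - t) + e * \<bar>s - t\<bar>"
  shows "(u b - v b) - (u a - v a) \<le> (p a - p b) * ((b - a) / real N) + 2 * e * (b - a)"
proof -
  define h where "h = (b - a) / real N"
  define \<tau> where "\<tau> = (\<lambda>i::nat. a + real i * h)"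
  have h: "0 < h" "h < d" "real N * h = b - a" using assms(1-3) by (simp_all add: h_def)
  have \<tau>_ends: "\<tau> 0 = a" "\<tau> N = b" using h(3) by (simp_all add: \<tau>_def)
  have \<tau>_in: "\<tau> i \<in> {a..b}" if "i \<le> N" for i
  proof -
    have "real i * h \<le> real N * h" using that h(1) by (intro mult_right_mono) auto
    then show ?thesis using h by (simp add: \<tau>_def)
  qed
  have step: "(u (\<tau> (Suc i)) - v (\<tau> (Suc i))) - (u (\<tau> i) - v (\<tau> i))
      \<le> (p (\<tau> i) - p (\<tau> (Suc i))) * h + 2 * e * h" if "i < N" for i
  proof -
    have \<tau>_step: "\<tau> (Suc i) - \<tau> i = h" by (simp add: \<tau>_def algebra_simps)
    then have \<tau>_step_back: "\<tau> i - \<tau> (Suc i) = - h" by linarith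
    have "u (\<tau> (Suc i)) - u (\<tau> i) \<le> p (\<tau> i) * h + e * h"
      using u[of "\<tau> (Suc i)" "\<tau> i"] \<tau>_in that h(1,2) by (simp add: \<tau>_step)
    moreover have "v (\<tau> i) - v (\<tau> (Suc i)) \<le> p (\<tau> (Suc i)) * (- h) + e * h"
      using v[of "\<tau> i" "\<tau> (Suc i)"] \<tau>_in that h(1,2) by (simp add: \<tau>_step_back)
    ultimately show ?thesis by (simp add: left_diff_distrib)
  qed
  have "(u b - v b) - (u a - v a) = (\<Sum>i<N. (u (\<tau> (Suc i)) - v (\<tau> (Suc i))) - (u (\<tau> i) - v (\<tau> i)))"
    using sum_lessThan_telescope[of "\<lambda>i. u (\<tau> i) - v (\<tau> i)" N] by (simp add: \<tau>_ends)
  also have "\<dots> \<le> (\<Sum>i<N. (p (\<tau> i) - p (\<tau> (Suc i))) * h + 2 * e * h)" using step by (intro sum_mono) auto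
  also have "\<dots> = (\<Sum>i<N. p (\<tau> i) - p (\<tau> (Suc i))) * h + 2 * e * (real N * h)"
    by (simp add: sum.distrib sum_distrib_right)
  also have "(\<Sum>i<N. p (\<tau> i) - p (\<tau> (Suc i))) = p a - p b"
    using sum_lessThan_telescope'[of "\<lambda>i. p (\<tau> i)" N] by (simp add: \<tau>_ends)
  finally show ?thesis by (simp only: h(3)) (simp add: h_def)
qed

lemma common_supergradient_antimono:
  assumes u: "uniform_supergradient_on S u p" and v: "uniform_supergradient_on S v p"
    and ab: "a < b" "{a..b} \<subseteq> S"
  shows "u b - v b \<le> u a - v a"
proof -
  have "(u b - v b) - (u a - v a) \<le> 0"
  proof (rule field_le_epsilon)
    fix \<eta> :: real assume \<eta>: "0 < \<eta>"
    define e where "e = \<eta> / (2 * (b - a))"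
    have e: "0 < e" "2 * e * (b - a) = \<eta>" using \<eta> ab(1) by (simp_all add: e_def field_simps)
    obtain du where du: "0 < du" "\<forall>s\<in>S. \<forall>t\<in>S. \<bar>s - t\<bar> < du \<longrightarrow> u s - u t \<le> p t * (s - t) + e * \<bar>s - t\<bar>"
      using u e(1) unfolding uniform_supergradient_on_def by blast
    obtain dv where dv: "0 < dv" "\<forall>s\<in>S. \<forall>t\<in>S. \<bar>s - t\<bar> < dv \<longrightarrow> v s - v t \<le> p t * (s - t) + e * \<bar>s - t\<bar>"
      using v e(1) unfolding uniform_supergradient_on_def by blast
    have "(\<lambda>N. (b - a) / real N) \<longlonglongrightarrow> 0" by real_asymp
    then have "\<forall>\<^sub>F N in sequentially. (b - a) / real N < min du dv"
      using du(1) dv(1) by (intro order_tendstoD(2)) auto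
    then have "\<forall>\<^sub>F N in sequentially. (u b - v b) - (u a - v a)
        \<le> (p a - p b) * ((b - a) / real N) + 2 * e * (b - a)"
      using eventually_gt_at_top[of 0]
    proof eventually_elim
      case (elim N)
      then show ?case using du(2) dv(2) ab(2)
        by (intro supergradient_telescope[OF ab(1), where d = "min du dv"]) (simp_all add: subset_iff)
    qed
    moreover have "(\<lambda>N. (p a - p b) * ((b - a) / real N) + 2 * e * (b - a)) \<longlonglongrightarrow> 0 + 2 * e * (b - a)"
      by (intro tendsto_intros) real_asymp
    ultimately show "(u b - v b) - (u a - v a) \<le> 0 + \<eta>"
      unfolding e(2) by (intro tendsto_lowerbound) auto
  qed
  then show ?thesis by simp
qed

lemma C1_offdiag_partial_derivative:
  assumes "C1_offdiag w"
  obtains g where "continuous_on offdiag g"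
    "\<And>J s z. (\<lambda>s. (s, z)) ` J \<subseteq> offdiag \<Longrightarrow> s \<in> J \<Longrightarrow>
       ((\<lambda>s. enn2real (w (s, z))) has_field_derivative g (s, z)) (at s within J)"
proof -
  obtain D :: "real \<times> real \<Rightarrow> ((real \<times> real) \<Rightarrow>\<^sub>L real)" where D: "continuous_on offdiag D"
    and w_deriv: "\<And>p. p \<in> offdiag \<Longrightarrow> ((\<lambda>q. enn2real (w q)) has_derivative blinfun_apply (D p)) (at p within offdiag)"
    using assms unfolding C1_offdiag_def by blast
  show ?thesis
  proof (rule that[of "\<lambda>p. blinfun_apply (D p) (1, 0)"])
    show "continuous_on offdiag (\<lambda>p. blinfun_apply (D p) (1, 0))" by (intro continuous_intros D)
    fix J s z assume J: "(\<lambda>s. (s, z)) ` J \<subseteq> offdiag" and s: "s \<in> J"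
    have "((\<lambda>q. enn2real (w q)) has_derivative blinfun_apply (D (s, z))) (at (s, z) within (\<lambda>s. (s, z)) ` J)"
      using J s by (intro has_derivative_subset[OF w_deriv J]) auto
    moreover have "((\<lambda>s. (s, z)) has_derivative (\<lambda>h. (h, 0))) (at s within J)"
      by (auto intro!: derivative_eq_intros)
    ultimately have "((\<lambda>q. enn2real (w q)) \<circ> (\<lambda>s. (s, z)) has_derivative
        blinfun_apply (D (s, z)) \<circ> (\<lambda>h. (h, 0))) (at s within J)"
      by (rule diff_chain_within[rotated])
    moreover have "blinfun_apply (D (s, z)) \<circ> (\<lambda>h. (h, 0)) = (*) (blinfun_apply (D (s, z)) (1, 0))"
    proof
      fix h :: real
      show "(blinfun_apply (D (s, z)) \<circ> (\<lambda>h. (h, 0))) h = blinfun_apply (D (s, z)) (1, 0) * h"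
        using blinfun.scaleR_right[of "D (s, z)" h "(1, 0)"] by simp
    qed
    ultimately show "((\<lambda>s. enn2real (w (s, z))) has_field_derivative
        blinfun_apply (D (s, z)) (1, 0)) (at s within J)"
      by (simp add: has_field_derivative_def o_def)
  qed
qed

context cost
begin

lemma linearization_error_le:
  fixes \<phi> :: "real \<Rightarrow> real"
  assumes deriv: "\<And>r. r \<in> closed_segment s t \<Longrightarrow> (\<phi> has_field_derivative \<phi>' r) (at r within closed_segment s t)"
    and close: "\<And>r. r \<in> closed_segment s t \<Longrightarrow> \<bar>\<phi>' r - c\<bar> \<le> e"
  shows "\<bar>\<phi> s - \<phi> t - c * (s - t)\<bar> \<le> e * \<bar>s - t\<bar>"
proof -
  have "norm ((\<phi> s - c * s) - (\<phi> t - c * t)) \<le> e * norm (s - t)"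
  proof (rule field_differentiable_bound)
    show "((\<lambda>r. \<phi> r - c * r) has_field_derivative \<phi>' r - c) (at r within closed_segment s t)"
      if "r \<in> closed_segment s t" for r using that by (auto intro!: derivative_eq_intros deriv)
  qed (use close in auto)
  then show ?thesis by (simp add: algebra_simps)
qed

definition uniform_partial_derivative :: "real \<Rightarrow> (real \<times> real \<Rightarrow> real) \<Rightarrow> bool" where
  "uniform_partial_derivative a g \<longleftrightarrow> (\<forall>e>0. \<exists>d>0. \<forall>t z. \<forall>s\<in>Iper. (t, z) \<in> separated_pairs a \<longrightarrow> \<bar>s - t\<bar> < d \<longrightarrow>
     \<bar>enn2real (w (s, z)) - enn2real (w (t, z)) - g (t, z) * (s - t)\<bar> \<le> e * \<bar>s - t\<bar>)"

lemma separated_pairs_offdiag: "0 < a \<Longrightarrow> separated_pairs a \<subseteq> offdiag"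
  by (auto simp: separated_pairs_def offdiag_def)

lemma uniform_partial_derivative_exists:
  assumes C1: "C1_offdiag w" and a: "0 < a"
  obtains g where "uniform_partial_derivative a g"
proof -
  obtain g where g: "continuous_on offdiag g"
    and w_deriv: "\<And>J s z. (\<lambda>s. (s, z)) ` J \<subseteq> offdiag \<Longrightarrow> s \<in> J \<Longrightarrow>
       ((\<lambda>s. enn2real (w (s, z))) has_field_derivative g (s, z)) (at s within J)"
    using C1_offdiag_partial_derivative[OF C1] by metis
  have half_offdiag: "separated_pairs (a / 2) \<subseteq> offdiag" using a by (intro separated_pairs_offdiag) simp
  have "uniformly_continuous_on (separated_pairs (a / 2)) g"
    by (intro compact_uniformly_continuous compact_separated_pairs continuous_on_subset[OF g half_offdiag])
  note g_unif = this[unfolded uniformly_continuous_on_def, rule_format]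
  have "uniform_partial_derivative a g" unfolding uniform_partial_derivative_def
  proof (intro allI impI)
    fix e :: real assume "0 < e"
    from g_unif[OF this] obtain d where d: "0 < d"
      "\<And>p q. p \<in> separated_pairs (a / 2) \<Longrightarrow> q \<in> separated_pairs (a / 2) \<Longrightarrow> dist q p < d \<Longrightarrow> dist (g q) (g p) < e"
        by blast
    show "\<exists>d>0. \<forall>t z. \<forall>s\<in>Iper. (t, z) \<in> separated_pairs a \<longrightarrow> \<bar>s - t\<bar> < d \<longrightarrow>
      \<bar>enn2real (w (s, z)) - enn2real (w (t, z)) - g (t, z) * (s - t)\<bar> \<le> e * \<bar>s - t\<bar>"
    proof (intro exI[of _ "min d (a / 4)"] conjI allI ballI impI)
      show "0 < min d (a / 4)" using d(1) a by simp
      fix t z s assume s: "s \<in> Iper" and tz: "(t, z) \<in> separated_pairs a" and close: "\<bar>s - t\<bar> < min d (a / 4)"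
      define J where "J = closed_segment s t"
      have J_close: "\<bar>r - t\<bar> \<le> \<bar>s - t\<bar>" and J_Iper: "r \<in> Iper" if "r \<in> J" for r
        using that s tz
        by (auto simp: J_def closed_segment_eq_real_ivl separated_pairs_def Iper_def split: if_splits)
      have J_separated: "(r, z) \<in> separated_pairs (a / 2)" if "r \<in> J" for r
        using separated_pairs_perturb[OF tz, of "(r, z)"] J_close[OF that] J_Iper[OF that] tz close a
        by (auto simp: separated_pairs_def)
      have J_offdiag: "(\<lambda>r. (r, z)) ` J \<subseteq> offdiag" using J_separated half_offdiag by blast
      have "\<bar>g (r, z) - g (t, z)\<bar> \<le> e" if "r \<in> J" for r
        using d(2)[of "(t, z)" "(r, z)"] J_separated[OF that] J_separated[of t] J_close[OF that] close
        by (simp add: J_def dist_Pair_Pair dist_real_def)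
      then show "\<bar>enn2real (w (s, z)) - enn2real (w (t, z)) - g (t, z) * (s - t)\<bar> \<le> e * \<bar>s - t\<bar>"
        using w_deriv[OF J_offdiag] unfolding J_def by (intro linearization_error_le)
    qed
  qed
  then show ?thesis by (rule that)
qed

lemma real_cost_fun_upd:
  assumes x: "\<And>j. j < n \<Longrightarrow> x j \<in> Iper" and s: "s \<in> Iper" and i: "i < n"
  shows "real_cost (x(i := s)) - real_cost x
      = (\<Sum>j\<in>{..<n} - {i}. 2 * (enn2real (w (s, x j)) - enn2real (w (x i, x j))))"
proof -
  let ?W = "\<lambda>a b. enn2real (w (a, b))" and ?I = "{..<n} - {i}"
  have split: "real_cost z = (\<Sum>j\<in>?I. ?W (z i) (z j)) + (\<Sum>k\<in>?I. ?W (z k) (z i))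
      + (\<Sum>k\<in>?I. \<Sum>j\<in>?I - {k}. ?W (z k) (z j))" for z
  proof -
    have "real_cost z = (\<Sum>j\<in>?I. ?W (z i) (z j)) + (\<Sum>k\<in>?I. \<Sum>j\<in>{..<n} - {k}. ?W (z k) (z j))"
      unfolding real_cost_def using i by (intro sum.remove) auto
    also have "(\<Sum>k\<in>?I. \<Sum>j\<in>{..<n} - {k}. ?W (z k) (z j)) = (\<Sum>k\<in>?I. ?W (z k) (z i) + (\<Sum>j\<in>?I - {k}. ?W (z k) (z j)))"
    proof (rule sum.cong)
      fix k assume "k \<in> ?I"
      moreover have "{..<n} - {k} - {i} = ?I - {k}" by blast
      ultimately show "(\<Sum>j\<in>{..<n} - {k}. ?W (z k) (z j)) = ?W (z k) (z i) + (\<Sum>j\<in>?I - {k}. ?W (z k) (z j))"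
        using i sum.remove[of "{..<n} - {k}" i "\<lambda>j. ?W (z k) (z j)"] by simp
    qed simp
    finally show ?thesis by (simp add: sum.distrib)
  qed
  let ?y = "x(i := s)"
  have row: "(\<Sum>j\<in>?I. ?W (?y i) (?y j)) = (\<Sum>j\<in>?I. ?W s (x j))" by (rule sum.cong) auto
  have column: "(\<Sum>k\<in>?I. ?W (?y k) (?y i)) = (\<Sum>k\<in>?I. ?W s (x k))" "(\<Sum>k\<in>?I. ?W (x k) (x i)) = (\<Sum>k\<in>?I. ?W (x i) (x k))"
    using x s i w_sym by (auto intro!: sum.cong)
  have rest: "(\<Sum>k\<in>?I. \<Sum>j\<in>?I - {k}. ?W (?y k) (?y j)) = (\<Sum>k\<in>?I. \<Sum>j\<in>?I - {k}. ?W (x k) (x j))"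
    by (intro sum.cong) auto
  show ?thesis unfolding split[of ?y] split[of x] row column rest
    by (simp add: sum_subtractf flip: sum_distrib_left)
qed

lemma real_cost_fun_upd_le:
  assumes e: "\<And>j. j < n \<Longrightarrow> j \<noteq> i \<Longrightarrow> \<bar>enn2real (w (s, x j)) - enn2real (w (x i, x j)) - G j * (s - x i)\<bar>
      \<le> e * \<bar>s - x i\<bar>"
    and x: "\<And>j. j < n \<Longrightarrow> x j \<in> Iper" and s: "s \<in> Iper" and i: "i < n" and "0 \<le> e"
  shows "real_cost (x(i := s)) - real_cost x \<le> (\<Sum>j\<in>{..<n} - {i}. 2 * G j) * (s - x i) + 2 * real n * e * \<bar>s - x i\<bar>"
proof -
  let ?I = "{..<n} - {i}"
  have "real_cost (x(i := s)) - real_cost x = (\<Sum>j\<in>?I. 2 * (enn2real (w (s, x j)) - enn2real (w (x i, x j))))"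
    by (rule real_cost_fun_upd[OF x s i])
  also have "\<dots> \<le> (\<Sum>j\<in>?I. 2 * G j * (s - x i) + 2 * e * \<bar>s - x i\<bar>)"
  proof (rule sum_mono)
    fix j assume "j \<in> ?I"
    then show "2 * (enn2real (w (s, x j)) - enn2real (w (x i, x j))) \<le> 2 * G j * (s - x i) + 2 * e * \<bar>s - x i\<bar>"
      using e[of j] by auto
  qed
  also have "\<dots> = (\<Sum>j\<in>?I. 2 * G j) * (s - x i) + real (card ?I) * (2 * e * \<bar>s - x i\<bar>)"
    by (simp add: sum.distrib sum_distrib_right)
  also have "real (card ?I) * (2 * e * \<bar>s - x i\<bar>) \<le> real n * (2 * e * \<bar>s - x i\<bar>)"
    using i \<open>0 \<le> e\<close> by (intro mult_right_mono) auto
  finally show ?thesis by (simp add: mult_ac)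
qed

definition contact_family :: "real \<Rightarrow> (real \<Rightarrow> real) \<Rightarrow> (real \<Rightarrow> nat \<Rightarrow> real) \<Rightarrow> bool" where
  "contact_family a u X \<longleftrightarrow> (\<forall>t\<in>Iper. X t \<in> separated a \<and> X t 0 = t \<and> (\<Sum>i<n. u (X t i)) = real_cost (X t))"

lemma contact_family_supergradient:
  assumes a: "0 < a" and u: "dual_feasible u" and X: "contact_family a u X"
    and g: "uniform_partial_derivative a g"
  shows "uniform_supergradient_on Iper u (\<lambda>t. \<Sum>j\<in>{..<n} - {0}. 2 * g (t, X t j))"
  unfolding uniform_supergradient_on_def
proof (intro allI impI)
  fix e :: real assume "0 < e"
  define e' where "e' = e / (2 * real n)"
  have e': "0 < e'" "2 * real n * e' = e" using \<open>0 < e\<close> n_pos by (simp_all add: e'_def)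
  obtain d1 where d1: "0 < d1" "\<And>t z s. s \<in> Iper \<Longrightarrow> (t, z) \<in> separated_pairs a \<Longrightarrow> \<bar>s - t\<bar> < d1 \<Longrightarrow>
      \<bar>enn2real (w (s, z)) - enn2real (w (t, z)) - g (t, z) * (s - t)\<bar> \<le> e' * \<bar>s - t\<bar>"
    using g[unfolded uniform_partial_derivative_def, rule_format, OF e'(1)] by blast
  obtain d2 where d2: "cost_modulus a 1 d2" using cost_modulus_exists[OF a zero_less_one] by blast
  show "\<exists>d>0. \<forall>s\<in>Iper. \<forall>t\<in>Iper. \<bar>s - t\<bar> < d \<longrightarrow>
      u s - u t \<le> (\<Sum>j\<in>{..<n} - {0}. 2 * g (t, X t j)) * (s - t) + e * \<bar>s - t\<bar>"
  proof (intro exI[of _ "min d1 d2"] conjI ballI impI)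
    show "0 < min d1 d2" using d1(1) d2 by (simp add: cost_modulus_def)
    fix s t assume s: "s \<in> Iper" and "t \<in> Iper" and close: "\<bar>s - t\<bar> < min d1 d2"
    with X have Xt: "X t \<in> separated a" "X t 0 = t" "(\<Sum>i<n. u (X t i)) = real_cost (X t)"
      by (auto simp: contact_family_def)
    have X_Iper: "X t j \<in> Iper" if "j < n" for j using Xt(1) that by (simp add: separated_def)
    let ?y = "(X t)(0 := s)"
    have "?y \<in> separated (a / 2)"
      by (rule cost_modulusD(1)[OF d2 Xt(1)]) (use s close X_Iper Xt(2) d2 in \<open>auto simp: cost_modulus_def\<close>)
    then have "(\<Sum>i<n. u (?y i)) \<le> real_cost ?y"
      by (rule dual_feasibleD[OF u separated_imp_noncolliding[OF _ half_gt_zero[OF a]]])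
    moreover have "(\<Sum>i<n. u (?y i)) = (\<Sum>i<n. u (X t i)) + u s - u (X t 0)"
      using n_pos by (intro sum_fun_upd_point) auto
    moreover have "real_cost ?y - real_cost (X t)
        \<le> (\<Sum>j\<in>{..<n} - {0}. 2 * g (t, X t j)) * (s - X t 0) + 2 * real n * e' * \<bar>s - X t 0\<bar>"
    proof (rule real_cost_fun_upd_le)
      fix j assume j: "j < n" "j \<noteq> 0"
      then have "(X t 0, X t j) \<in> separated_pairs a" using Xt(1) n_pos by (auto simp: separated_iff)
      then show "\<bar>enn2real (w (s, X t j)) - enn2real (w (X t 0, X t j)) - g (t, X t j) * (s - X t 0)\<bar>
          \<le> e' * \<bar>s - X t 0\<bar>"
        using d1(2)[OF s, of t "X t j"] close by (simp add: Xt(2))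
    qed (use X_Iper s n_pos e' in auto)
    ultimately show "u s - u t \<le> (\<Sum>j\<in>{..<n} - {0}. 2 * g (t, X t j)) * (s - t) + e * \<bar>s - t\<bar>"
      unfolding Xt(2,3) e'(2) by linarith
  qed
qed

lemma common_contact_family:
  assumes \<rho>: "Dper \<rho>" and u: "regular_kantorovich_pot n w \<rho> u" and v: "regular_kantorovich_pot n w \<rho> v"
  obtains a X where "0 < a" "contact_family a u X" "contact_family a v X"
proof -
  obtain X where X: "\<And>t. t \<in> Iper \<Longrightarrow> X t \<in> noncolliding \<and> X t 0 = t \<and>
      (\<Sum>i<n. u (X t i)) = real_cost (X t) \<and> (\<Sum>i<n. v (X t i)) = real_cost (X t)"
    using common_contact_exists[OF \<rho> u v] by metis
  obtain a where a: "0 < a" "\<And>x. x \<in> noncolliding \<Longrightarrow> real_cost x \<le> (\<Sum>i<n. u (x i)) + 1 \<Longrightarrow> x \<in> separated a"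
    using contact_imp_separated[OF regular_kantorovich_potD(1)[OF u]] by metis
  have "X t \<in> separated a" if "t \<in> Iper" for t using X[OF that] by (intro a(2)) auto
  then show ?thesis using a(1) X by (intro that[of a X]) (auto simp: contact_family_def)
qed

lemma regular_kantorovich_pot_unique:
  assumes \<rho>: "Dper \<rho>" and C1: "C1_offdiag w" and u: "regular_kantorovich_pot n w \<rho> u"
    and v: "regular_kantorovich_pot n w \<rho> v"
    and "x \<in> Iper"
  shows "u x = v x"
proof -
  obtain a X where a: "0 < a" and X: "contact_family a u X" "contact_family a v X"
    using common_contact_family[OF \<rho> u v] by blast
  obtain g where g: "uniform_partial_derivative a g" using uniform_partial_derivative_exists[OF C1 a] by blast
  let ?p = "\<lambda>t. \<Sum>j\<in>{..<n} - {0}. 2 * g (t, X t j)"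
  have gradient: "uniform_supergradient_on Iper u ?p" "uniform_supergradient_on Iper v ?p"
    using X u v by (auto intro: contact_family_supergradient[OF a _ _ g] regular_kantorovich_potD)
  have difference_const: "u s - v s = u t - v t" if "s \<in> Iper" "t \<in> Iper" "s < t" for s t
  proof -
    have "{s..t} \<subseteq> Iper" using that by (auto simp: Iper_def)
    from common_supergradient_antimono[OF gradient that(3) this]
      common_supergradient_antimono[OF gradient(2,1) that(3) this]
    show ?thesis by linarith
  qed
  have difference: "u t - v t = u x - v x" if "t \<in> Iper" for t
    using difference_const[OF that \<open>x \<in> Iper\<close>] difference_const[OF \<open>x \<in> Iper\<close> that]
    by (metis linorder_less_linear)
  have integrable: "integrable Lper (\<lambda>t. \<rho> t * u t)" "integrable Lper (\<lambda>t. \<rho> t * v t)"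
    by (intro integrable_Lper_cont continuous_on_mult DperD(2)[OF \<rho>] regular_kantorovich_potD(1)[OF u]
      regular_kantorovich_potD(1)[OF v])+
  have "(\<integral>t. (u x - v x) * \<rho> t \<partial>Lper) = (\<integral>t. \<rho> t * u t - \<rho> t * v t \<partial>Lper)"
    by (rule Bochner_Integration.integral_cong) (use difference in \<open>auto simp flip: right_diff_distrib\<close>)
  also have "\<dots> = 0" using regular_kantorovich_pot_integral_eq[OF u v] integrable by simp
  finally show ?thesis using DperD(4)[OF \<rho>] by simp
qed

end

section \<open>Convergence of the normalised potentials\<close>

lemma tendsto_at_right_if_subsequences:
  fixes a b :: "'a :: {linorder_topology, first_countable_topology}" and f :: "'a \<Rightarrow> 'b :: topological_space"
  assumes "a < b"
    and subseq: "\<And>s :: nat \<Rightarrow> 'a. (\<And>i. a < s i) \<Longrightarrow> (\<And>i. s i < b) \<Longrightarrow> s \<longlonglongrightarrow> a \<Longrightarrow>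
      \<exists>r. strict_mono r \<and> (\<lambda>i. f (s (r i))) \<longlonglongrightarrow> L"
  shows "(f \<longlongrightarrow> L) (at_right a)"
proof (rule tendsto_at_right_sequentially[OF \<open>a < b\<close>], rule topological_tendstoI, rule ccontr)
  fix s :: "nat \<Rightarrow> 'a" and U
  assume s: "\<And>i. a < s i" "\<And>i. s i < b" "s \<longlonglongrightarrow> a" and U: "open U" "L \<in> U"
    and "\<not> (\<forall>\<^sub>F i in sequentially. f (s i) \<in> U)"
  then have "infinite {i. f (s i) \<notin> U}"
    by (simp add: eventually_cofinite flip: cofinite_eq_sequentially)
  then obtain q :: "nat \<Rightarrow> nat" where q: "strict_mono q" "\<And>i. f (s (q i)) \<notin> U"
    using infinite_enumerate by blast
  have "(\<lambda>i. s (q i)) \<longlonglongrightarrow> a" using LIMSEQ_subseq_LIMSEQ[OF s(3) q(1)] by (simp add: o_def)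
  then obtain r where "(\<lambda>i. f (s (q (r i)))) \<longlonglongrightarrow> L" using subseq[of "\<lambda>i. s (q i)"] s(1,2) by blast
  from topological_tendstoD[OF this U] show False using q(2) by simp
qed

context cost
begin

definition optimal_potential :: "real \<Rightarrow> (real \<Rightarrow> real) \<Rightarrow> ((real \<Rightarrow> real) \<Rightarrow> real) \<Rightarrow> bool" where
  "optimal_potential \<epsilon> \<rho> v \<longleftrightarrow> Hminus v \<and> (\<forall>\<zeta>. adm \<zeta> \<longrightarrow>
     enn2ereal (Feps n w \<epsilon> \<rho>) - ereal (real n * v \<rho>) \<le> enn2ereal (Feps n w \<epsilon> \<zeta>) - ereal (real n * v \<zeta>))"

text \<open>The additive constant is chosen such that n times the normalised potential takes the value of the energy at rho;
  it is then dominated by the energy on all admissible densities.\<close>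

definition normalizing_constant :: "real \<Rightarrow> (real \<Rightarrow> real) \<Rightarrow> ((real \<Rightarrow> real) \<Rightarrow> real) \<Rightarrow> real" where
  "normalizing_constant \<epsilon> \<rho> v = enn2real (Feps n w \<epsilon> \<rho>) / real n - v \<rho>"

definition normalized :: "real \<Rightarrow> (real \<Rightarrow> real) \<Rightarrow> ((real \<Rightarrow> real) \<Rightarrow> real) \<Rightarrow> (real \<Rightarrow> real) \<Rightarrow> real" where
  "normalized \<epsilon> \<rho> v f = v f + normalizing_constant \<epsilon> \<rho> v * (\<integral>t. f t \<partial>Lper)"

lemma Hminus_normalized:
  assumes "Hminus v"
  shows "Hminus (normalized \<epsilon> \<rho> v)"
proof -
  have "normalized \<epsilon> \<rho> v = (\<lambda>f. 1 * v f + normalizing_constant \<epsilon> \<rho> v * (\<integral>t. 1 * f t \<partial>Lper))"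
    by (simp add: normalized_def fun_eq_iff)
  then show ?thesis
    using Hminus_functional_lin[OF assms Hminus_integral[OF continuous_on_const]] by (simp only:)
qed

lemma optimal_potential_Feps_finite:
  assumes v: "optimal_potential \<epsilon> \<rho> v" and "0 < \<epsilon>"
  obtains F where "Feps n w \<epsilon> \<rho> = ennreal F" "0 \<le> F"
proof -
  obtain \<zeta> where \<zeta>: "adm \<zeta>" "Feps n w \<epsilon> \<zeta> < top" using Feps_finite_somewhere \<open>0 < \<epsilon>\<close> by blast
  then obtain E where E: "Feps n w \<epsilon> \<zeta> = ennreal E" "0 \<le> E" by (cases "Feps n w \<epsilon> \<zeta>") auto
  have "enn2ereal (Feps n w \<epsilon> \<rho>) - ereal (real n * v \<rho>) \<le> ereal (E - real n * v \<zeta>)"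
    using v \<zeta>(1) E by (auto simp: optimal_potential_def enn2ereal_ennreal)
  then have "Feps n w \<epsilon> \<rho> \<noteq> top" by auto
  then show ?thesis using that by (cases "Feps n w \<epsilon> \<rho>") auto
qed

lemma normalized_self:
  assumes "Dper \<rho>"
  shows "real n * normalized \<epsilon> \<rho> v \<rho> = enn2real (Feps n w \<epsilon> \<rho>)"
  using DperD(4)[OF assms] n_pos by (simp add: normalized_def normalizing_constant_def)

lemma normalized_self_nonneg:
  assumes "Dper \<rho>"
  shows "0 \<le> normalized \<epsilon> \<rho> v \<rho>"
proof -
  have "0 \<le> real n * normalized \<epsilon> \<rho> v \<rho>" by (simp add: normalized_self[OF assms])
  then show ?thesis using n_pos by (simp add: zero_le_mult_iff)
qed

lemma FOT_le_normalized_self: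
  assumes \<rho>: "Dper \<rho>" and v: "optimal_potential \<epsilon> \<rho> v" and "0 < \<epsilon>"
  shows "FOT n w \<rho> \<le> ennreal (real n * normalized \<epsilon> \<rho> v \<rho>)"
proof -
  obtain F where "Feps n w \<epsilon> \<rho> = ennreal F" "0 \<le> F" using optimal_potential_Feps_finite[OF v \<open>0 < \<epsilon>\<close>] .
  then show ?thesis
    using FOT_le_Feps[OF _ A DperD(2)[OF \<rho>], of n \<epsilon>] n_pos by (simp add: normalized_self[OF \<rho>])
qed

lemma normalized_le_if_Feps_le:
  assumes v: "optimal_potential \<epsilon> \<rho> v" and "0 < \<epsilon>" and \<zeta>: "adm \<zeta>" "Feps n w \<epsilon> \<zeta> \<le> ennreal B" and "0 \<le> B"
  shows "real n * normalized \<epsilon> \<rho> v \<zeta> \<le> B"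
proof -
  obtain F where F: "Feps n w \<epsilon> \<rho> = ennreal F" "0 \<le> F" using optimal_potential_Feps_finite[OF v \<open>0 < \<epsilon>\<close>] .
  obtain E where E: "Feps n w \<epsilon> \<zeta> = ennreal E" "0 \<le> E" "E \<le> B"
    using \<zeta>(2) \<open>0 \<le> B\<close> by (cases "Feps n w \<epsilon> \<zeta>") (auto simp: top_unique)
  have "F - real n * v \<rho> \<le> E - real n * v \<zeta>"
    using v \<zeta>(1) F E(1,2) by (auto simp: optimal_potential_def enn2ereal_ennreal)
  moreover have "real n * normalized \<epsilon> \<rho> v \<zeta> = real n * v \<zeta> + (F - real n * v \<rho>)"
    using \<zeta>(1) F n_pos by (simp add: normalized_def normalizing_constant_def adm_def algebra_simps)
  ultimately show ?thesis using E(3) by linarith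
qed

lemma orbital_bound_normalized:
  assumes v: "optimal_potential \<epsilon> \<rho> v" and "0 < \<epsilon>"
  shows "orbital_bound \<epsilon> (normalized \<epsilon> \<rho> v)"
  unfolding orbital_bound_def
proof (intro allI impI)
  fix \<phi> \<phi>' S assume \<phi>: "disjoint_orbitals n \<phi> \<phi>'" and S: "support_cost_le n w \<phi> S" "0 \<le> S"
  let ?V = "normalized \<epsilon> \<rho> v"
  have V: "Hminus ?V" using v by (intro Hminus_normalized) (simp add: optimal_potential_def)
  have squares: "H1per (\<lambda>t. (\<phi> j t)\<^sup>2)" if "j < n" for j
    using \<phi> that by (auto simp: disjoint_orbitals_def orbital_def intro: C1per_H1per[OF C1per_power2])
  have "(\<Sum>j<n. ?V (\<lambda>t. (\<phi> j t)\<^sup>2)) = ?V (\<lambda>t. \<Sum>j<n. (\<phi> j t)\<^sup>2)"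
    using squares by (intro Hminus_sum[OF V, symmetric]) auto
  also have "\<dots> = real n * ?V (orbital_density n \<phi>)"
  proof -
    have "H1per (\<lambda>t. \<Sum>j<n. (\<phi> j t)\<^sup>2)" by (rule H1per_sum) (use squares in auto)
    then have "?V (\<lambda>t. 1 / real n * (\<Sum>j<n. (\<phi> j t)\<^sup>2)) = 1 / real n * ?V (\<lambda>t. \<Sum>j<n. (\<phi> j t)\<^sup>2)"
      by (rule Hminus_cmult[OF V])
    then show ?thesis unfolding orbital_density_def[abs_def] using n_pos by simp
  qed
  also have "\<dots> \<le> \<epsilon> * kinetic_bound n \<phi>' + S"
    by (rule normalized_le_if_Feps_le[OF v \<open>0 < \<epsilon>\<close> adm_orbital_density[OF n_pos \<phi>]
      Feps_orbital_density_le[OF n_pos \<phi> S \<open>0 < \<epsilon>\<close>]])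
       (use \<open>0 < \<epsilon>\<close> S(2) kinetic_bound_nonneg[of n \<phi>'] in auto)
  finally show "(\<Sum>j<n. ?V (\<lambda>t. (\<phi> j t)\<^sup>2)) \<le> \<epsilon> * kinetic_bound n \<phi>' + S" .
qed

lemma normalized_convergent_subsequence:
  assumes \<rho>: "Dper \<rho>" and v: "\<And>\<epsilon>. 0 < \<epsilon> \<Longrightarrow> optimal_potential \<epsilon> \<rho> (v \<epsilon>)"
    and e: "\<And>j. 0 < e j" "\<And>j. e j \<le> 1" "e \<longlonglongrightarrow> 0"
  obtains r u where "strict_mono (r :: nat \<Rightarrow> nat)" "regular_kantorovich_pot n w \<rho> u"
    "\<And>f. H1per f \<Longrightarrow> (\<lambda>j. normalized (e (r j)) \<rho> (v (e (r j))) f) \<longlonglongrightarrow> (\<integral>t. u t * f t \<partial>Lper)"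
proof -
  define V where "V = (\<lambda>j. normalized (e j) \<rho> (v (e j)))"
  have V: "Hminus (V j)" "orbital_bound (e j) (V j)" "0 \<le> V j \<rho>" "FOT n w \<rho> \<le> ennreal (real n * V j \<rho>)" for j
    using v[OF e(1)] e(1) \<rho> unfolding V_def
    by (auto intro: Hminus_normalized orbital_bound_normalized normalized_self_nonneg FOT_le_normalized_self
      simp: optimal_potential_def)
  obtain r W where r: "strict_mono r" and W: "Hminus W" "orbital_bound 0 W"
    and lim: "\<And>f. H1per f \<Longrightarrow> (\<lambda>j. V (r j) f) \<longlonglongrightarrow> W f"
    using orbital_bound_weak_limit[of \<rho> e V] \<rho> e V(1-3) by metis
  note lim_\<rho> = lim[OF DperD(1)[OF \<rho>]]
  have "0 \<le> W \<rho>" by (rule LIMSEQ_le_const[OF lim_\<rho>]) (use V(3) in auto)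
  moreover have "(\<lambda>j. ennreal (real n * V (r j) \<rho>)) \<longlonglongrightarrow> ennreal (real n * W \<rho>)"
    by (intro tendsto_ennrealI tendsto_mult tendsto_const lim_\<rho>)
  then have "FOT n w \<rho> \<le> ennreal (real n * W \<rho>)" by (rule LIMSEQ_le_const) (use V(4) in auto)
  ultimately interpret limit_potential n w \<rho> W by unfold_locales (use \<rho> W in auto)
  obtain u where u: "regular_kantorovich_pot n w \<rho> u" "\<And>f. H1per f \<Longrightarrow> W f = (\<integral>t. u t * f t \<partial>Lper)"
    using exists_potential by metis
  show ?thesis by (rule that[OF r u(1)]) (use lim u(2) in \<open>auto simp: V_def\<close>)
qed

lemma normalized_convergent_decreasing:
  assumes \<rho>: "Dper \<rho>" and v: "\<And>\<epsilon>. 0 < \<epsilon> \<Longrightarrow> optimal_potential \<epsilon> \<rho> (v \<epsilon>)"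
  obtains s u where "\<And>k :: nat. 0 < s k" "\<And>k. s (Suc k) < s k" "s \<longlonglongrightarrow> 0" "regular_kantorovich_pot n w \<rho> u"
    "\<And>f. H1per f \<Longrightarrow> (\<lambda>k. normalized (s k) \<rho> (v (s k)) f) \<longlonglongrightarrow> (\<integral>t. u t * f t \<partial>Lper)"
proof -
  define e where "e = (\<lambda>j::nat. inverse (real (Suc j)))"
  have e: "0 < e j" "e j \<le> 1" "e \<longlonglongrightarrow> 0" for j
    unfolding e_def by (simp, simp add: inverse_le_1_iff, rule LIMSEQ_inverse_real_of_nat)
  obtain r u where r: "strict_mono r" and u: "regular_kantorovich_pot n w \<rho> u"
    and lim: "\<And>f. H1per f \<Longrightarrow> (\<lambda>j. normalized (e (r j)) \<rho> (v (e (r j))) f) \<longlonglongrightarrow> (\<integral>t. u t * f t \<partial>Lper)"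
    by (rule normalized_convergent_subsequence[where v = v and e = e, OF \<rho> v e]) blast+
  show ?thesis
  proof (rule that[of "\<lambda>k. e (r k)" u])
    show "e (r (Suc k)) < e (r k)" for k using strict_monoD[OF r, of k "Suc k"] by (simp add: e_def)
    show "(\<lambda>k. e (r k)) \<longlonglongrightarrow> 0" using LIMSEQ_subseq_LIMSEQ[OF e(3) r] by (simp add: o_def)
  qed (use e u lim in auto)
qed

lemma normalized_tendsto:
  assumes \<rho>: "Dper \<rho>" and v: "\<And>\<epsilon>. 0 < \<epsilon> \<Longrightarrow> optimal_potential \<epsilon> \<rho> (v \<epsilon>)"
    and C1: "C1_offdiag w" and u: "regular_kantorovich_pot n w \<rho> u" and f: "H1per f"
  shows "((\<lambda>\<epsilon>. normalized \<epsilon> \<rho> (v \<epsilon>) f) \<longlongrightarrow> (\<integral>t. u t * f t \<partial>Lper)) (at_right 0)"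
proof (rule tendsto_at_right_if_subsequences[OF zero_less_one])
  fix s :: "nat \<Rightarrow> real" assume s: "\<And>i. 0 < s i" "\<And>i. s i < 1" "s \<longlonglongrightarrow> 0"
  obtain r u' where r: "strict_mono r" and u': "regular_kantorovich_pot n w \<rho> u'"
    and lim: "\<And>f. H1per f \<Longrightarrow> (\<lambda>i. normalized (s (r i)) \<rho> (v (s (r i))) f) \<longlonglongrightarrow> (\<integral>t. u' t * f t \<partial>Lper)"
    by (rule normalized_convergent_subsequence[where v = v and e = s, OF \<rho> v s(1) less_imp_le[OF s(2)] s(3)]) blast+
  have "(\<integral>t. u' t * f t \<partial>Lper) = (\<integral>t. u t * f t \<partial>Lper)"
    using regular_kantorovich_pot_unique[OF \<rho> C1 u' u] by (intro Bochner_Integration.integral_cong) auto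
  then show "\<exists>r. strict_mono r \<and> (\<lambda>i. normalized (s (r i)) \<rho> (v (s (r i))) f) \<longlonglongrightarrow> (\<integral>t. u t * f t \<partial>Lper)"
    using r lim[OF f] by auto
qed

end

theorem theorem2p4:
  fixes n :: nat and w :: "real \<times> real \<Rightarrow> ennreal" and \<rho> :: "real \<Rightarrow> real"
    and v :: "real \<Rightarrow> (real \<Rightarrow> real) \<Rightarrow> real"
  assumes "1 \<le> n"
    and "assumptionA w"
    and "Dper \<rho>"
    and "\<forall>\<epsilon>>0. Hminus (v \<epsilon>) \<and>
           (\<forall>\<zeta>. adm \<zeta> \<longrightarrow>
              enn2ereal (Feps n w \<epsilon> \<rho>) - ereal (real n * v \<epsilon> \<rho>)
                \<le> enn2ereal (Feps n w \<epsilon> \<zeta>) - ereal (real n * v \<epsilon> \<zeta>))"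
  shows "\<exists>(C :: real \<Rightarrow> real) (u :: real \<Rightarrow> real).
           regular_kantorovich_pot n w \<rho> u \<and>
           (\<exists>\<epsilon>s :: nat \<Rightarrow> real. (\<forall>k. 0 < \<epsilon>s k) \<and> (\<forall>k. \<epsilon>s (Suc k) < \<epsilon>s k) \<and> \<epsilon>s \<longlonglongrightarrow> 0 \<and>
              (\<forall>f. H1per f \<longrightarrow>
                 (\<lambda>k. v (\<epsilon>s k) f + C (\<epsilon>s k) * (\<integral>t. f t \<partial>lebesgue_on Iper))
                   \<longlonglongrightarrow> (\<integral>t. u t * f t \<partial>lebesgue_on Iper))) \<and>
           (C1_offdiag w \<longrightarrow>
              (\<forall>u'. regular_kantorovich_pot n w \<rho> u' \<longrightarrow> (\<forall>x\<in>Iper. u' x = u x)) \<and>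
              (\<forall>f. H1per f \<longrightarrow>
                 ((\<lambda>\<epsilon>. v \<epsilon> f + C \<epsilon> * (\<integral>t. f t \<partial>lebesgue_on Iper))
                   \<longlongrightarrow> (\<integral>t. u t * f t \<partial>lebesgue_on Iper)) (at_right 0)))"
proof -
  interpret cost n w by unfold_locales (fact assms)+
  have v: "optimal_potential \<epsilon> \<rho> (v \<epsilon>)" if "0 < \<epsilon>" for \<epsilon>
    using assms(4) that by (simp add: optimal_potential_def)
  obtain s u
    where s: "\<And>k :: nat. 0 < s k" "\<And>k. s (Suc k) < s k" "s \<longlonglongrightarrow> 0" and u: "regular_kantorovich_pot n w \<rho> u"
    and lim: "\<And>f. H1per f \<Longrightarrow> (\<lambda>k. normalized (s k) \<rho> (v (s k)) f) \<longlonglongrightarrow> (\<integral>t. u t * f t \<partial>Lper)"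
    by (rule normalized_convergent_decreasing[where v = v, OF assms(3) v]) blast+
  show ?thesis
  proof (rule exI[of _ "\<lambda>\<epsilon>. normalizing_constant \<epsilon> \<rho> (v \<epsilon>)"], rule exI[of _ u], intro conjI exI[of _ s]
    impI allI ballI)
    show "(\<lambda>k. v (s k) f + normalizing_constant (s k) \<rho> (v (s k)) * (\<integral>t. f t \<partial>Lper)) \<longlonglongrightarrow> (\<integral>t. u t * f t \<partial>Lper)"
      if "H1per f" for f using lim[OF that] by (simp add: normalized_def)
    assume C1: "C1_offdiag w"
    show "u' x = u x" if "regular_kantorovich_pot n w \<rho> u'" "x \<in> Iper" for u' x
      using regular_kantorovich_pot_unique[OF assms(3) C1 that(1) u that(2)] .
    show "((\<lambda>\<epsilon>. v \<epsilon> f + normalizing_constant \<epsilon> \<rho> (v \<epsilon>) * (\<integral>t. f t \<partial>Lper)) \<longlongrightarrow> (\<integral>t. u t * f t \<partial>Lper)) (at_right 0)"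
      if "H1per f" for f
      using normalized_tendsto[OF assms(3) v C1 u that] by (simp add: normalized_def)
  qed (use s u in auto)
qed

end
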